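(* Let $n\ge1$, $m\ge0$, $d=n+m$, let $H\in\mathbb{Z}^{d\times n}$ be a matrix of rank $n$ in reduced Hermite normal form, let $c\in\mathbb{Z}^n$, $b\in\mathbb{Z}^d$, and let $\Delta=\Delta(H)$. Then the integer linear programming problem $$\max\{c^\top x : x\in P(H,b)\cap\mathbb{Z}^n\}$$ can be solved by an algorithm with complexity $$O\bigl((\log\Delta+m)\cdot n^{2(m+1)}\cdot\Delta^{2(m+1)}\cdot\mathrm{mult}(\mathrm{size}(c)+\log\Delta)\bigr).$$
   Context: $P(H,b)=\{x\in\mathbb{R}^n : Hx\le b\}$. For an integer matrix $A$, $\Delta_k(A)$ is the greatest absolute value of the determinants of all $k\times k$ submatrices of $A$, and $\Delta(A)=\Delta_{\mathrm{rank}(A)}(A)$. Reduced Hermite normal form: write $H_B$ for the $n\times n$ matrix of the first $n$ rows of $H$ and $H_N$ for the $m\times n$ matrix of its remaining rows. $H$ is in reduced Hermite normal form if $H_B$ is non-singular and lower triangular, $0\le H_{ij}<H_{ii}$ for all $1\le j<i\le n$, and there is $s\in\{0,\dots,n\}$ with $H_{ii}=1$ for $i\le s$ and $H_{ii}\ge 2$ for $s<i\le n$ (so the first $s$ rows of $H_B$ are those of the identity matrix). For an integer $x$, $\mathrm{size}(x)=1+\lceil\log_2(|x|+1)\rceil$; for an integer vector $v\in\mathbb{Z}^n$, $\mathrm{size}(v)=n+\sum_{i=1}^n\mathrm{size}(v_i)$. $\mathrm{mult}(k)$ is the bit complexity of multiplying two integers of bit size $k$.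
   Formalization: Complexity is on an integer RAM where the bits of b are not charged (the bound is independent of b, yet the answer can be b itself), integers of about log(input length) bits cost one step, and the factor log Δ + m is replaced by max(1, log Δ + m), since it is 0 for Δ=1, m=0. *)

theory Defs
  imports Complex_Main "Jordan_Normal_Form.DL_Rank" "Jordan_Normal_Form.DL_Submatrix"
begin

section \<open>Matrices, polyhedra and the integer program\<close>

definition mat_rank :: "int mat \<Rightarrow> nat" where
  "mat_rank A = vec_space.rank (dim_row A) (map_mat real_of_int A)"

definition Delta_k :: "nat \<Rightarrow> int mat \<Rightarrow> int" where
  "Delta_k k A = Max {\<bar>det (submatrix A I J)\<bar> | I J.
      I \<subseteq> {..<dim_row A} \<and> J \<subseteq> {..<dim_col A} \<and> card I = k \<and> card J = k}"

definition Delta :: "int mat \<Rightarrow> int" where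
  "Delta A = Delta_k (mat_rank A) A"

definition polyhedron :: "real mat \<Rightarrow> real vec \<Rightarrow> real vec set" where
  "polyhedron H b = {x \<in> carrier_vec (dim_col H). H *\<^sub>v x \<le> b}"

definition integer_points :: "int mat \<Rightarrow> int vec \<Rightarrow> int vec set" where
  "integer_points H b =
     {x. map_vec real_of_int x \<in> polyhedron (map_mat real_of_int H) (map_vec real_of_int b)}"

definition basis_part :: "int mat \<Rightarrow> int mat" where
  "basis_part H = mat (dim_col H) (dim_col H) (\<lambda>(i, j). H $$ (i, j))"

text \<open>Row and column indices start at 0.\<close>

definition reduced_hnf :: "int mat \<Rightarrow> bool" where
  "reduced_hnf H \<longleftrightarrow> (let n = dim_col H; B = basis_part H in
     n \<le> dim_row H \<and>
     det B \<noteq> 0 \<and>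
     (\<forall>i<n. \<forall>j<n. i < j \<longrightarrow> B $$ (i, j) = 0) \<and>
     (\<forall>i<n. \<forall>j<i. 0 \<le> B $$ (i, j) \<and> B $$ (i, j) < B $$ (i, i)) \<and>
     (\<exists>s\<le>n. (\<forall>i<s. B $$ (i, i) = 1) \<and> (\<forall>i. s \<le> i \<and> i < n \<longrightarrow> B $$ (i, i) \<ge> 2)))"

definition int_size :: "int \<Rightarrow> nat" where
  "int_size x = 1 + nat \<lceil>log 2 (real_of_int \<bar>x\<bar> + 1)\<rceil>"

definition vec_size :: "int vec \<Rightarrow> nat" where
  "vec_size v = dim_vec v + (\<Sum>i<dim_vec v. int_size (v $ i))"

text \<open>
  The properties of the bit complexity of integer multiplication that are used:
  all bits are read, longer operands are not cheaper, and doubling the length of the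
  operands costs at most a constant factor (split both operands into two halves).
\<close>

definition multiplication_cost :: "(nat \<Rightarrow> nat) \<Rightarrow> bool" where
  "multiplication_cost mul \<longleftrightarrow>
     mono mul \<and> (\<forall>k. k \<le> mul k) \<and> (\<exists>K. \<forall>k. mul (2 * k) \<le> K * mul k)"

section \<open>Programs and their complexity\<close>

text \<open>
  Algorithms are programs for a random access machine over the integers with finitely
  many registers and finitely many integer-indexed arrays (the registers and arrays
  occurring in the program text).

  An instruction whose operands have bit size at most \<open>k\<close> costs \<open>mul k\<close>, except that
  it costs one step if \<open>k\<close> does not exceed the word length \<open>L\<close>; \<open>L\<close> will be the number
  of bits of an address of an input entry, so that loop counters and input addresses
  are not charged by their bit length.

  Bit sizes are counted without the bits of the right-hand side \<open>b\<close>: the complexity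
  bounds to be expressed do not involve \<open>b\<close>, although the size of a solution, and hence
  any time that includes the bits of \<open>b\<close>, grows with \<open>b\<close> (take \<open>max {x. x \<le> b}\<close>). To this
  end a cell holds an integer together with its charged size. Entries of \<open>b\<close> have
  charged size 1. The charged size of a result is the usual a priori bound in terms of
  the charged sizes of the operands, or the actual size of the result if that is
  smaller. In particular, it is never below the actual size for a computation that
  does not involve \<open>b\<close>, as shown in \<open>charged_size_exact\<close> below. The bound for
  quotients and remainders is the sum of both charged sizes (rather than that of the
  dividend or divisor alone), as otherwise an integer could be stripped of its charged
  size by dividing a large entry of \<open>b\<close> by it, or by reducing it modulo such an entry.
\<close>

type_synonym cell = "int \<times> nat"

definition cell_of :: "int \<Rightarrow> nat \<Rightarrow> cell" where
  "cell_of v k = (v, min (int_size v) k)"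

definition exact_cell :: "int \<Rightarrow> cell" where
  "exact_cell v = (v, int_size v)"

record state =
  reg :: "nat \<Rightarrow> cell"
  arr :: "nat \<Rightarrow> int \<Rightarrow> cell"

datatype binop = OAdd | OSub | OMul | ODiv | OMod

text \<open>\<^const>\<open>divide\<close> on integers is floor division, also for negative numbers.\<close>

fun binop_val :: "binop \<Rightarrow> int \<Rightarrow> int \<Rightarrow> int" where
  "binop_val OAdd x y = x + y"
| "binop_val OSub x y = x - y"
| "binop_val OMul x y = x * y"
| "binop_val ODiv x y = x div y"
| "binop_val OMod x y = x mod y"

fun binop_size :: "binop \<Rightarrow> nat \<Rightarrow> nat \<Rightarrow> nat" where
  "binop_size OAdd k l = max k l + 1"
| "binop_size OSub k l = max k l + 1"
| "binop_size OMul k l = k + l"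
| "binop_size ODiv k l = k + l"
| "binop_size OMod k l = k + l"

definition binop_cell :: "binop \<Rightarrow> cell \<Rightarrow> cell \<Rightarrow> cell" where
  "binop_cell f x y = cell_of (binop_val f (fst x) (fst y)) (binop_size f (snd x) (snd y))"

datatype com =
    Skip
  | Const nat int            \<comment> \<open>\<open>Const r z\<close>: \<open>r := z\<close>\<close>
  | Op binop nat nat nat     \<comment> \<open>\<open>Op f r p q\<close>: \<open>r := f p q\<close>\<close>
  | Load nat nat nat         \<comment> \<open>\<open>Load r a p\<close>: \<open>r := a[p]\<close>\<close>
  | Store nat nat nat        \<comment> \<open>\<open>Store a p r\<close>: \<open>a[p] := r\<close>\<close>
  | Seq com com
  | IfPos nat com com        \<comment> \<open>branches on \<open>r > 0\<close>\<close>
  | WhilePos nat com         \<comment> \<open>repeats as long as \<open>r > 0\<close>\<close>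

definition set_reg :: "nat \<Rightarrow> cell \<Rightarrow> state \<Rightarrow> state" where
  "set_reg r x s = s\<lparr>reg := (reg s)(r := x)\<rparr>"

definition set_arr :: "nat \<Rightarrow> int \<Rightarrow> cell \<Rightarrow> state \<Rightarrow> state" where
  "set_arr a i x s = s\<lparr>arr := (arr s)(a := (arr s a)(i := x))\<rparr>"

definition charge :: "(nat \<Rightarrow> nat) \<Rightarrow> nat \<Rightarrow> nat \<Rightarrow> nat" where
  "charge mul L k = (if k \<le> L then 1 else mul k)"

text \<open>\<open>exec mul L P s t s'\<close>: started in \<open>s\<close>, the program \<open>P\<close> terminates in \<open>s'\<close> at cost \<open>t\<close>.\<close>

inductive exec :: "(nat \<Rightarrow> nat) \<Rightarrow> nat \<Rightarrow> com \<Rightarrow> state \<Rightarrow> nat \<Rightarrow> state \<Rightarrow> bool"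
  for mul :: "nat \<Rightarrow> nat" and L :: nat where
  Skip: "exec mul L Skip s 0 s"
| Const: "exec mul L (Const r z) s (charge mul L (int_size z)) (set_reg r (exact_cell z) s)"
| Op: "exec mul L (Op f r p q) s (charge mul L (max (snd (reg s p)) (snd (reg s q))))
         (set_reg r (binop_cell f (reg s p) (reg s q)) s)"
| Load: "x = arr s a (fst (reg s p)) \<Longrightarrow>
         exec mul L (Load r a p) s (charge mul L (max (snd (reg s p)) (snd x))) (set_reg r x s)"
| Store: "exec mul L (Store a p r) s (charge mul L (max (snd (reg s p)) (snd (reg s r))))
         (set_arr a (fst (reg s p)) (reg s r) s)"
| Seq: "exec mul L P s t s' \<Longrightarrow> exec mul L Q s' t' s'' \<Longrightarrow> exec mul L (Seq P Q) s (t + t') s''"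
| IfTrue: "fst (reg s r) > 0 \<Longrightarrow> exec mul L P s t s' \<Longrightarrow>
         exec mul L (IfPos r P Q) s (charge mul L (snd (reg s r)) + t) s'"
| IfFalse: "\<not> fst (reg s r) > 0 \<Longrightarrow> exec mul L Q s t s' \<Longrightarrow>
         exec mul L (IfPos r P Q) s (charge mul L (snd (reg s r)) + t) s'"
| WhileFalse: "\<not> fst (reg s r) > 0 \<Longrightarrow>
         exec mul L (WhilePos r P) s (charge mul L (snd (reg s r))) s"
| WhileTrue: "fst (reg s r) > 0 \<Longrightarrow> exec mul L P s t s' \<Longrightarrow> exec mul L (WhilePos r P) s' t' s'' \<Longrightarrow>
         exec mul L (WhilePos r P) s (charge mul L (snd (reg s r)) + t + t') s''"

lemma exec_deterministic:
  "exec mul L P s t s' \<Longrightarrow> exec mul L P s u v \<Longrightarrow> u = t \<and> v = s'"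
proof (induction arbitrary: u v rule: exec.induct)
  case (Skip s)
  then show ?case by cases simp
next
  case (Const r z s)
  then show ?case by cases simp
next
  case (Op f r p q s)
  then show ?case by cases simp
next
  case (Load x s a p r)
  from Load.prems Load.hyps show ?case by cases simp
next
  case (Store a p r s)
  then show ?case by cases simp
next
  case (Seq P s t s' Q t' s'')
  note IH = Seq.IH
  from Seq.prems show ?case
  proof cases
    case (Seq t1 s1 t2)
    have "t1 = t \<and> s1 = s'" using IH(1) Seq by blast
    moreover have "t2 = t' \<and> v = s''" using IH(2) Seq calculation by blast
    ultimately show ?thesis using Seq by simp
  qed
next
  case (IfTrue s r P t s' Q)
  note pos = IfTrue.hyps(1) and IH = IfTrue.IH
  from IfTrue.prems show ?case
  proof cases
    case (IfTrue t1)
    then show ?thesis using IH by blast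
  next
    case IfFalse
    with pos show ?thesis by blast
  qed
next
  case (IfFalse s r Q t s' P)
  note pos = IfFalse.hyps(1) and IH = IfFalse.IH
  from IfFalse.prems show ?case
  proof cases
    case (IfFalse t1)
    then show ?thesis using IH by blast
  next
    case IfTrue
    with pos show ?thesis by blast
  qed
next
  case (WhileFalse s r P)
  from WhileFalse.prems show ?case by cases (use WhileFalse.hyps in simp_all)
next
  case (WhileTrue s r P t s' t' s'')
  note pos = WhileTrue.hyps(1) and IH = WhileTrue.IH
  from WhileTrue.prems show ?case
  proof cases
    case WhileFalse
    with pos show ?thesis by simp
  next
    case (WhileTrue t1 s1 t2)
    have "t1 = t \<and> s1 = s'" using IH(1) WhileTrue by blast
    moreover have "t2 = t' \<and> v = s''" using IH(2) WhileTrue calculation by blast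
    ultimately show ?thesis using WhileTrue by simp
  qed
qed

text \<open>Operations on cells with exact sizes yield cells with exact sizes.\<close>

lemma int_size_le_iff: "int_size x \<le> Suc k \<longleftrightarrow> \<bar>x\<bar> + 1 \<le> 2 ^ k"
proof -
  have "int_size x \<le> Suc k \<longleftrightarrow> log 2 (real_of_int \<bar>x\<bar> + 1) \<le> real k"
    unfolding int_size_def by (simp add: nat_le_iff ceiling_le_iff)
  also have "\<dots> \<longleftrightarrow> real_of_int \<bar>x\<bar> + 1 \<le> 2 ^ k"
    by (subst log_le_iff) (auto simp: powr_realpow add_pos_nonneg)
  also have "\<dots> \<longleftrightarrow> \<bar>x\<bar> + 1 \<le> 2 ^ k"
  proof -
    have "real_of_int \<bar>x\<bar> + 1 = real_of_int (\<bar>x\<bar> + 1)"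
      "(2::real) ^ k = real_of_int (2 ^ k)" by simp_all
    then show ?thesis by (simp only: of_int_le_iff)
  qed
  finally show ?thesis .
qed

lemma int_size_pos: "0 < int_size x"
  by (simp add: int_size_def)

lemma abs_lt_int_size: "\<bar>x\<bar> + 1 \<le> 2 ^ (int_size x - 1)"
  using int_size_le_iff[of x "int_size x - 1"] int_size_pos[of x] by simp

lemma charged_size_exact:
  "binop_cell f (exact_cell x) (exact_cell y) = exact_cell (binop_val f x y)"
proof -
  define k where "k = int_size x - 1"
  define l where "l = int_size y - 1"
  have sz: "int_size x = Suc k" "int_size y = Suc l"
    using int_size_pos[of x] int_size_pos[of y] by (simp_all add: k_def l_def)
  have x: "\<bar>x\<bar> + 1 \<le> 2 ^ k" and y: "\<bar>y\<bar> + 1 \<le> 2 ^ l"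
    using abs_lt_int_size[of x] abs_lt_int_size[of y] by (simp_all add: k_def l_def)
  have kl: "(2::int) ^ k \<le> 2 ^ max k l" "(2::int) ^ l \<le> 2 ^ max k l"
    by (auto intro: power_increasing)
  have prod: "(\<bar>x\<bar> + 1) * (\<bar>y\<bar> + 1) \<le> 2 ^ (k + l)"
    unfolding power_add using x y by (intro mult_mono) auto
  have xkl: "\<bar>x\<bar> + 1 \<le> 2 ^ (k + l)" and ykl: "\<bar>y\<bar> + 1 \<le> 2 ^ (k + l)"
    using x y order_trans[OF x power_increasing[of k "k + l" "2::int"]]
      order_trans[OF y power_increasing[of l "k + l" "2::int"]] by simp_all
  have kl1: "(2::int) ^ (k + l) \<le> 2 ^ Suc (k + l)" by simp
  have div: "\<bar>x div y\<bar> \<le> \<bar>x\<bar>"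
  proof (cases "y = 0 \<or> x = 0")
    case False
    then have "\<bar>x div y\<bar> * 1 \<le> \<bar>x\<bar>"
    proof -
      have *: "\<bar>a div b\<bar> \<le> \<bar>a\<bar>" if "b > 0" for a b :: int
      proof (cases "a \<ge> 0")
        case True
        then have "0 \<le> a div b" using that by (simp add: pos_imp_zdiv_nonneg_iff)
        moreover have "0 \<le> (b - 1) * (a div b)" using calculation that by simp
        then have "a div b \<le> b * (a div b)" by (simp add: algebra_simps)
        then have "a div b \<le> b * (a div b) + a mod b" using pos_mod_sign[OF that, of a] by linarith
        then have "a div b \<le> a" by simp
        ultimately show ?thesis by simp
      next
        case False
        then have neg: "a div b < 0" using that by (simp add: pos_imp_zdiv_neg_iff)
        have "a mod b \<le> (b - 1) * 1" using that pos_mod_bound[of b a] by simp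
        also have "\<dots> \<le> (b - 1) * (- (a div b))"
          using neg that by (intro mult_left_mono) auto
        finally have "b * (a div b) + a mod b \<le> a div b" by (simp add: algebra_simps)
        then have "a \<le> a div b" by simp
        with neg False show ?thesis by simp
      qed
      show ?thesis
      proof (cases "y > 0")
        case True
        then show ?thesis using *[of y x] by simp
      next
        case neg: False
        then have "- y > 0" using False by simp
        from *[OF this, of "- x"] show ?thesis by simp
      qed
    qed
    then show ?thesis by simp
  qed auto
  have mod: "\<bar>x mod y\<bar> \<le> max \<bar>x\<bar> \<bar>y\<bar>"
  proof (cases "y = 0")
    case False
    then show ?thesis using abs_mod_less[of y x] by simp
  qed simp
  have "int_size (binop_val f x y) \<le> binop_size f (int_size x) (int_size y)"
  proof (cases f)
    case OAdd
    have "\<bar>x + y\<bar> + 1 \<le> 2 * 2 ^ max k l" using x y kl by linarith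
    then show ?thesis using int_size_le_iff[of "x + y" "Suc (max k l)"] by (simp add: OAdd sz)
  next
    case OSub
    have "\<bar>x - y\<bar> + 1 \<le> 2 * 2 ^ max k l" using x y kl by linarith
    then show ?thesis using int_size_le_iff[of "x - y" "Suc (max k l)"] by (simp add: OSub sz)
  next
    case OMul
    have "\<bar>x * y\<bar> + 1 \<le> (\<bar>x\<bar> + 1) * (\<bar>y\<bar> + 1)" by (simp add: abs_mult algebra_simps)
    then have "\<bar>x * y\<bar> + 1 \<le> 2 ^ Suc (k + l)" using prod kl1 by linarith
    then show ?thesis using int_size_le_iff[of "x * y" "Suc (k + l)"] by (simp add: OMul sz)
  next
    case ODiv
    have "\<bar>x div y\<bar> + 1 \<le> 2 ^ Suc (k + l)" using div xkl kl1 by linarith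
    then show ?thesis using int_size_le_iff[of "x div y" "Suc (k + l)"] by (simp add: ODiv sz)
  next
    case OMod
    have "\<bar>x mod y\<bar> + 1 \<le> 2 ^ Suc (k + l)" using mod xkl ykl kl1 by linarith
    then show ?thesis using int_size_le_iff[of "x mod y" "Suc (k + l)"] by (simp add: OMod sz)
  qed
  then show ?thesis
    by (simp add: binop_cell_def exact_cell_def cell_of_def)
qed

section \<open>Input and output of an integer programming algorithm\<close>

text \<open>
  Registers 0 and 1 hold \<open>n\<close> and \<open>m\<close>; arrays 0, 1 and 2 hold \<open>H\<close> (row by row), \<open>c\<close>
  and \<open>b\<close>.
\<close>

definition input_array :: "int mat \<Rightarrow> int vec \<Rightarrow> int vec \<Rightarrow> nat \<Rightarrow> int \<Rightarrow> cell" where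
  "input_array H c b a i =
    (if a = 0 \<and> 0 \<le> i \<and> i < int (dim_row H * dim_col H)
       then exact_cell (H $$ (nat i div dim_col H, nat i mod dim_col H))
     else if a = 1 \<and> 0 \<le> i \<and> i < int (dim_vec c) then exact_cell (c $ nat i)
     else if a = 2 \<and> 0 \<le> i \<and> i < int (dim_vec b) then cell_of (b $ nat i) 1
     else exact_cell 0)"

definition input_state :: "int mat \<Rightarrow> int vec \<Rightarrow> int vec \<Rightarrow> state" where
  "input_state H c b =
    \<lparr>reg = (\<lambda>_. exact_cell 0)(0 := exact_cell (int (dim_col H)),
                             1 := exact_cell (int (dim_row H) - int (dim_col H))),
     arr = input_array H c b\<rparr>"

definition word_length :: "int mat \<Rightarrow> int vec \<Rightarrow> int vec \<Rightarrow> nat" where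
  "word_length H c b = int_size (int (dim_row H * dim_col H + dim_vec c + dim_vec b))"

text \<open>
  Register 0 reports infeasibility (0), an optimal solution (1), which is then found in
  array 3, or unboundedness (2).
\<close>

definition output_vec :: "nat \<Rightarrow> state \<Rightarrow> int vec" where
  "output_vec n s = vec n (\<lambda>i. fst (arr s 3 (int i)))"

definition solves_ilp :: "int mat \<Rightarrow> int vec \<Rightarrow> int vec \<Rightarrow> state \<Rightarrow> bool" where
  "solves_ilp H c b s \<longleftrightarrow> (let F = integer_points H b; x = output_vec (dim_col H) s in
     (fst (reg s 0) = 0 \<and> F = {}) \<or>
     (fst (reg s 0) = 1 \<and> x \<in> F \<and> (\<forall>y\<in>F. c \<bullet> y \<le> c \<bullet> x)) \<or>
     (fst (reg s 0) = 2 \<and> F \<noteq> {} \<and> (\<forall>M. \<exists>y\<in>F. c \<bullet> y > M)))"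

text \<open>
  The factor \<open>log \<Delta> + m\<close> vanishes for \<open>\<Delta> = 1\<close>, \<open>m = 0\<close>, where no algorithm could have
  cost 0; in all other cases it is at least 1, and the maximum below has no effect.
\<close>

definition ilp_bound :: "(nat \<Rightarrow> nat) \<Rightarrow> nat \<Rightarrow> nat \<Rightarrow> int \<Rightarrow> int vec \<Rightarrow> real" where
  "ilp_bound mul n m D c =
     max 1 (log 2 (real_of_int D) + real m) * real n ^ (2 * (m + 1)) *
     real_of_int D ^ (2 * (m + 1)) * real (mul (vec_size c + nat \<lceil>log 2 (real_of_int D)\<rceil>))"

end

(*
The nonbasic rows of a basis of rows of H form a set of m rows, and the algorithm enumerates these
sets by means of the combinatorial number system. For each of them it computes a fraction-free
tableau with entries bounded by subdeterminants. A feasible program without an improving ray at a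
basis has, for every feasible point, one at least as good whose slacks at the rows of some basis are
smaller than the largest basis determinant D. So for a fixed basis only slack vectors y in [0, D)^n
matter. Such a y belongs to an integer point iff it lies in the right class of Z^n modulo the lattice
of the basis, and feasibility at the other rows depends on m linear forms in y. A dynamic program over
the n slacks has as states the group element and the values of the m forms, hence at most
Delta * (n * Delta^2)^m states per stage. The factor (n + m choose m) <= 8 (3/4)^m n^m for n >= 2
leaves a geometric gap that absorbs all polynomial factors in m; n = 1 is an interval.
*)

theory Submission
 imports Defs
begin

section \<open>Structured programs\<close>

text \<open>The bound must not involve the bits of \<open>b\<close>, although solutions grow with
  \<open>b\<close>. Hence values computed from \<open>b\<close> have no magnitude bound at all; only
  their charged size is controlled. The dynamic program is therefore kept free of \<open>b\<close>:
  the right-hand side enters at its end, through a target group element and m thresholds, and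
  afterwards in sums of products followed by one division by the denominator. \<Delta> is not part
  of the input, so a separate pass over all bases first determines the largest determinant. The
  Hermite form is used through 2^(n - s) \<le> \<Delta>. This bounds the number n - s of coordinates
  whose integrality needs extra tableau rows, which yields the factor log \<Delta>, and it keeps
  tableau rows of arbitrary vectors, such as the objective, polynomially bounded where substitution
  alone would lose 2^n. State numbers have about m log(n \<Delta>^2) bits, whereas the claim admits
  multiplications of size(c) + log \<Delta> bits only. The excess is a power of m + 1, and this is
  what the geometric gap pays for. With n = 1 there is no gap, so that case must avoid long numbers
  altogether.\<close>

declare split_paired_All [simp del] split_paired_Ex [simp del]

datatype aexp = N int | V nat | B binop aexp aexp | Ix nat aexp

abbreviation Add (infixl "+." 65) where "x +. y \<equiv> B OAdd x y"
abbreviation Sub (infixl "-." 65) where "x -. y \<equiv> B OSub x y"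
abbreviation Mul (infixl "*." 70) where "x *. y \<equiv> B OMul x y"
abbreviation Dvd (infixl "div." 70) where "x div. y \<equiv> B ODiv x y"
abbreviation Mod (infixl "mod." 70) where "x mod. y \<equiv> B OMod x y"

fun ev :: "state \<Rightarrow> aexp \<Rightarrow> cell" where
 "ev s (N z) = exact_cell z"
| "ev s (V r) = reg s r"
| "ev s (B f x y) = binop_cell f (ev s x) (ev s y)"
| "ev s (Ix a e) = arr s a (fst (ev s e))"

fun regs_of :: "aexp \<Rightarrow> nat set" where
 "regs_of (N z) = {}"
| "regs_of (V r) = {r}"
| "regs_of (B f x y) = regs_of x \<union> regs_of y"
| "regs_of (Ix a e) = regs_of e"

text \<open>A register operand is used where it is, since it cannot be copied by one instruction;
  only compound expressions occupy a temporary.\<close>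

fun loc :: "nat \<Rightarrow> aexp \<Rightarrow> nat" where
 "loc t (V r) = r"
| "loc t _ = t"

fun code :: "nat \<Rightarrow> aexp \<Rightarrow> com" where
 "code t (N z) = Const t z"
| "code t (V r) = Skip"
| "code t (B f x y) = Seq (code t x) (Seq (code (Suc t) y) (Op f t (loc t x) (loc (Suc t) y)))"
| "code t (Ix a e) = Seq (code t e) (Load t a (loc t e))"

text \<open>There is no move instruction: \<open>asg r (V q)\<close> is a junk case.\<close>

fun asg :: "nat \<Rightarrow> aexp \<Rightarrow> com" where
 "asg r (N z) = Const r z"
| "asg r (V q) = Skip"
| "asg r (B f x y) = Seq (code 100 x) (Seq (code 101 y) (Op f r (loc 100 x) (loc 101 y)))"
| "asg r (Ix a e) = Seq (code 100 e) (Load r a (loc 100 e))"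

definition sto :: "nat \<Rightarrow> aexp \<Rightarrow> aexp \<Rightarrow> com" where
 "sto a i e = Seq (code 100 i) (Seq (code 101 e) (Store a (loc 100 i) (loc 101 e)))"

definition cif :: "aexp \<Rightarrow> com \<Rightarrow> com \<Rightarrow> com" where
 "cif e P Q = Seq (code 100 e) (IfPos (loc 100 e) P Q)"

text \<open>\<open>WhilePos\<close> tests a register, so the code of the guard is placed before the
  loop and again at the end of the body.\<close>

definition whl :: "aexp \<Rightarrow> com \<Rightarrow> com" where
 "whl e P = Seq (code 100 e) (WhilePos (loc 100 e) (Seq P (code 100 e)))"

definition loop :: "nat \<Rightarrow> nat \<Rightarrow> com \<Rightarrow> com" where
 "loop i r P = Seq (asg i (N 0)) (whl (V r -. V i) (Seq P (asg i (V i +. N 1))))"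

text \<open>Counts instructions; the price of a single instruction is factored out as \<mu>
  below.\<close>

fun cost :: "aexp \<Rightarrow> nat" where
 "cost (N z) = 1"
| "cost (V r) = 0"
| "cost (B f x y) = cost x + cost y + 1"
| "cost (Ix a e) = cost e + 1"

abbreviation rv :: "state \<Rightarrow> nat \<Rightarrow> int" where "rv p r \<equiv> fst (reg p r)"
abbreviation av :: "state \<Rightarrow> nat \<Rightarrow> int \<Rightarrow> int" where "av p a i \<equiv> fst (arr p a i)"

section \<open>Cells and the visible part of a state\<close>

lemma fst_binop_cell [simp]: "fst (binop_cell f x y) = binop_val f (fst x) (fst y)"
 by (simp add: binop_cell_def cell_of_def)

lemma fst_exact_cell [simp]: "fst (exact_cell z) = z"
 by (simp add: exact_cell_def)

lemma snd_exact_cell [simp]: "snd (exact_cell z) = int_size z"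
 by (simp add: exact_cell_def)

lemma snd_binop_cell:
 "snd (binop_cell f x y) = min (int_size (binop_val f (fst x) (fst y))) (binop_size f (snd x) (snd y))"
 by (simp add: binop_cell_def cell_of_def)

lemma reg_set_reg [simp]: "reg (set_reg r x p) = (reg p)(r := x)"
 and arr_set_reg [simp]: "arr (set_reg r x p) = arr p"
 and reg_set_arr [simp]: "reg (set_arr a i x p) = reg p"
 and arr_set_arr [simp]: "arr (set_arr a i x p) = (arr p)(a := (arr p a)(i := x))"
 by (simp_all add: set_reg_def set_arr_def)

text \<open>Registers from 100 on hold intermediate results and are invisible in assertions.\<close>

definition view :: "state \<Rightarrow> state" where
 "view s = s\<lparr>reg := \<lambda>r. if r < 100 then reg s r else (0, 0)\<rparr>"

lemma reg_view: "reg (view s) r = (if r < 100 then reg s r else (0, 0))"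
 and arr_view [simp]: "arr (view s) = arr s"
 by (simp_all add: view_def)

lemma view_set_reg: "r < 100 \<Longrightarrow> view (set_reg r x s) = set_reg r x (view s)"
 by (auto simp: view_def set_reg_def fun_eq_iff)

lemma view_set_arr: "view (set_arr a i x s) = set_arr a i x (view s)"
 by (auto simp: view_def set_arr_def fun_eq_iff)

lemma state_eqI: "reg s = reg t \<Longrightarrow> arr s = arr t \<Longrightarrow> s = (t :: state)"
 by (cases s, cases t) simp

lemma ev_cong:
 "(\<And>r. r \<in> regs_of e \<Longrightarrow> reg s r = reg t r) \<Longrightarrow> arr s = arr t \<Longrightarrow> ev s e = ev t e"
 by (induction e) auto

lemma ev_view: "\<forall>r\<in>regs_of e. r < 100 \<Longrightarrow> ev (view s) e = ev s e"
 by (rule ev_cong) (auto simp: reg_view)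

text \<open>Two thresholds for charged sizes: \<open>a\<close> for cells that are kept,
  \<open>W\<close> for intermediate results within one expression. Up to \<open>W\<close> an
  instruction costs at most \<mu>, which turns running time into an instruction count.
  \<open>Bd\<close> translates \<open>a\<close> into a bound on absolute values.\<close>

locale machine =
 fixes mul :: "nat \<Rightarrow> nat" and L W a \<mu> :: nat and Bd :: int
 assumes a_le: "a \<le> W"
  and charge_le: "k \<le> W \<Longrightarrow> charge mul L k \<le> \<mu>"
  and size_le: "\<bar>v\<bar> \<le> Bd \<Longrightarrow> int_size v \<le> a"
  and Bd_ge: "10 \<le> Bd"
begin

fun okE :: "state \<Rightarrow> aexp \<Rightarrow> bool" where
 "okE s (N z) \<longleftrightarrow> int_size z \<le> W"
| "okE s (V r) \<longleftrightarrow> snd (reg s r) \<le> W"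
| "okE s (B f x y) \<longleftrightarrow> okE s x \<and> okE s y \<and> snd (binop_cell f (ev s x) (ev s y)) \<le> W"
| "okE s (Ix b e) \<longleftrightarrow> okE s e \<and> snd (arr s b (fst (ev s e))) \<le> W"

lemma okE_snd: "okE s e \<Longrightarrow> snd (ev s e) \<le> W"
 by (cases e) auto

lemma okE_cong:
 "(\<And>r. r \<in> regs_of e \<Longrightarrow> reg s r = reg t r) \<Longrightarrow> arr s = arr t \<Longrightarrow> okE s e = okE t e"
proof (induction e)
 case (B f x y)
 have "ev s x = ev t x" "ev s y = ev t y" using B.prems by (auto intro!: ev_cong)
 with B show ?case by auto
next
 case (Ix b e)
 have "ev s e = ev t e" using Ix.prems by (auto intro!: ev_cong)
 with Ix show ?case by auto
qed auto

lemma code_correct: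
 assumes "\<forall>r\<in>regs_of e. r < 100" "100 \<le> t" "okE s e"
 shows "\<exists>k s'. exec mul L (code t e) s k s' \<and> k \<le> cost e * \<mu> \<and> arr s' = arr s \<and>
  (\<forall>r<t. reg s' r = reg s r) \<and> reg s' (loc t e) = ev s e"
 using assms
proof (induction e arbitrary: t s)
 case (N z)
 show ?case
  unfolding code.simps
  by (rule exI, rule exI, rule conjI[OF exec.Const]) (use N charge_le in auto)
next
 case (V r)
 show ?case unfolding code.simps by (rule exI, rule exI, rule conjI[OF exec.Skip]) auto
next
 case (B f x y)
 obtain k1 s1 where 1: "exec mul L (code t x) s k1 s1" "k1 \<le> cost x * \<mu>" "arr s1 = arr s"
  "\<forall>r<t. reg s1 r = reg s r" "reg s1 (loc t x) = ev s x"
  using B.IH(1)[of t s] B.prems by auto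
 have cg: "reg s1 r = reg s r" if "r \<in> regs_of y" for r
  using 1(4) B.prems(1,2) that by (auto dest!: bspec[of _ _ r])
 have e1: "ev s1 y = ev s y" "okE s1 y = okE s y"
  using ev_cong[OF cg 1(3)] okE_cong[OF cg 1(3)] by auto
 obtain k2 s2 where 2: "exec mul L (code (Suc t) y) s1 k2 s2" "k2 \<le> cost y * \<mu>" "arr s2 = arr s1"
  "\<forall>r<Suc t. reg s2 r = reg s1 r" "reg s2 (loc (Suc t) y) = ev s1 y"
  using B.IH(2)[of "Suc t" s1] B.prems e1 by auto
 \<comment> \<open>The left operand lies in temporary \<open>t\<close> or in a program register, out
   of reach of the code for \<open>y\<close>, which starts at \<open>Suc t\<close>.\<close>
 have "loc t x < Suc t" using B.prems by (cases x) auto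
 then have lx: "reg s2 (loc t x) = ev s x" using 2 1 by simp
 let ?k = "charge mul L (max (snd (reg s2 (loc t x))) (snd (reg s2 (loc (Suc t) y))))"
 have "?k \<le> \<mu>" unfolding lx 2 e1 by (rule charge_le) (use B.prems okE_snd in auto)
 moreover have "exec mul L (code t (B f x y)) s (k1 + (k2 + ?k))
   (set_reg t (binop_cell f (reg s2 (loc t x)) (reg s2 (loc (Suc t) y))) s2)"
  unfolding code.simps by (rule exec.Seq[OF 1(1) exec.Seq[OF 2(1) exec.Op]])
 ultimately show ?case using 1 2
  by (intro exI conjI) (assumption, auto simp: lx e1 algebra_simps)
next
 case (Ix b e)
 obtain k1 s1 where 1: "exec mul L (code t e) s k1 s1" "k1 \<le> cost e * \<mu>" "arr s1 = arr s"
  "\<forall>r<t. reg s1 r = reg s r" "reg s1 (loc t e) = ev s e"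
  using Ix.IH[of t s] Ix.prems by auto
 let ?x = "arr s1 b (fst (reg s1 (loc t e)))"
 let ?k = "charge mul L (max (snd (reg s1 (loc t e))) (snd ?x))"
 have "?k \<le> \<mu>" unfolding 1 by (rule charge_le) (use Ix.prems okE_snd in auto)
 moreover have "exec mul L (code t (Ix b e)) s (k1 + ?k) (set_reg t ?x s1)"
  unfolding code.simps by (rule exec.Seq[OF 1(1) exec.Load[OF refl]])
 ultimately show ?case using 1
  by (intro exI conjI) (assumption, auto simp: algebra_simps)
qed

text \<open>The second conjunct, charge at most the true size, holds for every result of an
  instruction because of the minimum in \<open>cell_of\<close>. It allows a bound on the value to
  serve as a bound on the charge.\<close>

definition wfc :: "cell \<Rightarrow> bool" where
 "wfc x = (snd x \<le> a \<and> snd x \<le> int_size (fst x))"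

definition wfs :: "state \<Rightarrow> bool" where
 "wfs p = ((\<forall>r<100. wfc (reg p r)) \<and> (\<forall>b i. wfc (arr p b i)))"

text \<open>Total correctness from one visible start state instead of a precondition, so that
  symbolic execution is rewriting. \<open>T\<close> counts instructions at price \<mu>, and
  well-formedness of the cells is carried along.\<close>

definition spec :: "com \<Rightarrow> state \<Rightarrow> nat \<Rightarrow> (state \<Rightarrow> bool) \<Rightarrow> bool" where
 "spec P p T Q = ((wfs p \<longrightarrow> (\<forall>s. view s = p \<longrightarrow>
   (\<exists>t s'. exec mul L P s t s' \<and> t \<le> T * \<mu> \<and> wfs (view s') \<and> Q (view s')))))"

lemma wfc_ev_size: "wfc x \<Longrightarrow> snd x \<le> W"
 using a_le by (auto simp: wfc_def)

lemma wfs_reg: "wfs p \<Longrightarrow> r < 100 \<Longrightarrow> wfc (reg p r)"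
 unfolding wfs_def by blast

lemma wfs_arr: "wfs p \<Longrightarrow> wfc (arr p b i)"
 unfolding wfs_def by blast

section \<open>Total correctness rules for the instructions\<close>

lemma spec_mono:
 "spec P p T Q \<Longrightarrow> T \<le> T' \<Longrightarrow> (\<And>p'. wfs p' \<Longrightarrow> Q p' \<Longrightarrow> Q' p') \<Longrightarrow> spec P p T' Q'"
 unfolding spec_def
proof (intro impI allI)
 fix s
 assume *: "wfs p \<longrightarrow> (\<forall>s. view s = p \<longrightarrow> (\<exists>t s'. exec mul L P s t s' \<and> t \<le> T * \<mu> \<and> wfs (view s') \<and> Q (view s')))"
  "T \<le> T'" "\<And>p'. wfs p' \<Longrightarrow> Q p' \<Longrightarrow> Q' p'" "wfs p" "view s = p"
 then obtain t s' where "exec mul L P s t s'" "t \<le> T * \<mu>" "wfs (view s')" "Q (view s')" by blast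
 moreover have "T * \<mu> \<le> T' * \<mu>" using *(2) by simp
 ultimately show "\<exists>t s'. exec mul L P s t s' \<and> t \<le> T' * \<mu> \<and> wfs (view s') \<and> Q' (view s')"
  using *(3) by (meson le_trans)
qed

lemma spec_conseq:
 "spec P p T Q \<Longrightarrow> (\<And>p'. wfs p' \<Longrightarrow> Q p' \<Longrightarrow> Q' p') \<Longrightarrow> spec P p T Q'"
 using spec_mono by blast

lemma spec_le: "spec P p T Q \<Longrightarrow> T \<le> T' \<Longrightarrow> spec P p T' Q"
 using spec_mono by blast

lemma spec_Skip: "Q p \<Longrightarrow> spec Skip p 0 Q"
 unfolding spec_def by (auto intro: exec.Skip)

lemma spec_Seq:
 assumes "spec P p T1 (\<lambda>p'. spec R p' T2 Q)"
 shows "spec (Seq P R) p (T1 + T2) Q"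
 unfolding spec_def
proof (intro impI allI)
 fix s assume "wfs p" "view s = p"
 then obtain t s1 where 1: "exec mul L P s t s1" "t \<le> T1 * \<mu>" "wfs (view s1)" "spec R (view s1) T2 Q"
  using assms unfolding spec_def[of P] by blast
 then obtain t' s2 where 2: "exec mul L R s1 t' s2" "t' \<le> T2 * \<mu>" "wfs (view s2)" "Q (view s2)"
  unfolding spec_def by blast
 show "\<exists>t s'. exec mul L (Seq P R) s t s' \<and> t \<le> (T1 + T2) * \<mu> \<and> wfs (view s') \<and> Q (view s')"
  using exec.Seq[OF 1(1) 2(1)] 1 2 by (intro exI conjI) (assumption, auto simp: algebra_simps)
qed

lemma snd_ev_le_int_size:
 "wfs p \<Longrightarrow> \<forall>r\<in>regs_of e. r < 100 \<Longrightarrow> snd (ev p e) \<le> int_size (fst (ev p e))"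
 using wfs_reg wfs_arr by (cases e) (auto simp: snd_binop_cell wfc_def)

lemma wfc_ev: "wfs p \<Longrightarrow> \<forall>r\<in>regs_of e. r < 100 \<Longrightarrow> snd (ev p e) \<le> a \<Longrightarrow> wfc (ev p e)"
 using snd_ev_le_int_size unfolding wfc_def by blast

lemma view_eqI:
 "(\<And>r. r < 100 \<Longrightarrow> reg s r = reg t r) \<Longrightarrow> arr s = arr t \<Longrightarrow> view s = view t"
 by (rule state_eqI) (auto simp: reg_view)

lemma code_view:
 assumes "\<forall>r\<in>regs_of e. r < 100" "okE (view s) e"
 obtains k s' where "exec mul L (code 100 e) s k s'" "k \<le> cost e * \<mu>" "view s' = view s"
  "reg s' (loc 100 e) = ev (view s) e"
proof -
 have "okE s e" using assms by (subst (asm) okE_cong[of e "view s" s]) (auto simp: reg_view)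
 then obtain k s' where *: "exec mul L (code 100 e) s k s'" "k \<le> cost e * \<mu>" "arr s' = arr s"
  "\<forall>r<100. reg s' r = reg s r" "reg s' (loc 100 e) = ev s e"
  using code_correct[of e 100 s] assms by auto
 moreover have "ev (view s) e = ev s e" using assms by (intro ev_view)
 moreover have "view s' = view s" using * by (intro view_eqI) auto
 ultimately show ?thesis using that by simp
qed

lemma code_code:
 assumes "\<forall>r\<in>regs_of x. r < 100" "okE (view s) x" "\<forall>r\<in>regs_of y. r < 100" "okE (view s) y"
 obtains k s1 k' s2 where "exec mul L (code 100 x) s k s1" "exec mul L (code 101 y) s1 k' s2"
  "k + k' \<le> (cost x + cost y) * \<mu>" "view s2 = view s"
  "reg s2 (loc 100 x) = ev (view s) x" "reg s2 (loc 101 y) = ev (view s) y"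
proof -
 have "okE s x" using assms by (subst (asm) okE_cong[of x "view s" s]) (auto simp: reg_view)
 then obtain k1 s1 where 1: "exec mul L (code 100 x) s k1 s1" "k1 \<le> cost x * \<mu>" "arr s1 = arr s"
  "\<forall>r<100. reg s1 r = reg s r" "reg s1 (loc 100 x) = ev s x"
  using code_correct[of x 100 s] assms by auto
 have oy: "okE s1 y" using assms 1 by (subst (asm) okE_cong[of y "view s" s1]) (auto simp: reg_view)
 obtain k2 s2 where 2: "exec mul L (code 101 y) s1 k2 s2" "k2 \<le> cost y * \<mu>" "arr s2 = arr s1"
  "\<forall>r<101. reg s2 r = reg s1 r" "reg s2 (loc 101 y) = ev s1 y"
  using code_correct[OF assms(3) _ oy, of 101] by auto
 have "loc 100 x < 101" using assms(1) by (cases x) auto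
 then have "reg s2 (loc 100 x) = ev s x" using 2 1 by simp
 moreover have "ev (view s) x = ev s x" "ev (view s) y = ev s y" using assms by (auto intro: ev_view)
 moreover have "ev s1 y = ev s y" using 1 assms by (intro ev_cong) auto
 moreover have "view s2 = view s" using 1 2 by (intro view_eqI) auto
 ultimately show ?thesis using that[OF 1(1) 2(1)] 1(2) 2(2,5) by (simp add: algebra_simps)
qed

lemma wfs_set_reg: "wfs p \<Longrightarrow> wfc x \<Longrightarrow> wfs (set_reg r x p)"
 unfolding wfs_def by simp

lemma wfs_set_arr: "wfs p \<Longrightarrow> wfc x \<Longrightarrow> wfs (set_arr b i x p)"
 unfolding wfs_def by simp

lemma spec_asg_basic:
 assumes e: "\<nexists>q. e = V q" "\<forall>q\<in>regs_of e. q < 100" and r: "r < 100"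
  and ok: "wfs p \<Longrightarrow> okE p e" "wfs p \<Longrightarrow> snd (ev p e) \<le> a"
  and Q: "wfs p \<Longrightarrow> Q (set_reg r (ev p e) p)"
 shows "spec (asg r e) p (cost e) Q"
 unfolding spec_def
proof (intro impI allI)
 fix s assume p: "wfs p" "view s = p"
 have iv: "wfs (set_reg r (ev p e) p)" by (intro wfs_set_reg wfc_ev p e ok)
 show "\<exists>t s'. exec mul L (asg r e) s t s' \<and> t \<le> cost e * \<mu> \<and> wfs (view s') \<and> Q (view s')"
 proof (cases e)
  case (N z)
  have "charge mul L (int_size z) \<le> \<mu>" using ok p N by (intro charge_le) simp
  then show ?thesis using N iv Q p r
   by (intro exI conjI) (simp only: asg.simps, rule exec.Const, auto simp: view_set_reg)
 next
  case (V q) with e show ?thesis by simp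
 next
  case (B f x y)
  have c: "\<forall>r\<in>regs_of x. r < 100" "okE (view s) x" "\<forall>r\<in>regs_of y. r < 100" "okE (view s) y"
   using ok(1) p e(2) B by auto
  obtain k s1 k' s2 where *: "exec mul L (code 100 x) s k s1" "exec mul L (code 101 y) s1 k' s2"
   "k + k' \<le> (cost x + cost y) * \<mu>" "view s2 = view s"
   "reg s2 (loc 100 x) = ev (view s) x" "reg s2 (loc 101 y) = ev (view s) y"
   by (rule code_code[OF c])
  let ?k = "charge mul L (max (snd (reg s2 (loc 100 x))) (snd (reg s2 (loc 101 y))))"
  have "?k \<le> \<mu>" unfolding * by (rule charge_le) (use ok p B okE_snd in auto)
  moreover have "exec mul L (asg r e) s (k + (k' + ?k))
    (set_reg r (binop_cell f (reg s2 (loc 100 x)) (reg s2 (loc 101 y))) s2)"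
   unfolding asg.simps B by (rule exec.Seq[OF *(1) exec.Seq[OF *(2) exec.Op]])
  ultimately show ?thesis using * p iv Q r B
   by (intro exI conjI) (assumption, auto simp: algebra_simps view_set_reg)
 next
  case (Ix b y)
  have c: "\<forall>r\<in>regs_of y. r < 100" "okE (view s) y" using ok(1) p e(2) Ix by auto
  obtain k s' where *: "exec mul L (code 100 y) s k s'" "k \<le> cost y * \<mu>" "view s' = view s"
   "reg s' (loc 100 y) = ev (view s) y"
   by (rule code_view[OF c])
  let ?x = "arr s' b (fst (reg s' (loc 100 y)))"
  have as: "arr s' = arr p" using * p by (metis arr_view)
  let ?k = "charge mul L (max (snd (reg s' (loc 100 y))) (snd ?x))"
  have "?k \<le> \<mu>" unfolding * as by (rule charge_le) (use ok p Ix okE_snd in auto)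
  moreover have "exec mul L (asg r e) s (k + ?k) (set_reg r ?x s')"
   unfolding Ix asg.simps by (rule exec.Seq[OF *(1) exec.Load[OF refl]])
  ultimately show ?thesis using * p iv Q r Ix as
   by (intro exI conjI) (assumption, auto simp: algebra_simps view_set_reg)
 qed
qed

lemma spec_sto_basic:
 assumes e: "\<forall>q\<in>regs_of e. q < 100" "\<forall>q\<in>regs_of i. q < 100"
  and ok: "wfs p \<Longrightarrow> okE p i" "wfs p \<Longrightarrow> okE p e" "wfs p \<Longrightarrow> snd (ev p e) \<le> a"
  and Q: "wfs p \<Longrightarrow> Q (set_arr b (fst (ev p i)) (ev p e) p)"
 shows "spec (sto b i e) p (cost i + cost e + 1) Q"
 unfolding spec_def
proof (intro impI allI)
 fix s assume p: "wfs p" "view s = p"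
 have iv: "wfs (set_arr b (fst (ev p i)) (ev p e) p)" by (intro wfs_set_arr wfc_ev p e ok)
 have c: "okE (view s) i" "okE (view s) e" using ok p by auto
 obtain k s1 k' s2 where *: "exec mul L (code 100 i) s k s1" "exec mul L (code 101 e) s1 k' s2"
  "k + k' \<le> (cost i + cost e) * \<mu>" "view s2 = view s"
  "reg s2 (loc 100 i) = ev (view s) i" "reg s2 (loc 101 e) = ev (view s) e"
  by (rule code_code[OF e(2) c(1) e(1) c(2)])
 let ?k = "charge mul L (max (snd (reg s2 (loc 100 i))) (snd (reg s2 (loc 101 e))))"
 have "?k \<le> \<mu>" unfolding * by (rule charge_le) (use ok p okE_snd in auto)
 moreover have "exec mul L (sto b i e) s (k + (k' + ?k))
    (set_arr b (fst (reg s2 (loc 100 i))) (reg s2 (loc 101 e)) s2)"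
  unfolding sto_def by (rule exec.Seq[OF *(1) exec.Seq[OF *(2) exec.Store]])
 ultimately show "\<exists>t s'. exec mul L (sto b i e) s t s' \<and> t \<le> (cost i + cost e + 1) * \<mu> \<and> wfs (view s') \<and> Q (view s')"
  using * p iv Q by (intro exI conjI) (assumption, auto simp: algebra_simps view_set_arr)
qed

lemma spec_cif_basic:
 assumes e: "\<forall>q\<in>regs_of e. q < 100" and ok: "wfs p \<Longrightarrow> okE p e"
  and P: "fst (ev p e) > 0 \<Longrightarrow> spec P p T1 Q" and R: "fst (ev p e) \<le> 0 \<Longrightarrow> spec R p T2 Q"
 shows "spec (cif e P R) p (cost e + 1 + max T1 T2) Q"
 unfolding spec_def
proof (intro impI allI)
 fix s assume p: "wfs p" "view s = p"
 have c: "okE (view s) e" using ok p by auto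
 obtain k s' where *: "exec mul L (code 100 e) s k s'" "k \<le> cost e * \<mu>" "view s' = view s"
   "reg s' (loc 100 e) = ev (view s) e"
  by (rule code_view[OF e c])
 let ?k = "charge mul L (snd (reg s' (loc 100 e)))"
 have k: "?k \<le> \<mu>" unfolding * by (rule charge_le) (use ok p okE_snd in auto)
 show "\<exists>t s'. exec mul L (cif e P R) s t s' \<and> t \<le> (cost e + 1 + max T1 T2) * \<mu> \<and> wfs (view s') \<and> Q (view s')"
 proof (cases "fst (ev p e) > 0")
  case True
  from P[OF this] p * obtain t2 s2 where 2: "exec mul L P s' t2 s2" "t2 \<le> T1 * \<mu>" "wfs (view s2)" "Q (view s2)"
   unfolding spec_def by metis
  have "exec mul L (cif e P R) s (k + (?k + t2)) s2"
   unfolding cif_def by (rule exec.Seq[OF *(1) exec.IfTrue[OF _ 2(1)]]) (use True * p in simp)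
  moreover have "k + (?k + t2) \<le> (cost e + 1 + T1) * \<mu>" using * k 2 by (simp add: algebra_simps)
  then have "k + (?k + t2) \<le> (cost e + 1 + max T1 T2) * \<mu>" by (rule order_trans) (simp add: mult_le_mono1)
  ultimately show ?thesis using 2 by blast
 next
  case False
  then have F: "fst (ev p e) \<le> 0" by simp
  from R[OF this] p * obtain t2 s2 where 2: "exec mul L R s' t2 s2" "t2 \<le> T2 * \<mu>" "wfs (view s2)" "Q (view s2)"
   unfolding spec_def by metis
  have "exec mul L (cif e P R) s (k + (?k + t2)) s2"
   unfolding cif_def by (rule exec.Seq[OF *(1) exec.IfFalse[OF _ 2(1)]]) (use F * p in simp)
  moreover have "k + (?k + t2) \<le> (cost e + 1 + T2) * \<mu>" using * k 2 by (simp add: algebra_simps)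
  then have "k + (?k + t2) \<le> (cost e + 1 + max T1 T2) * \<mu>" by (rule order_trans) (simp add: mult_le_mono1)
  ultimately show ?thesis using 2 by blast
 qed
qed

text \<open>Termination is hidden in \<open>step\<close>: a positive guard forces
  \<open>k < n\<close>, so the index of the invariant is also the iteration counter.\<close>

lemma spec_whl_basic:
 assumes e: "\<forall>q\<in>regs_of e. q < 100"
  and I0: "I 0 p"
  and ok: "\<And>k p. k \<le> n \<Longrightarrow> I k p \<Longrightarrow> wfs p \<Longrightarrow> okE p e"
  and step: "\<And>k p. k \<le> n \<Longrightarrow> I k p \<Longrightarrow> wfs p \<Longrightarrow> fst (ev p e) > 0 \<Longrightarrow> k < n \<and> spec P p T (I (Suc k))"
 shows "spec (whl e P) p (cost e + 1 + n * (T + cost e + 1)) (\<lambda>p'. \<exists>k\<le>n. I k p' \<and> fst (ev p' e) \<le> 0)"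
proof -
 define WP where "WP = WhilePos (loc 100 e) (Seq P (code 100 e))"
 have wloop: "\<exists>t s'. exec mul L WP s t s' \<and> t \<le> (1 + (n - k) * (T + cost e + 1)) * \<mu> \<and>
   wfs (view s') \<and> (\<exists>k\<le>n. I k (view s') \<and> fst (ev (view s') e) \<le> 0)"
  if "k \<le> n" "I k (view s)" "wfs (view s)" "reg s (loc 100 e) = ev (view s) e" for k s
  using that
 proof (induction "n - k" arbitrary: k s rule: less_induct)
  case less
  let ?k = "charge mul L (snd (reg s (loc 100 e)))"
  have k: "?k \<le> \<mu>" unfolding less.prems by (rule charge_le) (use ok less.prems okE_snd in auto)
  show ?case
  proof (cases "fst (ev (view s) e) > 0")
   case False
   then have "exec mul L WP s ?k s" unfolding WP_def
    by (intro exec.WhileFalse) (use less.prems in auto)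
   moreover have "?k \<le> (1 + (n - k) * (T + cost e + 1)) * \<mu>" using k by (simp add: algebra_simps)
   ultimately show ?thesis using False less.prems by (meson not_less)
  next
   case True
   with step less.prems have kn: "k < n" and sp: "spec P (view s) T (I (Suc k))" by auto
   from sp less.prems obtain t1 s1 where 1: "exec mul L P s t1 s1" "t1 \<le> T * \<mu>" "wfs (view s1)" "I (Suc k) (view s1)"
    unfolding spec_def by blast
   have c: "okE (view s1) e" by (rule ok[OF _ 1(4,3)]) (use kn in simp)
   obtain k2 s2 where 2: "exec mul L (code 100 e) s1 k2 s2" "k2 \<le> cost e * \<mu>" "view s2 = view s1"
    "reg s2 (loc 100 e) = ev (view s1) e"
    by (rule code_view[OF e c])
   have "n - Suc k < n - k" "Suc k \<le> n" using kn by auto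
   from less.hyps[OF this(1) this(2), of s2] 1 2 obtain t3 s3 where
    3: "exec mul L WP s2 t3 s3" "t3 \<le> (1 + (n - Suc k) * (T + cost e + 1)) * \<mu>"
     "wfs (view s3)" "\<exists>k\<le>n. I k (view s3) \<and> fst (ev (view s3) e) \<le> 0"
    by auto
   have "exec mul L WP s (?k + (t1 + k2) + t3) s3" unfolding WP_def
    by (rule exec.WhileTrue[OF _ exec.Seq[OF 1(1) 2(1)] 3(1)[unfolded WP_def]]) (use True less.prems in auto)
   moreover have "?k + (t1 + k2) + t3 \<le> (1 + (n - k) * (T + cost e + 1)) * \<mu>"
   proof -
    have "n - k = Suc (n - Suc k)" using kn by simp
    then have eq: "(1 + (n - k) * (T + cost e + 1)) * \<mu> =
     \<mu> + (T * \<mu> + cost e * \<mu>) + (1 + (n - Suc k) * (T + cost e + 1)) * \<mu>"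
     by (simp only: mult_Suc add_mult_distrib)
    show ?thesis unfolding eq using k 1(2) 2(2) 3(2) by linarith
   qed
   ultimately show ?thesis using 3 by blast
  qed
 qed
 show ?thesis
  unfolding spec_def
 proof (intro impI allI)
  fix s assume p: "wfs p" "view s = p"
  have c: "okE (view s) e" using ok[of 0 p] I0 p by auto
  obtain k s' where *: "exec mul L (code 100 e) s k s'" "k \<le> cost e * \<mu>" "view s' = view s"
   "reg s' (loc 100 e) = ev (view s) e"
   by (rule code_view[OF e c])
  from wloop[of 0 s'] * p I0 obtain t2 s2 where 2: "exec mul L WP s' t2 s2"
   "t2 \<le> (1 + n * (T + cost e + 1)) * \<mu>" "wfs (view s2)" "\<exists>k\<le>n. I k (view s2) \<and> fst (ev (view s2) e) \<le> 0"
   by auto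
  have "exec mul L (whl e P) s (k + t2) s2"
   unfolding whl_def using exec.Seq[OF *(1) 2(1)] by (simp add: WP_def)
  moreover have "k + t2 \<le> (cost e + 1 + n * (T + cost e + 1)) * \<mu>"
   using *(2) 2(2) by (simp add: algebra_simps)
  ultimately show "\<exists>t s'. exec mul L (whl e P) s t s' \<and> t \<le> (cost e + 1 + n * (T + cost e + 1)) * \<mu> \<and> wfs (view s') \<and> (\<exists>k\<le>n. I k (view s') \<and> fst (ev (view s') e) \<le> 0)"
   using 2 by blast
 qed
qed

lemma snd_small: "\<bar>binop_val f (fst y) (fst z)\<bar> \<le> Bd \<Longrightarrow> snd (binop_cell f y z) \<le> a"
 using size_le[of "binop_val f (fst y) (fst z)"] by (simp add: snd_binop_cell)

lemma int_size_le_W: "\<bar>v\<bar> \<le> Bd \<Longrightarrow> int_size v \<le> W"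
 using size_le a_le order_trans by blast

text \<open>The quantifier over \<open>x\<close> hides the charged size of the loop counter.\<close>

lemma spec_loop:
 assumes ir: "i < 100" "r < 100" "i \<noteq> r" and n: "int n \<le> Bd"
  and I0: "\<And>x. I 0 (set_reg i x p)"
  and rI: "\<And>k p. k \<le> n \<Longrightarrow> I k p \<Longrightarrow> rv p r = int n"
  and step: "\<And>k p. k < n \<Longrightarrow> I k p \<Longrightarrow> wfs p \<Longrightarrow> rv p i = int k \<Longrightarrow>
   spec P p T (\<lambda>p'. rv p' i = int k \<and> (\<forall>x. I (Suc k) (set_reg i x p')))"
  and Q: "\<And>p. wfs p \<Longrightarrow> I n p \<Longrightarrow> Q p"
 shows "spec (loop i r P) p (3 + n * (T + 4)) Q"
proof -
 define J where "J k p = (I k p \<and> rv p i = int k)" for k p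
 have w: "spec (whl (V r -. V i) (Seq P (asg i (V i +. N 1)))) p
  (cost (V r -. V i) + 1 + n * ((T + cost (V i +. N 1)) + cost (V r -. V i) + 1))
  (\<lambda>p'. \<exists>k\<le>n. J k p' \<and> fst (ev p' (V r -. V i)) \<le> 0)" if "J 0 p" for p
 proof (rule spec_whl_basic)
  show "\<forall>q\<in>regs_of (V r -. V i). q < 100" "J 0 p" using ir that by auto
  show "okE p (V r -. V i)" if "k \<le> n" "J k p" "wfs p" for k p
  proof -
   have "\<bar>rv p r - rv p i\<bar> \<le> Bd" using that n rI by (auto simp: J_def)
   then have "snd (binop_cell OSub (reg p r) (reg p i)) \<le> a" by (intro snd_small) simp
   with a_le show ?thesis
    using wfc_ev_size[OF wfs_reg[OF \<open>wfs p\<close> ir(1)]] wfc_ev_size[OF wfs_reg[OF \<open>wfs p\<close> ir(2)]] by simp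
  qed
  show "k < n \<and> spec (Seq P (asg i (V i +. N 1))) p (T + cost (V i +. N 1)) (J (Suc k))"
   if *: "k \<le> n" "J k p" "wfs p" "0 < fst (ev p (V r -. V i))" for k p
  proof
   show kn: "k < n" using * rI by (auto simp: J_def)
   show "spec (Seq P (asg i (V i +. N 1))) p (T + cost (V i +. N 1)) (J (Suc k))"
   proof (rule spec_Seq, rule spec_conseq[OF step[OF kn]])
    show "I k p" "wfs p" "rv p i = int k" using * by (auto simp: J_def)
    fix p' assume p': "wfs p'" "rv p' i = int k \<and> (\<forall>x. I (Suc k) (set_reg i x p'))"
    have sz: "\<bar>rv p' i + 1\<bar> \<le> Bd" using p' n kn by auto
    have "snd (binop_cell OAdd (reg p' i) (exact_cell 1)) \<le> a"
     by (rule snd_small) (use sz in simp)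
    moreover have "int_size 1 \<le> W" using int_size_le_W[of 1] Bd_ge by simp
    moreover have "snd (reg p' i) \<le> W" using wfc_ev_size[OF wfs_reg[OF p'(1) ir(1)]] .
    ultimately show "spec (asg i (V i +. N 1)) p' (cost (V i +. N 1)) (J (Suc k))"
     using p' ir a_le by (intro spec_asg_basic) (simp_all add: J_def)
   qed
  qed
 qed
 have "int_size 0 \<le> a" using size_le[of 0] Bd_ge by simp
 then have "spec (loop i r P) p (1 + (cost (V r -. V i) + 1 + n * ((T + cost (V i +. N 1)) + cost (V r -. V i) + 1))) Q"
  unfolding loop_def
  apply (intro spec_Seq)
  apply (rule spec_conseq[where Q = "J 0"])
  subgoal using spec_asg_basic[of "N 0" i p "J 0"] ir I0 a_le by (auto simp: J_def)
  subgoal for p' by (rule spec_conseq[OF w]) (use Q rI in \<open>auto simp: J_def\<close>)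
  done
 then show ?thesis by (rule spec_le) (simp add: algebra_simps)
qed

end

section \<open>Syntactic bounds on charged sizes\<close>

fun szn :: "aexp \<Rightarrow> nat" where
 "szn (N z) = 1"
| "szn (V r) = 1"
| "szn (B f x y) = (if f = OAdd \<or> f = OSub then max (szn x) (szn y) + 1 else szn x + szn y)"
| "szn (Ix a e) = 1"

text \<open>\<open>szn\<close> measures an expression in multiples of \<open>a\<close>, the leaves
  counting 1. The limit 8 corresponds to the assumption \<open>8 * a \<le> W\<close>, the limit 10
  on literals to \<open>10 \<le> Bd\<close>.\<close>

fun wfe :: "aexp \<Rightarrow> bool" where
 "wfe (N z) \<longleftrightarrow> \<bar>z\<bar> \<le> 10"
| "wfe (V r) \<longleftrightarrow> r < 100"
| "wfe (B f x y) \<longleftrightarrow> wfe x \<and> wfe y \<and> szn (B f x y) \<le> 8"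
| "wfe (Ix a e) \<longleftrightarrow> wfe e"

fun is_atom :: "aexp \<Rightarrow> bool" where
 "is_atom (V r) = True"
| "is_atom (Ix a e) = True"
| "is_atom _ = False"

fun is_reg :: "aexp \<Rightarrow> bool" where
 "is_reg (V r) = True"
| "is_reg _ = False"

lemma wfe_regs: "wfe e \<Longrightarrow> \<forall>r\<in>regs_of e. r < 100"
 by (induction e) auto

text \<open>Scratch registers are those from \<open>l\<close> on. Nested blocks use higher registers
  than the blocks around them, so their frames are also frames of the caller.\<close>

definition frame :: "nat \<Rightarrow> nat set \<Rightarrow> nat set \<Rightarrow> state \<Rightarrow> state \<Rightarrow> bool" where
 "frame l X Y p q = ((\<forall>r<l. r \<notin> X \<longrightarrow> reg q r = reg p r) \<and> (\<forall>a. a \<notin> Y \<longrightarrow> arr q a = arr p a))"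

lemma frame_refl [simp]: "frame l X Y p p"
 by (simp add: frame_def)

lemma frame_reg: "frame l X Y p q \<Longrightarrow> r < l \<Longrightarrow> r \<notin> X \<Longrightarrow> reg q r = reg p r"
 by (simp add: frame_def)

lemma frame_arr: "frame l X Y p q \<Longrightarrow> b \<notin> Y \<Longrightarrow> arr q b = arr p b"
 by (simp add: frame_def)

lemma frame_set_reg [simp]: "l \<le> r \<or> r \<in> X \<Longrightarrow> frame l X Y p (set_reg r x q) = frame l X Y p q"
 by (auto simp: frame_def)

lemma frame_set_arr [simp]: "b \<in> Y \<Longrightarrow> frame l X Y p (set_arr b i x q) = frame l X Y p q"
 by (auto simp: frame_def)

lemma frame_mono:
 "frame l' X' Y' p q \<Longrightarrow> l \<le> l' \<Longrightarrow> (\<And>r. r \<in> X' \<Longrightarrow> r \<in> X \<or> l \<le> r) \<Longrightarrow> Y' \<subseteq> Y \<Longrightarrow> frame l X Y p q"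
 unfolding frame_def by (meson less_le_trans subsetD not_less)

locale machine8 = machine +
 assumes a8: "8 * a \<le> W"
begin

lemma a_pos: "1 \<le> a"
 using size_le[of 0] Bd_ge int_size_pos[of 0] by simp

lemma snd_ev_szn: "wfs p \<Longrightarrow> wfe e \<Longrightarrow> snd (ev p e) \<le> szn e * a"
proof (induction e)
 case (N z)
 then show ?case using size_le[of z] Bd_ge by simp
next
 case (V r)
 then show ?case using wfs_reg[of p r] by (simp add: wfc_def)
next
 case (Ix b e)
 then show ?case using wfs_arr[of p b] by (simp add: wfc_def)
next
 case (B f x y)
 then have x: "snd (ev p x) \<le> szn x * a" and y: "snd (ev p y) \<le> szn y * a" by auto
 have "szn x * a \<le> max (szn x) (szn y) * a" "szn y * a \<le> max (szn x) (szn y) * a" by simp_all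
 then have m: "max (snd (ev p x)) (snd (ev p y)) \<le> max (szn x) (szn y) * a"
  using x y by linarith
 \<comment> \<open>The carry bit of an addition is absorbed by \<open>1 \<le> a\<close>.\<close>
 have "binop_size f (snd (ev p x)) (snd (ev p y)) \<le> szn (B f x y) * a"
  using x y m a_pos by (cases f) (auto simp: add_mult_distrib simp del: max.bounded_iff)
 then show ?case by (simp add: snd_binop_cell)
qed

lemma wfe_szn: "wfe e \<Longrightarrow> szn e \<le> 8"
 by (cases e) auto

lemma snd_ev_W: "wfs p \<Longrightarrow> wfe e \<Longrightarrow> snd (ev p e) \<le> W"
proof -
 assume "wfs p" "wfe e"
 then have "snd (ev p e) \<le> szn e * a" "szn e * a \<le> 8 * a"
  using snd_ev_szn wfe_szn by simp_all
 with a8 show ?thesis by linarith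
qed

lemma okE_wfe: "wfs p \<Longrightarrow> wfe e \<Longrightarrow> okE p e"
proof (induction e)
 case (N z) then show ?case using snd_ev_W[of p "N z"] by simp
next
 case (V r) then show ?case using snd_ev_W[of p "V r"] by simp
next
 case (B f x y) then show ?case using snd_ev_W[of p "B f x y"] by simp
next
 case (Ix b e) then show ?case using snd_ev_W[of p "Ix b e"] by simp
qed

lemma snd_ev_small:
 assumes "wfs p" "wfe e" "is_atom e \<or> \<bar>fst (ev p e)\<bar> \<le> Bd"
 shows "snd (ev p e) \<le> a"
proof (cases e)
 case (N z) with assms show ?thesis using size_le[of z] Bd_ge by simp
next
 case (V r) with assms show ?thesis using wfs_reg[of p r] by (simp add: wfc_def)
next
 case (B f x y)
 with assms show ?thesis using snd_small[of f "ev p x" "ev p y"] by simp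
next
 case (Ix b y) with assms show ?thesis using wfs_arr[of p b] by (simp add: wfc_def)
qed

lemma spec_asg_size:
 assumes "wfe e" "\<not> is_reg e" "r < 100" "wfs p \<Longrightarrow> snd (ev p e) \<le> a"
  and "wfs p \<Longrightarrow> Q (set_reg r (ev p e) p)"
 shows "spec (asg r e) p (cost e) Q"
 by (rule spec_asg_basic) (use assms wfe_regs okE_wfe in auto)

lemma spec_asg:
 assumes "wfe e" "\<not> is_reg e" "r < 100" "is_atom e \<or> \<bar>fst (ev p e)\<bar> \<le> Bd"
  and "\<And>k. Q (set_reg r (fst (ev p e), k) p)"
 shows "spec (asg r e) p (cost e) Q"
 by (rule spec_asg_size) (use assms assms(5)[of "snd (ev p e)"] snd_ev_small in auto)

lemma spec_sto_size:
 assumes "wfe i" "wfe e" "wfs p \<Longrightarrow> snd (ev p e) \<le> a"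
  and "wfs p \<Longrightarrow> Q (set_arr b (fst (ev p i)) (ev p e) p)"
 shows "spec (sto b i e) p (cost i + cost e + 1) Q"
 by (rule spec_sto_basic) (use assms wfe_regs okE_wfe in auto)

lemma spec_sto:
 assumes "wfe i" "wfe e" "is_atom e \<or> \<bar>fst (ev p e)\<bar> \<le> Bd"
  and "\<And>k. Q (set_arr b (fst (ev p i)) (fst (ev p e), k) p)"
 shows "spec (sto b i e) p (cost i + cost e + 1) Q"
 by (rule spec_sto_size) (use assms assms(4)[of "snd (ev p e)"] snd_ev_small in auto)

lemma spec_cif:
 assumes "wfe e"
  and "fst (ev p e) > 0 \<Longrightarrow> spec P p T1 Q" "fst (ev p e) \<le> 0 \<Longrightarrow> spec R p T2 Q"
 shows "spec (cif e P R) p (cost e + 1 + max T1 T2) Q"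
 by (rule spec_cif_basic) (use assms wfe_regs okE_wfe in auto)

lemma spec_whl:
 assumes "wfe e" "I 0 p"
  and "\<And>k p. k \<le> n \<Longrightarrow> I k p \<Longrightarrow> wfs p \<Longrightarrow> fst (ev p e) > 0 \<Longrightarrow> k < n \<and> spec P p T (I (Suc k))"
  and "\<And>k p. k \<le> n \<Longrightarrow> wfs p \<Longrightarrow> I k p \<Longrightarrow> fst (ev p e) \<le> 0 \<Longrightarrow> Q p"
 shows "spec (whl e P) p (cost e + 1 + n * (T + cost e + 1)) Q"
 by (rule spec_conseq[OF spec_whl_basic[where I = I]]) (use assms wfe_regs okE_wfe in auto)

end

section \<open>Loop-free blocks\<close>

text \<open>\<open>Asg\<close> and \<open>AsgS\<close> (likewise \<open>Sto\<close> and
  \<open>StoS\<close>) produce the same code and differ only in the proof obligation: a bound on the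
  value or a bound on the charged size.\<close>

datatype prog =
  Nop
 | Asg nat aexp (infix "::=" 62)
 | Sto nat aexp aexp
 | AsgS nat aexp
 | StoS nat aexp aexp
 | If aexp prog prog
 | Sq prog prog (infixr ";." 60)

fun blk :: "prog \<Rightarrow> com" where
 "blk Nop = Skip"
| "blk (r ::= e) = asg r e"
| "blk (Sto b i e) = sto b i e"
| "blk (AsgS r e) = asg r e"
| "blk (StoS b i e) = sto b i e"
| "blk (If e P R) = cif e (blk P) (blk R)"
| "blk (P ;. R) = Seq (blk P) (blk R)"

declare blk.simps [simp del] asg.simps [simp del]

fun wfp :: "prog \<Rightarrow> bool" where
 "wfp Nop \<longleftrightarrow> True"
| "wfp (r ::= e) \<longleftrightarrow> wfe e \<and> \<not> is_reg e \<and> r < 100"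
| "wfp (Sto b i e) \<longleftrightarrow> wfe i \<and> wfe e"
| "wfp (AsgS r e) \<longleftrightarrow> wfe e \<and> \<not> is_reg e \<and> r < 100"
| "wfp (StoS b i e) \<longleftrightarrow> wfe i \<and> wfe e"
| "wfp (If e P R) \<longleftrightarrow> wfe e \<and> wfp P \<and> wfp R"
| "wfp (P ;. R) \<longleftrightarrow> wfp P \<and> wfp R"

fun pcost :: "prog \<Rightarrow> nat" where
 "pcost Nop = 0"
| "pcost (r ::= e) = cost e"
| "pcost (Sto b i e) = cost i + cost e + 1"
| "pcost (AsgS r e) = cost e"
| "pcost (StoS b i e) = cost i + cost e + 1"
| "pcost (If e P R) = cost e + 1 + max (pcost P) (pcost R)"
| "pcost (P ;. R) = pcost P + pcost R"

context machine8
begin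

text \<open>The quantifier over \<open>k\<close> hides the charged size, except for the instructions
 \<^const>\<open>AsgS\<close> and \<^const>\<open>StoS\<close>, which are used for values that depend on \<open>b\<close>.\<close>

fun wp :: "prog \<Rightarrow> (state \<Rightarrow> bool) \<Rightarrow> state \<Rightarrow> bool" where
 "wp Nop Q p \<longleftrightarrow> Q p"
| "wp (r ::= e) Q p \<longleftrightarrow> (is_atom e \<or> \<bar>fst (ev p e)\<bar> \<le> Bd) \<and>
   (\<forall>k. Q (set_reg r (fst (ev p e), k) p))"
| "wp (Sto b i e) Q p \<longleftrightarrow> (is_atom e \<or> \<bar>fst (ev p e)\<bar> \<le> Bd) \<and>
   (\<forall>k. Q (set_arr b (fst (ev p i)) (fst (ev p e), k) p))"
| "wp (AsgS r e) Q p \<longleftrightarrow> (wfs p \<longrightarrow> snd (ev p e) \<le> a \<and> Q (set_reg r (ev p e) p))"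
| "wp (StoS b i e) Q p \<longleftrightarrow> (wfs p \<longrightarrow> snd (ev p e) \<le> a \<and> Q (set_arr b (fst (ev p i)) (ev p e) p))"
| "wp (If e P R) Q p \<longleftrightarrow> (0 < fst (ev p e) \<longrightarrow> wp P Q p) \<and> (fst (ev p e) \<le> 0 \<longrightarrow> wp R Q p)"
| "wp (P ;. R) Q p \<longleftrightarrow> wp P (wp R Q) p"

lemma wp_spec: "wfp P \<Longrightarrow> wp P Q p \<Longrightarrow> spec (blk P) p (pcost P) Q"
proof (induction P arbitrary: Q p)
 case Nop
 then show ?case by (auto simp: blk.simps intro: spec_Skip)
next
 case (Asg r e)
 then show ?case unfolding blk.simps pcost.simps by (intro spec_asg) auto
next
 case (Sto b i e)
 then show ?case unfolding blk.simps pcost.simps by (intro spec_sto) auto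
next
 case (AsgS r e)
 then show ?case unfolding blk.simps pcost.simps by (intro spec_asg_size) auto
next
 case (StoS b i e)
 then show ?case unfolding blk.simps pcost.simps by (intro spec_sto_size) auto
next
 case (If e P R)
 then show ?case unfolding blk.simps pcost.simps by (intro spec_cif) auto
next
 case (Sq P R)
 from Sq.prems have "wp P (wp R Q) p" "wfp P" "wfp R" by auto
 from spec_conseq[OF Sq.IH(1)[OF this(2,1)] Sq.IH(2)[OF this(3)]] show ?case
  unfolding blk.simps pcost.simps by (rule spec_Seq)
qed

lemma spec_blk: "wfp P \<Longrightarrow> wp P Q p \<Longrightarrow> pcost P \<le> T \<Longrightarrow> spec (blk P) p T Q"
 using wp_spec spec_le by blast

lemma spec_Seq_mid:
 "spec P p T1 A \<Longrightarrow> (\<And>p'. wfs p' \<Longrightarrow> A p' \<Longrightarrow> spec R p' T2 Q) \<Longrightarrow> spec (Seq P R) p (T1 + T2) Q"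
 by (rule spec_Seq, erule spec_conseq) blast

lemma wp_Seq:
 "wfp P \<Longrightarrow> wp P A p \<Longrightarrow> (\<And>p'. wfs p' \<Longrightarrow> A p' \<Longrightarrow> spec R p' T Q) \<Longrightarrow> spec (Seq (blk P) R) p (pcost P + T) Q"
 by (rule spec_Seq_mid[OF wp_spec])

lemma spec_loop_Seq:
 assumes "i < 100" "r < 100" "i \<noteq> r" "int n \<le> Bd" "\<And>x. I 0 (set_reg i x p)"
  and "\<And>k p. k \<le> n \<Longrightarrow> I k p \<Longrightarrow> rv p r = int n"
  and "\<And>k p. k < n \<Longrightarrow> I k p \<Longrightarrow> wfs p \<Longrightarrow> rv p i = int k \<Longrightarrow>
   spec P p T (\<lambda>p'. rv p' i = int k \<and> (\<forall>x. I (Suc k) (set_reg i x p')))"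
  and "\<And>p'. wfs p' \<Longrightarrow> I n p' \<Longrightarrow> spec R p' T2 Q"
 shows "spec (Seq (loop i r P) R) p (3 + n * (T + 4) + T2) Q"
 by (rule spec_Seq_mid[OF spec_loop[where I = I and Q = "I n"]]) (use assms in auto)

end

section \<open>Bases of rows\<close>

definition dot :: "nat \<Rightarrow> (nat \<Rightarrow> int) \<Rightarrow> (nat \<Rightarrow> int) \<Rightarrow> int" where
 "dot n u v = (\<Sum>l<n. u l * v l)"

text \<open>The selected rows become columns, so that the product with a vector is a linear
  combination of rows and Cramer's rule applies column by column.\<close>

definition basis_mat :: "nat \<Rightarrow> (nat \<Rightarrow> nat \<Rightarrow> int) \<Rightarrow> (nat \<Rightarrow> nat) \<Rightarrow> int mat" where
 "basis_mat n h f = mat n n (\<lambda>(l, j). h (f j) l)"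

abbreviation bdet :: "nat \<Rightarrow> (nat \<Rightarrow> nat \<Rightarrow> int) \<Rightarrow> (nat \<Rightarrow> nat) \<Rightarrow> int" where
 "bdet n h f \<equiv> det (basis_mat n h f)"

lemma basis_mat_carrier [simp]: "basis_mat n h f \<in> carrier_mat n n"
 by (simp add: basis_mat_def)

lemma dim_basis_mat [simp]: "dim_row (basis_mat n h f) = n" "dim_col (basis_mat n h f) = n"
 by (simp_all add: basis_mat_def)

lemma basis_mat_mult_vec:
 "l < n \<Longrightarrow> (basis_mat n h f *\<^sub>v vec n t) $ l = (\<Sum>j<n. t j * h (f j) l)"
 by (simp add: basis_mat_def scalar_prod_def mult.commute lessThan_atLeast0)

text \<open>Cramer's rule without division: the coefficients are the adjugate applied to
  \<open>r\<close>.\<close>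

lemma basis_repr:
 "\<exists>t. \<forall>l<n. bdet n h f * r l = (\<Sum>j<n. t j * h (f j) l)"
proof -
 let ?A = "basis_mat n h f"
 let ?t = "adj_mat ?A *\<^sub>v vec n r"
 have A: "?A \<in> carrier_mat n n" by simp
 have "?A *\<^sub>v ?t = (?A * adj_mat ?A) *\<^sub>v vec n r"
  using A adj_mat(1)[OF A] by (simp add: assoc_mult_mat_vec[of _ n n _ n])
 also have "\<dots> = bdet n h f \<cdot>\<^sub>v vec n r"
  using adj_mat(2)[OF A] by (intro eq_vecI) (auto simp: scalar_prod_def smult_mat_def if_distrib if_distribR cong: if_cong)
 finally have eq: "?A *\<^sub>v ?t = bdet n h f \<cdot>\<^sub>v vec n r" .
 have t: "?t = vec n (\<lambda>j. ?t $ j)" using adj_mat(1)[OF A] by (intro eq_vecI) auto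
 have "bdet n h f * r l = (\<Sum>j<n. ?t $ j * h (f j) l)" if "l < n" for l
 proof -
  have "bdet n h f * r l = (?A *\<^sub>v ?t) $ l" unfolding eq using that by simp
  also have "\<dots> = (?A *\<^sub>v vec n (\<lambda>j. ?t $ j)) $ l" using t by metis
  also have "\<dots> = (\<Sum>j<n. ?t $ j * h (f j) l)" by (rule basis_mat_mult_vec[OF that])
  finally show ?thesis .
 qed
 then show ?thesis by blast
qed

lemma basis_unique:
 assumes "bdet n h f \<noteq> 0" and eq: "\<And>l. l < n \<Longrightarrow> (\<Sum>j<n. t j * h (f j) l) = 0" and k: "k < n"
 shows "t k = 0"
proof -
 let ?A = "basis_mat n h f"
 have A: "?A \<in> carrier_mat n n" by simp
 have z: "?A *\<^sub>v vec n t = 0\<^sub>v n"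
  using eq by (intro eq_vecI) (auto simp: basis_mat_mult_vec simp del: index_mult_mat_vec)
 have "(adj_mat ?A * ?A) *\<^sub>v vec n t = adj_mat ?A *\<^sub>v (?A *\<^sub>v vec n t)"
  using A adj_mat(1)[OF A] by (intro assoc_mult_mat_vec[of _ n n _ n]) auto
 also have "\<dots> = 0\<^sub>v n" unfolding z using adj_mat(1)[OF A] by (intro eq_vecI) auto
 finally have "(bdet n h f \<cdot>\<^sub>m 1\<^sub>m n *\<^sub>v vec n t) $ k = 0" using k adj_mat(3)[OF A] by simp
 then have "bdet n h f * t k = 0"
  using k by (simp add: scalar_prod_def if_distrib if_distribR cong: if_cong)
 with assms show ?thesis by simp
qed

lemma basis_unique_eq:
 assumes "bdet n h f \<noteq> 0"
  and "\<And>l. l < n \<Longrightarrow> (\<Sum>j<n. s j * h (f j) l) = (\<Sum>j<n. t j * h (f j) l)" and "k < n"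
 shows "s k = t k"
proof -
 have "(\<lambda>j. s j - t j) k = 0"
  by (rule basis_unique[OF assms(1) _ assms(3)]) (use assms(2) in \<open>simp add: algebra_simps sum_subtractf\<close>)
 then show ?thesis by simp
qed

text \<open>\<open>v\<close> is the k-th row of the adjugate. Geometrically it is an edge direction
  of the cone of the basis, scaled by the determinant to be integral.\<close>

lemma basis_dual: "k < n \<Longrightarrow> \<exists>v. \<forall>j<n. dot n (h (f j)) v = (if j = k then bdet n h f else 0)"
proof -
 assume k: "k < n"
 let ?A = "basis_mat n h f"
 have A: "?A \<in> carrier_mat n n" by simp
 have "dot n (h (f j)) (\<lambda>l. adj_mat ?A $$ (k, l)) = (if j = k then bdet n h f else 0)" if "j < n" for j
 proof -
  have "(adj_mat ?A * ?A) $$ (k, j) = (if j = k then bdet n h f else 0)"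
   using k that adj_mat(3)[OF A] by simp
  moreover have "(adj_mat ?A * ?A) $$ (k, j) = (\<Sum>l<n. adj_mat ?A $$ (k, l) * ?A $$ (l, j))"
   using k that A carrier_matD[OF adj_mat(1)[OF A]] by (simp add: scalar_prod_def lessThan_atLeast0)
  ultimately show ?thesis using that
   by (simp add: dot_def basis_mat_def mult.commute)
 qed
 then show ?thesis by blast
qed

lemma det_replace_col_smult:
 fixes A :: "int mat"
 assumes A: "A \<in> carrier_mat n n" and v: "v \<in> carrier_vec n" and k: "k < n"
 shows "det (replace_col A (e \<cdot>\<^sub>v v) k) = e * det (replace_col A v k)"
proof -
 have c: "replace_col A w k \<in> carrier_mat n n" for w using A by (simp add: replace_col_def)
 have d: "mat_delete (replace_col A w k) i k = mat_delete A i k" for w i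
  using A k by (intro eq_matI) (auto simp: mat_delete_def replace_col_def)
 have e: "replace_col A w k $$ (i, k) = w $ i" if "i < n" for w i
  using A k that by (simp add: replace_col_def)
 show ?thesis
  unfolding laplace_expansion_column[OF c k] cofactor_def d sum_distrib_left
  using v by (intro sum.cong) (auto simp: e)
qed

text \<open>Exchanging position \<open>k\<close> of the basis replaces one column, so Cramer's rule
  identifies coordinates with determinants of neighbouring bases. This is the origin of the bound on
  tableau entries.\<close>

lemma basis_cramer:
 assumes eq: "\<And>l. l < n \<Longrightarrow> e * h i l = (\<Sum>j<n. t j * h (f j) l)" and k: "k < n"
 shows "e * bdet n h (f(k := i)) = t k * bdet n h f"
proof -
 let ?A = "basis_mat n h f"
 have A: "?A \<in> carrier_mat n n" by simp
 have m: "?A *\<^sub>v vec n t = e \<cdot>\<^sub>v vec n (h i)"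
  using eq by (intro eq_vecI) (auto simp: basis_mat_mult_vec simp del: index_mult_mat_vec)
 have r: "replace_col ?A (vec n (h i)) k = basis_mat n h (f(k := i))"
  by (rule eq_matI) (auto simp: replace_col_def basis_mat_def)
 have "det (replace_col ?A (?A *\<^sub>v vec n t) k) = t k * bdet n h f"
  using cramer_lemma_mat[OF A _ k, of "vec n t"] k by simp
 then show ?thesis unfolding m det_replace_col_smult[OF A vec_carrier k] r .
qed

section \<open>The index of the lattice of a basis\<close>

text \<open>The values that integer points take on the basis rows. This is the lattice generated by
  the n coordinate columns of the selected rows; integrality of a point is membership of its values
  in it.\<close>

definition row_lat :: "nat \<Rightarrow> (nat \<Rightarrow> nat \<Rightarrow> int) \<Rightarrow> (nat \<Rightarrow> nat) \<Rightarrow> (nat \<Rightarrow> int) \<Rightarrow> bool" where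
 "row_lat n h f u = ((\<exists>z. \<forall>j<n. u j = dot n (h (f j)) z))"

lemma dot_lin: "dot n u (\<lambda>l. x * v l + y * w l) = x * dot n u v + y * dot n u w"
 by (simp add: dot_def algebra_simps sum.distrib sum_distrib_left)

lemma row_lat_lin:
 assumes "row_lat n h f u" "row_lat n h f v"
 shows "row_lat n h f (\<lambda>j. x * u j + y * v j)"
proof -
 obtain z w where "\<forall>j<n. u j = dot n (h (f j)) z" "\<forall>j<n. v j = dot n (h (f j)) w"
  using assms by (auto simp: row_lat_def)
 then show ?thesis unfolding row_lat_def
  by (intro exI[of _ "\<lambda>l. x * z l + y * w l"]) (simp add: dot_lin)
qed

lemma row_lat_cong: "row_lat n h f u \<Longrightarrow> (\<And>j. j < n \<Longrightarrow> u j = v j) \<Longrightarrow> row_lat n h f v"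
 unfolding row_lat_def by metis

text \<open>The lattice has triangular generators \<open>g i\<close>, with the least possible
  positive entry \<open>q i\<close> at position \<open>i\<close> and zeros behind it. Division with
  remainder from the last position to the first moves any \<open>u\<close> into the box with side
  lengths \<open>q i\<close>. The selected rows factor through \<open>g\<close>, so the volume of
  the box divides the determinant.\<close>

lemma row_lat_index:
 assumes D: "bdet n h f \<noteq> 0"
 shows "\<exists>R. finite R \<and> card R \<le> nat \<bar>bdet n h f\<bar> \<and> (\<forall>u. \<exists>r\<in>R. row_lat n h f (\<lambda>j. u j - r j))"
proof -
 let ?L = "row_lat n h f"
 define P where "P i t u = (0 < (t::nat) \<and> ?L u \<and> u i = int t \<and> (\<forall>j<n. i < j \<longrightarrow> u j = 0))" for i t u
 define q where "q i = (LEAST t. \<exists>u. P i t u)" for i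
 \<comment> \<open>The least entry exists because the lattice contains \<bar>det\<bar> times the
   i-th unit vector, a multiple of a dual direction.\<close>
 have ex: "\<exists>u. P i (q i) u" if i: "i < n" for i
 proof -
  obtain v where v: "\<forall>j<n. dot n (h (f j)) v = (if j = i then bdet n h f else 0)" using basis_dual[OF i] by blast
  have sg: "sgn (bdet n h f) * bdet n h f = \<bar>bdet n h f\<bar>" by (simp only: abs_sgn mult.commute)
  have "?L (\<lambda>j. if j = i then bdet n h f else 0)"
   using v unfolding row_lat_def by metis
  from row_lat_lin[OF this this, of "sgn (bdet n h f)" 0]
  have "?L (\<lambda>j. if j = i then \<bar>bdet n h f\<bar> else 0)"
   by (rule row_lat_cong) (use sg in auto)
  then have "P i (nat \<bar>bdet n h f\<bar>) (\<lambda>j. if j = i then \<bar>bdet n h f\<bar> else 0)"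
   unfolding P_def using D by simp
  then have "\<exists>t. \<exists>u. P i t u" by blast
  from LeastI_ex[OF this] show ?thesis unfolding q_def .
 qed
 then obtain g where g: "\<And>i. i < n \<Longrightarrow> P i (q i) (g i)" by metis
 have qpos: "0 < q i" if "i < n" for i using g[OF that] by (simp add: P_def)
 have div: "int (q i) dvd u i" if i: "i < n" and u: "?L u" "\<forall>j<n. i < j \<longrightarrow> u j = 0" for i u
 proof (rule ccontr)
  assume nd: "\<not> int (q i) dvd u i"
  let ?w = "\<lambda>j. 1 * u j + (- (u i div int (q i))) * g i j"
  have "?L ?w" by (rule row_lat_lin) (use u g[OF i] in \<open>auto simp: P_def\<close>)
  moreover have wi: "?w i = u i mod int (q i)" using g[OF i] by (simp add: P_def minus_div_mult_eq_mod)
  moreover have "u i mod int (q i) > 0" using nd qpos[OF i]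
   by (metis dvd_eq_mod_eq_0 of_nat_0_less_iff order_le_less pos_mod_sign)
  ultimately have "P i (nat (u i mod int (q i))) ?w"
   using u g[OF i] unfolding P_def by simp
  then have "q i \<le> nat (u i mod int (q i))" unfolding q_def by (intro Least_le) blast
  moreover have "u i mod int (q i) < int (q i)" using qpos[OF i] by simp
  ultimately show False using qpos[OF i] by (simp add: le_nat_iff)
 qed
 have gen: "\<exists>y. \<forall>j<n. u j = (\<Sum>i<n. y i * g i j)" if "?L u" "k \<le> n" "\<forall>j<n. k \<le> j \<longrightarrow> u j = 0" for u k
  using that
 proof (induction k arbitrary: u)
  case 0
  then show ?case by (intro exI[of _ "\<lambda>_. 0"]) simp
 next
  case (Suc k)
  then have k: "k < n" by simp
  define c where "c = u k div int (q k)"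
  let ?w = "\<lambda>j. 1 * u j + (- c) * g k j"
  have "?L ?w" by (rule row_lat_lin) (use Suc.prems g[OF k] in \<open>auto simp: P_def\<close>)
  moreover have "int (q k) dvd u k" using div[OF k Suc.prems(1)] Suc.prems by simp
  then have "?w k = 0" using g[OF k] by (simp add: P_def c_def)
  then have "\<forall>j<n. k \<le> j \<longrightarrow> ?w j = 0"
   using Suc.prems g[OF k] by (auto simp: P_def le_eq_less_or_eq Suc_le_eq)
  ultimately obtain y where y: "\<forall>j<n. ?w j = (\<Sum>i<n. y i * g i j)" using Suc.IH[of ?w] k by auto
  have "u j = (\<Sum>i<n. (y(k := y k + c)) i * g i j)" if "j < n" for j
  proof -
   have "(\<Sum>i<n. (y(k := y k + c)) i * g i j) = (\<Sum>i<n. y i * g i j + (if i = k then c * g i j else 0))"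
    by (intro sum.cong) (auto simp: algebra_simps)
   also have "\<dots> = (\<Sum>i<n. y i * g i j) + c * g k j" using k by (simp add: sum.distrib)
   also have "\<dots> = u j" using y that by (simp add: algebra_simps)
   finally show ?thesis by simp
  qed
  then show ?case by blast
 qed
 \<comment> \<open>Reduction at position \<open>k\<close> leaves the later positions alone, as
   \<open>g k\<close> vanishes there; hence the induction runs downwards.\<close>
 have red: "\<exists>r. ?L (\<lambda>j. u j - r j) \<and> (\<forall>j<n. k \<le> j \<longrightarrow> 0 \<le> r j \<and> r j < int (q j))" if "k \<le> n" for u k
  using that
 proof (induction "n - k" arbitrary: k u)
  case 0
  have "?L (\<lambda>j. u j - u j)" unfolding row_lat_def by (intro exI[of _ "\<lambda>_. 0"]) (simp add: dot_def)
  with 0 show ?case by (intro exI[of _ u]) auto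
 next
  case (Suc x)
  then have k: "k < n" and x: "x = n - Suc k" by simp_all
  then obtain r where r: "?L (\<lambda>j. u j - r j)" "\<forall>j<n. Suc k \<le> j \<longrightarrow> 0 \<le> r j \<and> r j < int (q j)"
   using Suc.hyps(1)[OF x, of u] by auto
  define c where "c = r k div int (q k)"
  let ?r = "\<lambda>j. r j - c * g k j"
  have "?L (\<lambda>j. 1 * (u j - r j) + c * g k j)"
   by (rule row_lat_lin) (use r g[OF k] in \<open>auto simp: P_def\<close>)
  then have "?L (\<lambda>j. u j - ?r j)" by (rule row_lat_cong) simp
  moreover have "?r k = r k mod int (q k)" using g[OF k] by (simp add: P_def c_def minus_div_mult_eq_mod)
  then have "0 \<le> ?r k \<and> ?r k < int (q k)" using qpos[OF k] by simp
  moreover have "0 \<le> ?r j \<and> ?r j < int (q j)" if "j < n" "k < j" for j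
   using g[OF k] that r(2) by (simp add: P_def)
  ultimately show ?case
   by (intro exI[of _ ?r]) (auto simp: le_eq_less_or_eq)
 qed
 define R where "R = (\<Pi>\<^sub>E i\<in>{..<n}. {0..<int (q i)})"
 have "card R = (\<Prod>i<n. q i)" by (simp add: R_def card_PiE)
 moreover have "finite R" by (simp add: R_def finite_PiE)
 moreover have "\<exists>r\<in>R. ?L (\<lambda>j. u j - r j)" for u
 proof -
  obtain r where r: "?L (\<lambda>j. u j - r j)" "\<forall>j<n. 0 \<le> r j \<and> r j < int (q j)" using red[of 0 u] by auto
  let ?r = "restrict r {..<n}"
  have "?r \<in> R" using r(2) by (auto simp: R_def)
  moreover have "?L (\<lambda>j. u j - ?r j)" using r(1) by (rule row_lat_cong) simp
  ultimately show ?thesis by blast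
 qed
 moreover have "(\<Prod>i<n. q i) \<le> nat \<bar>bdet n h f\<bar>"
 proof -
  have "\<exists>y. \<forall>j<n. h (f j) l = (\<Sum>i<n. y i * g i j)" if "l < n" for l
  proof (rule gen[of _ n])
   show "?L (\<lambda>j. h (f j) l)" unfolding row_lat_def dot_def
    by (intro exI[of _ "\<lambda>i. if i = l then 1 else 0"]) (use that in \<open>simp add: if_distrib cong: if_cong\<close>)
  qed auto
  then obtain y where y: "\<And>l j. l < n \<Longrightarrow> j < n \<Longrightarrow> h (f j) l = (\<Sum>i<n. y l i * g i j)" by metis
  let ?Y = "mat n n (\<lambda>(l, i). y l i)" and ?G = "mat n n (\<lambda>(i, j). g i j)"
  have "basis_mat n h f = ?Y * ?G"
   by (rule eq_matI) (auto simp: basis_mat_def scalar_prod_def y lessThan_atLeast0)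
  then have eq: "bdet n h f = det ?Y * det ?G" by (simp add: det_mult[of _ n])
  have "det ?G = prod_list (diag_mat ?G)"
   by (rule det_lower_triangular[of n]) (use g in \<open>auto simp: P_def\<close>)
  also have "\<dots> = (\<Prod>i<n. int (q i))"
   unfolding prod_list_diag_prod using g by (auto simp: P_def lessThan_atLeast0 intro!: prod.cong)
  finally have G: "det ?G = int (\<Prod>i<n. q i)" by simp
  have "1 \<le> \<bar>det ?Y\<bar>" using D eq by (cases "det ?Y = 0") auto
  then have "1 * \<bar>det ?G\<bar> \<le> \<bar>bdet n h f\<bar>" unfolding eq abs_mult by (intro mult_right_mono) auto
  then show ?thesis unfolding G by linarith
 qed
 ultimately show ?thesis by (intro exI[of _ R]) auto
qed

section \<open>Tableaux\<close>

text \<open>Coordinates of \<open>r\<close> in the basis over the common denominator \<delta>. Later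
  only \<bar>\<delta>\<bar> is tied to the determinant, so that the sign changes of exchanges need
  not be followed.\<close>

definition tab_row :: "nat \<Rightarrow> (nat \<Rightarrow> nat \<Rightarrow> int) \<Rightarrow> (nat \<Rightarrow> nat) \<Rightarrow> int \<Rightarrow> (nat \<Rightarrow> int) \<Rightarrow> (nat \<Rightarrow> int) \<Rightarrow> bool" where
 "tab_row n h f \<delta> r T = ((\<forall>l<n. \<delta> * r l = (\<Sum>j<n. T j * h (f j) l)))"

lemma tab_row_exists:
 assumes "\<bar>\<delta>\<bar> = \<bar>bdet n h f\<bar>"
 shows "\<exists>T. tab_row n h f \<delta> r T"
proof -
 obtain t where t: "\<forall>l<n. bdet n h f * r l = (\<Sum>j<n. t j * h (f j) l)" using basis_repr by blast
 obtain e where e: "\<delta> = e * bdet n h f" using assms by (metis abs_eq_iff mult_minus1 mult_1)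
 have "tab_row n h f \<delta> r (\<lambda>j. e * t j)"
  unfolding tab_row_def e using t by (simp add: mult.assoc sum_distrib_left[symmetric])
 then show ?thesis by blast
qed

text \<open>An entry is, up to sign, the determinant after the corresponding exchange. Hence
  subdeterminants bound the entries, and a nonzero entry is exactly the denominator of the next
  tableau.\<close>

lemma tab_row_bdet:
 assumes "bdet n h f \<noteq> 0" "\<bar>\<delta>\<bar> = \<bar>bdet n h f\<bar>" "tab_row n h f \<delta> (h i) T" "k < n"
 shows "\<bar>T k\<bar> = \<bar>bdet n h (f(k := i))\<bar>"
proof -
 have "\<delta> * bdet n h (f(k := i)) = T k * bdet n h f"
  by (rule basis_cramer) (use assms in \<open>auto simp: tab_row_def\<close>)
 then have "\<bar>\<delta>\<bar> * \<bar>bdet n h (f(k := i))\<bar> = \<bar>T k\<bar> * \<bar>bdet n h f\<bar>" by (metis abs_mult)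
 with assms show ?thesis by simp
qed

lemma tab_row_dot:
 assumes "tab_row n h f \<delta> r T"
 shows "\<delta> * dot n r z = (\<Sum>j<n. T j * dot n (h (f j)) z)"
proof -
 have "\<delta> * dot n r z = (\<Sum>l<n. (\<Sum>j<n. T j * h (f j) l) * z l)"
  using assms by (simp add: dot_def tab_row_def sum_distrib_left mult.assoc[symmetric])
 also have "\<dots> = (\<Sum>l<n. \<Sum>j<n. T j * h (f j) l * z l)" by (simp add: sum_distrib_right)
 also have "\<dots> = (\<Sum>j<n. \<Sum>l<n. T j * h (f j) l * z l)" by (rule sum.swap)
 also have "\<dots> = (\<Sum>j<n. T j * dot n (h (f j)) z)"
  by (simp add: dot_def sum_distrib_left mult.assoc)
 finally show ?thesis .
qed

text \<open>Along \<open>v\<close> only the k-th basis row changes, at speed \<delta>, and every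
  other row changes at the speed given by column \<open>k\<close> of its tableau row.\<close>

lemma tab_row_dual:
 assumes "\<bar>\<delta>\<bar> = \<bar>bdet n h f\<bar>" "\<delta> \<noteq> 0" "k < n"
 shows "\<exists>v. (\<forall>j<n. dot n (h (f j)) v = (if j = k then \<delta> else 0)) \<and>
  (\<forall>r T. tab_row n h f \<delta> r T \<longrightarrow> dot n r v = T k)"
proof -
 obtain v where v: "\<forall>j<n. dot n (h (f j)) v = (if j = k then bdet n h f else 0)"
  using basis_dual[OF assms(3)] by blast
 obtain e where e: "\<delta> = e * bdet n h f" using assms by (metis abs_eq_iff mult_minus1 mult_1)
 define w where "w = (\<lambda>l. e * v l)"
 have "dot n u w = e * dot n u v" for u by (simp add: w_def dot_def sum_distrib_left mult.left_commute)
 then have w: "\<forall>j<n. dot n (h (f j)) w = (if j = k then \<delta> else 0)" using v e by simp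
 moreover have "dot n r w = T k" if "tab_row n h f \<delta> r T" for r T
 proof -
  have "\<delta> * dot n r w = (\<Sum>j<n. if j = k then T k * \<delta> else 0)"
   unfolding tab_row_dot[OF that] by (intro sum.cong) (use w in auto)
  also have "\<dots> = \<delta> * T k" using assms by simp
  finally show ?thesis using assms by simp
 qed
 ultimately show ?thesis by blast
qed

lemma sum_upd:
 fixes T :: "nat \<Rightarrow> int"
 assumes "j < n"
 shows "(\<Sum>j'<n. T j' * h ((f(j := i)) j') l) = T j * h i l + (\<Sum>j'\<in>{..<n} - {j}. T j' * h (f j') l)"
 using assms by (subst sum.remove[of "{..<n}" j]) (auto intro!: sum.cong)

lemma sum_rem:
 fixes g :: "nat \<Rightarrow> int"
 assumes "j < n" shows "(\<Sum>j'<n. g j') = g j + (\<Sum>j'\<in>{..<n} - {j}. g j')"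
 using assms by (simp add: sum.remove[of "{..<n}" j])

text \<open>The relation for the entering row is solved for the leaving one; the pivot element
  becomes the denominator.\<close>

lemma pivot_leaving:
 assumes j: "j < n" and Ti: "tab_row n h f \<delta> (h i) Ti"
 shows "tab_row n h (f(j := i)) (Ti j) (h (f j)) (\<lambda>j'. if j' = j then \<delta> else - Ti j')"
 unfolding tab_row_def
proof (intro allI impI)
 fix l assume l: "l < n"
 have "\<delta> * h i l = Ti j * h (f j) l + (\<Sum>j'\<in>{..<n} - {j}. Ti j' * h (f j') l)"
  using Ti l sum_rem[OF j, of "\<lambda>j'. Ti j' * h (f j') l"] by (simp add: tab_row_def)
 then show "Ti j * h (f j) l = (\<Sum>j'<n. (if j' = j then \<delta> else - Ti j') * h ((f(j := i)) j') l)"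
  unfolding sum_upd[OF j, of _ h f i l] by (simp add: sum_negf)
qed

text \<open>The division by \<delta> is exact, as in fraction-free elimination: integral coordinates
  \<open>S\<close> over the new denominator exist by Cramer's rule, and uniqueness of coordinates
  identifies \<delta> times them with the numerators.\<close>

lemma pivot_other:
 assumes D: "bdet n h f \<noteq> 0" "\<bar>\<delta>\<bar> = \<bar>bdet n h f\<bar>"
  and j: "j < n" and Ti: "tab_row n h f \<delta> (h i) Ti" and p: "Ti j \<noteq> 0"
  and Tr: "tab_row n h f \<delta> r Tr"
 shows "tab_row n h (f(j := i)) (Ti j) r (\<lambda>j'. if j' = j then Tr j else (Ti j * Tr j' - Tr j * Ti j') div \<delta>)"
proof -
 let ?f = "f(j := i)"
 have \<delta>: "\<delta> \<noteq> 0" using D by auto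
 have bd: "\<bar>Ti j\<bar> = \<bar>bdet n h ?f\<bar>" using tab_row_bdet[OF D Ti j] .
 then obtain S where S: "tab_row n h ?f (Ti j) r S" using tab_row_exists by blast
 have "\<delta> * S k = (if k = j then \<delta> * Tr j else Ti j * Tr k - Tr j * Ti k)" if k: "k < n" for k
 proof (rule basis_unique_eq[of n h ?f "\<lambda>k. \<delta> * S k" "\<lambda>k. if k = j then \<delta> * Tr j else Ti j * Tr k - Tr j * Ti k", OF _ _ k])
  show "bdet n h ?f \<noteq> 0" using bd p by auto
  fix l assume l: "l < n"
  let ?s = "\<lambda>T. \<Sum>j'\<in>{..<n} - {j}. T j' * h (f j') l"
  have "(\<Sum>j'<n. \<delta> * S j' * h (?f j') l) = \<delta> * (Ti j * r l)"
   using S l by (simp add: tab_row_def sum_distrib_left mult.assoc)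
  also have "\<dots> = Ti j * (\<delta> * r l)" by simp
  also have "\<delta> * r l = Tr j * h (f j) l + ?s Tr"
   using Tr l sum_rem[OF j, of "\<lambda>j'. Tr j' * h (f j') l"] by (simp add: tab_row_def)
  also have "Ti j * (Tr j * h (f j) l + ?s Tr) = Tr j * (Ti j * h (f j) l) + Ti j * ?s Tr"
   by (simp add: algebra_simps)
  also have "Ti j * h (f j) l = \<delta> * h i l - ?s Ti"
   using Ti l sum_rem[OF j, of "\<lambda>j'. Ti j' * h (f j') l"] by (simp add: tab_row_def)
  also have "Tr j * (\<delta> * h i l - ?s Ti) + Ti j * ?s Tr =
    \<delta> * Tr j * h i l + (\<Sum>j'\<in>{..<n} - {j}. (Ti j * Tr j' - Tr j * Ti j') * h (f j') l)"
   by (simp add: algebra_simps sum_subtractf sum_distrib_left)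
  also have "\<dots> = (\<Sum>j'<n. (if j' = j then \<delta> * Tr j else Ti j * Tr j' - Tr j * Ti j') * h (?f j') l)"
   unfolding sum_upd[OF j, of _ h f i l] by simp
  finally show "(\<Sum>j'<n. \<delta> * S j' * h (?f j') l) = \<dots>" .
 qed
 then have "S k = (if k = j then Tr j else (Ti j * Tr k - Tr j * Ti k) div \<delta>)" if "k < n" for k
  using that \<delta> by (metis mult_cancel_left nonzero_mult_div_cancel_left)
 then show ?thesis using S unfolding tab_row_def by simp
qed

section \<open>Integer points near a basis\<close>

text \<open>Choose the pair with the most slacks below \<open>D\<close>. If the slack of row \<open>f j\<close> is large, move along the
 \<open>j\<close>-th edge of the basis in the direction that does not decrease the objective. By the bound on the
 determinants, every step changes each slack by at most \<open>D\<close>, so just before a row blocks, its slack is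
 below \<open>D\<close> and it can replace row \<open>f j\<close>.\<close>

lemma near_basis:
 fixes n d :: nat and b c :: "nat \<Rightarrow> int"
 assumes D: "\<And>f. (\<forall>j<n. f j < d) \<Longrightarrow> \<bar>bdet n h f\<bar> \<le> D"
  and f0: "\<forall>j<n. f0 j < d" "bdet n h f0 \<noteq> 0"
  and noray: "\<And>f k w. (\<forall>j<n. f j < d) \<Longrightarrow> bdet n h f \<noteq> 0 \<Longrightarrow> k < n \<Longrightarrow>
   (\<forall>j<n. dot n (h (f j)) w = (if j = k then - \<bar>bdet n h f\<bar> else 0)) \<Longrightarrow>
   (\<forall>i<d. dot n (h i) w \<le> 0) \<Longrightarrow> dot n c w \<le> 0"
  and z0: "\<forall>i<d. dot n (h i) z0 \<le> b i"
 shows "\<exists>f z. (\<forall>j<n. f j < d) \<and> bdet n h f \<noteq> 0 \<and> (\<forall>i<d. dot n (h i) z \<le> b i) \<and>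
  dot n c z0 \<le> dot n c z \<and> (\<forall>j<n. b (f j) - dot n (h (f j)) z < D)"
proof -
 define G where "G f z = ((\<forall>j<n. f j < d) \<and> bdet n h f \<noteq> 0 \<and> (\<forall>i<d. dot n (h i) z \<le> b i) \<and> dot n c z0 \<le> dot n c z)" for f z
 define K where "K f z = {j\<in>{..<n}. b (f j) - dot n (h (f j)) z < D}" for f z
 define Z where "Z = {card (K f z) |f z. G f z}"
 have cn: "card (K f z) \<le> n" for f z
 proof -
  have "K f z \<subseteq> {..<n}" unfolding K_def by blast
  from card_mono[OF _ this] show ?thesis by simp
 qed
 have "Z \<subseteq> {..n}" unfolding Z_def using cn by blast
 then have fin: "finite Z" by (rule finite_subset) simp
 have "G f0 z0" using f0 z0 unfolding G_def by simp
 then have "Z \<noteq> {}" unfolding Z_def by blast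
 then have "Max Z \<in> Z" using fin by simp
 moreover have "\<exists>f z. x = card (K f z) \<and> G f z" if "x \<in> Z" for x using that unfolding Z_def by blast
 ultimately obtain f z where fz: "G f z" "card (K f z) = Max Z" by metis
 have mx: "card (K f' z') \<le> card (K f z)" if "G f' z'" for f' z'
  unfolding fz(2) by (rule Max_ge[OF fin]) (use that Z_def in blast)
 show ?thesis
 proof (cases "\<forall>j<n. b (f j) - dot n (h (f j)) z < D")
  case True
  with fz show ?thesis by (auto simp: G_def)
 next
  case False
  then obtain j where j: "j < n" "j \<notin> K f z" by (auto simp: K_def)
  let ?B = "bdet n h f"
  have fl: "\<forall>j<n. f j < d" "?B \<noteq> 0" using fz by (auto simp: G_def)
  obtain v where v: "\<forall>j'<n. dot n (h (f j')) v = (if j' = j then ?B else 0)"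
   "\<And>r T. tab_row n h f ?B r T \<Longrightarrow> dot n r v = T j"
   using tab_row_dual[of ?B n h f j] fl j by blast
  \<comment> \<open>The sign makes the objective grow along the edge. If the objective is constant,
    the sign lets the slack of \<open>f j\<close> shrink instead, so that the walk has to
    end.\<close>
  define e :: int where "e = (if dot n c v = 0 then sgn ?B else sgn (dot n c v))"
  define w where "w l = e * v l" for l
  have e: "\<bar>e\<bar> = 1" using fl by (simp add: e_def sgn_if)
  have dw: "dot n u w = e * dot n u v" for u by (simp add: w_def dot_def sum_distrib_left mult.left_commute)
  have cw: "0 \<le> dot n c w" unfolding dw e_def by (simp add: sgn_if)
  have w0: "dot n (h (f j')) w = 0" if "j' < n" "j' \<noteq> j" for j' using v that by (simp add: dw)
  have wb: "\<bar>dot n (h i) w\<bar> = \<bar>bdet n h (f(j := i))\<bar>" if "i < d" for i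
  proof -
   obtain T where T: "tab_row n h f ?B (h i) T" using tab_row_exists by blast
   have "\<bar>dot n (h i) w\<bar> = \<bar>T j\<bar>" unfolding dw abs_mult e v(2)[OF T] by simp
   also have "\<dots> = \<bar>bdet n h (f(j := i))\<bar>" using tab_row_bdet[OF fl(2) refl T j(1)] .
   finally show ?thesis .
  qed
  have wD: "\<bar>dot n (h i) w\<bar> \<le> D" if "i < d" for i
   unfolding wb[OF that] using D[of "f(j := i)"] that fl by simp
  \<comment> \<open>In the constant case row \<open>f j\<close> itself is approached. Otherwise a
    direction that approaches no row would be an improving ray, which \<open>noray\<close>
    excludes.\<close>
  have ex: "\<exists>i<d. 0 < dot n (h i) w"
  proof (cases "dot n c v = 0")
   case True
   then have "dot n (h (f j)) w = \<bar>?B\<bar>" using v(1) j by (simp add: dw e_def sgn_if)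
   then show ?thesis using fl j by (intro exI[of _ "f j"]) auto
  next
   case False
   show ?thesis
   proof (rule ccontr)
    assume "\<not> ?thesis"
    then have le: "\<forall>i<d. dot n (h i) w \<le> 0" by (meson not_less)
    have "\<bar>dot n (h (f j)) w\<bar> = \<bar>?B\<bar>" using v(1) j e by (simp add: dw abs_mult)
    then have "\<forall>j'<n. dot n (h (f j')) w = (if j' = j then - \<bar>?B\<bar> else 0)"
     using w0 le j fl by (auto simp: abs_if split: if_splits)
    from noray[OF fl j(1) this le] have "dot n c w \<le> 0" .
    then show False using False cw by (auto simp: dw e_def sgn_if split: if_splits)
   qed
  qed
  define y where "y t l = z l + int t * w l" for t l
  have dy: "dot n u (y t) = dot n u z + int t * dot n u w" for u t
   by (simp add: y_def dot_def algebra_simps sum.distrib sum_distrib_left)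
  define Pt where "Pt t = ((\<exists>i<d. 0 < dot n (h i) w \<and> b i - dot n (h i) (y t) < D))" for t
  have "\<exists>t. Pt t"
  proof -
   obtain i where i: "i < d" "0 < dot n (h i) w" using ex by blast
   define t where "t = nat (b i - dot n (h i) z - D + 1)"
   have "int t * 1 \<le> int t * dot n (h i) w" using i by (intro mult_left_mono) auto
   then have "b i - dot n (h i) (y t) < D" unfolding dy t_def by linarith
   with i show ?thesis by (auto simp: Pt_def)
  qed
  define t where "t = (LEAST t. Pt t)"
  have "Pt t" unfolding t_def using \<open>\<exists>t. Pt t\<close> by (rule LeastI_ex)
  then obtain i where i: "i < d" "0 < dot n (h i) w" "b i - dot n (h i) (y t) < D" by (auto simp: Pt_def)
  \<comment> \<open>If \<open>t\<close> is positive, then by minimality every approached row still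
    had slack at least \<open>D\<close> one step earlier, and one step uses at most
    \<open>D\<close>.\<close>
  have feas: "dot n (h i') (y t) \<le> b i'" if i': "i' < d" for i'
  proof (cases "t = 0 \<or> dot n (h i') w \<le> 0")
   case True
   then have "int t * dot n (h i') w \<le> 0" by (auto simp: mult_nonneg_nonpos)
   moreover have "dot n (h i') z \<le> b i'" using fz i' by (simp add: G_def)
   ultimately show ?thesis by (simp add: dy)
  next
   case False
   then have "\<not> Pt (t - 1)" using not_less_Least[of "t - 1" Pt] by (simp add: t_def)
   then have "D \<le> b i' - dot n (h i') (y (t - 1))" using False i' unfolding Pt_def by (meson not_less)
   moreover have "dot n (h i') (y t) = dot n (h i') (y (t - 1)) + dot n (h i') w"
    using False by (simp add: dy of_nat_diff algebra_simps)
   ultimately show ?thesis using wD[OF i'] by linarith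
  qed
  let ?f = "f(j := i)"
  have "0 \<le> int t * dot n c w" using cw by simp
  then have "G ?f (y t)"
   using fz feas wb[OF i(1)] i by (auto simp: G_def dy)
  \<comment> \<open>Along the edge the other basis rows keep their slack, so position
    \<open>j\<close> is gained without losing any. This contradicts the maximality of the
    pair.\<close>
  moreover have "insert j (K f z) \<subseteq> K ?f (y t)"
   using i j w0 by (auto simp: K_def dy)
  then have "card (insert j (K f z)) \<le> card (K ?f (y t))" by (intro card_mono) (auto simp: K_def)
  then have "card (K f z) < card (K ?f (y t))" using j by (simp add: K_def)
  ultimately show ?thesis using mx[of ?f "y t"] by simp
 qed
qed

section \<open>Subdeterminants\<close>

lemma bdet_noninj: "\<not> inj_on f {..<n} \<Longrightarrow> bdet n h f = 0"
proof -
 assume "\<not> inj_on f {..<n}"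
 then obtain i j where "i < n" "j < n" "i \<noteq> j" "f i = f j" by (auto simp: inj_on_def)
 then show ?thesis
  by (intro det_identical_columns[of _ n i j]) (auto simp: basis_mat_def intro!: eq_vecI)
qed

text \<open>\<open>f\<close> may list its rows in any order while \<open>submatrix\<close> sorts
  them, so the two determinants agree up to the sign of a permutation.\<close>

lemma bdet_le_Delta:
 assumes H: "H \<in> carrier_mat d n" "mat_rank H = n" "n \<le> d" and f: "\<forall>j<n. f j < d"
 shows "\<bar>bdet n (\<lambda>i l. H $$ (i, l)) f\<bar> \<le> Delta H"
proof -
 let ?S = "{\<bar>det (submatrix H I J)\<bar> | I J.
   I \<subseteq> {..<dim_row H} \<and> J \<subseteq> {..<dim_col H} \<and> card I = n \<and> card J = n}"
 have Del: "Delta H = Max ?S" using H by (simp add: Delta_def Delta_k_def)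
 have "finite (Pow {..<dim_row H} \<times> Pow {..<dim_col H})" by simp
 then have fin: "finite ?S"
  by (rule finite_surj[of _ _ "\<lambda>(I, J). \<bar>det (submatrix H I J)\<bar>"]) auto
 show ?thesis
 proof (cases "inj_on f {..<n}")
  case False
  \<comment> \<open>The determinant of \<open>f\<close> is 0 here, so any member of the set shows
    that the maximum is large enough.\<close>
  have "\<bar>det (submatrix H {..<n} {..<n})\<bar> \<in> ?S" using H by (intro CollectI exI conjI) auto
  then have "\<bar>det (submatrix H {..<n} {..<n})\<bar> \<le> Delta H" unfolding Del using fin by simp
  with bdet_noninj[OF False] show ?thesis by simp
 next
  case True
  define I where "I = f ` {..<n}"
  have I: "I \<subseteq> {..<d}" "card I = n" using True f by (auto simp: I_def card_image)
  then have finI: "finite I" using finite_subset by blast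
  have cI: "card {i. i < d \<and> i \<in> I} = n"
  proof -
   have "{i. i < d \<and> i \<in> I} = I" using I(1) by blast
   with I(2) show ?thesis by simp
  qed
  let ?A = "submatrix H I {..<n}"
  have A: "?A \<in> carrier_mat n n"
   using dim_submatrix[of H I "{..<n}"] H cI by (intro carrier_matI) (auto simp: lessThan_def)
  have Ae: "?A $$ (i, l) = H $$ (pick I i, l)" if "i < n" "l < n" for i l
  proof -
   have "pick {..<n} l = l"
   proof -
    have "pick {..<n} (card {a\<in>{..<n}. a < l}) = l" using that by (intro pick_card_in_set) simp
    moreover have "{a\<in>{..<n}. a < l} = {..<l}" using that by auto
    ultimately show ?thesis by simp
   qed
   then show ?thesis using that H cI submatrix_index[of i H I l "{..<n}"] by (simp add: lessThan_def)
  qed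
  \<comment> \<open>The position of row \<open>f j\<close> among the sorted rows, inverse to
    \<open>pick\<close>.\<close>
  define p where "p j = (if j < n then card {a\<in>I. a < f j} else j)" for j
  have pk: "pick I (p j) = f j" if "j < n" for j
   using that pick_card_in_set[of "f j" I] by (simp add: p_def I_def)
  have pl: "p j < n" if "j < n" for j
  proof -
   have "{a\<in>I. a < f j} \<subset> I" using that by (auto simp: I_def)
   then have "card {a\<in>I. a < f j} < card I" using finI by (rule psubset_card_mono[rotated])
   then show ?thesis using I that by (simp add: p_def)
  qed
  have inj: "inj_on p {0..<n}"
  proof (rule inj_onI)
   fix i j assume ij: "i \<in> {0..<n}" "j \<in> {0..<n}" "p i = p j"
   then have "f i = f j" using pk[of i] pk[of j] by simp
   with True ij show "i = j" by (auto dest: inj_onD)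
  qed
  moreover have "p ` {0..<n} = {0..<n}"
   by (rule endo_inj_surj[OF _ _ inj]) (use pl in auto)
  ultimately have "p permutes {0..<n}"
   by (intro bij_imp_permutes) (auto simp: bij_betw_def p_def)
  then have "det (mat n n (\<lambda>(j, l). ?A $$ (p j, l))) = signof p * det ?A"
   by (rule det_permute_rows[OF A])
  also have "mat n n (\<lambda>(j, l). ?A $$ (p j, l)) = (basis_mat n (\<lambda>i l. H $$ (i, l)) f)\<^sup>T"
   by (rule eq_matI) (auto simp: basis_mat_def Ae pl pk)
  also have "det \<dots> = bdet n (\<lambda>i l. H $$ (i, l)) f" by (rule det_transpose[of _ n]) simp
  finally have "\<bar>bdet n (\<lambda>i l. H $$ (i, l)) f\<bar> = \<bar>det ?A\<bar>" by (simp add: abs_mult sign_def)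
  moreover have "\<bar>det ?A\<bar> \<in> ?S" using H I by (intro CollectI exI[of _ I] exI[of _ "{..<n}"] conjI) auto
  then have "\<bar>det ?A\<bar> \<le> Delta H" unfolding Del using fin by simp
  ultimately show ?thesis by simp
 qed
qed

section \<open>The program\<close>

notation Seq (infixr ";;" 60)

text \<open>\<open>xK\<close> is the number of tableau rows without the objective, \<open>xMn\<close> the size of the tableau, \<open>xdB\<close> the
 determinant of the first basis, \<open>xdel\<close> the common denominator of the tableau, \<open>xD\<close> the largest
 basis determinant, \<open>xcnt\<close> the order of the group, \<open>xW\<close> the number of values of a digit, \<open>xS\<close>
 the number of states of a stage, \<open>xgs\<close> the target group element and \<open>xfx\<close> the best final
 state, or -1.\<close>

abbreviation (input) "xn \<equiv> 2 :: nat"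
abbreviation (input) "xm \<equiv> 3 :: nat"
abbreviation (input) "xs \<equiv> 4 :: nat"
abbreviation (input) "xK \<equiv> 5 :: nat"
abbreviation (input) "xM \<equiv> 6 :: nat"
abbreviation (input) "xMn \<equiv> 7 :: nat"
abbreviation (input) "xd \<equiv> 8 :: nat"
abbreviation (input) "xdB \<equiv> 9 :: nat"
abbreviation (input) "xph \<equiv> 10 :: nat"
abbreviation (input) "xD \<equiv> 11 :: nat"
abbreviation (input) "xfeas \<equiv> 12 :: nat"
abbreviation (input) "xbest \<equiv> 13 :: nat"
abbreviation (input) "xray \<equiv> 14 :: nat"
abbreviation (input) "xgo \<equiv> 15 :: nat"
abbreviation (input) "xdel \<equiv> 16 :: nat"
abbreviation (input) "xcnt \<equiv> 17 :: nat"
abbreviation (input) "xgs \<equiv> 18 :: nat"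
abbreviation (input) "xW \<equiv> 19 :: nat"
abbreviation (input) "xS \<equiv> 20 :: nat"
abbreviation (input) "xfx \<equiv> 21 :: nat"

text \<open>\<open>aT0\<close> is the tableau of the first basis, \<open>acol\<close> and \<open>arow\<close> are the basic and nonbasic rows, \<open>aq\<close>
 and \<open>amk\<close> hold the set of rows to be avoided, \<open>aG\<close> the residues of the group elements, \<open>aSub\<close>
 the subtraction of a unit vector in the group, \<open>aoff\<close> the shift that makes the digits nonnegative,
 and \<open>aY\<close>, \<open>aF\<close>, \<open>aP\<close> the last slack (-1 if unreachable), value and predecessor of a state.\<close>

abbreviation (input) "aH \<equiv> 0 :: nat"
abbreviation (input) "ac \<equiv> 1 :: nat"
abbreviation (input) "ab \<equiv> 2 :: nat"
abbreviation (input) "az \<equiv> 3 :: nat"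
abbreviation (input) "aT0 \<equiv> 4 :: nat"
abbreviation (input) "aT \<equiv> 5 :: nat"
abbreviation (input) "aT2 \<equiv> 6 :: nat"
abbreviation (input) "acol \<equiv> 7 :: nat"
abbreviation (input) "arow \<equiv> 8 :: nat"
abbreviation (input) "aq \<equiv> 9 :: nat"
abbreviation (input) "amk \<equiv> 10 :: nat"
abbreviation (input) "aG \<equiv> 11 :: nat"
abbreviation (input) "aSub \<equiv> 12 :: nat"
abbreviation (input) "aoff \<equiv> 13 :: nat"
abbreviation (input) "atau \<equiv> 14 :: nat"
abbreviation (input) "arho \<equiv> 15 :: nat"
abbreviation (input) "aA \<equiv> 16 :: nat"
abbreviation (input) "aF \<equiv> 17 :: nat"
abbreviation (input) "aY \<equiv> 18 :: nat"
abbreviation (input) "aP \<equiv> 19 :: nat"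
abbreviation (input) "aV \<equiv> 20 :: nat"
abbreviation (input) "au \<equiv> 21 :: nat"

abbreviation (input) sq :: "aexp \<Rightarrow> aexp" where "sq e \<equiv> e *. e"

text \<open>Branching tests positivity only, so inequality of indices is tested by a square.
  Registers 31 and 30 are the pivot row and column, register 41 is the pivot element.\<close>

definition pivot_entry :: com where
 "pivot_entry = blk (
  43 ::= V 42 div. V xn ;.
  44 ::= V 42 mod. V xn ;.
  If (sq (V 43 -. V 31))
   (If (sq (V 44 -. V 30))
    (45 ::= (V 41 *. Ix aT (V 42) -. Ix aT (V 43 *. V xn +. V 30) *. Ix aT (V 31 *. V xn +. V 44)) div. V xdel)
    (45 ::= Ix aT (V 42)))
   (If (sq (V 44 -. V 30))
    (45 ::= N 0 -. Ix aT (V 42))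
    (45 ::= V xdel +. N 0)) ;.
  Sto aT2 (V 42) (V 45))"

text \<open>The new entries go to \<open>aT2\<close> first, because each of them depends on the old
  pivot row and the old pivot column.\<close>

definition pivot :: com where
 "pivot =
  blk (41 ::= Ix aT (V 31 *. V xn +. V 30)) ;;
  loop 42 xMn pivot_entry ;;
  loop 42 xMn (blk (Sto aT (V 42) (Ix aT2 (V 42)))) ;;
  blk (45 ::= Ix acol (V 30) ;.
   Sto acol (V 30) (Ix arow (V 31)) ;.
   Sto arow (V 31) (V 45) ;.
   xdel ::= V 41 +. N 0)"

section \<open>Pivoting in memory\<close>

definition piv :: "(nat \<Rightarrow> nat \<Rightarrow> int) \<Rightarrow> int \<Rightarrow> nat \<Rightarrow> nat \<Rightarrow> nat \<Rightarrow> nat \<Rightarrow> int" where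
 "piv T \<delta> ir jc i j =
  (if i = ir then if j = jc then \<delta> else - T ir j
   else if j = jc then T i jc else (T ir jc * T i j - T i jc * T ir j) div \<delta>)"

lemma sq_pos_iff: "0 < (x - y) * (x - y) \<longleftrightarrow> x \<noteq> (y :: int)"
 by (auto simp: zero_less_mult_iff)

lemma sq_le_iff: "(x - y) * (x - y) \<le> 0 \<longleftrightarrow> x = (y :: int)"
 by (auto simp: mult_le_0_iff)

locale ilp = machine8 +
 fixes n m s :: nat and h :: "nat \<Rightarrow> nat \<Rightarrow> int" and b c :: "nat \<Rightarrow> int" and \<Delta> TB :: int
 assumes n_pos: "0 < n" and s_le: "s \<le> n"
begin

definition d :: nat where "d = n + m"
definition K :: nat where "K = m + (n - s)"
definition M :: nat where "M = K + 1"

text \<open>The unit vectors make the integrality of \<open>z\<close> visible in the tableau; those of index below \<open>s\<close>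
 are rows of \<open>h\<close>.\<close>

definition row_vec :: "(nat \<Rightarrow> nat) \<Rightarrow> nat \<Rightarrow> nat \<Rightarrow> int" where
 "row_vec rw i = (if i < m then h (rw i) else if i < K then (\<lambda>l. if l = s + i - m then 1 else 0) else c)"

text \<open>The sign of \<delta> is open, since a pivot may be negative. By the last conjunct every
  row of the program is either basic or has its own tableau row, so statements about all rows split
  into these two cases.\<close>

definition tabl :: "(nat \<Rightarrow> nat) \<Rightarrow> (nat \<Rightarrow> nat) \<Rightarrow> int \<Rightarrow> (nat \<Rightarrow> nat \<Rightarrow> int) \<Rightarrow> bool" where
 "tabl f rw \<delta> T = ((\<forall>j<n. f j < d) \<and> (\<forall>i<m. rw i < d) \<and> bdet n h f \<noteq> 0 \<and> \<bar>\<delta>\<bar> = \<bar>bdet n h f\<bar> \<and>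
  (\<forall>i<M. tab_row n h f \<delta> (row_vec rw i) (T i)) \<and> (\<forall>r<d. (\<exists>j<n. f j = r) \<or> (\<exists>i<m. rw i = r)))"

definition tab_mem :: "state \<Rightarrow> (nat \<Rightarrow> nat) \<Rightarrow> (nat \<Rightarrow> nat) \<Rightarrow> int \<Rightarrow> (nat \<Rightarrow> nat \<Rightarrow> int) \<Rightarrow> bool" where
 "tab_mem p f rw \<delta> T = (rv p xdel = \<delta> \<and> (\<forall>j<n. av p acol (int j) = int (f j)) \<and>
  (\<forall>i<m. av p arow (int i) = int (rw i)) \<and> (\<forall>i<M. \<forall>j<n. av p aT (int i * int n + int j) = T i j))"

definition glob :: "state \<Rightarrow> bool" where
 "glob p = (rv p xn = int n \<and> rv p xm = int m \<and> rv p xs = int s \<and> rv p xK = int K \<and> rv p xM = int M \<and>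
  rv p xMn = int (M * n) \<and> rv p xd = int d)"

lemma tabl_pivot:
 assumes t: "tabl f rw \<delta> T" and ir: "ir < m" and j: "j < n" and p: "T ir j \<noteq> 0"
 shows "tabl (f(j := rw ir)) (rw(ir := f j)) (T ir j) (piv T \<delta> ir j)"
proof -
 have D: "bdet n h f \<noteq> 0" "\<bar>\<delta>\<bar> = \<bar>bdet n h f\<bar>" using t by (auto simp: tabl_def)
 have mM: "m < M" by (simp add: M_def K_def)
 have rows: "tab_row n h f \<delta> (row_vec rw i) (T i)" if "i < M" for i using t that by (simp add: tabl_def)
 have Ti: "tab_row n h f \<delta> (h (rw ir)) (T ir)" using rows[of ir] ir mM by (simp add: row_vec_def)
 have bd: "\<bar>T ir j\<bar> = \<bar>bdet n h (f(j := rw ir))\<bar>" by (rule tab_row_bdet[OF D Ti j])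
 have "tab_row n h (f(j := rw ir)) (T ir j) (row_vec (rw(ir := f j)) i) (piv T \<delta> ir j i)" if i: "i < M" for i
 proof (cases "i = ir")
  case True
  then have "piv T \<delta> ir j i = (\<lambda>j'. if j' = j then \<delta> else - T ir j')" by (auto simp: piv_def)
  then show ?thesis using pivot_leaving[OF j Ti] True ir by (simp add: row_vec_def)
 next
  case False
  then have "piv T \<delta> ir j i = (\<lambda>j'. if j' = j then T i j else (T ir j * T i j' - T i j * T ir j') div \<delta>)"
   by (auto simp: piv_def)
  moreover have "row_vec (rw(ir := f j)) i = row_vec rw i" using False by (simp add: row_vec_def)
  ultimately show ?thesis using pivot_other[OF D j Ti p rows[OF i]] by simp
 qed
 moreover have "(\<exists>j'<n. (f(j := rw ir)) j' = r) \<or> (\<exists>i<m. (rw(ir := f j)) i = r)" if "r < d" for r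
 proof -
  have "(\<exists>j<n. f j = r) \<or> (\<exists>i<m. rw i = r)" using t that by (simp add: tabl_def)
  then consider (col) j' where "j' < n" "f j' = r" | (row) i where "i < m" "rw i = r"
   by blast
  then show ?thesis
  proof cases
   case col
   then show ?thesis using ir by (cases "j' = j") (auto intro: exI[of _ j'] exI[of _ ir])
  next
   case row
   then show ?thesis using j by (cases "i = ir") (auto intro: exI[of _ j] exI[of _ i])
  qed
 qed
 ultimately show ?thesis using t bd p j ir unfolding tabl_def by auto
qed

end

text \<open>Two bounds on numbers: \<Delta> for determinants, and \<open>TB\<close> for all tableau
  entries, including those of the objective and the unit vectors, which need not be
  subdeterminants.\<close>

locale ilp_bounds = ilp +
 assumes TB: "\<And>f rw \<delta> T i j. tabl f rw \<delta> T \<Longrightarrow> i < M \<Longrightarrow> j < n \<Longrightarrow> \<bar>T i j\<bar> \<le> TB"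
  and bdet_le: "\<And>f. \<forall>j<n. f j < d \<Longrightarrow> \<bar>bdet n h f\<bar> \<le> \<Delta>"
  and TB_le: "TB \<le> Bd" and Delta_le: "\<Delta> \<le> Bd" and Mn_le: "int (M * n) \<le> Bd" and d_le: "int d \<le> Bd"
begin

lemma index_lt: "i < x \<Longrightarrow> j < n \<Longrightarrow> i * n + j < x * n"
proof -
 assume "i < x" "j < n"
 then have "i * n + j < Suc i * n" "Suc i * n \<le> x * n" by (simp_all del: mult_Suc add: mult_le_mono1) (simp)
 then show ?thesis by linarith
qed

lemma div_lt: "k < x * n \<Longrightarrow> k div n < x"
 by (simp add: less_mult_imp_div_less)

lemma mod_lt: "k mod n < n"
 using n_pos by simp

lemma at_index:
 assumes "\<forall>i<x. \<forall>j<n. A (int i * int n + int j) = T i j" "k < x * n"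
 shows "A (int k) = T (k div n) (k mod n)"
proof -
 have "int k = int (k div n) * int n + int (k mod n)"
  by (metis div_mult_mod_eq of_nat_add of_nat_mult)
 then show ?thesis using assms div_lt[of k x] mod_lt[of k] by metis
qed

lemma from_index:
 assumes "\<forall>k<x * n. A (int k) = T (k div n) (k mod n)" "i < x" "j < n"
 shows "A (int i * int n + int j) = T i j"
proof -
 have "i * n + j < x * n" by (rule index_lt[OF assms(2,3)])
 then have "A (int (i * n + j)) = T ((i * n + j) div n) ((i * n + j) mod n)" using assms(1) by blast
 then show ?thesis using assms(3) by simp
qed

lemma pivot_spec:
 assumes g: "glob p" and t: "tabl f rw \<delta> T" and tm: "tab_mem p f rw \<delta> T"
  and ir: "rv p 31 = int ir" "ir < m" and j: "rv p 30 = int j" "j < n" and nz: "T ir j \<noteq> 0"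
 shows "spec pivot p (60 * (M * n + 1)) (\<lambda>q. frame 40 {xdel} {aT, aT2, acol, arow} p q \<and>
  tab_mem q (f(j := rw ir)) (rw(ir := f j)) (T ir j) (piv T \<delta> ir j))"
proof -
 let ?T' = "piv T \<delta> ir j"
 note t' = tabl_pivot[OF t ir(2) j(2) nz]
 have mM: "m < M" by (simp add: M_def K_def)
 have gl: "rv p xn = int n" "rv p xMn = int (M * n)" using g by (auto simp: glob_def)
 have Tm: "\<forall>i<M. \<forall>j<n. av p aT (int i * int n + int j) = T i j" "rv p xdel = \<delta>" using tm by (auto simp: tab_mem_def)
 have T'b: "\<bar>?T' i j'\<bar> \<le> Bd" if "i < M" "j' < n" for i j'
  using TB[OF t' that] TB_le by simp
 have Tb: "\<bar>T i j'\<bar> \<le> Bd" if "i < M" "j' < n" for i j'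
  using TB[OF t that] TB_le by simp
 have irM: "ir < M" using ir mM by simp
 define I1 where "I1 k q = (frame 41 {} {aT2} p q \<and> rv q 41 = T ir j \<and>
    (\<forall>x<k. av q aT2 (int x) = ?T' (x div n) (x mod n)))" for k q
 define I2 where "I2 k q = (frame 41 {} {aT2, aT} p q \<and> rv q 41 = T ir j \<and>
    (\<forall>x<M * n. av q aT2 (int x) = ?T' (x div n) (x mod n)) \<and>
    (\<forall>x<k. av q aT (int x) = ?T' (x div n) (x mod n)))" for k q
 have body: "spec pivot_entry q 40 (\<lambda>q'. rv q' 42 = int k \<and> (\<forall>x. I1 (Suc k) (set_reg 42 x q')))"
  if k: "k < M * n" and q: "I1 k q" "rv q 42 = int k" for k q
 proof -
  define i where "i = k div n"
  define l where "l = k mod n"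
  have il: "i < M" "l < n" using div_lt[OF k] mod_lt by (auto simp: i_def l_def)
  have fr: "frame 41 {} {aT2} p q" using q by (simp add: I1_def)
  note [simp] = frame_reg[OF fr] frame_arr[OF fr]
  have Tk: "av p aT (int k) = T i l" unfolding i_def l_def by (rule at_index[OF Tm(1) k])
  have dm: "int k div int n = int i" "int k mod int n = int l" by (simp_all add: i_def l_def zdiv_int zmod_int)
  have T': "?T' i l = (if i = ir then if l = j then \<delta> else - T ir l
   else if l = j then T i j else (T ir j * T i l - T i j * T ir l) div \<delta>)"
   by (simp add: piv_def)
  have "int i \<le> int k" "int l \<le> int k" by (simp_all add: i_def l_def div_le_dividend mod_less_eq_dividend)
  then have kb: "int i \<le> Bd" "int l \<le> Bd" using k Mn_le by linarith+
  show ?thesis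
   unfolding pivot_entry_def
   apply (rule spec_blk)
   apply simp
   apply (use q T'b[OF il] T' kb in \<open>simp add: gl ir j Tm Tk dm il irM sq_pos_iff sq_le_iff I1_def i_def[symmetric] l_def[symmetric] less_Suc_eq\<close>)
   apply (auto split: if_splits)[1]
   apply simp
   done
 qed
 have fin: "wp (45 ::= Ix acol (V 30) ;. Sto acol (V 30) (Ix arow (V 31)) ;. Sto arow (V 31) (V 45) ;.
   xdel ::= V 41 +. N 0) (\<lambda>q. frame 40 {xdel} {aT, aT2, acol, arow} p q \<and>
    tab_mem q (f(j := rw ir)) (rw(ir := f j)) (T ir j) ?T') q" if q: "I2 (M * n) q" for q
 proof -
  have fr: "frame 41 {} {aT2, aT} p q" using q by (simp add: I2_def)
  note [simp] = frame_reg[OF fr] frame_arr[OF fr]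
  have T'q: "av q aT (int i * int n + int j') = ?T' i j'" if "i < M" "j' < n" for i j'
   by (rule from_index[OF _ that, where A = "av q aT"]) (use q in \<open>auto simp: I2_def\<close>)
  have "frame 40 {xdel} {aT, aT2, acol, arow} p q" by (rule frame_mono[OF fr]) auto
  then show ?thesis
   using Tb[OF irM j(2)] q tm j ir T'q by (simp add: tab_mem_def I2_def)
 qed
 show ?thesis
  unfolding pivot_def
  apply (rule spec_le, rule wp_Seq[where A = "I1 0"], simp)
  apply (simp add: gl ir j Tm irM I1_def)
  apply (rule spec_Seq_mid[where A = "I1 (M * n)"], rule spec_loop[where n = "M * n" and I = I1])
  apply (simp_all add: Mn_le[simplified])[4]
  apply (simp add: I1_def; fail)
  apply (use gl in \<open>simp add: I1_def frame_def; fail\<close>)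
  apply (rule body; simp; fail)
  apply assumption
  apply (rule spec_Seq_mid[where A = "I2 (M * n)"], rule spec_loop[where n = "M * n" and I = I2])
  apply (simp_all add: Mn_le[simplified])[4]
  apply (simp add: I1_def I2_def frame_def; fail)
  apply (use gl in \<open>simp add: I2_def frame_def; fail\<close>)
  apply (rule spec_blk[where T = 5])
  apply simp
  apply (simp add: I2_def less_Suc_eq; fail)
  apply simp
  apply assumption
  apply (rule wp_spec, simp)
  apply (rule fin; simp; fail)
  apply simp
  done
qed

end

section \<open>Exchanging a set of rows out of the basis\<close>

definition tableau_init :: com where
 "tableau_init =
  loop 30 xd (blk (Sto amk (V 30) (N 0))) ;;
  loop 30 xm (blk (Sto amk (Ix aq (V 30)) (N 1))) ;;
  loop 30 xMn (blk (Sto aT (V 30) (Ix aT0 (V 30)))) ;;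
  loop 30 xn (blk (Sto acol (V 30) (V 30))) ;;
  loop 30 xm (blk (Sto arow (V 30) (V xn +. V 30))) ;;
  blk (xdel ::= V xdB +. N 0)"

text \<open>The product is positive exactly for an unmarked row with a nonzero entry in the column;
  -1 stays if there is none.\<close>

definition search_row :: com where
 "search_row =
  blk (31 ::= N (-1)) ;;
  loop 32 xm (blk (
   If ((N 1 -. Ix amk (Ix arow (V 32))) *. sq (Ix aT (V 32 *. V xn +. V 30)))
    (31 ::= V 32 +. N 0) Nop))"

definition tableau_step :: com where
 "tableau_step =
  cif (Ix amk (Ix acol (V 30)))
   (search_row ;; cif (V 31 +. N 1) pivot Skip)
   Skip"

text \<open>Each row set starts afresh from the first basis. The final sign change makes the
  denominator positive, which the residues modulo it and the sign tests for rays rely on.\<close>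

definition tableau :: com where
 "tableau =
  tableau_init ;;
  loop 30 xn tableau_step ;;
  cif (N 0 -. V xdel)
   (blk (xdel ::= N 0 -. V xdel) ;;
    loop 30 xMn (blk (Sto aT (V 30) (N 0 -. Ix aT (V 30)))))
   Skip"

context ilp
begin

definition init_mem :: "state \<Rightarrow> (nat \<Rightarrow> nat \<Rightarrow> int) \<Rightarrow> bool" where
 "init_mem p T0 = (glob p \<and> tabl (\<lambda>j. j) (\<lambda>i. n + i) (rv p xdB) T0 \<and>
  (\<forall>i<M. \<forall>j<n. av p aT0 (int i * int n + int j) = T0 i j))"

definition avoids :: "nat set \<Rightarrow> (nat \<Rightarrow> nat) \<Rightarrow> bool" where
 "avoids Q g = (bdet n h g \<noteq> 0 \<and> (\<forall>j<n. g j < d \<and> g j \<notin> Q))"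

definition mark_mem :: "state \<Rightarrow> nat set \<Rightarrow> bool" where
 "mark_mem p Q = ((\<forall>r<d. av p amk (int r) = (if r \<in> Q then 1 else 0)))"

text \<open>The edge direction of column \<open>j\<close> is orthogonal to all rows outside
  \<open>Q\<close>: to the basic ones by duality, to the others because their entries vanish. So
  these rows do not span, and a failed search proves that no basis avoids \<open>Q\<close>.\<close>

lemma tabl_stuck:
 assumes t: "tabl f rw \<delta> T" and j: "j < n" "f j \<in> Q" and z: "\<And>i. i < m \<Longrightarrow> rw i \<notin> Q \<Longrightarrow> T i j = 0"
 shows "\<not> avoids Q g"
proof
 assume g: "avoids Q g"
 have D: "\<bar>\<delta>\<bar> = \<bar>bdet n h f\<bar>" "\<delta> \<noteq> 0" using t by (auto simp: tabl_def)
 have mM: "m < M" by (simp add: M_def K_def)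
 obtain v where v: "\<forall>j'<n. dot n (h (f j')) v = (if j' = j then \<delta> else 0)"
  "\<And>r T. tab_row n h f \<delta> r T \<Longrightarrow> dot n r v = T j"
  using tab_row_dual[OF D j(1)] by blast
 have gv: "dot n (h (g j')) v = 0" if j': "j' < n" for j'
 proof -
  have gj: "g j' < d" "g j' \<notin> Q" using g j' by (auto simp: avoids_def)
  have "(\<exists>j<n. f j = g j') \<or> (\<exists>i<m. rw i = g j')" using t gj by (simp add: tabl_def)
  then consider (col) k where "k < n" "f k = g j'" | (row) i where "i < m" "rw i = g j'" by blast
  then show ?thesis
  proof cases
   case col
   then have "k \<noteq> j" using gj j by auto
   then show ?thesis using v(1) col by metis
  next
   case row
   have "tab_row n h f \<delta> (row_vec rw i) (T i)" using t row mM by (auto simp: tabl_def)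
   then have "dot n (h (rw i)) v = T i j" using v(2) row by (simp add: row_vec_def)
   then show ?thesis using z[OF row(1)] row gj by simp
  qed
 qed
 obtain S where S: "tab_row n h g (bdet n h g) (h (f j)) S" using tab_row_exists by blast
 have "bdet n h g * dot n (h (f j)) v = 0" unfolding tab_row_dot[OF S] using gv by simp
 then show False using g v(1) j D by (auto simp: avoids_def)
qed

lemma tabl_uminus: "tabl f rw \<delta> T \<Longrightarrow> tabl f rw (- \<delta>) (\<lambda>i j. - T i j)"
 by (auto simp: tabl_def tab_row_def sum_negf)

end

context ilp_bounds
begin

lemma Tbd: "tabl f rw \<delta> T \<Longrightarrow> i < M \<Longrightarrow> j < n \<Longrightarrow> \<bar>T i j\<bar> \<le> Bd"
 using TB TB_le by (meson order_trans)

lemma delta_bd: "tabl f rw \<delta> T \<Longrightarrow> \<bar>\<delta>\<bar> \<le> \<Delta>"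
 using bdet_le[of f] by (simp add: tabl_def)

lemma nm_le: "int n \<le> Bd" "int m \<le> Bd"
 using d_le by (simp_all add: d_def)

lemma search_spec:
 assumes g: "glob p" and t: "tabl f rw \<delta> T" and tm: "tab_mem p f rw \<delta> T" and mk: "mark_mem p Q"
  and j: "rv p 30 = int j" "j < n"
 shows "spec search_row p (30 * (m + 1))
  (\<lambda>q. frame 31 {} {} p q \<and> (rv q 31 = -1 \<and> (\<forall>i<m. rw i \<notin> Q \<longrightarrow> T i j = 0) \<or>
   (\<exists>i<m. rv q 31 = int i \<and> T i j \<noteq> 0 \<and> rw i \<notin> Q)))"
proof -
 have mM: "i < M" if "i < m" for i using that by (simp add: M_def K_def)
 have rwd: "rw i < d" if "i < m" for i using t that by (simp add: tabl_def)
 define I where "I k q = (frame 31 {} {} p q \<and> (rv q 31 = -1 \<and> (\<forall>i<k. rw i \<notin> Q \<longrightarrow> T i j = 0) \<or>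
   (\<exists>i<m. rv q 31 = int i \<and> T i j \<noteq> 0 \<and> rw i \<notin> Q)))" for k q
 have body: "spec (blk (If ((N 1 -. Ix amk (Ix arow (V 32))) *. sq (Ix aT (V 32 *. V xn +. V 30)))
       (31 ::= V 32 +. N 0) Nop)) q 20 (\<lambda>q'. rv q' 32 = int k \<and> (\<forall>x. I (Suc k) (set_reg 32 x q')))"
  if k: "k < m" and q: "I k q" "rv q 32 = int k" for k q
 proof -
  have fr: "frame 31 {} {} p q" using q by (simp add: I_def)
  have facts: "rv p xn = int n" "av p arow (int k) = int (rw k)" "rv p 30 = int j"
   "av p amk (int (rw k)) = (if rw k \<in> Q then 1 else 0)" "av p aT (int k * int n + int j) = T k j"
   using g tm mk k j mM[OF k] rwd[OF k] by (auto simp: glob_def tab_mem_def mark_mem_def)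
  have sq: "0 < x * x \<longleftrightarrow> x \<noteq> 0" "x * x \<le> 0 \<longleftrightarrow> x = 0" for x :: int
   using sq_pos_iff[of x 0] sq_le_iff[of x 0] by simp_all
  note [simp] = frame_reg[OF fr] frame_arr[OF fr]
  have "int k \<le> Bd" using k nm_le by linarith
  then show ?thesis
   apply (intro spec_blk)
   apply simp
   apply (use q k in \<open>auto simp: I_def facts sq less_Suc_eq\<close>)[1]
   apply simp
   done
 qed
 show ?thesis
  unfolding search_row_def
  apply (rule spec_le, rule wp_Seq[where A = "I 0"], simp)
  apply (use Bd_ge in \<open>simp add: I_def\<close>)
  apply (rule spec_loop[where n = m and I = I])
  apply (simp_all add: nm_le)[4]
  apply (simp add: I_def; fail)
  apply (use g in \<open>simp add: I_def frame_def glob_def; fail\<close>)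
  apply (rule body; simp; fail)
  apply (simp add: I_def)
  apply simp
  done
qed

lemma tableau_init_spec:
 assumes g: "glob p" and im: "init_mem p T0"
  and q: "\<forall>i<m. av p aq (int i) = int (qv i)" "\<forall>i<m. qv i < d"
 shows "spec tableau_init p (100 * (d + M * n + 1))
  (\<lambda>q. frame 30 {xdel} {amk, aT, acol, arow} p q \<and> mark_mem q (qv ` {..<m}) \<and>
   tab_mem q (\<lambda>j. j) (\<lambda>i. n + i) (rv p xdB) T0)"
proof -
 have t: "tabl (\<lambda>j. j) (\<lambda>i. n + i) (rv p xdB) T0" and
  T0: "\<forall>i<M. \<forall>j<n. av p aT0 (int i * int n + int j) = T0 i j" using im by (auto simp: init_mem_def)
 have gl: "rv p xn = int n" "rv p xm = int m" "rv p xMn = int (M * n)" "rv p xd = int d"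
  using g by (auto simp: glob_def)
 have dB: "\<bar>rv p xdB\<bar> \<le> Bd" using delta_bd[OF t] Delta_le by linarith
 have nm: "int (n + i) \<le> Bd" if "i < m" for i using that d_le by (simp add: d_def)
 define J1 where "J1 k q = (frame 30 {} {amk} p q \<and> (\<forall>r<k. av q amk (int r) = 0))" for k :: nat and q
 define J2 where "J2 k q = (frame 30 {} {amk} p q \<and> mark_mem q (qv ` {..<k}))" for k and q
 define J3 where "J3 k q = (frame 30 {} {amk, aT} p q \<and> mark_mem q (qv ` {..<m}) \<and>
  (\<forall>x<k. av q aT (int x) = T0 (x div n) (x mod n)))" for k and q
 define J4 where "J4 k q = (frame 30 {} {amk, aT, acol} p q \<and> mark_mem q (qv ` {..<m}) \<and>
  (\<forall>x<M*n. av q aT (int x) = T0 (x div n) (x mod n)) \<and> (\<forall>j<k. av q acol (int j) = int j))" for k and q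
 define J5 where "J5 k q = (frame 30 {} {amk, aT, acol, arow} p q \<and> mark_mem q (qv ` {..<m}) \<and>
  (\<forall>x<M*n. av q aT (int x) = T0 (x div n) (x mod n)) \<and> (\<forall>j<n. av q acol (int j) = int j) \<and>
  (\<forall>i<k. av q arow (int i) = int (n + i)))" for k and q
 show ?thesis
  unfolding tableau_init_def
  apply (rule spec_le, rule spec_loop_Seq[where n = d and I = J1])
  apply (simp_all add: d_le)[4]
  apply (simp add: J1_def; fail)
  apply (use gl in \<open>simp add: J1_def frame_def; fail\<close>)
  apply (rule spec_blk[where T = 5])
  apply simp
  apply (use Bd_ge in \<open>simp add: J1_def less_Suc_eq; fail\<close>)
  apply simp
  apply (rule spec_loop_Seq[where n = m and I = J2])
  apply (simp_all add: nm_le)[4]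
  apply (simp add: J1_def J2_def mark_mem_def; fail)
  apply (use gl in \<open>simp add: J2_def frame_def; fail\<close>)
  apply (rule spec_blk[where T = 5])
  apply simp
  apply (use Bd_ge q in \<open>auto simp: J2_def mark_mem_def lessThan_Suc frame_def\<close>)[1]
  apply simp
  apply (rule spec_Seq_mid[where A = "J3 (M * n)"], rule spec_loop[where n = "M * n" and I = J3])
  apply (simp_all add: Mn_le[simplified])[4]
  apply (simp add: J2_def J3_def mark_mem_def frame_def; fail)
  apply (use gl in \<open>simp add: J3_def frame_def; fail\<close>)
  apply (rule spec_blk[where T = 5])
  apply simp
  apply (use at_index[OF T0] in \<open>auto simp: J3_def less_Suc_eq frame_def mark_mem_def\<close>)[1]
  apply simp
  apply assumption
  apply (rule spec_loop_Seq[where n = n and I = J4])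
  apply (simp_all add: nm_le)[4]
  apply (simp add: J3_def J4_def mark_mem_def frame_def; fail)
  apply (use gl in \<open>simp add: J4_def frame_def; fail\<close>)
  apply (rule spec_blk[where T = 5])
  apply simp
  apply (simp add: J4_def less_Suc_eq mark_mem_def; fail)
  apply simp
  apply (rule spec_loop_Seq[where n = m and I = J5])
  apply (simp_all add: nm_le)[4]
  apply (simp add: J4_def J5_def mark_mem_def frame_def; fail)
  apply (use gl in \<open>simp add: J5_def frame_def; fail\<close>)
  apply (rule spec_blk[where T = 5])
  apply simp
  apply (use gl nm in \<open>auto simp: J5_def less_Suc_eq mark_mem_def frame_def\<close>)[1]
  apply simp
  apply (rule wp_spec, simp)
  apply (use dB T0 in \<open>auto simp: J5_def frame_def tab_mem_def mark_mem_def\<close>)[1]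
  apply (erule from_index[where A = "\<lambda>z. fst (f z)" for f]; assumption)
  apply (simp add: d_def)
  done
qed

lemma tableau_step_spec:
 assumes g: "glob p" and t: "tabl f rw \<delta> T" and tm: "tab_mem p f rw \<delta> T" and mk: "mark_mem p Q"
  and j: "rv p 30 = int j" "j < n" and prev: "\<And>g j'. avoids Q g \<Longrightarrow> j' < j \<Longrightarrow> f j' \<notin> Q"
 shows "spec tableau_step p (100 * (m + M * n + 1))
  (\<lambda>q. frame 31 {xdel} {aT, aT2, acol, arow} p q \<and> mark_mem q Q \<and>
   (\<exists>f rw \<delta> T. tabl f rw \<delta> T \<and> tab_mem q f rw \<delta> T \<and>
    (\<forall>g j'. avoids Q g \<longrightarrow> j' < Suc j \<longrightarrow> f j' \<notin> Q)))" (is "spec _ _ _ ?Q")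
proof -
 have fj: "f j < d" using t j by (simp add: tabl_def)
 have mm: "mark_mem q Q" if "frame 31 {xdel} {aT, aT2, acol, arow} p q" for q
  using that mk by (simp add: mark_mem_def frame_def)
 have a: "av p amk (av p acol (rv p 30)) = (if f j \<in> Q then 1 else 0)"
  using tm mk j fj by (simp add: tab_mem_def mark_mem_def)
 have noop: "?Q q" if "frame 31 {} {} p q" "\<And>g. avoids Q g \<Longrightarrow> f j \<notin> Q" for q
 proof -
  have "frame 31 {xdel} {aT, aT2, acol, arow} p q" using that(1) by (simp add: frame_def)
  moreover have "tab_mem q f rw \<delta> T" using tm that(1) by (simp add: tab_mem_def frame_def)
  moreover have "\<forall>g j'. avoids Q g \<longrightarrow> j' < Suc j \<longrightarrow> f j' \<notin> Q"
   using that(2) prev by (metis less_SucE)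
  ultimately show ?thesis using t mm by blast
 qed
 have piv: "spec pivot q (60 * (M * n + 1)) ?Q"
  if fr: "frame 31 {} {} p q" and i: "i < m" "rv q 31 = int i" "T i j \<noteq> 0" "rw i \<notin> Q" for q i
 proof (rule spec_conseq[OF pivot_spec[of q f rw \<delta> T i j]])
  show "glob q" "tab_mem q f rw \<delta> T" "rv q 30 = int j"
   using g tm fr j by (simp_all add: glob_def tab_mem_def frame_def)
  fix q' assume q': "frame 40 {xdel} {aT, aT2, acol, arow} q q' \<and>
   tab_mem q' (f(j := rw i)) (rw(i := f j)) (T i j) (piv T \<delta> i j)"
  have "frame 31 {xdel} {aT, aT2, acol, arow} p q'"
   using fr q' by (simp add: frame_def)
  moreover have "tabl (f(j := rw i)) (rw(i := f j)) (T i j) (piv T \<delta> i j)"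
   by (rule tabl_pivot[OF t i(1) j(2) i(3)])
  moreover have "\<forall>g j'. avoids Q g \<longrightarrow> j' < Suc j \<longrightarrow> (f(j := rw i)) j' \<notin> Q"
   using i(4) prev by (simp add: less_Suc_eq)
  ultimately show "?Q q'" using mm q' by blast
 qed (use t i j in auto)
 show ?thesis
  unfolding tableau_step_def
  apply (rule spec_le, rule spec_cif)
  apply simp
  apply (rule spec_Seq_mid, rule search_spec[OF g t tm mk j], rule spec_cif)
  apply simp
  apply (erule conjE, erule disjE)
  apply simp
  apply (elim exE conjE)
  apply (rule piv; assumption)
  apply (rule spec_Skip)
  apply (erule conjE, erule disjE, rule noop, assumption)
  apply (use tabl_stuck[OF t j(2)] in blast)
  apply simp
  apply (rule spec_Skip, rule noop)
  apply simp
  apply (use a in \<open>simp split: if_splits\<close>)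
  apply simp
  done
qed

text \<open>If no basis avoids \<open>Q\<close>, the result is still the tableau of some basis.
  Processing that basis is sound, and the conditional conclusion spares the program a separate
  treatment of degenerate sets.\<close>

lemma tableau_spec:
 assumes im: "init_mem p T0"
  and q: "\<forall>i<m. av p aq (int i) = int (qv i)" "\<forall>i<m. qv i < d"
 defines "Q \<equiv> qv ` {..<m}"
 shows "spec tableau p (400 * n * (d + M * n + 1)) (\<lambda>q. frame 30 {xdel} {amk, aT, aT2, acol, arow} p q \<and>
  (\<exists>f rw \<delta> T. tabl f rw \<delta> T \<and> 0 < \<delta> \<and> tab_mem q f rw \<delta> T \<and>
   (\<forall>g j. avoids Q g \<longrightarrow> j < n \<longrightarrow> f j \<notin> Q)))" (is "spec _ _ _ ?P")
proof -
 have g: "glob p" and t0: "tabl (\<lambda>j. j) (\<lambda>i. n + i) (rv p xdB) T0"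
  using im by (auto simp: init_mem_def)
 have gf: "glob q" if "frame 30 {xdel} Y p q" for q Y
  using g that by (simp add: glob_def frame_def)
 define I where "I k q = (frame 30 {xdel} {amk, aT, aT2, acol, arow} p q \<and> mark_mem q Q \<and>
   (\<exists>f rw \<delta> T. tabl f rw \<delta> T \<and> tab_mem q f rw \<delta> T \<and>
    (\<forall>g j'. avoids Q g \<longrightarrow> j' < k \<longrightarrow> f j' \<notin> Q)))" for k q
 have mem: "mark_mem (set_reg 30 x q) Q = mark_mem q Q" "tab_mem (set_reg 30 x q) f rw \<delta> T = tab_mem q f rw \<delta> T"
  for x q f rw \<delta> T by (simp_all add: mark_mem_def tab_mem_def)
 have step: "spec tableau_step q (100 * (m + M * n + 1)) (\<lambda>q'. rv q' 30 = int k \<and> (\<forall>x. I (Suc k) (set_reg 30 x q')))"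
  if k: "k < n" and q: "I k q" "rv q 30 = int k" for k q
 proof -
  obtain f rw \<delta> T where *: "tabl f rw \<delta> T" "tab_mem q f rw \<delta> T"
   "\<And>g j'. avoids Q g \<Longrightarrow> j' < k \<Longrightarrow> f j' \<notin> Q" using q(1) unfolding I_def by metis
  have fr: "frame 30 {xdel} {amk, aT, aT2, acol, arow} p q" "mark_mem q Q" using q by (auto simp: I_def)
  show ?thesis
  proof (rule spec_conseq[OF tableau_step_spec[OF gf[OF fr(1)] *(1,2) fr(2) q(2) k *(3)]])
   fix q' assume q': "frame 31 {xdel} {aT, aT2, acol, arow} q q' \<and> mark_mem q' Q \<and>
    (\<exists>f rw \<delta> T. tabl f rw \<delta> T \<and> tab_mem q' f rw \<delta> T \<and> (\<forall>g j'. avoids Q g \<longrightarrow> j' < Suc k \<longrightarrow> f j' \<notin> Q))"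
   have "frame 30 {xdel} {amk, aT, aT2, acol, arow} p q'" using fr q' by (simp add: frame_def)
   moreover have "rv q' 30 = int k" using q' q by (simp add: frame_def)
   ultimately show "rv q' 30 = int k \<and> (\<forall>x. I (Suc k) (set_reg 30 x q'))"
    using q' unfolding I_def mem by simp
  qed
 qed
 have fin: "spec (cif (N 0 -. V xdel)
   (blk (xdel ::= N 0 -. V xdel) ;;
    loop 30 xMn (blk (Sto aT (V 30) (N 0 -. Ix aT (V 30)))))
   Skip) q (20 * (M * n + 1)) ?P" if q: "I n q" for q
 proof -
  obtain f rw \<delta> T where *: "tabl f rw \<delta> T" "tab_mem q f rw \<delta> T"
   "\<And>g j. avoids Q g \<Longrightarrow> j < n \<Longrightarrow> f j \<notin> Q" using q(1) unfolding I_def by metis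
  have fr: "frame 30 {xdel} {amk, aT, aT2, acol, arow} p q" "mark_mem q Q" using q by (auto simp: I_def)
  have \<delta>: "rv q xdel = \<delta>" using * by (simp add: tab_mem_def)
  have n0: "\<delta> \<noteq> 0" using *(1) by (auto simp: tabl_def)
  have \<delta>b: "\<bar>\<delta>\<bar> \<le> Bd" using delta_bd[OF *(1)] Delta_le by linarith
  have Tq: "av q aT (int k) = T (k div n) (k mod n)" if "k < M * n" for k
   using at_index[OF _ that, of "av q aT" T] * by (simp add: tab_mem_def)
  have gq: "rv q xMn = int M * int n" using gf[OF fr(1)] by (simp add: glob_def)
  define q1 where "q1 = set_reg xdel (- \<delta>, snd (reg q xdel)) q"
  define J where "J k q' = (frame 30 {xdel} {aT} q q' \<and> rv q' xdel = - \<delta> \<and>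
    (\<forall>x<M * n. av q' aT (int x) = (if x < k then - T (x div n) (x mod n) else T (x div n) (x mod n))))" for k q'
  have J: "?P q'" if q': "J (M * n) q'" "\<delta> < 0" for q'
  proof -
   have "frame 30 {xdel} {amk, aT, aT2, acol, arow} p q'" using fr q' by (simp add: J_def frame_def)
   moreover have "tab_mem q' f rw (- \<delta>) (\<lambda>i j. - T i j)"
    using q' * from_index[of M "av q' aT" "\<lambda>i j. - T i j"] by (simp add: tab_mem_def J_def frame_def)
   moreover have "0 < - \<delta>" using that by simp
   ultimately show ?thesis using tabl_uminus[OF *(1)] *(3) by blast
  qed
  have pos: "?P q" if "0 < \<delta>" using fr(1) * that by blast
  have body: "spec (blk (Sto aT (V 30) (N 0 -. Ix aT (V 30)))) q' 10
   (\<lambda>q''. rv q'' 30 = int k \<and> (\<forall>x. J (Suc k) (set_reg 30 x q'')))"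
   if k: "k < M * n" and q': "J k q'" "rv q' 30 = int k" for k q'
   apply (rule spec_blk)
   apply simp
   apply (use k q' Tbd[OF *(1) div_lt[OF k] mod_lt[of k]] in \<open>auto simp: J_def less_Suc_eq\<close>)[1]
   apply simp
   done
  show ?thesis
   apply (rule spec_le, rule spec_cif)
   apply simp
   apply (rule wp_Seq[where A = "J 0"], simp)
   apply (use Tq \<delta> \<delta>b in \<open>simp add: J_def\<close>)
   apply (rule spec_loop[where n = "M * n" and I = J])
   apply (simp_all add: Mn_le[simplified])[4]
   apply (simp add: J_def; fail)
   apply (use gq in \<open>simp add: J_def frame_def; fail\<close>)
   apply (rule body; simp; fail)
   apply (rule J; simp add: \<delta>)
   apply (rule spec_Skip, rule pos)
   apply (use \<delta> n0 in simp)
   apply simp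
   done
 qed
 have cost: "100 * (d + M * n + 1) + (3 + n * (100 * (m + M * n + 1) + 4) + 20 * (M * n + 1)) \<le> 400 * n * (d + M * n + 1)"
 proof -
  define X where "X = d + M * n + 1"
  have X: "1 \<le> X" "M * n + 1 \<le> X" "m + M * n + 1 \<le> X" by (simp_all add: X_def d_def)
  have 1: "100 * x + 4 \<le> 110 * X" if "x \<le> X" for x using that X(1) by linarith
  have 2: "x + (3 + y + z) \<le> 400 * Y" if "x \<le> 100 * Y" "y \<le> 110 * Y" "z \<le> 20 * Y" "1 \<le> Y"
   for x y z Y :: nat using that by linarith
  have nX: "X \<le> n * X" using n_pos by simp
  have "n * (100 * (m + M * n + 1) + 4) \<le> n * (110 * X)" using 1[OF X(3)] by (rule mult_le_mono2)
  then have "n * (100 * (m + M * n + 1) + 4) \<le> 110 * (n * X)" by (simp only: mult.left_commute)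
  moreover have "100 * X \<le> 100 * (n * X)" using nX by (rule mult_le_mono2)
  moreover have "20 * (M * n + 1) \<le> 20 * (n * X)" using order_trans[OF X(2) nX] by (rule mult_le_mono2)
  moreover have "1 \<le> n * X" using X(1) nX by (rule order_trans)
  ultimately show ?thesis unfolding X_def[symmetric] mult.assoc using 2 by blast
 qed
 have I0: "I 0 (set_reg 30 x q)" if "frame 30 {xdel} {amk, aT, acol, arow} p q \<and> mark_mem q (qv ` {..<m}) \<and>
   tab_mem q (\<lambda>j. j) (\<lambda>i. n + i) (rv p xdB) T0" for x q
 proof -
  have "frame 30 {xdel} {amk, aT, aT2, acol, arow} p q" using that by (simp add: frame_def)
  then show ?thesis using that t0 unfolding I_def mem Q_def[symmetric] by auto
 qed
 show ?thesis
  unfolding tableau_def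
  apply (rule spec_le[OF _ cost], rule spec_Seq_mid, rule tableau_init_spec[OF g im q], rule spec_loop_Seq[where n = n and I = I])
  apply (simp_all add: nm_le)[4]
  apply (rule I0; assumption)
  apply (use g in \<open>simp add: I_def frame_def glob_def; fail\<close>)
  apply (rule step; assumption)
  apply (erule fin)
  done
qed

end

section \<open>Rays and the group of a basis\<close>

definition ray_check :: com where
 "ray_check =
  loop 30 xn (
   cif (N 0 -. Ix aT (V xK *. V xn +. V 30))
    (blk (31 ::= N 1) ;;
     loop 32 xm (blk (If (N 0 -. Ix aT (V 32 *. V xn +. V 30)) (31 ::= N 0) Nop)) ;;
     blk (If (V 31) (xray ::= N 1) Nop))
    Skip)"

text \<open>Not found is reported as \<open>xcnt\<close>, which is also the index that a new element
  receives.\<close>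

definition find_elem :: com where
 "find_elem =
  blk (41 ::= V xcnt +. N 0) ;;
  loop 42 xcnt (
   blk (43 ::= N 1) ;;
   loop 44 xK (blk (If (sq (Ix aG (V 42 *. V xK +. V 44) -. Ix aV (V 44))) (43 ::= N 0) Nop)) ;;
   blk (If (V 43) (41 ::= V 42 +. N 0) Nop))"

text \<open>The candidate is written behind the last element before the search, so appending it is
  just an increment of \<open>xcnt\<close>. The condition holds exactly if the search
  failed.\<close>

definition group_step :: com where
 "group_step =
  loop 32 xK (blk (
   33 ::= (Ix aG (V 30 *. V xK +. V 32) -. Ix aT (V 32 *. V xn +. V 31)) mod. V xdel ;.
   Sto aV (V 32) (V 33) ;.
   Sto aG (V xcnt *. V xK +. V 32) (V 33))) ;;
  find_elem ;;
  blk (If (V 41 -. V xcnt +. N 1) (xcnt ::= V xcnt +. N 1) Nop ;.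
   Sto aSub (V 30 *. V xn +. V 31) (V 41))"

text \<open>Closure of the zero element under subtraction of the n generators. In a finite group
  this already reaches every element.\<close>

definition group :: com where
 "group =
  blk (xcnt ::= N 1) ;;
  loop 30 xK (blk (Sto aG (V 30) (N 0))) ;;
  blk (30 ::= N 0) ;;
  whl (V xcnt -. V 30) (
   loop 31 xn group_step ;;
   blk (30 ::= V 30 +. N 1))"

locale basis = ilp_bounds +
 fixes f rw :: "nat \<Rightarrow> nat" and \<delta> :: int and T :: "nat \<Rightarrow> nat \<Rightarrow> int"
 assumes tabl: "tabl f rw \<delta> T" and delta_pos: "0 < \<delta>"
  and K_le: "int K \<le> Bd"
begin

definition mem :: "state \<Rightarrow> bool" where
 "mem p = (glob p \<and> tab_mem p f rw \<delta> T)"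

lemma mem_frame: "mem p \<Longrightarrow> frame l X Y p q \<Longrightarrow> 22 \<le> l \<Longrightarrow> X \<inter> {xn, xm, xs, xK, xM, xMn, xd, xdel} = {} \<Longrightarrow>
  Y \<inter> {aT, acol, arow} = {} \<Longrightarrow> mem q"
 by (simp add: mem_def glob_def tab_mem_def frame_def)

lemma memD:
 assumes "mem p"
 shows "rv p xn = int n" "rv p xm = int m" "rv p xs = int s" "rv p xK = int K" "rv p xM = int M"
  "rv p xMn = int M * int n" "rv p xd = int d" "rv p xdel = \<delta>"
  "\<And>j. j < n \<Longrightarrow> av p acol (int j) = int (f j)" "\<And>i. i < m \<Longrightarrow> av p arow (int i) = int (rw i)"
  "\<And>i j. i < M \<Longrightarrow> j < n \<Longrightarrow> av p aT (int i * int n + int j) = T i j"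
 using assms by (simp_all add: mem_def glob_def tab_mem_def)

lemma KM: "K < M" "i < m \<Longrightarrow> i < M" "i < m \<Longrightarrow> i < K" "i < K \<Longrightarrow> i < M"
 by (simp_all add: M_def K_def)

lemma Tb: "i < M \<Longrightarrow> j < n \<Longrightarrow> \<bar>T i j\<bar> \<le> Bd"
 by (rule Tbd[OF tabl])

lemma delta_b: "\<delta> \<le> Bd" "\<delta> \<le> \<Delta>"
 using delta_bd[OF tabl] Delta_le delta_pos by simp_all

text \<open>The direction meant is the negative of the j-th edge direction: it changes nonbasic row
  \<open>i\<close> by \<open>- T i j\<close>, the objective by \<open>- T K j\<close>, and basic row
  \<open>j\<close> by - \<delta>. The unit rows between \<open>m\<close> and \<open>K\<close> impose
  no sign condition, as they are no constraints.\<close>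

definition is_ray :: "nat \<Rightarrow> bool" where
 "is_ray j = (T K j < 0 \<and> (\<forall>i<m. 0 \<le> T i j))"

lemma ray_check_spec:
 assumes p: "mem p"
 shows "spec ray_check p (100 * n * (m + 1)) (\<lambda>q. frame 30 {xray} {} p q \<and>
  rv q xray = (if \<exists>j<n. is_ray j then 1 else rv p xray))"
proof -
 note mp = memD[OF p]
 define I where "I k q = (frame 30 {xray} {} p q \<and> rv q xray = (if \<exists>j<k. is_ray j then 1 else rv p xray))" for k q
 have inner: "spec (blk (31 ::= N 1) ;;
     loop 32 xm (blk (If (N 0 -. Ix aT (V 32 *. V xn +. V 30)) (31 ::= N 0) Nop)) ;;
     blk (If (V 31) (xray ::= N 1) Nop)) q (30 * (m + 1)) (\<lambda>q'. rv q' 30 = int k \<and> (\<forall>x. I (Suc k) (set_reg 30 x q')))"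
  if k: "k < n" and q: "I k q" "rv q 30 = int k" and neg: "T K k < 0" for k q
 proof -
  define J where "J i q' = (frame 31 {} {} q q' \<and> rv q' 31 = (if \<forall>i'<i. 0 \<le> T i' k then 1 else 0))" for i q'
  have fr: "frame 30 {xray} {} p q" using q by (simp add: I_def)
  have "mem q" using mem_frame[OF p fr] by simp
  note mq = memD[OF this]
  have fin: "wp (If (V 31) (xray ::= N 1) Nop) (\<lambda>q'. rv q' 30 = int k \<and> (\<forall>x. I (Suc k) (set_reg 30 x q'))) q'"
   if "J m q'" for q'
  proof -
   have e: "(\<forall>i<m. 0 \<le> T i k) \<longleftrightarrow> is_ray k" using neg by (simp add: is_ray_def)
   have q': "frame 31 {} {} q q'" "rv q' 31 = (if is_ray k then 1 else 0)" using that by (simp_all add: J_def e)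
   have r: "rv q' 30 = int k" using q q' by (simp add: frame_def)
   have I: "frame 30 {xray} {} p q'" "rv q' xray = (if \<exists>j<k. is_ray j then 1 else rv p xray)"
    using q q'(1) by (auto simp: I_def frame_def)
   show ?thesis
    using q'(2) r Bd_ge by (cases "is_ray k") (auto simp: I_def I less_Suc_eq)
  qed
  show ?thesis
   apply (rule spec_le, rule wp_Seq[where A = "J 0"], simp)
   apply (use Bd_ge in \<open>simp add: J_def\<close>)
   apply (rule spec_loop_Seq[where n = m and I = J])
   apply (simp_all add: nm_le)[4]
   apply (simp add: J_def; fail)
   apply (simp add: J_def frame_def mq; fail)
   apply (rule spec_blk[where T = 15])
   apply simp
   apply (use Bd_ge in \<open>auto simp: J_def frame_def less_Suc_eq mq q KM k\<close>)[1]
   apply simp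
   apply (rule wp_spec, simp)
   apply (erule fin)
   apply simp
   done
 qed
 show ?thesis
  unfolding ray_check_def
  apply (rule spec_le, rule spec_loop[where n = n and I = I])
  apply (simp_all add: nm_le)[4]
  apply (simp add: I_def; fail)
  apply (use mp in \<open>simp add: I_def frame_def; fail\<close>)
  apply (rule spec_cif)
  apply simp
  apply (rule inner, assumption, assumption, assumption)
  apply (use mp KM in \<open>simp add: I_def frame_def\<close>)
  apply (rule spec_Skip)
  apply (use mp KM in \<open>auto simp: I_def frame_def is_ray_def less_Suc_eq\<close>)[1]
  apply (simp add: I_def)
  apply (use n_pos in \<open>cases n; simp add: algebra_simps\<close>)
  done
qed

section \<open>Residues and the finite group of a basis\<close>

definition hsh :: "(nat \<Rightarrow> int) \<Rightarrow> nat \<Rightarrow> int" where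
 "hsh u i = (\<Sum>j<n. T i j * u j) mod \<delta>"

text \<open>The residues \<^term>\<open>hsh u\<close> encode the class of \<open>u\<close> modulo the lattice of the basis.\<close>

lemma hsh_row_lat:
 assumes "row_lat n h f (\<lambda>j. u j - r j)" and i: "i < M"
 shows "hsh u i = hsh r i"
proof -
 obtain z where z: "\<forall>j<n. u j - r j = dot n (h (f j)) z" using assms by (auto simp: row_lat_def)
 have "(\<Sum>j<n. T i j * u j) - (\<Sum>j<n. T i j * r j) = (\<Sum>j<n. T i j * dot n (h (f j)) z)"
  unfolding sum_subtractf[symmetric] by (intro sum.cong) (use z in \<open>auto simp: right_diff_distrib[symmetric]\<close>)
 also have "\<dots> = \<delta> * dot n (row_vec rw i) z"
  by (rule tab_row_dot[symmetric]) (use tabl i in \<open>simp add: tabl_def\<close>)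
 finally show ?thesis unfolding hsh_def by (simp add: mod_eq_dvd_iff)
qed

text \<open>Residues depend only on the lattice class, so distinct residue vectors belong to
  distinct classes, and there are at most \<bar>det\<bar> of them.\<close>

lemma hsh_card:
 assumes g: "\<And>g. g < cnt \<Longrightarrow> \<exists>u. \<forall>i<K. G g i = hsh u i"
  and dist: "\<And>g g'. g < g' \<Longrightarrow> g' < cnt \<Longrightarrow> \<exists>i<K. G g i \<noteq> G g' i"
 shows "int cnt \<le> \<delta>"
proof -
 have D: "bdet n h f \<noteq> 0" "\<delta> = \<bar>bdet n h f\<bar>" using tabl delta_pos by (auto simp: tabl_def)
 obtain R where R: "finite R" "card R \<le> nat \<bar>bdet n h f\<bar>" "\<forall>u. \<exists>r\<in>R. row_lat n h f (\<lambda>j. u j - r j)"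
  using row_lat_index[OF D(1)] by blast
 have "\<exists>r\<in>R. \<forall>i<K. G g i = hsh r i" if g': "g < cnt" for g
 proof -
  obtain u where u: "\<forall>i<K. G g i = hsh u i" using g[OF g'] by blast
  obtain r where r: "r \<in> R" "row_lat n h f (\<lambda>j. u j - r j)" using R by blast
  have "hsh u i = hsh r i" if "i < K" for i by (rule hsh_row_lat[OF r(2) KM(4)[OF that]])
  then show ?thesis using u r by (intro bexI[of _ r]) auto
 qed
 then obtain r where r: "\<And>g. g < cnt \<Longrightarrow> r g \<in> R \<and> (\<forall>i<K. G g i = hsh (r g) i)" by metis
 have "inj_on r {..<cnt}"
 proof (rule inj_onI)
  fix g g' assume gg: "g \<in> {..<cnt}" "g' \<in> {..<cnt}" "r g = r g'"
  then have "\<forall>i<K. G g i = G g' i" using r by simp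
  then show "g = g'" using dist[of g g'] dist[of g' g] gg by (metis lessThan_iff linorder_neqE_nat)
 qed
 then have "card (r ` {..<cnt}) = cnt" by (simp add: card_image)
 moreover have "card (r ` {..<cnt}) \<le> card R" using R r by (intro card_mono) auto
 ultimately show ?thesis using R D by linarith
qed

text \<open>\<open>g0\<close> and \<open>j0\<close> mark how far the subtraction table has been
  filled. \<open>G\<close> holds pairwise distinct residue vectors, with the zero element at index
  0.\<close>

definition grp :: "nat \<Rightarrow> nat \<Rightarrow> nat \<Rightarrow> (nat \<Rightarrow> nat \<Rightarrow> int) \<Rightarrow> (nat \<Rightarrow> nat \<Rightarrow> nat) \<Rightarrow> bool" where
 "grp g0 j0 cnt G S = (0 < cnt \<and> (\<forall>i<K. G 0 i = 0) \<and>
  (\<forall>g<cnt. \<exists>u. \<forall>i<K. G g i = hsh u i) \<and>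
  (\<forall>g' g. g < g' \<longrightarrow> g' < cnt \<longrightarrow> (\<exists>i<K. G g i \<noteq> G g' i)) \<and>
  (\<forall>g j. g < g0 \<and> j < n \<or> g = g0 \<and> j < j0 \<longrightarrow> S g j < cnt \<and> (\<forall>i<K. G (S g j) i = (G g i - T i j) mod \<delta>)))"

text \<open>Modulo \<delta> every \<open>u\<close> is the negative of a nonnegative vector
  \<open>w\<close>. Induction on the sum of \<open>w\<close> then reaches its class by single
  subtractions, each one a lookup in the table.\<close>

lemma grp_onto:
 assumes "grp cnt 0 cnt G S"
 shows "\<exists>g<cnt. \<forall>i<K. G g i = hsh u i"
proof -
 have *: "\<exists>g<cnt. \<forall>i<K. G g i = (- (\<Sum>j<n. T i j * int (w j))) mod \<delta>" for w :: "nat \<Rightarrow> nat"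
 proof (induction "\<Sum>j<n. w j" arbitrary: w)
  case 0
  then show ?case using assms by (auto simp: grp_def intro!: exI[of _ 0])
 next
  case (Suc k)
  have "\<exists>j<n. 0 < w j"
  proof (rule ccontr)
   assume "\<not> ?thesis"
   then have "(\<Sum>j<n. w j) = 0" by simp
   with Suc.hyps(2) show False by simp
  qed
  then obtain j where j: "j < n" "0 < w j" by blast
  define w' where "w' = w(j := w j - 1)"
  have wj: "w l = w' l + (if l = j then 1 else 0)" for l using j by (simp add: w'_def)
  have "(\<Sum>l<n. w l) = (\<Sum>l<n. w' l) + 1" unfolding wj sum.distrib using j by simp
  then obtain g where g: "g < cnt" "\<forall>i<K. G g i = (- (\<Sum>j<n. T i j * int (w' j))) mod \<delta>"
   using Suc.hyps by fastforce
  have "(\<Sum>l<n. T i l * int (w l)) = (\<Sum>l<n. T i l * int (w' l)) + T i j" for i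
  proof -
   have "(\<Sum>l<n. T i l * int (w l)) = (\<Sum>l<n. T i l * int (w' l) + (if l = j then T i l else 0))"
    by (intro sum.cong) (auto simp: wj algebra_simps)
   also have "\<dots> = (\<Sum>l<n. T i l * int (w' l)) + T i j" unfolding sum.distrib using j by simp
   finally show ?thesis .
  qed
  then have e: "- (\<Sum>l<n. T i l * int (w l)) = - (\<Sum>l<n. T i l * int (w' l)) - T i j" for i by simp
  have "G (S g j) i = (- (\<Sum>l<n. T i l * int (w l))) mod \<delta>" if "i < K" for i
  proof -
   have "G (S g j) i = (G g i - T i j) mod \<delta>" using assms g j that by (simp add: grp_def)
   also have "\<dots> = (- (\<Sum>l<n. T i l * int (w' l)) - T i j) mod \<delta>" using g that by (simp add: mod_diff_left_eq)
   finally show ?thesis unfolding e .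
  qed
  moreover have "S g j < cnt" using assms g j by (simp add: grp_def)
  ultimately show ?case by blast
 qed
 \<comment> \<open>\<open>(- u j) mod \<delta>\<close> is a nonnegative representative of
   \<open>- u j\<close>.\<close>
 have "hsh u i = (- (\<Sum>j<n. T i j * int (nat ((- u j) mod \<delta>)))) mod \<delta>" for i
 proof -
  have "(- (\<Sum>j<n. T i j * int (nat ((- u j) mod \<delta>)))) = (\<Sum>j<n. T i j * u j) - (\<Sum>j<n. T i j * (u j + (- u j) mod \<delta>))"
   using delta_pos by (simp add: distrib_left sum.distrib)
  moreover have "\<delta> dvd (\<Sum>j<n. T i j * (u j + (- u j) mod \<delta>))"
   by (intro dvd_sum dvd_mult) (simp add: mod_eq_0_iff_dvd[symmetric] mod_add_right_eq)
  ultimately show ?thesis unfolding hsh_def by (simp add: mod_eq_dvd_iff)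
 qed
 then show ?thesis using *[of "\<lambda>j. nat ((- u j) mod \<delta>)"] by simp
qed

definition grp_mem :: "state \<Rightarrow> nat \<Rightarrow> nat \<Rightarrow> nat \<Rightarrow> (nat \<Rightarrow> nat \<Rightarrow> int) \<Rightarrow> (nat \<Rightarrow> nat \<Rightarrow> nat) \<Rightarrow> bool" where
 "grp_mem q g0 j0 cnt G S = (rv q xcnt = int cnt \<and>
  (\<forall>g<cnt. \<forall>i<K. av q aG (int g * int K + int i) = G g i) \<and>
  (\<forall>g j. g < g0 \<and> j < n \<or> g = g0 \<and> j < j0 \<longrightarrow> av q aSub (int g * int n + int j) = int (S g j)))"

lemma find_elem_spec:
 assumes gl: "rv p xK = int K" and cnt: "rv p xcnt = int cnt" "int cnt \<le> Bd"
  and G: "\<forall>g<cnt. \<forall>i<K. av p aG (int g * int K + int i) = G g i" and v: "\<forall>i<K. av p aV (int i) = v i"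
 shows "spec find_elem p (30 * (cnt + 1) * (K + 1)) (\<lambda>q. frame 41 {} {} p q \<and>
  ((\<exists>e<cnt. rv q 41 = int e \<and> (\<forall>i<K. G e i = v i)) \<or> (rv q 41 = int cnt \<and> (\<forall>e<cnt. \<exists>i<K. G e i \<noteq> v i))))"
proof -
 define I where "I k q = (frame 41 {} {} p q \<and>
  ((\<exists>e<k. rv q 41 = int e \<and> (\<forall>i<K. G e i = v i)) \<or> (rv q 41 = int cnt \<and> (\<forall>e<k. \<exists>i<K. G e i \<noteq> v i))))" for k q
 have body: "spec (blk (43 ::= N 1) ;;
   loop 44 xK (blk (If (sq (Ix aG (V 42 *. V xK +. V 44) -. Ix aV (V 44))) (43 ::= N 0) Nop)) ;;
   blk (If (V 43) (41 ::= V 42 +. N 0) Nop)) q (26 * (K + 1)) (\<lambda>q'. rv q' 42 = int k \<and> (\<forall>x. I (Suc k) (set_reg 42 x q')))"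
  if k: "k < cnt" and q: "I k q" "rv q 42 = int k" for k q
 proof -
  have fr: "frame 41 {} {} p q" using q by (simp add: I_def)
  define J where "J i q' = (frame 43 {} {} q q' \<and> rv q' 43 = (if \<forall>i'<i. G k i' = v i' then 1 else 0))" for i q'
  have fin: "wp (If (V 43) (41 ::= V 42 +. N 0) Nop) (\<lambda>q'. rv q' 42 = int k \<and> (\<forall>x. I (Suc k) (set_reg 42 x q'))) q'"
   if "J K q'" for q'
  proof -
   have q': "frame 43 {} {} q q'" "rv q' 43 = (if \<forall>i'<K. G k i' = v i' then 1 else 0)" using that by (simp_all add: J_def)
   have r: "rv q' 42 = int k" "rv q' 41 = rv q 41" using q q' by (simp_all add: frame_def)
   have I: "frame 41 {} {} p q'" using fr q' by (simp add: frame_def)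
   have kb: "\<bar>int k\<bar> \<le> Bd" using k cnt by simp
   show ?thesis
    using q'(2) r kb q(1) by (auto simp: I_def I less_Suc_eq split: if_splits)
  qed
  show ?thesis
   apply (rule spec_le, rule wp_Seq[where A = "J 0"], simp)
   apply (use Bd_ge in \<open>simp add: J_def\<close>)
   apply (rule spec_loop_Seq[where n = K and I = J])
   apply (simp_all add: K_le)[4]
   apply (simp add: J_def; fail)
   apply (use fr in \<open>simp add: J_def frame_def gl; fail\<close>)
   apply (rule spec_blk[where T = 15])
   apply simp
   apply (use fr Bd_ge in \<open>auto simp: J_def frame_def less_Suc_eq q gl G v k sq_pos_iff sq_le_iff\<close>)[1]
   apply simp
   apply (rule wp_spec, simp)
   apply (erule fin)
   apply simp
   done
 qed
 show ?thesis
  unfolding find_elem_def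
  apply (rule spec_le, rule wp_Seq[where A = "I 0"], simp)
  apply (simp add: I_def cnt)
  apply (rule spec_loop[where n = cnt and I = I])
  apply (simp_all add: cnt)[4]
  apply (simp add: I_def; fail)
  apply (simp add: I_def frame_def cnt)
  apply (rule body; assumption)
  apply (simp add: I_def)
  apply (simp add: algebra_simps)
  done
qed

lemma grp_cnt: "grp g0 j0 cnt G S \<Longrightarrow> int cnt \<le> \<delta>"
 unfolding grp_def by (rule hsh_card[of cnt G]) blast+

lemma grp_repr: "grp g0 j0 cnt G S \<Longrightarrow> g < cnt \<Longrightarrow> \<exists>u. \<forall>i<K. G g i = hsh u i"
 by (simp add: grp_def)

lemma grp_G_bounds: "grp g0 j0 cnt G S \<Longrightarrow> g < cnt \<Longrightarrow> i < K \<Longrightarrow> 0 \<le> G g i \<and> G g i < \<delta>"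
proof -
 assume g: "grp g0 j0 cnt G S" "g < cnt" and i: "i < K"
 obtain u where "\<forall>i<K. G g i = hsh u i" using grp_repr[OF g] by blast
 then show ?thesis using i delta_pos by (simp add: hsh_def)
qed

lemma K_index_inj:
 assumes "i < K" "i' < K" "int g * int K + int i = int g' * int K + int i'"
 shows "g = g' \<and> i = i'"
proof -
 have "int (g * K + i) = int (g' * K + i')" using assms(3) by simp
 then have e: "g * K + i = g' * K + i'" by (simp only: of_nat_eq_iff)
 then have "(g * K + i) div K = (g' * K + i') div K" by simp
 then have "g = g'" using assms(1,2) by simp
 with e show ?thesis by simp
qed

lemma n_index_inj:
 assumes "i < n" "i' < n" "int g * int n + int i = int g' * int n + int i'"
 shows "g = g' \<and> i = i'"
proof -
 have "int (g * n + i) = int (g' * n + i')" using assms(3) by simp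
 then have e: "g * n + i = g' * n + i'" by (simp only: of_nat_eq_iff)
 then have "(g * n + i) div n = (g' * n + i') div n" by simp
 then have "g = g'" using assms(1,2) by simp
 with e show ?thesis by simp
qed

lemma group_step_spec:
 assumes p: "mem p" and g0: "rv p 30 = int g0" "g0 < cnt" and j0: "rv p 31 = int j0" "j0 < n"
  and gr: "grp g0 j0 cnt G S" and gm: "grp_mem p g0 j0 cnt G S"
 shows "spec group_step p (100 * (cnt + 1) * (K + 1)) (\<lambda>q. frame 32 {xcnt} {aV, aG, aSub} p q \<and>
  (\<exists>cnt' G S. cnt \<le> cnt' \<and> grp g0 (Suc j0) cnt' G S \<and> grp_mem q g0 (Suc j0) cnt' G S))" (is "spec _ _ _ ?P")
proof -
 note mp = memD[OF p]
 define v where "v i = (G g0 i - T i j0) mod \<delta>" for i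
 have vb: "0 \<le> v i" "v i < \<delta>" for i using delta_pos by (simp_all add: v_def)
 have cntb: "int cnt \<le> Bd" using grp_cnt[OF gr] delta_b by simp
 have G: "\<forall>g<cnt. \<forall>i<K. av p aG (int g * int K + int i) = G g i" "rv p xcnt = int cnt" using gm by (auto simp: grp_mem_def)
 define I where "I k q = (frame 32 {} {aV, aG} p q \<and> (\<forall>g<cnt. \<forall>i<K. av q aG (int g * int K + int i) = G g i) \<and>
  (\<forall>i<k. av q aV (int i) = v i \<and> av q aG (int cnt * int K + int i) = v i))" for k q
 have body: "wp (33 ::= (Ix aG (V 30 *. V xK +. V 32) -. Ix aT (V 32 *. V xn +. V 31)) mod. V xdel ;.
   Sto aV (V 32) (V 33) ;.
   Sto aG (V xcnt *. V xK +. V 32) (V 33)) (\<lambda>q'. rv q' 32 = int k \<and> (\<forall>x. I (Suc k) (set_reg 32 x q'))) q"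
  if k: "k < K" and q: "I k q" "rv q 32 = int k" for k q
 proof -
  have fr: "frame 32 {} {aV, aG} p q" using q by (simp add: I_def)
  note f = frame_reg[OF fr] frame_arr[OF fr]
  have Gq: "av q aG (int g * int K + int i) = G g i" if "g < cnt" "i < K" for g i using q that by (simp add: I_def)
  have vk: "(G g0 k - T k j0) mod \<delta> = v k" by (simp add: v_def)
  have ne: "int cnt * int K + int k \<noteq> int g * int K + int i" if "g < cnt" "i < K" for g i
   using K_index_inj[OF k that(2)] that(1) by blast
  have "\<bar>v k\<bar> \<le> Bd" using vb[of k] delta_b by simp
  then show ?thesis
   using q k fr ne ne[symmetric] vb[of k] by (auto simp: f mp g0 j0 KM G vk Gq I_def less_Suc_eq)
 qed
 have fin: "wp (If (V 41 -. V xcnt +. N 1) (xcnt ::= V xcnt +. N 1) Nop ;.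
   Sto aSub (V 30 *. V xn +. V 31) (V 41)) ?P q"
  if q0: "I K q0" and fr: "frame 41 {} {} q0 q" and
   e: "(\<exists>e<cnt. rv q 41 = int e \<and> (\<forall>i<K. G e i = v i)) \<or> (rv q 41 = int cnt \<and> (\<forall>e<cnt. \<exists>i<K. G e i \<noteq> v i))" for q0 q
 proof -
  have fr0: "frame 32 {} {aV, aG} p q" using q0 fr by (simp add: I_def frame_def)
  note f = frame_reg[OF fr0] frame_arr[OF fr0]
  have fr1: "frame 32 {xcnt} {aV, aG, aSub} p q" using fr0 by (simp add: frame_def)
  have Gq: "\<And>g i. g < cnt \<Longrightarrow> i < K \<Longrightarrow> av q aG (int g * int K + int i) = G g i"
   "\<And>i. i < K \<Longrightarrow> av q aG (int cnt * int K + int i) = v i" using q0 fr by (auto simp: I_def frame_def)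
  have S: "av p aSub (int g * int n + int j) = int (S g j)" if "g < g0 \<and> j < n \<or> g = g0 \<and> j < j0" for g j
   using gm that unfolding grp_mem_def by blast
  have Sne: "int g * int n + int j \<noteq> int g0 * int n + int j0" if "g < g0 \<and> j < n \<or> g = g0 \<and> j < j0" for g j
   using n_index_inj[of j j0 g g0] that j0 by fastforce
  obtain u where u: "\<forall>i<K. G g0 i = hsh u i" using grp_repr[OF gr g0(2)] by blast
  \<comment> \<open>The candidate is again a residue vector, namely that of \<open>u\<close> with
    coordinate \<open>j0\<close> lowered by one.\<close>
  have vu: "v i = hsh (u(j0 := u j0 - 1)) i" if "i < K" for i
  proof -
   have "(\<Sum>j<n. T i j * (u(j0 := u j0 - 1)) j) = (\<Sum>j<n. T i j * u j - (if j = j0 then T i j else 0))"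
    by (intro sum.cong) (auto simp: algebra_simps)
   also have "\<dots> = (\<Sum>j<n. T i j * u j) - T i j0" unfolding sum_subtractf using j0 by simp
   finally show ?thesis using u that by (simp add: v_def hsh_def mod_diff_left_eq)
  qed
  from e show ?thesis
  proof
   assume "\<exists>e<cnt. rv q 41 = int e \<and> (\<forall>i<K. G e i = v i)"
   then obtain e where e: "e < cnt" "rv q 41 = int e" "\<forall>i<K. G e i = v i" by blast
   define S' where "S' = (\<lambda>g j. if g = g0 \<and> j = j0 then e else S g j)"
   have "grp g0 (Suc j0) cnt G S'"
    using gr e unfolding grp_def S'_def by (auto simp: v_def less_Suc_eq)
   moreover have "grp_mem q' g0 (Suc j0) cnt G S'"
    if "q' = set_arr aSub (int g0 * int n + int j0) x q" "fst x = int e" for q' x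
    using that Gq S Sne by (auto simp: grp_mem_def S'_def f G less_Suc_eq)
   ultimately have "?P (set_arr aSub (int g0 * int n + int j0) x q)" if "fst x = int e" for x
    using that fr1 by (intro conjI exI[of _ cnt] exI[of _ G] exI[of _ S']) auto
   then show ?thesis
    using e by (auto simp: f mp G g0 j0)
  next
   assume e: "rv q 41 = int cnt \<and> (\<forall>e<cnt. \<exists>i<K. G e i \<noteq> v i)"
   define S' where "S' = (\<lambda>g j. if g = g0 \<and> j = j0 then cnt else S g j)"
   define G' where "G' = G(cnt := v)"
   have g': "grp g0 (Suc j0) (Suc cnt) G' S'"
    unfolding grp_def
   proof (intro conjI allI impI)
    show "0 < Suc cnt" by simp
    show "G' 0 i = 0" if "i < K" for i using gr that by (auto simp: grp_def G'_def)
    show "\<exists>u. \<forall>i<K. G' g i = hsh u i" if "g < Suc cnt" for g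
     using gr that vu unfolding grp_def G'_def by (auto simp: less_Suc_eq)
    show "\<exists>i<K. G' g i \<noteq> G' g' i" if "g < g'" "g' < Suc cnt" for g g'
     using gr that e unfolding grp_def G'_def by (auto simp: less_Suc_eq)
    fix g j assume gj: "g < g0 \<and> j < n \<or> g = g0 \<and> j < Suc j0"
    show "S' g j < Suc cnt" using gr gj unfolding grp_def S'_def by (auto simp: less_Suc_eq)
    show "G' (S' g j) i = (G' g i - T i j) mod \<delta>" if "i < K" for i
    proof (cases "g = g0 \<and> j = j0")
     case True then show ?thesis using g0 by (simp add: S'_def G'_def v_def)
    next
     case False
     then have "g < g0 \<and> j < n \<or> g = g0 \<and> j < j0" using gj by auto
     then have "S g j < cnt" "G (S g j) i = (G g i - T i j) mod \<delta>" "g < cnt" using gr that g0 by (auto simp: grp_def)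
     then show ?thesis using False by (auto simp: S'_def G'_def)
    qed
   qed
   \<comment> \<open>The enlarged list still consists of distinct residue vectors, so
     \<open>hsh_card\<close> bounds the new counter before it is stored.\<close>
   have cb: "int cnt + 1 \<le> Bd" using grp_cnt[OF g'] delta_b by simp
   moreover have "grp_mem q' g0 (Suc j0) (Suc cnt) G' S'"
    if "q' = set_arr aSub (int g0 * int n + int j0) x (set_reg xcnt y q)" "fst x = int cnt" "fst y = int cnt + 1" for q' x y
    using that Gq S Sne by (auto simp: grp_mem_def S'_def G'_def f G less_Suc_eq)
   ultimately have "?P (set_arr aSub (int g0 * int n + int j0) x (set_reg xcnt y q))"
    if "fst x = int cnt" "fst y = int cnt + 1" for x y
    using that fr1 g' by (intro conjI exI[of _ "Suc cnt"] exI[of _ G'] exI[of _ S']) auto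
   then show ?thesis
    using e cb by (auto simp: f mp G g0 j0)
  qed
 qed
 show ?thesis
  unfolding group_step_def
  apply (rule spec_le, rule spec_loop_Seq[where n = K and I = I])
  apply (simp_all add: K_le)[4]
  apply (simp add: I_def G; fail)
  apply (simp add: I_def frame_def mp; fail)
  apply (rule wp_spec, simp)
  apply (rule body; assumption)
  apply (rule spec_Seq_mid, rule find_elem_spec[where v = v and G = G])
  apply (simp add: I_def frame_def mp; fail)
  apply (simp add: I_def frame_def G; fail)
  apply (rule cntb)
  apply (simp add: I_def; fail)
  apply (simp add: I_def; fail)
  apply (rule wp_spec, simp)
  apply (elim conjE)
  apply (rule fin; assumption)
  apply (simp add: algebra_simps)
  done
qed

lemma grp_next: "grp g0 n cnt G S \<Longrightarrow> grp (Suc g0) 0 cnt G S"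
 unfolding grp_def less_Suc_eq by blast

lemma grp_mem_next: "grp_mem p g0 n cnt G S \<Longrightarrow> grp_mem p (Suc g0) 0 cnt G S"
 unfolding grp_mem_def less_Suc_eq by blast

lemma grp_0: "grp 0 0 1 (\<lambda>_ _. 0) S"
 by (auto simp: grp_def hsh_def intro: exI[of _ "\<lambda>_. 0"])

lemma group_spec:
 assumes p: "mem p"
 shows "spec group p (400 * n * nat \<delta> * (nat \<delta> + 1) * (K + 1)) (\<lambda>q. frame 30 {xcnt} {aV, aG, aSub} p q \<and>
  (\<exists>cnt G S. grp cnt 0 cnt G S \<and> grp_mem q cnt 0 cnt G S))" (is "spec _ _ _ ?P")
proof -
 note mp = memD[OF p]
 define dn where "dn = nat \<delta>"
 have dn: "1 \<le> dn" "int dn = \<delta>" using delta_pos by (simp_all add: dn_def)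
 define Z where "Z k q = (frame 30 {xcnt} {aG} p q \<and> rv q xcnt = 1 \<and> (\<forall>i<k. av q aG (int i) = 0))" for k :: nat and q
 define I where "I k q = (frame 30 {xcnt} {aV, aG, aSub} p q \<and> rv q 30 = int k \<and>
  (\<exists>cnt G S. k \<le> cnt \<and> grp k 0 cnt G S \<and> grp_mem q k 0 cnt G S))" for k q
 define J where "J k j q = (frame 30 {xcnt} {aV, aG, aSub} p q \<and> rv q 30 = int k \<and>
  (\<exists>cnt G S. k < cnt \<and> grp k j cnt G S \<and> grp_mem q k j cnt G S))" for k j q
 have gmr: "grp_mem (set_reg r x q) g j cnt G S = grp_mem q g j cnt G S" if "r \<noteq> xcnt" for r x q g j cnt G S
  using that by (simp add: grp_mem_def)
 have bnd: "cnt \<le> dn" if "grp g j cnt G S" for g j cnt G S using grp_cnt[OF that] dn by simp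
 have memq: "mem q" if "frame 30 {xcnt} {aV, aG, aSub} p q" for q
  using mem_frame[OF p that] by simp
 have step: "spec group_step q (100 * (dn + 1) * (K + 1)) (\<lambda>q'. rv q' 31 = int j \<and> (\<forall>x. J k (Suc j) (set_reg 31 x q')))"
  if j: "j < n" and q: "J k j q" "rv q 31 = int j" for k j q
 proof -
  have fr: "frame 30 {xcnt} {aV, aG, aSub} p q" "rv q 30 = int k" using q by (auto simp: J_def)
  obtain cnt G S where *: "k < cnt" "grp k j cnt G S" "grp_mem q k j cnt G S"
   using q(1) unfolding J_def by blast
  show ?thesis
  proof (rule spec_mono[OF group_step_spec[OF memq[OF fr(1)] fr(2) *(1) q(2) j *(2,3)]])
   show "100 * (cnt + 1) * (K + 1) \<le> 100 * (dn + 1) * (K + 1)"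
    using bnd[OF *(2)] by (intro mult_le_mono) auto
   fix q' assume q': "frame 32 {xcnt} {aV, aG, aSub} q q' \<and>
    (\<exists>cnt' G S. cnt \<le> cnt' \<and> grp k (Suc j) cnt' G S \<and> grp_mem q' k (Suc j) cnt' G S)"
   then have "frame 30 {xcnt} {aV, aG, aSub} p q'" "rv q' 30 = int k" "rv q' 31 = int j"
    using fr q by (auto simp: frame_def)
   then show "rv q' 31 = int j \<and> (\<forall>x. J k (Suc j) (set_reg 31 x q'))"
    using q' *(1) by (auto simp: J_def gmr intro: less_le_trans)
  qed
 qed
 have body: "spec (loop 31 xn group_step ;; blk (30 ::= V 30 +. N 1)) q
  (3 + n * (100 * (dn + 1) * (K + 1) + 4) + 2) (I (Suc k))"
  if q: "I k q" "0 < fst (ev q (V xcnt -. V 30))" for k q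
 proof -
  have J0: "J k 0 q"
  proof -
   obtain cnt G S where *: "frame 30 {xcnt} {aV, aG, aSub} p q" "rv q 30 = int k"
    "grp k 0 cnt G S" "grp_mem q k 0 cnt G S" using q(1) unfolding I_def by blast
   have "k < cnt" using q(2) * by (simp add: grp_mem_def)
   then show ?thesis using * unfolding J_def by blast
  qed
  show ?thesis
    apply (rule spec_loop_Seq[where n = n and I = "J k"])
       apply (simp_all add: nm_le)[4]
     apply (use J0 in \<open>simp add: J_def gmr\<close>)
     apply (simp add: J_def frame_def mp)
    apply (rule step; assumption)
   apply (rule spec_blk)
   apply simp
   subgoal for q'
   proof -
    assume "J k n q'"
    then obtain cnt G S where *: "frame 30 {xcnt} {aV, aG, aSub} p q'" "rv q' 30 = int k" "k < cnt"
     "grp k n cnt G S" "grp_mem q' k n cnt G S" by (auto simp: J_def)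
    have "int k + 1 \<le> Bd" using *(3) grp_cnt[OF *(4)] delta_b by linarith
    moreover have "I (Suc k) (set_reg 30 x q')" if "fst x = int k + 1" for x
     unfolding I_def
    proof (intro conjI exI)
     show "Suc k \<le> cnt" using *(3) by simp
     show "grp (Suc k) 0 cnt G S" by (rule grp_next[OF *(4)])
     show "grp_mem (set_reg 30 x q') (Suc k) 0 cnt G S" using grp_mem_next[OF *(5)] by (simp add: gmr)
    qed (use * that in simp_all)
    ultimately show ?thesis using *(2) by simp
   qed
   apply simp
   done
 qed
 have cost: "pcost (xcnt ::= N 1) + (3 + K * (10 + 4) + (pcost (30 ::= N 0) +
   (cost (V xcnt -. V 30) + 1 + dn * (3 + n * (100 * (dn + 1) * (K + 1) + 4) + 2 + cost (V xcnt -. V 30) + 1))))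
  \<le> 400 * n * dn * (dn + 1) * (K + 1)"
 proof -
  define Y where "Y = n * dn * (dn + 1) * (K + 1)"
  have 1: "1 \<le> n * dn" "1 \<le> n * (dn + 1)" using n_pos dn by simp_all
  have "1 * 1 * (K + 1) \<le> (n * dn) * (dn + 1) * (K + 1)" using 1 by (intro mult_le_mono) auto
  then have a: "K + 1 \<le> Y" by (simp add: Y_def)
  have "n * dn \<le> n * dn * ((dn + 1) * (K + 1))" by simp
  then have b: "n * dn \<le> Y" unfolding Y_def mult.assoc .
  have c: "dn \<le> Y"
  proof -
   have "dn \<le> n * dn" using n_pos by simp
   with b show ?thesis by linarith
  qed
  have "dn * (n * (100 * (dn + 1) * (K + 1))) = 100 * Y" by (simp only: Y_def mult_ac)
  moreover have "dn * (3 + n * (100 * (dn + 1) * (K + 1) + 4) + 2 + 1 + 1) = 7 * dn + dn * (n * (100 * (dn + 1) * (K + 1))) + 4 * (n * dn)"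
   by (simp add: algebra_simps)
  moreover have "400 * n * dn * (dn + 1) * (K + 1) = 400 * Y" by (simp add: Y_def mult.assoc)
  ultimately show ?thesis using a b c by simp
 qed
 show ?thesis
  unfolding group_def dn_def[symmetric]
  apply (rule spec_le[OF _ cost], rule wp_Seq[where A = "Z 0"], simp)
  apply (use Bd_ge in \<open>simp add: Z_def\<close>)
  apply (rule spec_loop_Seq[where n = K and I = Z])
  apply (simp_all add: K_le)[4]
  apply (simp add: Z_def; fail)
  apply (simp add: Z_def frame_def mp; fail)
  apply (rule spec_blk)
  apply simp
  apply (use Bd_ge in \<open>auto simp: Z_def less_Suc_eq\<close>)[1]
  apply simp
  apply (rule wp_Seq[where A = "I 0"], simp)
  subgoal for q1 q2
  proof -
   assume "Z K q2"
   then show ?thesis using Bd_ge grp_0 unfolding I_def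
    by (auto simp: Z_def gmr intro!: exI[of _ "1::nat"] exI[of _ "\<lambda>_ _. 0"]) (auto simp: grp_mem_def frame_def)
  qed
  \<comment> \<open>The list grows while it is traversed; the number of rounds is nevertheless at
    most \<delta>, because its length never exceeds \<delta>.\<close>
  apply (rule spec_whl[where I = I and n = dn])
  apply simp
  apply assumption
  apply (rule conjI)
  apply (use bnd in \<open>fastforce simp: I_def grp_mem_def\<close>)
  apply (rule body; assumption)
  subgoal for q1 q2 q3 k q
  proof -
   assume "I k q" "fst (ev q (V xcnt -. V 30)) \<le> 0"
   then show ?thesis by (fastforce simp: I_def grp_mem_def)
  qed
  done
qed

end

section \<open>The dynamic program\<close>

text \<open>A state number consists of a group index, the remainder modulo \<open>xcnt\<close>, and
  of m digits in base \<open>xW\<close> above it.\<close>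

definition decode :: com where
 "decode =
  blk (32 ::= V 31 mod. V xcnt ;. 50 ::= V 31 div. V xcnt) ;;
  loop 51 xm (blk (Sto aA (V 51) (V 50 mod. V xW) ;. 50 ::= V 50 div. V xW))"

text \<open>Horner's scheme from the top digit. Register 53 becomes 0 once a digit is out of range,
  which means that no such state exists.\<close>

definition encode :: com where
 "encode =
  blk (52 ::= N 0 ;. 53 ::= N 1) ;;
  loop 54 xm (blk (
   55 ::= Ix aA (V xm -. N 1 -. V 54) ;.
   If (V 53)
    (If (V 55 +. N 1)
     (If (V xW -. V 55) (52 ::= V 52 *. V xW +. V 55) (53 ::= N 0))
     (53 ::= N 0))
    Nop)) ;;
  blk (52 ::= V 52 *. V xcnt +. V 32)"

abbreviation (input) dp_take :: prog where
 "dp_take \<equiv> 34 ::= V 33 +. N 0 ;. 35 ::= V 56 +. N 0 ;. 36 ::= V 52 +. N 0"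

text \<open>States pull from their predecessors. Register 32 and \<open>aA\<close> describe the
  predecessor for the slack value in register 33; shifting it by one more column prepares the next
  slack value without decoding again. Registers 34, 35 and 36 hold the best slack value, its cost
  and its predecessor.\<close>

definition dp_pull :: com where
 "dp_pull =
  encode ;;
  blk (If (V 53)
   (If (Ix aY (V 30 *. V xS +. V 52) +. N 1)
    (56 ::= Ix aF (V 30 *. V xS +. V 52) +. V 33 *. Ix aT (V xK *. V xn +. V 30) ;.
     If (N 0 -. V 34) dp_take (If (V 35 -. V 56) dp_take Nop))
    Nop)
   Nop) ;;
  blk (32 ::= Ix aSub (V 32 *. V xn +. V 30)) ;;
  loop 54 xm (blk (Sto aA (V 54) (Ix aA (V 54) -. Ix aT (V 54 *. V xn +. V 30))))"

definition dp_cell :: com where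
 "dp_cell =
  decode ;;
  blk (34 ::= N (-1) ;. 35 ::= N 0 ;. 36 ::= N 0) ;;
  loop 33 xD dp_pull ;;
  blk (Sto aY ((V 30 +. N 1) *. V xS +. V 31) (V 34) ;.
   Sto aF ((V 30 +. N 1) *. V xS +. V 31) (V 35) ;.
   Sto aP ((V 30 +. N 1) *. V xS +. V 31) (V 36))"

text \<open>Before any slack is chosen exactly one state is reachable: the neutral group element
  with all forms equal to zero, that is, with digits \<open>aoff\<close>.\<close>

definition dp_init :: com where
 "dp_init =
  loop 30 xS (blk (Sto aY (V 30) (N (-1)))) ;;
  loop 30 xm (blk (Sto aA (V 30) (Ix aoff (V 30)))) ;;
  blk (32 ::= N 0) ;;
  encode ;;
  blk (Sto aY (V 52) (N 0) ;. Sto aF (V 52) (N 0))"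

definition dp :: com where
 "dp = dp_init ;; loop 30 xn (loop 31 xS dp_cell)"

text \<open>Slacks are at most \<open>D - 1\<close> and entries at most \<open>D\<close>, so a form
  ranges over an interval of length at most \<open>(D - 1) * n * D\<close>. Adding
  \<open>off\<close>, the negative of its least possible value, turns it into a digit in base
  \<open>Wd\<close>.\<close>

locale dp_tables = basis +
 fixes D cnt :: nat and G :: "nat \<Rightarrow> nat \<Rightarrow> int" and Sb :: "nat \<Rightarrow> nat \<Rightarrow> nat" and Wd S :: nat and off :: "nat \<Rightarrow> int"
 assumes D_pos: "1 \<le> D" and T_le_D: "\<And>i j. i < m \<Longrightarrow> j < n \<Longrightarrow> \<bar>T i j\<bar> \<le> int D"
  and grp: "grp cnt 0 cnt G Sb"
  and Wd_eq: "Wd = (D - 1) * n * D + 1" and S_eq: "S = cnt * Wd ^ m"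
  and off_eq: "\<And>i. off i = (int D - 1) * (\<Sum>j<n. max 0 (- T i j))"
  and S_le: "int S \<le> Bd" and WD_le: "int Wd + int D * int D \<le> Bd" and F_le: "int n * (int D * TB) \<le> Bd"
  and TB_nonneg: "0 \<le> TB"
begin

definition dgt :: "nat \<Rightarrow> nat \<Rightarrow> int" where
 "dgt x i = int (x div cnt div Wd ^ i mod Wd)"

definition pmem :: "state \<Rightarrow> bool" where
 "pmem p = (mem p \<and> rv p xD = int D \<and> rv p xW = int Wd \<and> rv p xS = int S \<and> grp_mem p cnt 0 cnt G Sb \<and>
  (\<forall>i<m. av p aoff (int i) = off i))"

lemma pmem_frame: "pmem p \<Longrightarrow> frame l X Y p q \<Longrightarrow> 22 \<le> l \<Longrightarrow>
  X \<inter> {xn, xm, xs, xK, xM, xMn, xd, xdel, xD, xcnt, xW, xS} = {} \<Longrightarrow>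
  Y \<inter> {aT, acol, arow, aG, aSub, aoff} = {} \<Longrightarrow> pmem q"
 by (simp add: pmem_def mem_def glob_def tab_mem_def frame_def grp_mem_def)

lemma pmemD:
 assumes "pmem p"
 shows "rv p xn = int n" "rv p xm = int m" "rv p xK = int K" "rv p xdel = \<delta>" "rv p xD = int D" "rv p xW = int Wd"
  "rv p xS = int S" "rv p xcnt = int cnt"
  "\<And>j. j < n \<Longrightarrow> av p acol (int j) = int (f j)" "\<And>i. i < m \<Longrightarrow> av p arow (int i) = int (rw i)"
  "\<And>i j. i < M \<Longrightarrow> j < n \<Longrightarrow> av p aT (int i * int n + int j) = T i j"
  "\<And>g j. g < cnt \<Longrightarrow> j < n \<Longrightarrow> av p aSub (int g * int n + int j) = int (Sb g j)"
  "\<And>i. i < m \<Longrightarrow> av p aoff (int i) = off i"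
 using assms memD[of p] by (simp_all add: pmem_def grp_mem_def)

lemma pos: "0 < cnt" "0 < Wd" "0 < S"
 using grp Wd_eq by (auto simp: grp_def S_eq)

lemma bounds: "int Wd \<le> Bd" "int cnt \<le> Bd" "int D \<le> Bd"
proof -
 have "0 \<le> int D * int D" by simp
 then show "int Wd \<le> Bd" using WD_le by linarith
 show "int cnt \<le> Bd" using grp_cnt[OF grp] delta_b by linarith
 have "1 * int D \<le> int D * int D" using D_pos by (intro mult_right_mono) auto
 then show "int D \<le> Bd" using WD_le by linarith
qed

lemma nat_le_Bd: "x \<le> S \<Longrightarrow> int x \<le> Bd"
 using S_le by linarith

lemma pow_le: "k \<le> m \<Longrightarrow> Wd ^ k \<le> S"
proof -
 assume "k \<le> m"
 then have "Wd ^ k \<le> Wd ^ m" using pos by (intro power_increasing) auto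
 also have "\<dots> \<le> S" using pos by (simp add: S_eq)
 finally show ?thesis .
qed

lemma decode_spec:
 assumes p: "pmem p" and x: "rv p 31 = int x" "x < S"
 shows "spec decode p (30 * (m + 1)) (\<lambda>q. frame 50 {32} {aA} p q \<and> rv q 32 = int (x mod cnt) \<and>
  (\<forall>i<m. av q aA (int i) = dgt x i))"
proof -
 note mp = pmemD[OF p]
 define I where "I k q = (frame 50 {32} {aA} p q \<and> rv q 32 = int (x mod cnt) \<and>
  rv q 50 = int (x div cnt div Wd ^ k) \<and> (\<forall>i<k. av q aA (int i) = dgt x i))" for k q
 have b: "int (x mod cnt) \<le> Bd" "int (x div cnt) \<le> Bd" "int (x div cnt div Wd ^ k) \<le> Bd" "int (x div cnt div Wd ^ k mod Wd) \<le> Bd" for k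
 proof -
  show "int (x mod cnt) \<le> Bd" using x by (intro nat_le_Bd) (meson mod_less_eq_dividend order_trans less_imp_le)
  have d: "x div cnt div Wd ^ k \<le> S" for k using x by (meson div_le_dividend order_trans less_imp_le)
  show "int (x div cnt) \<le> Bd" using d[of 0] by (intro nat_le_Bd) simp
  show "int (x div cnt div Wd ^ k) \<le> Bd" using d by (intro nat_le_Bd)
  show "int (x div cnt div Wd ^ k mod Wd) \<le> Bd" by (rule nat_le_Bd) (meson d mod_less_eq_dividend order_trans)
 qed
 have bi: "int x mod int cnt = int (x mod cnt)" "int x div int cnt = int (x div cnt)" by (simp_all add: zmod_int zdiv_int)
 have ws: "x div cnt div Wd ^ Suc k = x div cnt div Wd ^ k div Wd" for k
  by (simp only: power_Suc2 div_mult2_eq)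
 have ws2: "x div cnt div (Wd ^ k * Wd) = x div cnt div Wd ^ k div Wd" for k
  by (simp only: div_mult2_eq)
 show ?thesis
  unfolding decode_def
  apply (rule spec_le, rule wp_Seq[where A = "I 0"], simp)
  apply (use b in \<open>simp add: I_def x mp bi del: of_nat_mod of_nat_div\<close>)
  apply (rule spec_loop[where n = m and I = I])
  apply (simp_all add: nm_le)[4]
  apply (simp add: I_def; fail)
  apply (simp add: I_def frame_def mp; fail)
  apply (rule spec_blk[where T = 20])
  apply simp
  subgoal for p' k q
   using b(3)[of "Suc k"] b(4)[of k] unfolding ws
   by (auto simp: I_def frame_def mp less_Suc_eq dgt_def zdiv_int[symmetric] zmod_int[symmetric] ws ws2 simp del: of_nat_mod of_nat_div power_Suc power_Suc2 div_mult2_eq)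
  apply simp
  apply (simp add: I_def)
  apply simp
  done
qed

section \<open>Positional encoding of the states\<close>

fun horner :: "(nat \<Rightarrow> nat) \<Rightarrow> nat \<Rightarrow> nat" where
 "horner A 0 = 0"
| "horner A (Suc k) = horner A k * Wd + A (m - 1 - k)"

lemma horner_lt: "\<forall>t<k. A (m - 1 - t) < Wd \<Longrightarrow> horner A k < Wd ^ k"
proof (induction k)
 case (Suc k)
 then have "horner A k * Wd + A (m - 1 - k) < Suc (horner A k) * Wd" by simp
 also have "\<dots> \<le> Wd ^ k * Wd" using Suc by (intro mult_le_mono1) (simp add: Suc_le_eq)
 finally show ?case by (simp add: mult.commute)
qed simp

lemma horner_digit:
 "\<forall>t<k. A (m - 1 - t) < Wd \<Longrightarrow> k \<le> m \<Longrightarrow> t < k \<Longrightarrow> horner A k div Wd ^ t mod Wd = A (m - k + t)"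
proof (induction k arbitrary: t)
 case (Suc k)
 show ?case
 proof (cases t)
  case 0
  have "A (m - 1 - k) < Wd" using Suc.prems by simp
  with 0 show ?thesis using Suc.prems by simp
 next
  case (Suc t')
  have "A (m - 1 - k) < Wd" using Suc.prems by simp
  then have "horner A (Suc k) div Wd = horner A k" using pos by simp
  then have "horner A (Suc k) div Wd ^ t = horner A k div Wd ^ t'"
   using Suc by (simp add: div_mult2_eq del: horner.simps)
  also have "\<dots> mod Wd = A (m - k + t')" using Suc.IH[of t'] Suc.prems Suc by simp
  also have "m - k + t' = m - Suc k + t" using Suc Suc.prems by simp
  finally show ?thesis .
 qed
qed simp

lemma encode_spec:
 assumes p: "pmem p" and g: "rv p 32 = int g" "g < cnt" and A: "\<forall>i<m. av p aA (int i) = A i"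
 shows "spec encode p (40 * (m + 1)) (\<lambda>q. frame 52 {} {} p q \<and>
  (if \<forall>i<m. 0 \<le> A i \<and> A i < int Wd then rv q 53 = 1 \<and>
    (\<exists>e<S. rv q 52 = int e \<and> e mod cnt = g \<and> (\<forall>i<m. dgt e i = A i))
   else rv q 53 = 0))"
proof -
 note mp = pmemD[OF p]
 define ok where "ok k = ((\<forall>t<k. 0 \<le> A (m - 1 - t) \<and> A (m - 1 - t) < int Wd))" for k
 define A' where "A' i = nat (A i)" for i
 \<comment> \<open>Register 52 stays below \<open>Wd ^ k\<close> even after a digit has failed, so
   all intermediate numbers remain bounded; only its meaning depends on \<open>ok\<close>.\<close>
 define I where "I k q = (frame 52 {} {} p q \<and> (\<exists>e<Wd ^ k. rv q 52 = int e \<and> (ok k \<longrightarrow> e = horner A' k)) \<and>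
  rv q 53 = (if ok k then 1 else 0))" for k q
 have okS: "ok (Suc k) \<longleftrightarrow> ok k \<and> 0 \<le> A (m - 1 - k) \<and> A (m - 1 - k) < int Wd" for k by (auto simp: ok_def less_Suc_eq)
 have okm: "ok m \<longleftrightarrow> (\<forall>i<m. 0 \<le> A i \<and> A i < int Wd)"
 proof
  assume o: "ok m"
  show "\<forall>i<m. 0 \<le> A i \<and> A i < int Wd"
  proof (intro allI impI)
   fix i assume "i < m"
   then have "m - 1 - i < m" "m - 1 - (m - 1 - i) = i" by auto
   then show "0 \<le> A i \<and> A i < int Wd" using o unfolding ok_def by metis
  qed
 qed (auto simp: ok_def)
 have hl: "horner A' k < Wd ^ k" if "ok k" for k
  using that by (intro horner_lt) (auto simp: ok_def A'_def)
 have step: "wp (55 ::= Ix aA (V xm -. N 1 -. V 54) ;.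
   If (V 53)
    (If (V 55 +. N 1)
     (If (V xW -. V 55) (52 ::= V 52 *. V xW +. V 55) (53 ::= N 0))
     (53 ::= N 0))
    Nop) (\<lambda>q'. rv q' 54 = int k \<and> (\<forall>x. I (Suc k) (set_reg 54 x q'))) q"
  if k: "k < m" and q: "I k q" "rv q 54 = int k" for k q
 proof -
  have fr: "frame 52 {} {} p q" using q by (simp add: I_def)
  note f = frame_reg[OF fr] frame_arr[OF fr]
  obtain e where e: "e < Wd ^ k" "rv q 52 = int e" "ok k \<longrightarrow> e = horner A' k" using q by (auto simp: I_def)
  have ix: "av p aA (int m - 1 - int k) = A (m - 1 - k)"
   
  proof -
   have "int (m - 1 - k) = int m - 1 - int k" using k by simp
   moreover have "m - 1 - k < m" using k by simp
   ultimately show ?thesis using A by metis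
  qed
  have e': "e < Wd ^ Suc k"
  proof -
   have "Wd ^ k \<le> Wd ^ Suc k" using pos by (intro power_increasing) auto
   with e show ?thesis by linarith
  qed
  show ?thesis
  proof (cases "ok (Suc k)")
   case True
   then have o: "ok k" "0 \<le> A (m - 1 - k)" "A (m - 1 - k) < int Wd" using okS by auto
   have eq: "int e * int Wd + A (m - 1 - k) = int (horner A' (Suc k))" using o e by (simp add: A'_def)
   have h: "horner A' (Suc k) < Wd ^ Suc k" by (rule hl[OF True])
   then have "int (horner A' (Suc k)) \<le> Bd" using pow_le[of "Suc k"] k by (intro nat_le_Bd) linarith
   then show ?thesis
    using q o e h eq fr True by (simp add: f mp ix I_def del: horner.simps power_Suc)
  next
   case False
   then have "\<not> ok k \<or> \<not> (0 \<le> A (m - 1 - k) \<and> A (m - 1 - k) < int Wd)" using okS by blast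
   then show ?thesis
    using q e e' fr False Bd_ge by (cases "ok k") (auto simp: f mp ix I_def simp del: power_Suc)
  qed
 qed
 have fin: "wp (52 ::= V 52 *. V xcnt +. V 32) (\<lambda>q. frame 52 {} {} p q \<and>
  (if \<forall>i<m. 0 \<le> A i \<and> A i < int Wd then rv q 53 = 1 \<and>
    (\<exists>e<S. rv q 52 = int e \<and> e mod cnt = g \<and> (\<forall>i<m. dgt e i = A i))
   else rv q 53 = 0)) q" if q: "I m q" for q
 proof -
  have fr: "frame 52 {} {} p q" using q by (simp add: I_def)
  note f = frame_reg[OF fr] frame_arr[OF fr]
  obtain e where e: "e < Wd ^ m" "rv q 52 = int e" "ok m \<longrightarrow> e = horner A' m" "rv q 53 = (if ok m then 1 else 0)"
   using q by (auto simp: I_def)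
  have "e * cnt + g < Suc e * cnt" using g by simp
  also have "\<dots> \<le> Wd ^ m * cnt" using e by (intro mult_le_mono1) simp
  finally have lt: "e * cnt + g < S" by (simp add: S_eq mult.commute)
  then have b: "int (e * cnt + g) \<le> Bd" by (intro nat_le_Bd) simp
  have d: "dgt (e * cnt + g) i = A i" if "i < m" "ok m" for i
  proof -
   have "(e * cnt + g) div cnt = e" using g by simp
   then have "dgt (e * cnt + g) i = int (horner A' m div Wd ^ i mod Wd)" using e that by (simp add: dgt_def)
   also have "horner A' m div Wd ^ i mod Wd = A' (m - m + i)"
    by (rule horner_digit) (use that in \<open>auto simp: ok_def A'_def\<close>)
   also have "int \<dots> = A i" using that okm by (simp add: A'_def)
   finally show ?thesis .
  qed
  have md: "(e * cnt + g) mod cnt = g" using g by simp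
  show ?thesis
   using e b fr lt d md by (auto simp: f mp g okm[symmetric] intro!: exI[of _ "e * cnt + g"])
 qed
 show ?thesis
  unfolding encode_def
  apply (rule spec_le, rule wp_Seq[where A = "I 0"], simp)
  apply (use Bd_ge in \<open>simp add: I_def ok_def\<close>)
  apply (rule spec_loop_Seq[where n = m and I = I])
  apply (simp_all add: nm_le)[4]
  apply (simp add: I_def; fail)
  apply (simp add: I_def frame_def mp; fail)
  apply (rule spec_blk[where T = 25])
  apply simp
  apply (rule step; assumption)
  apply simp
  apply (rule wp_spec, simp)
  apply (erule fin)
  apply simp
  done
qed

lemma digits_unique:
 "x < Wd ^ k \<Longrightarrow> y < Wd ^ k \<Longrightarrow> (\<And>i. i < k \<Longrightarrow> x div Wd ^ i mod Wd = y div Wd ^ i mod Wd) \<Longrightarrow> x = y"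
proof (induction k arbitrary: x y)
 case (Suc k)
 have "x div Wd = y div Wd"
 proof (rule Suc.IH)
  show "x div Wd < Wd ^ k" "y div Wd < Wd ^ k" using Suc.prems(1,2) by (simp_all add: less_mult_imp_div_less mult.commute)
  show "x div Wd div Wd ^ i mod Wd = y div Wd div Wd ^ i mod Wd" if "i < k" for i
   using Suc.prems(3)[of "Suc i"] that by (simp add: div_mult2_eq)
 qed
 moreover have "x mod Wd = y mod Wd" using Suc.prems(3)[of 0] by simp
 ultimately show ?case by (metis div_mult_mod_eq)
qed simp

lemma state_unique:
 assumes "x < S" "y < S" "\<And>i. i < K \<Longrightarrow> G (x mod cnt) i = G (y mod cnt) i" "\<And>i. i < m \<Longrightarrow> dgt x i = dgt y i"
 shows "x = y"
proof -
 have lt: "x mod cnt < cnt" "y mod cnt < cnt" using pos by simp_all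
 have dist: "\<exists>i<K. G g i \<noteq> G g' i" if "g < g'" "g' < cnt" for g g' using grp that by (simp add: grp_def)
 have "x mod cnt = y mod cnt"
  using dist[of "x mod cnt" "y mod cnt"] dist[of "y mod cnt" "x mod cnt"] lt assms(3)
  by (metis linorder_neqE_nat)
 moreover have "x div cnt = y div cnt"
 proof (rule digits_unique[of _ m])
  show "x div cnt < Wd ^ m" "y div cnt < Wd ^ m"
   using assms(1,2) by (simp_all add: S_eq less_mult_imp_div_less mult.commute)
  show "x div cnt div Wd ^ i mod Wd = y div cnt div Wd ^ i mod Wd" if "i < m" for i
   using assms(4)[OF that] unfolding dgt_def of_nat_eq_iff .
 qed
 ultimately show ?thesis by (metis div_mult_mod_eq)
qed

text \<open>\<open>e\<close> leads to \<open>x\<close> when slack \<open>j\<close> takes the value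
  \<open>y\<close>. Stating this by residues and digits rather than by codes keeps arithmetic on
  codes out of the recurrence; \<open>state_unique\<close> makes \<open>e\<close> unique.\<close>

definition pr :: "nat \<Rightarrow> nat \<Rightarrow> nat \<Rightarrow> nat \<Rightarrow> bool" where
 "pr j x y e = (e < S \<and> (\<forall>i<K. G (e mod cnt) i = (G (x mod cnt) i - int y * T i j) mod \<delta>) \<and>
  (\<forall>i<m. dgt e i = dgt x i - int y * T i j))"

lemma pr_unique: "pr j x y e \<Longrightarrow> pr j x y e' \<Longrightarrow> e = e'"
 by (rule state_unique) (auto simp: pr_def)

definition Yv :: "state \<Rightarrow> nat \<Rightarrow> nat \<Rightarrow> int" where "Yv p j x = av p aY (int j * int S + int x)"
definition Fv :: "state \<Rightarrow> nat \<Rightarrow> nat \<Rightarrow> int" where "Fv p j x = av p aF (int j * int S + int x)"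
definition Pv :: "state \<Rightarrow> nat \<Rightarrow> nat \<Rightarrow> int" where "Pv p j x = av p aP (int j * int S + int x)"

section \<open>The recurrence and its minima\<close>

definition best :: "state \<Rightarrow> nat \<Rightarrow> nat \<Rightarrow> nat \<Rightarrow> int \<Rightarrow> int \<Rightarrow> int \<Rightarrow> bool" where
 "best p j x k y0 f0 e0 \<longleftrightarrow>
  (y0 = -1 \<and> (\<forall>y<k. \<forall>e. pr j x y e \<longrightarrow> Yv p j e < 0)) \<or>
  ((\<exists>y<k. \<exists>e. y0 = int y \<and> e0 = int e \<and> pr j x y e \<and> 0 \<le> Yv p j e \<and> f0 = Fv p j e + int y * T K j) \<and>
   (\<forall>y<k. \<forall>e. pr j x y e \<longrightarrow> 0 \<le> Yv p j e \<longrightarrow> f0 \<le> Fv p j e + int y * T K j))"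

lemma best_skip: "best p j x k y0 f0 e0 \<Longrightarrow> (\<And>e. pr j x k e \<Longrightarrow> Yv p j e < 0) \<Longrightarrow> best p j x (Suc k) y0 f0 e0"
 unfolding best_def less_Suc_eq by (metis not_less)

lemma best_take:
 assumes "best p j x k y0 f0 e0" "pr j x k e" "0 \<le> Yv p j e" "y0 < 0 \<or> Fv p j e + int k * T K j < f0"
 shows "best p j x (Suc k) (int k) (Fv p j e + int k * T K j) (int e)"
proof -
 have "Fv p j e + int k * T K j \<le> Fv p j e' + int y * T K j"
  if "y < Suc k" "pr j x y e'" "0 \<le> Yv p j e'" for y e'
 proof (cases "y = k")
  case True then show ?thesis using pr_unique[OF assms(2)] that by simp
 next
  case False
  then have y: "y < k" using that by simp
  show ?thesis
  proof (cases "y0 = -1")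
   case True
   then have "\<forall>y<k. \<forall>e. pr j x y e \<longrightarrow> Yv p j e < 0" using assms(1) by (auto simp: best_def)
   with y that show ?thesis by fastforce
  next
   case False
   then have "0 \<le> y0" "\<forall>y<k. \<forall>e. pr j x y e \<longrightarrow> 0 \<le> Yv p j e \<longrightarrow> f0 \<le> Fv p j e + int y * T K j"
    using assms(1) by (auto simp: best_def)
   with y that assms(4) show ?thesis by fastforce
  qed
 qed
 then show ?thesis using assms(2,3) unfolding best_def by blast
qed

lemma best_keep:
 assumes "best p j x k y0 f0 e0" "pr j x k e" "0 \<le> y0" "f0 \<le> Fv p j e + int k * T K j"
 shows "best p j x (Suc k) y0 f0 e0"
proof -
 have b: "\<exists>y<k. \<exists>e. y0 = int y \<and> e0 = int e \<and> pr j x y e \<and> 0 \<le> Yv p j e \<and> f0 = Fv p j e + int y * T K j"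
   "\<forall>y<k. \<forall>e. pr j x y e \<longrightarrow> 0 \<le> Yv p j e \<longrightarrow> f0 \<le> Fv p j e + int y * T K j"
  using assms(1,3) by (auto simp: best_def)
 have "f0 \<le> Fv p j e' + int k * T K j" if "pr j x k e'" for e'
  using pr_unique[OF assms(2) that] assms(4) by simp
 then show ?thesis using b unfolding best_def less_Suc_eq by blast
qed

definition pull_inv :: "state \<Rightarrow> nat \<Rightarrow> nat \<Rightarrow> nat \<Rightarrow> state \<Rightarrow> bool" where
 "pull_inv p j x k q = (frame 33 {32} {aA} p q \<and>
  (\<exists>g<cnt. rv q 32 = int g \<and> (\<forall>i<K. G g i = (G (x mod cnt) i - int k * T i j) mod \<delta>)) \<and>
  (\<forall>i<m. av q aA (int i) = dgt x i - int k * T i j) \<and> best p j x k (rv q 34) (rv q 35) (rv q 36))"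

lemma dp_pull_spec:
 assumes p: "pmem p" and j: "rv p 30 = int j" "j < n" and x: "x < S" and k: "k < D"
  and Fb: "\<And>e. e < S \<Longrightarrow> 0 \<le> Yv p j e \<Longrightarrow> \<bar>Fv p j e\<bar> \<le> int j * (int D * TB)"
  and q: "pull_inv p j x k q" "rv q 33 = int k"
 shows "spec dp_pull q (120 * (m + 1)) (\<lambda>q'. rv q' 33 = int k \<and> (\<forall>x'. pull_inv p j x (Suc k) (set_reg 33 x' q')))"
proof -
 note mp = pmemD[OF p]
 have fr: "frame 33 {32} {aA} p q" using q by (simp add: pull_inv_def)
 note f = frame_reg[OF fr] frame_arr[OF fr]
 have pq: "pmem q" using pmem_frame[OF p fr] by simp
 obtain g where g: "g < cnt" "rv q 32 = int g" "\<forall>i<K. G g i = (G (x mod cnt) i - int k * T i j) mod \<delta>"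
  using q by (auto simp: pull_inv_def)
 define A where "A i = dgt x i - int k * T i j" for i
 have A: "\<forall>i<m. av q aA (int i) = A i" using q by (simp add: pull_inv_def A_def)
 define EQ where "EQ q1 = (frame 52 {} {} q q1 \<and>
  (if \<forall>i<m. 0 \<le> A i \<and> A i < int Wd then rv q1 53 = 1 \<and>
    (\<exists>e<S. rv q1 52 = int e \<and> e mod cnt = g \<and> (\<forall>i<m. dgt e i = A i))
   else rv q1 53 = 0))" for q1
 define BQ where "BQ q2 = (frame 34 {} {} q q2 \<and> best p j x (Suc k) (rv q2 34) (rv q2 35) (rv q2 36))" for q2
 define DQ where "DQ i0 q2 = (frame 34 {32} {aA} q q2 \<and> best p j x (Suc k) (rv q2 34) (rv q2 35) (rv q2 36) \<and>
  rv q2 32 = int (Sb g j) \<and> (\<forall>i<m. av q2 aA (int i) = (if i < i0 then A i - T i j else A i)))" for i0 q2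
 have upd: "wp (If (V 53)
   (If (Ix aY (V 30 *. V xS +. V 52) +. N 1)
    (56 ::= Ix aF (V 30 *. V xS +. V 52) +. V 33 *. Ix aT (V xK *. V xn +. V 30) ;.
     If (N 0 -. V 34) dp_take (If (V 35 -. V 56) dp_take Nop))
    Nop)
   Nop) BQ q1" if q1: "EQ q1" for q1
 proof -
  have fr1: "frame 52 {} {} q q1" using q1 by (simp add: EQ_def)
  note f1 = frame_reg[OF fr1] frame_arr[OF fr1]
  have bq: "best p j x k (rv q 34) (rv q 35) (rv q 36)" using q by (simp add: pull_inv_def)
  have fq: "frame 34 {} {} q q1" using fr1 by (simp add: frame_def)
  show ?thesis
  proof (cases "\<forall>i<m. 0 \<le> A i \<and> A i < int Wd")
   case False
   then have 53: "rv q1 53 = 0" using q1 by (simp add: EQ_def)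
   \<comment> \<open>Digits of a state are always in range, so an out-of-range digit excludes every
     predecessor.\<close>
   have "\<not> pr j x k e" for e
   proof
    assume "pr j x k e"
    then have "\<forall>i<m. dgt e i = A i" by (simp add: pr_def A_def)
    then have "\<forall>i<m. 0 \<le> A i \<and> A i < int Wd" using pos by (metis dgt_def mod_less_divisor of_nat_0_le_iff of_nat_less_iff)
    with False show False by blast
   qed
   then have "BQ q1" using best_skip[OF bq] fq by (simp add: BQ_def f1)
   then show ?thesis using 53 by simp
  next
   case True
   then obtain e where 53: "rv q1 53 = 1" and e: "e < S" "rv q1 52 = int e" "e mod cnt = g" "\<forall>i<m. dgt e i = A i"
   proof -
    have "rv q1 53 = 1 \<and> (\<exists>e<S. rv q1 52 = int e \<and> e mod cnt = g \<and> (\<forall>i<m. dgt e i = A i))"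
     using q1 True by (simp add: EQ_def)
    then show ?thesis using that by blast
   qed
   have pre: "pr j x k e" using e g by (simp add: pr_def A_def)
   have cells: "av p aY (int j * int S + int e) = Yv p j e" "av p aF (int j * int S + int e) = Fv p j e"
    by (simp_all add: Yv_def Fv_def)
   show ?thesis
   proof (cases "0 \<le> Yv p j e")
    case False
    then have "best p j x (Suc k) (rv q 34) (rv q 35) (rv q 36)"
     using pr_unique[OF pre] by (intro best_skip[OF bq]) auto
    then have "BQ q1" using fq by (simp add: BQ_def f1)
    then show ?thesis using 53 False by (simp add: f1 f mp e cells j)
   next
    case Y: True
    define v where "v = Fv p j e + int k * T K j"
    \<comment> \<open>One stage changes the value by at most \<open>D * TB\<close>, so after n
      stages it is within \<open>Bd\<close>.\<close>
    have kT: "\<bar>int k * T K j\<bar> \<le> int D * TB"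
     unfolding abs_mult using k j KM TB[OF tabl, of K j] by (intro mult_mono) auto
    have "\<bar>v\<bar> \<le> int (Suc j) * (int D * TB)" using Fb[OF e(1) Y] kT unfolding v_def by (simp add: algebra_simps)
    also have "\<dots> \<le> int n * (int D * TB)" using j TB_nonneg by (intro mult_right_mono) auto
    finally have vb: "\<bar>v\<bar> \<le> Bd" using F_le by linarith
    have kb: "int k \<le> Bd" "int e \<le> Bd" using k bounds nat_le_Bd[of e] e by simp_all
    have val: "av q1 aF (rv q1 30 * rv q1 xS + rv q1 52) + rv q1 33 * av q1 aT (rv q1 xK * rv q1 xn + rv q1 30) = v"
     using j KM by (simp add: f1 f mp e cells q v_def)
    have yval: "av q1 aY (rv q1 30 * rv q1 xS + rv q1 52) = Yv p j e"
     using j by (simp add: f1 f mp e cells q)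
    have r: "rv q1 33 = int k" "rv q1 34 = rv q 34" "rv q1 35 = rv q 35" "rv q1 36 = rv q 36" using q by (simp_all add: f1)
    have take: "BQ q'" if "frame 34 {} {} q q'" "rv q' 34 = int k" "rv q' 35 = v" "rv q' 36 = int e" "rv q 34 < 0 \<or> v < rv q 35" for q'
     using best_take[OF bq pre Y] that by (simp add: BQ_def v_def)
    have keep: "BQ q'" if "frame 34 {} {} q q'" "rv q' 34 = rv q 34" "rv q' 35 = rv q 35" "rv q' 36 = rv q 36" "0 \<le> rv q 34" "rv q 35 \<le> v" for q'
     using best_keep[OF bq pre] that by (simp add: BQ_def v_def)
    show ?thesis
    proof (cases "rv q 34 < 0 \<or> v < rv q 35")
     case True
     then show ?thesis
      using 53 Y vb kb fq val yval by (auto simp: r e intro: take)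
    next
     case False
     then show ?thesis
      using 53 Y vb kb fq val yval by (auto simp: r e intro: keep)
    qed
   qed
  qed
 qed
 have Sg: "Sb g j < cnt" "\<forall>i<K. G (Sb g j) i = (G g i - T i j) mod \<delta>" using grp g j by (auto simp: grp_def)
 \<comment> \<open>Entries of \<open>aA\<close> may leave the digit range, but by at most
   \<open>D * D\<close> over all slack values; hence the summand \<open>D * D\<close> in
   \<open>WD_le\<close>.\<close>
 have Ab: "\<bar>A i - T i j\<bar> \<le> Bd" if i: "i < m" for i
 proof -
  have "\<bar>int (Suc k) * T i j\<bar> \<le> int D * int D"
   unfolding abs_mult using k T_le_D[OF i j(2)] by (intro mult_mono) auto
  moreover have "\<bar>dgt x i\<bar> \<le> int Wd" using pos by (simp add: dgt_def less_imp_le)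
  ultimately show ?thesis using WD_le by (simp add: A_def algebra_simps)
 qed
 have dig: "wp (Sto aA (V 54) (Ix aA (V 54) -. Ix aT (V 54 *. V xn +. V 30)))
   (\<lambda>q'. rv q' 54 = int i \<and> (\<forall>x. DQ (Suc i) (set_reg 54 x q'))) q'"
  if i: "i < m" and q': "DQ i q'" "rv q' 54 = int i" for i q'
 proof -
  have frq: "frame 34 {32} {aA} q q'" using q' by (simp add: DQ_def)
  note fq = frame_reg[OF frq] frame_arr[OF frq]
  have a: "av q' aA (int i') = (if i' < i then A i' - T i' j else A i')" if "i' < m" for i'
   using q' that by (simp add: DQ_def)
  have t: "av q' aT (rv q' 54 * rv q' xn + rv q' 30) = T i j"
   by (simp add: fq f mp q' j KM(2)[OF i])
  show ?thesis
   using Ab[OF i] q' t a i by (auto simp: DQ_def less_Suc_eq)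
 qed
 have fin: "rv q' 33 = int k \<and> (\<forall>x'. pull_inv p j x (Suc k) (set_reg 33 x' q'))" if q': "DQ m q'" for q'
 proof -
  have frq: "frame 34 {32} {aA} q q'" using q' by (simp add: DQ_def)
  have "frame 33 {32} {aA} p q'" using fr frq by (simp add: frame_def)
  moreover have "rv q' 33 = int k" using frq q by (simp add: frame_def)
  moreover have "\<forall>i<K. G (Sb g j) i = (G (x mod cnt) i - int (Suc k) * T i j) mod \<delta>"
   using Sg g by (simp add: mod_diff_left_eq algebra_simps)
  ultimately show ?thesis using q' Sg by (auto simp: pull_inv_def DQ_def A_def algebra_simps)
 qed
 show ?thesis
  unfolding dp_pull_def
  apply (rule spec_le, rule spec_Seq_mid[where A = EQ], rule spec_conseq[OF encode_spec[OF pq g(2,1) A]])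
  apply (simp add: EQ_def)
  apply (rule spec_Seq_mid[where A = BQ], rule wp_spec, simp)
  apply (erule upd, rule wp_Seq[where A = "DQ 0"], simp)
  apply (use g j A mp f in \<open>simp add: BQ_def DQ_def frame_def\<close>)
  apply (rule spec_loop[where n = m and I = DQ])
  apply (simp_all add: nm_le)[4]
  apply (simp add: DQ_def; fail)
  apply (simp add: DQ_def frame_def f mp; fail)
  apply (rule spec_blk[where T = 20])
  apply simp
  apply (rule dig; assumption)
  apply simp
  apply (erule fin)
  apply simp
  done
qed

text \<open>The first half is soundness, an entry is realised by the recorded predecessor and can be
  traced back. The second half is optimality, which includes that reachable states are marked as
  such.\<close>

definition cellok :: "state \<Rightarrow> nat \<Rightarrow> nat \<Rightarrow> bool" where
 "cellok p j x \<longleftrightarrow>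
  (0 \<le> Yv p (Suc j) x \<longrightarrow> (\<exists>y<D. \<exists>e. Yv p (Suc j) x = int y \<and> Pv p (Suc j) x = int e \<and> pr j x y e \<and>
   0 \<le> Yv p j e \<and> Fv p (Suc j) x = Fv p j e + int y * T K j)) \<and>
  (\<forall>y<D. \<forall>e. pr j x y e \<longrightarrow> 0 \<le> Yv p j e \<longrightarrow>
   0 \<le> Yv p (Suc j) x \<and> Fv p (Suc j) x \<le> Fv p j e + int y * T K j)"

definition baseok :: "state \<Rightarrow> bool" where
 "baseok p = ((\<forall>x<S. (0 \<le> Yv p 0 x \<longleftrightarrow> (\<forall>i<K. G (x mod cnt) i = 0) \<and> (\<forall>i<m. dgt x i = off i)) \<and>
  (0 \<le> Yv p 0 x \<longrightarrow> Fv p 0 x = 0)))"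

definition tblok :: "state \<Rightarrow> nat \<Rightarrow> bool" where
 "tblok p k = (baseok p \<and> (\<forall>j<k. \<forall>x<S. cellok p j x))"

lemma pr_lt: "pr j x y e \<Longrightarrow> e < S"
 by (simp add: pr_def)

lemma Fv_bound:
 "tblok p k \<Longrightarrow> j \<le> k \<Longrightarrow> j \<le> n \<Longrightarrow> x < S \<Longrightarrow> 0 \<le> Yv p j x \<Longrightarrow> \<bar>Fv p j x\<bar> \<le> int j * (int D * TB)"
proof (induction j arbitrary: x)
 case 0
 then show ?case by (simp add: tblok_def baseok_def)
next
 case (Suc j)
 then have "cellok p j x" by (simp add: tblok_def)
 then obtain y e where ye: "y < D" "pr j x y e" "0 \<le> Yv p j e" "Fv p (Suc j) x = Fv p j e + int y * T K j"
  using Suc.prems(5) unfolding cellok_def by blast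
 have "\<bar>Fv p j e\<bar> \<le> int j * (int D * TB)" using Suc ye pr_lt by simp
 moreover have "\<bar>int y * T K j\<bar> \<le> int D * TB"
  unfolding abs_mult using ye Suc.prems KM TB[OF tabl, of K j] by (intro mult_mono) auto
 ultimately show ?case using ye(4) by (simp add: algebra_simps)
qed

lemma S_index_inj:
 assumes "x < S" "x' < S" "int j * int S + int x = int j' * int S + int x'"
 shows "j = j' \<and> x = x'"
proof -
 have "int (j * S + x) = int (j' * S + x')" using assms(3) by simp
 then have e: "j * S + x = j' * S + x'" by (simp only: of_nat_eq_iff)
 then have "(j * S + x) div S = (j' * S + x') div S" by simp
 then have "j = j'" using assms(1,2) by simp
 with e show ?thesis by simp
qed

lemma cellok_cong:
 assumes "cellok p j x" and x: "x < S"
  and eq: "\<And>x. x < S \<Longrightarrow> Yv q j x = Yv p j x \<and> Fv q j x = Fv p j x"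
  "Yv q (Suc j) x = Yv p (Suc j) x" "Fv q (Suc j) x = Fv p (Suc j) x" "Pv q (Suc j) x = Pv p (Suc j) x"
 shows "cellok q j x"
proof -
 have "pr j x y e \<Longrightarrow> Yv q j e = Yv p j e \<and> Fv q j e = Fv p j e" for y e using eq(1) pr_lt by blast
 then show ?thesis using assms(1) unfolding cellok_def eq(2-4) by metis
qed

lemma tblok_cong:
 assumes "tblok p k" and eq: "\<And>j x. j \<le> k \<Longrightarrow> x < S \<Longrightarrow> Yv q j x = Yv p j x \<and> Fv q j x = Fv p j x \<and> Pv q j x = Pv p j x"
 shows "tblok q k"
 unfolding tblok_def
proof (intro conjI allI impI)
 show "baseok q" using assms by (simp add: tblok_def baseok_def)
 fix j x assume jx: "j < k" "x < S"
 show "cellok q j x"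
 proof (rule cellok_cong[of p])
  show "cellok p j x" using assms(1) jx by (simp add: tblok_def)
 qed (use eq[of j] eq[of "Suc j"] jx in simp_all)
qed

definition layer_inv :: "state \<Rightarrow> nat \<Rightarrow> nat \<Rightarrow> state \<Rightarrow> bool" where
 "layer_inv p j x q = (frame 30 {} {aA, aY, aF, aP} p q \<and> rv q 30 = int j \<and> tblok q j \<and> (\<forall>x'<x. cellok q j x'))"

lemma dp_cell_spec:
 assumes p: "pmem p" and j: "j < n" and x: "x < S" "rv q 31 = int x" and q: "layer_inv p j x q"
 shows "spec dp_cell q (300 * D * (m + 1)) (\<lambda>q'. rv q' 31 = int x \<and> (\<forall>x'. layer_inv p j (Suc x) (set_reg 31 x' q')))"
proof -
 have fr: "frame 30 {} {aA, aY, aF, aP} p q" "rv q 30 = int j" "tblok q j" "\<forall>x'<x. cellok q j x'"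
  using q by (auto simp: layer_inv_def)
 have pq: "pmem q" using pmem_frame[OF p fr(1)] by simp
 note mp = pmemD[OF pq]
 have Fb: "\<bar>Fv q j e\<bar> \<le> int j * (int D * TB)" if "e < S" "0 \<le> Yv q j e" for e
  using Fv_bound[OF fr(3) _ _ that] j by simp
 define A1 where "A1 q' = (frame 50 {32} {aA} q q' \<and> rv q' 32 = int (x mod cnt) \<and> (\<forall>i<m. av q' aA (int i) = dgt x i))" for q'
 have P0: "pull_inv q j x 0 (set_reg 33 y q')"
  if "A1 q0" "q' = set_reg 36 v3 (set_reg 35 v2 (set_reg 34 v1 q0))" "fst v1 = -1" for q0 q' v1 v2 v3 y
 proof -
  have "G (x mod cnt) i mod \<delta> = G (x mod cnt) i" if "i < K" for i
   using grp_G_bounds[OF grp _ that, of "x mod cnt"] pos by simp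
  then show ?thesis using that pos
   by (auto simp: A1_def pull_inv_def best_def frame_def intro!: exI[of _ "x mod cnt"])
 qed
 have fin: "wp (Sto aY ((V 30 +. N 1) *. V xS +. V 31) (V 34) ;.
   Sto aF ((V 30 +. N 1) *. V xS +. V 31) (V 35) ;.
   Sto aP ((V 30 +. N 1) *. V xS +. V 31) (V 36))
   (\<lambda>q'. rv q' 31 = int x \<and> (\<forall>x'. layer_inv p j (Suc x) (set_reg 31 x' q'))) q'" if q': "pull_inv q j x D q'" for q'
 proof -
  have frq: "frame 33 {32} {aA} q q'" using q' by (simp add: pull_inv_def)
  note f = frame_reg[OF frq] frame_arr[OF frq]
  have b: "best q j x D (rv q' 34) (rv q' 35) (rv q' 36)" using q' by (simp add: pull_inv_def)
  have addr: "(int j + 1) * int S + int x = int (Suc j) * int S + int x" by simp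
  have li: "layer_inv p j (Suc x) r" if r: "frame 31 {} {aY, aF, aP} q' r"
   "\<And>j' x'. x' < S \<Longrightarrow> Yv r j' x' = (if j' = Suc j \<and> x' = x then rv q' 34 else Yv q' j' x')"
   "\<And>j' x'. x' < S \<Longrightarrow> Fv r j' x' = (if j' = Suc j \<and> x' = x then rv q' 35 else Fv q' j' x')"
   "\<And>j' x'. x' < S \<Longrightarrow> Pv r j' x' = (if j' = Suc j \<and> x' = x then rv q' 36 else Pv q' j' x')" for r
  proof -
   have qq: "Yv q' = Yv q" "Fv q' = Fv q" "Pv q' = Pv q" by (simp_all add: Yv_def Fv_def Pv_def f fun_eq_iff)
   have "frame 30 {} {aA, aY, aF, aP} p r" using fr(1) frq r(1) by (simp add: frame_def)
   moreover have "rv r 30 = int j" using fr(2) frq r(1) by (simp add: frame_def)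
   moreover have "tblok r j" by (rule tblok_cong[OF fr(3)]) (simp add: r qq)
   moreover have "cellok r j x'" if "x' < Suc x" for x'
   proof (cases "x' = x")
    case False
    then have x': "x' < x" "x' < S" using that x(1) by simp_all
    show ?thesis
    proof (rule cellok_cong[of q])
     show "cellok q j x'" using fr(4) x' by blast
    qed (use x' in \<open>simp_all add: r qq\<close>)
   next
    case True
    have e: "pr j x y e \<Longrightarrow> Yv r j e = Yv q j e \<and> Fv r j e = Fv q j e" for y e using pr_lt by (simp add: r qq)
    have new: "Yv r (Suc j) x = rv q' 34" "Fv r (Suc j) x = rv q' 35" "Pv r (Suc j) x = rv q' 36"
     by (simp_all add: r x(1))
    from b[unfolded best_def] show ?thesis
    proof (elim disjE conjE exE)
     assume 1: "rv q' 34 = -1" "\<forall>y<D. \<forall>e. pr j x y e \<longrightarrow> Yv q j e < 0"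
     have "\<not> 0 \<le> Yv r j e'" if "y < D" "pr j x y e'" for y e' using 1(2) that e[OF that(2)] by fastforce
     then show ?thesis unfolding True cellok_def new using 1(1) by auto
    next
     fix y0 e0
     assume 2: "y0 < D" "rv q' 34 = int y0" "rv q' 36 = int e0" "pr j x y0 e0" "0 \<le> Yv q j e0"
      "rv q' 35 = Fv q j e0 + int y0 * T K j"
      "\<forall>y<D. \<forall>e. pr j x y e \<longrightarrow> 0 \<le> Yv q j e \<longrightarrow> rv q' 35 \<le> Fv q j e + int y * T K j"
     show ?thesis unfolding True cellok_def new
     proof (intro conjI impI allI)
      show "\<exists>y<D. \<exists>e. rv q' 34 = int y \<and> rv q' 36 = int e \<and> pr j x y e \<and> 0 \<le> Yv r j e \<and> rv q' 35 = Fv r j e + int y * T K j"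
       using 2(1-6) e[OF 2(4)] by (intro exI[of _ y0] exI[of _ e0]) simp
      show "0 \<le> rv q' 34" using 2 by simp
      show "rv q' 35 \<le> Fv r j e' + int y * T K j" if "y < D" "pr j x y e'" "0 \<le> Yv r j e'" for y e'
       using 2(7) that e[OF that(2)] by simp
     qed
    qed
   qed
   ultimately show ?thesis by (simp add: layer_inv_def)
  qed
  have r31: "rv q' 31 = int x" using x by (simp add: f)
  define ad where "ad = int (Suc j) * int S + int x"
  have ad: "int j' * int S + int x' = ad \<longleftrightarrow> j' = Suc j \<and> x' = x" if "x' < S" for j' x'
   using S_index_inj[OF that x(1)] unfolding ad_def by blast
  have "layer_inv p j (Suc x) (set_reg 31 y (set_arr aP ad z3 (set_arr aF ad z2 (set_arr aY ad z1 q'))))"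
   if "fst z1 = rv q' 34" "fst z2 = rv q' 35" "fst z3 = rv q' 36" for y z1 z2 z3
   by (rule li) (use that in \<open>simp_all add: Yv_def Fv_def Pv_def ad\<close>)
  moreover have "(1 + int j) * int S + int x = ad" "(int j + 1) * int S + int x = ad" by (simp_all add: ad_def)
  ultimately show ?thesis
   using r31 fr(2) by (simp add: f mp)
 qed
 show ?thesis
  unfolding dp_cell_def
  apply (rule spec_le, rule spec_Seq_mid[where A = A1], rule spec_conseq[OF decode_spec[OF pq x(2,1)]])
  apply (simp add: A1_def)
  apply (rule wp_Seq[where A = "\<lambda>q'. \<forall>y. pull_inv q j x 0 (set_reg 33 y q')"], simp)
  apply (use Bd_ge in \<open>auto intro!: P0\<close>)[1]
  apply (rule spec_loop_Seq[where n = D and I = "pull_inv q j x"])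
  apply (simp_all add: bounds)[4]
  apply blast
  apply (simp add: pull_inv_def frame_def mp; fail)
  apply (rule dp_pull_spec[OF pq fr(2) j x(1)]; (assumption | rule Fb; assumption))
  apply (rule wp_spec, simp)
  apply (erule fin)
  apply (use D_pos in \<open>cases D; simp add: algebra_simps\<close>)
  done
qed

lemma dp_init_spec:
 assumes p: "pmem p" and off: "\<And>i. i < m \<Longrightarrow> 0 \<le> off i \<and> off i < int Wd"
 shows "spec dp_init p (100 * (S + m + 1)) (\<lambda>q. frame 30 {} {aA, aY, aF} p q \<and> baseok q)"
proof -
 note mp = pmemD[OF p]
 define I where "I k q = (frame 30 {} {aY} p q \<and> (\<forall>x<k. av q aY (int x) = -1))" for k :: nat and q
 define J where "J k q = (frame 30 {} {aA, aY} p q \<and> (\<forall>x<S. av q aY (int x) = -1) \<and> (\<forall>i<k. av q aA (int i) = off i))" for k q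
 define E where "E q = (frame 30 {} {aA, aY} p q \<and> (\<forall>x<S. av q aY (int x) = -1) \<and>
  (\<exists>e<S. rv q 52 = int e \<and> e mod cnt = 0 \<and> (\<forall>i<m. dgt e i = off i)))" for q
 have offb: "\<bar>off i\<bar> \<le> Bd" if "i < m" for i using off[OF that] bounds by simp
 have G0: "\<forall>i<K. G 0 i = 0" using grp by (simp add: grp_def)
 have fin: "wp (Sto aY (V 52) (N 0) ;. Sto aF (V 52) (N 0)) (\<lambda>q. frame 30 {} {aA, aY, aF} p q \<and> baseok q) q" if q: "E q" for q
 proof -
  obtain e where e: "e < S" "rv q 52 = int e" "e mod cnt = 0" "\<forall>i<m. dgt e i = off i" using q by (auto simp: E_def)
  \<comment> \<open>Codes are injective, so the single cell that is written is the only initial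
    state.\<close>
  have u: "x = e \<longleftrightarrow> (\<forall>i<K. G (x mod cnt) i = 0) \<and> (\<forall>i<m. dgt x i = off i)" if "x < S" for x
   using state_unique[OF that e(1)] e G0 by auto
  have "baseok (set_arr aF (int e) z2 (set_arr aY (int e) z1 q))" if "fst z1 = 0" "fst z2 = 0" for z1 z2
   using q that u by (auto simp: baseok_def Yv_def Fv_def E_def)
  moreover have "frame 30 {} {aA, aY, aF} p q" using q by (simp add: E_def frame_def)
  ultimately show ?thesis using Bd_ge by (simp add: e)
 qed
 show ?thesis
  unfolding dp_init_def
  apply (rule spec_le, rule spec_loop_Seq[where n = S and I = I])
  apply (simp_all add: S_le)[4]
  apply (simp add: I_def; fail)
  apply (simp add: I_def frame_def mp; fail)
  apply (rule spec_blk[where T = 5])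
  apply simp
  apply (use Bd_ge in \<open>auto simp: I_def less_Suc_eq\<close>)[1]
  apply simp
  apply (rule spec_loop_Seq[where n = m and I = J])
  apply (simp_all add: nm_le)[4]
  apply (simp add: I_def J_def frame_def; fail)
  apply (simp add: J_def frame_def mp; fail)
  apply (rule spec_blk[where T = 5])
  apply simp
  apply (use offb in \<open>auto simp: J_def less_Suc_eq mp frame_def\<close>)[1]
  apply simp
  apply (rule wp_Seq[where A = "\<lambda>q. J m q \<and> rv q 32 = 0"], simp)
  apply (use Bd_ge in \<open>simp add: J_def\<close>)
  apply (rule spec_Seq_mid[where A = E], rule spec_conseq[OF encode_spec[where g = 0 and A = off]])
  subgoal for q1 q2 q3
   by (rule pmem_frame[OF p, where l = 22 and X = "{}" and Y = "{aA, aY}"]) (auto simp: J_def frame_def)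
  apply simp
  apply (rule pos)
  apply (simp add: J_def; fail)
  subgoal for q1 q2 q3 q4
   using off by (auto simp: E_def J_def frame_def)
  apply (rule wp_spec, simp)
  apply (erule fin)
  apply simp
  done
qed

lemma dp_spec:
 assumes p: "pmem p" and off: "\<And>i. i < m \<Longrightarrow> 0 \<le> off i \<and> off i < int Wd"
 shows "spec dp p (600 * n * S * D * (m + 1)) (\<lambda>q. frame 30 {} {aA, aY, aF, aP} p q \<and> tblok q n)"
proof -
 note mp = pmemD[OF p]
 define I where "I j q = (frame 30 {} {aA, aY, aF, aP} p q \<and> tblok q j)" for j q
 have st: "tblok (set_reg r x q) j = tblok q j" "cellok (set_reg r x q) j' x' = cellok q j' x'"
  "baseok (set_reg r x q) = baseok q" for r x q j j' x'
  by (simp_all add: tblok_def baseok_def cellok_def Yv_def Fv_def Pv_def)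
 have layer: "spec (loop 31 xS dp_cell) q (3 + S * (300 * D * (m + 1) + 4))
   (\<lambda>q'. rv q' 30 = int j \<and> (\<forall>x. I (Suc j) (set_reg 30 x q')))"
  if j: "j < n" and q: "I j q" "rv q 30 = int j" for j q
  apply (rule spec_loop[where n = S and I = "layer_inv p j"])
  apply (simp_all add: S_le)[4]
  apply (use q in \<open>simp add: layer_inv_def I_def st; fail\<close>)
  apply (simp add: layer_inv_def frame_def mp; fail)
  apply (rule dp_cell_spec[OF p j]; assumption)
  apply (auto simp: layer_inv_def I_def st tblok_def less_Suc_eq)
  done
 have cost: "100 * (S + m + 1) + (3 + n * (3 + S * (300 * D * (m + 1) + 4) + 4)) \<le> 600 * n * S * D * (m + 1)"
 proof -
  define Y where "Y = n * S * D * (m + 1)"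
  have "1 * (S * 1 * 1) \<le> n * (S * D * (m + 1))" using n_pos D_pos by (intro mult_le_mono) auto
  then have a: "S \<le> Y" by (simp only: Y_def mult.assoc mult_1 mult_1_right)
  have "1 * (1 * 1 * (m + 1)) \<le> n * (S * D * (m + 1))" using n_pos D_pos pos by (intro mult_le_mono) auto
  then have b: "m + 1 \<le> Y" by (simp only: Y_def mult.assoc mult_1 mult_1_right)
  have "n * (S * 1 * 1) \<le> n * (S * D * (m + 1))" using n_pos D_pos pos by (intro mult_le_mono) auto
  then have c: "n * S \<le> Y" by (simp only: Y_def mult.assoc mult_1 mult_1_right)
  have "n * (1 * 1 * 1) \<le> n * (S * D * (m + 1))" using n_pos D_pos pos by (intro mult_le_mono) auto
  then have e: "n \<le> Y" by (simp only: Y_def mult.assoc mult_1 mult_1_right)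
  have "n * (3 + S * (300 * D * (m + 1) + 4) + 4) = 7 * n + 300 * Y + 4 * (n * S)"
   by (simp add: Y_def algebra_simps)
  then have "n * (3 + S * (300 * D * (m + 1) + 4) + 4) \<le> 311 * Y" using c e by linarith
  moreover have "100 * (S + m + 1) \<le> 200 * Y" using a b by simp
  moreover have "x + (3 + z) \<le> 600 * Y" if "x \<le> 200 * Y" "z \<le> 311 * Y" for x z using that b by linarith
  moreover have "600 * n * S * D * (m + 1) = 600 * Y" by (simp add: Y_def algebra_simps)
  ultimately show ?thesis by presburger
 qed
 show ?thesis
  unfolding dp_def
  apply (rule spec_le[OF _ cost], rule spec_Seq_mid[where A = "I 0"], rule spec_conseq[OF dp_init_spec[OF p off]])
  apply assumption
  apply (simp add: I_def tblok_def frame_def)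
  apply (rule spec_loop[where n = n and I = I])
  apply (simp_all add: nm_le)[4]
  apply (simp add: I_def st; fail)
  apply (simp add: I_def frame_def mp; fail)
  apply (rule layer; assumption)
  apply (simp add: I_def)
  done
qed

end

section \<open>Solutions for one basis\<close>

definition scan_cell :: com where
 "scan_cell =
  cif (Ix aY (V xn *. V xS +. V 31) +. N 1)
   (decode ;;
    blk (37 ::= N 1 ;. If (sq (V 32 -. V xgs)) (37 ::= N 0) Nop) ;;
    loop 33 xm (blk (If (Ix arho (V 33) -. Ix aA (V 33) +. Ix aoff (V 33)) (37 ::= N 0) Nop)) ;;
    blk (If (V 37)
     (If (N 0 -. V xfx)
      (xfx ::= V 31 +. N 0 ;. 36 ::= Ix aF (V xn *. V xS +. V 31))
      (If (V 36 -. Ix aF (V xn *. V xS +. V 31))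
       (xfx ::= V 31 +. N 0 ;. 36 ::= Ix aF (V xn *. V xS +. V 31))
       Nop))
     Nop))
   Skip"

definition scan :: com where
 "scan = blk (xfx ::= N (-1) ;. 36 ::= N 0) ;; loop 31 xS scan_cell"

text \<open>\<open>au\<close> receives \<open>b\<close> minus slack, the values on the basis rows
  that the integer point has to attain.\<close>

definition backtrack :: com where
 "backtrack =
  blk (31 ::= V xfx +. N 0) ;;
  loop 32 xn (blk (
   33 ::= V xn -. N 1 -. V 32 ;.
   34 ::= Ix aY ((V 33 +. N 1) *. V xS +. V 31) ;.
   StoS au (V 33) (Ix ab (Ix acol (V 33)) -. V 34) ;.
   31 ::= Ix aP ((V 33 +. N 1) *. V xS +. V 31)))"

definition objective :: com where
 "objective =
  blk (31 ::= N 0) ;;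
  loop 32 xn (blk (AsgS 31 (V 31 +. Ix aT (V xK *. V xn +. V 32) *. Ix au (V 32)))) ;;
  blk (AsgS 31 (V 31 div. V xdel))"

definition put_entry :: prog where
 "put_entry = AsgS 33 (V 33 div. V xdel) ;.
  If (V xm -. V 32)
   (If (V xs -. Ix arow (V 32)) (StoS az (Ix arow (V 32)) (V 33)) Nop)
   (StoS az (V xs +. V 32 -. V xm) (V 33))"

definition write_row :: com where
 "write_row =
  blk (33 ::= N 0) ;;
  loop 34 xn (blk (AsgS 33 (V 33 +. Ix aT (V 32 *. V xn +. V 34) *. Ix au (V 34)))) ;;
  blk put_entry"

text \<open>Every coordinate is the value of a unit row. For indices below \<open>s\<close> this is
  a row of \<open>h\<close>, found among the basic or the nonbasic rows; the remaining ones are the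
  additional tableau rows.\<close>

definition write_solution :: com where
 "write_solution =
  loop 32 xn (blk (If (V xs -. Ix acol (V 32)) (StoS az (Ix acol (V 32)) (Ix au (V 32))) Nop)) ;;
  loop 32 xK write_row"

definition finish :: com where
 "finish =
  objective ;;
  cif (N 1 -. V xfeas)
   (blk (AsgS xbest (V 31 +. N 0) ;. xfeas ::= N 1) ;; write_solution)
   (cif (V 31 -. V xbest)
    (blk (AsgS xbest (V 31 +. N 0) ;. xfeas ::= N 1) ;; write_solution)
    Skip)"

definition offset_row :: com where
 "offset_row =
  blk (31 ::= N 0) ;;
  loop 32 xn (blk (If (N 0 -. Ix aT (V 30 *. V xn +. V 32))
   (31 ::= V 31 -. (V xD -. N 1) *. Ix aT (V 30 *. V xn +. V 32)) Nop)) ;;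
  blk (Sto aoff (V 30) (V 31))"

text \<open>Computes the digit base, the number \<open>xcnt * xW ^ m\<close> of states and the digit
  offsets for the basis at hand.\<close>

definition prep :: com where
 "prep =
  blk (xW ::= (V xD -. N 1) *. V xn *. V xD +. N 1 ;. xS ::= V xcnt +. N 0) ;;
  loop 30 xm (blk (xS ::= V xS *. V xW)) ;;
  loop 30 xm offset_row"

definition target_row :: com where
 "target_row =
  blk (31 ::= N 0) ;;
  loop 32 xn (blk (AsgS 31 (V 31 +. Ix aT (V 30 *. V xn +. V 32) *. Ix ab (Ix acol (V 32))))) ;;
  blk (StoS atau (V 30) (V 31) ;. Sto aV (V 30) (V 31 mod. V xdel))"

definition targets :: com where
 "targets =
  loop 30 xK target_row ;;
  loop 30 xm (blk (StoS arho (V 30) (Ix atau (V 30) -. V xdel *. Ix ab (Ix arow (V 30))))) ;;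
  find_elem ;;
  blk (xgs ::= V 41 +. N 0)"

definition body2 :: com where
 "body2 = prep ;; targets ;; dp ;; scan ;; cif (V xfx +. N 1) (backtrack ;; finish) Skip"

section \<open>Slack vectors and final states\<close>

context dp_tables
begin

text \<open>Partial sums matter because intermediate stages must be states as well. They obey the
  same bounds, since \<open>off\<close> covers all negative terms at once and the width covers all
  positive ones.\<close>

lemma off_range:
 assumes i: "i < m" and y: "\<And>l. l < n \<Longrightarrow> y l < D" and j: "j \<le> n"
 shows "0 \<le> off i + (\<Sum>l<j. T i l * int (y l))" "off i + (\<Sum>l<j. T i l * int (y l)) < int Wd"
proof -
 have sub: "(\<Sum>l<j. g l) \<le> (\<Sum>l<n. g l)" if "\<And>l. 0 \<le> g l" for g :: "nat \<Rightarrow> int"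
  using j that by (intro sum_mono2) auto
 have yD: "int (y l) \<le> int D - 1" if "l < n" for l using y[OF that] by simp
 have "- (\<Sum>l<j. T i l * int (y l)) \<le> (\<Sum>l<j. (int D - 1) * max 0 (- T i l))"
  unfolding sum_negf[symmetric]
 proof (rule sum_mono)
  fix l assume "l \<in> {..<j}"
  then have "l < n" using j by simp
  have "- (T i l * int (y l)) \<le> max 0 (- T i l) * int (y l)" by (simp add: max_def mult_nonneg_nonneg)
  also have "\<dots> \<le> max 0 (- T i l) * (int D - 1)" using yD[OF \<open>l < n\<close>] by (intro mult_left_mono) auto
  finally show "- (T i l * int (y l)) \<le> (int D - 1) * max 0 (- T i l)" by (simp only: mult.commute)
 qed
 also have "\<dots> \<le> (\<Sum>l<n. (int D - 1) * max 0 (- T i l))" using D_pos by (intro sub) simp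
 also have "\<dots> = off i" by (simp add: off_eq sum_distrib_left)
 finally show "0 \<le> off i + (\<Sum>l<j. T i l * int (y l))" by simp
 have "(\<Sum>l<j. T i l * int (y l)) \<le> (\<Sum>l<j. (int D - 1) * max 0 (T i l))"
 proof (rule sum_mono)
  fix l assume "l \<in> {..<j}"
  then have "l < n" using j by simp
  have "T i l * int (y l) \<le> max 0 (T i l) * int (y l)" by (intro mult_right_mono) auto
  also have "\<dots> \<le> max 0 (T i l) * (int D - 1)" using yD[OF \<open>l < n\<close>] by (intro mult_left_mono) auto
  finally show "T i l * int (y l) \<le> (int D - 1) * max 0 (T i l)" by (simp only: mult.commute)
 qed
 also have "\<dots> \<le> (\<Sum>l<n. (int D - 1) * max 0 (T i l))" using D_pos by (intro sub) simp
 finally have "off i + (\<Sum>l<j. T i l * int (y l)) \<le> (\<Sum>l<n. (int D - 1) * max 0 (- T i l)) + (\<Sum>l<n. (int D - 1) * max 0 (T i l))"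
  by (simp add: off_eq sum_distrib_left)
 also have "\<dots> = (\<Sum>l<n. (int D - 1) * \<bar>T i l\<bar>)"
  unfolding sum.distrib[symmetric] by (intro sum.cong) (auto simp: max_def algebra_simps)
 also have "\<dots> \<le> (\<Sum>l<n. (int D - 1) * int D)" using D_pos T_le_D[OF i] by (intro sum_mono mult_left_mono) auto
 also have "\<dots> < int Wd" using D_pos by (simp add: Wd_eq of_nat_diff algebra_simps)
 finally show "off i + (\<Sum>l<j. T i l * int (y l)) < int Wd" .
qed

lemma off_bounds: "i < m \<Longrightarrow> 0 \<le> off i \<and> off i < int Wd"
 using off_range[of i "\<lambda>_. 0" 0] D_pos by simp

definition st :: "nat \<Rightarrow> (nat \<Rightarrow> nat) \<Rightarrow> nat \<Rightarrow> bool" where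
 "st j y x = (x < S \<and> (\<forall>i<K. G (x mod cnt) i = (\<Sum>l<j. T i l * int (y l)) mod \<delta>) \<and>
  (\<forall>i<m. dgt x i = off i + (\<Sum>l<j. T i l * int (y l))))"

lemma st_Suc:
 assumes "pr j x y e" "st j z e" "x < S"
 shows "st (Suc j) (z(j := y)) x"
 unfolding st_def
proof (intro conjI allI impI)
 fix i assume i: "i < K"
 have "G (x mod cnt) i = G (x mod cnt) i mod \<delta>" using grp_G_bounds[OF grp _ i, of "x mod cnt"] pos by simp
 also have "\<dots> = (G (e mod cnt) i + int y * T i j) mod \<delta>"
  using assms(1) i by (simp add: pr_def mod_add_left_eq)
 also have "\<dots> = (\<Sum>l<Suc j. T i l * int ((z(j := y)) l)) mod \<delta>"
  using assms(2) i by (simp add: st_def mod_add_left_eq mult.commute)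
 finally show "G (x mod cnt) i = (\<Sum>l<Suc j. T i l * int ((z(j := y)) l)) mod \<delta>" .
next
 fix i assume "i < m"
 then show "dgt x i = off i + (\<Sum>l<Suc j. T i l * int ((z(j := y)) l))"
  using assms(1,2) by (simp add: pr_def st_def algebra_simps)
qed (use assms in simp)

lemma st_exists:
 assumes y: "\<And>l. l < n \<Longrightarrow> y l < D" and j: "j \<le> n"
 shows "\<exists>x. st j y x"
proof -
 define A where "A i = nat (off i + (\<Sum>l<j. T i l * int (y l)))" for i
 have A: "int (A i) = off i + (\<Sum>l<j. T i l * int (y l))" "A i < Wd" if "i < m" for i
  using off_range[OF that y j] by (simp_all add: A_def nat_less_iff)
 obtain g where g: "g < cnt" "\<forall>i<K. G g i = hsh (\<lambda>l. if l < j then int (y l) else 0) i" using grp_onto[OF grp] by blast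
 have h: "hsh (\<lambda>l. if l < j then int (y l) else 0) i = (\<Sum>l<j. T i l * int (y l)) mod \<delta>" for i
 proof -
  have "(\<Sum>l<n. T i l * (if l < j then int (y l) else 0)) = (\<Sum>l<j. T i l * int (y l))"
   using j by (intro sum.mono_neutral_cong_right) auto
  then show ?thesis by (simp add: hsh_def)
 qed
 define x where "x = horner A m * cnt + g"
 have "\<forall>t<m. A (m - 1 - t) < Wd" using A(2) by simp
 note hd = horner_lt[OF this] horner_digit[OF this order_refl]
 have "x < Suc (horner A m) * cnt" using g by (simp add: x_def)
 also have "\<dots> \<le> Wd ^ m * cnt" using hd(1) by (intro mult_le_mono1) simp
 finally have "x < S" by (simp add: S_eq mult.commute)
 moreover have "x mod cnt = g" "x div cnt = horner A m" using g by (simp_all add: x_def)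
 ultimately have "st j y x"
  using g hd(2) A by (simp add: st_def h dgt_def)
 then show ?thesis by blast
qed

lemma st_pr:
 assumes "st (Suc j) y x" "st j y e"
 shows "pr j x (y j) e"
 unfolding pr_def
proof (intro conjI allI impI)
 fix i assume i: "i < K"
 show "G (e mod cnt) i = (G (x mod cnt) i - int (y j) * T i j) mod \<delta>"
  using assms i by (simp add: st_def mod_diff_left_eq algebra_simps)
qed (use assms in \<open>simp_all add: st_def algebra_simps\<close>)

text \<open>Every prefix of an admissible slack vector is a state by \<open>st_exists\<close>.
  Consecutive prefixes are related by \<open>pr\<close>, so the optimality half of
  \<open>cellok\<close> carries the bound from stage to stage.\<close>

lemma tbl_complete:
 assumes t: "tblok p n" and y: "\<And>l. l < n \<Longrightarrow> y l < D"
 shows "j \<le> n \<Longrightarrow> st j y x \<Longrightarrow> 0 \<le> Yv p j x \<and> Fv p j x \<le> (\<Sum>l<j. T K l * int (y l))"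
proof (induction j arbitrary: x)
 case 0
 then show ?case using t by (auto simp: tblok_def baseok_def st_def)
next
 case (Suc j)
 obtain e where e: "st j y e" using st_exists[of y j] y Suc.prems(1) by auto
 have pre: "pr j x (y j) e" by (rule st_pr[OF Suc.prems(2) e])
 have IH: "0 \<le> Yv p j e" "Fv p j e \<le> (\<Sum>l<j. T K l * int (y l))" using Suc.IH[OF _ e] Suc.prems by auto
 have x: "x < S" using Suc.prems by (simp add: st_def)
 have "cellok p j x" using t Suc.prems x by (simp add: tblok_def)
 then have "0 \<le> Yv p (Suc j) x \<and> Fv p (Suc j) x \<le> Fv p j e + int (y j) * T K j"
  using pre IH y[of j] Suc.prems unfolding cellok_def by simp
 with IH show ?case by (simp add: mult.commute)
qed

text \<open>The group index decides integrality. The inequality is feasibility at a nonbasic row: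
  \<delta> times its value is a constant minus the form, and \<open>rho i\<close> is that constant
  minus \<delta> times the right-hand side.\<close>

definition scan_ok :: "state \<Rightarrow> nat \<Rightarrow> (nat \<Rightarrow> int) \<Rightarrow> nat \<Rightarrow> bool" where
 "scan_ok p gs rho x = (0 \<le> Yv p n x \<and> x mod cnt = gs \<and> (\<forall>i<m. rho i \<le> dgt x i - off i))"

lemma scan_spec:
 assumes p: "pmem p" and gs: "rv p xgs = int gs" and rho: "\<forall>i<m. av p arho (int i) = rho i"
 shows "spec scan p (200 * S * (m + 1)) (\<lambda>q. frame 30 {xfx} {aA} p q \<and>
  ((rv q xfx = -1 \<and> (\<forall>x<S. \<not> scan_ok p gs rho x)) \<or>
   (\<exists>x<S. rv q xfx = int x \<and> scan_ok p gs rho x \<and> (\<forall>x'<S. scan_ok p gs rho x' \<longrightarrow> Fv p n x \<le> Fv p n x'))))"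
proof -
 note mp = pmemD[OF p]
 define I where "I k q = (frame 30 {xfx} {aA} p q \<and>
  ((rv q xfx = -1 \<and> (\<forall>x<k. \<not> scan_ok p gs rho x)) \<or>
   (\<exists>x<S. rv q xfx = int x \<and> rv q 36 = Fv p n x \<and> scan_ok p gs rho x \<and> (\<forall>x'<k. scan_ok p gs rho x' \<longrightarrow> Fv p n x \<le> Fv p n x'))))" for k q
 have cell: "spec scan_cell q (110 * (m + 1)) (\<lambda>q'. rv q' 31 = int x \<and> (\<forall>v. I (Suc x) (set_reg 31 v q')))"
  if x: "x < S" and q: "I x q" "rv q 31 = int x" for x q
 proof -
  have fr: "frame 30 {xfx} {aA} p q" using q by (simp add: I_def)
  note f = frame_reg[OF fr] frame_arr[OF fr]
  have pq: "pmem q" using pmem_frame[OF p fr] by simp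
  note mq = pmemD[OF pq]
  have cy: "av p aY (int n * int S + int x) = Yv p n x" "av p aF (int n * int S + int x) = Fv p n x" by (simp_all add: Yv_def Fv_def)
  have skip: "I (Suc x) q'" if "frame 31 {} {aA} q q'" "rv q' 36 = rv q 36" "\<not> scan_ok p gs rho x" for q'
   using q that by (auto simp: I_def frame_def less_Suc_eq)
  define J where "J k q' = (frame 36 {32, 33} {aA} q q' \<and> rv q' 36 = rv q 36 \<and> (\<forall>i<m. av q' aA (int i) = dgt x i) \<and>
   rv q' 37 = (if x mod cnt = gs \<and> (\<forall>i<k. rho i \<le> dgt x i - off i) then 1 else 0))" for k q'
  have fin: "wp (If (V 37)
     (If (N 0 -. V xfx)
      (xfx ::= V 31 +. N 0 ;. 36 ::= Ix aF (V xn *. V xS +. V 31))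
      (If (V 36 -. Ix aF (V xn *. V xS +. V 31))
       (xfx ::= V 31 +. N 0 ;. 36 ::= Ix aF (V xn *. V xS +. V 31))
       Nop))
     Nop) (\<lambda>q'. rv q' 31 = int x \<and> (\<forall>v. I (Suc x) (set_reg 31 v q'))) q'"
   if J: "J m q'" and Y: "0 \<le> Yv p n x" for q'
  proof -
   have frq: "frame 36 {32, 33} {aA} q q'" using J by (simp add: J_def)
   note fq = frame_reg[OF frq] frame_arr[OF frq]
   have r: "rv q' 37 = (if scan_ok p gs rho x then 1 else 0)" "rv q' 36 = rv q 36" using J Y by (simp_all add: J_def scan_ok_def)
   have fp: "frame 30 {xfx} {aA} p q'" using fr frq by (simp add: frame_def)
   show ?thesis
   proof (cases "scan_ok p gs rho x")
    case False
    then show ?thesis using r q frq by (auto simp: fq intro!: skip) (auto simp: frame_def)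
   next
    case True
    have "int x \<le> Bd" using x by (intro nat_le_Bd) simp
    then show ?thesis
     using r q(1) x True fp by (auto simp: fq f mp mq q cy I_def less_Suc_eq)
   qed
  qed
  show ?thesis
   unfolding scan_cell_def
   apply (rule spec_le, rule spec_cif)
   apply simp
   apply (rule spec_Seq_mid, rule decode_spec[OF pq q(2) x], rule wp_Seq[where A = "J 0"], simp)
   subgoal for q1
    using Bd_ge gs by (auto simp: J_def frame_def sq_pos_iff sq_le_iff f)
   apply (rule spec_loop_Seq[where n = m and I = J])
   apply (simp_all add: nm_le)[4]
   apply (simp add: J_def; fail)
   apply (simp add: J_def frame_def mq; fail)
   apply (rule spec_blk[where T = 20])
   apply simp
   subgoal for q1 q2 i q3
    using Bd_ge rho mq by (auto simp: J_def frame_def f less_Suc_eq)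
   apply simp
   apply (rule wp_spec, simp, rule fin, assumption)
   apply (simp add: mq mp f q cy; fail)
   apply (rule spec_Skip)
   apply (use q in \<open>auto simp: mq mp f cy scan_ok_def intro!: skip\<close>)[1]
   apply (simp)
   done
 qed
 show ?thesis
  unfolding scan_def
  apply (rule spec_le, rule wp_Seq[where A = "I 0"], simp)
  apply (use Bd_ge in \<open>simp add: I_def\<close>)
  apply (rule spec_loop[where n = S and I = I])
  apply (simp_all add: S_le)[4]
  apply (simp add: I_def; fail)
  apply (simp add: I_def frame_def mp; fail)
  apply (rule cell; assumption)
  apply (auto simp: I_def)[1]
  apply (use pos in \<open>cases S; simp add: algebra_simps\<close>)
  done
qed

end

context ilp
begin

definition bmem :: "state \<Rightarrow> bool" where
 "bmem p = ((\<forall>j<d. av p ab (int j) = b j \<and> snd (arr p ab (int j)) \<le> 1))"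

definition feas_pt :: "(nat \<Rightarrow> int) \<Rightarrow> bool" where
 "feas_pt z = ((\<forall>i<d. dot n (h i) z \<le> b i))"

definition sol :: "state \<Rightarrow> bool" where
 "sol p = (rv p xfeas = 0 \<or> (rv p xfeas = 1 \<and> feas_pt (\<lambda>l. av p az (int l)) \<and>
  rv p xbest = dot n c (\<lambda>l. av p az (int l))))"

lemma feas_pt_cong: "(\<And>l. l < n \<Longrightarrow> u l = v l) \<Longrightarrow> feas_pt u = feas_pt v"
 by (simp add: feas_pt_def dot_def)

definition cand :: "(nat \<Rightarrow> nat) \<Rightarrow> int \<Rightarrow> (nat \<Rightarrow> int) \<Rightarrow> bool" where
 "cand f D z = (feas_pt z \<and> (\<forall>j<n. b (f j) - dot n (h (f j)) z < D))"

definition improves :: "state \<Rightarrow> state \<Rightarrow> bool" where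
 "improves p q = (sol q \<and> (rv p xfeas = 1 \<longrightarrow> rv q xfeas = 1 \<and> rv p xbest \<le> rv q xbest))"

end

text \<open>Values that depend on \<open>b\<close> are bounded by charge only: a product with a
  tableau entry has at most \<open>2 * a0 + 1\<close> bits, n additions contribute one bit each, and
  the division by \<delta> adds \<open>a0\<close>. This explains
  \<open>3 * a0 + n + 20\<close>.\<close>

locale basis_sizes = dp_tables +
 fixes a0 :: nat
 assumes a0: "\<And>v. \<bar>v\<bar> \<le> TB \<Longrightarrow> int_size v \<le> a0"
  and D_TB: "int D \<le> TB" and delta_TB: "\<delta> \<le> TB" and a_big: "3 * a0 + n + 20 \<le> a"
  and unit_rows: "\<And>r l. r < s \<Longrightarrow> l < n \<Longrightarrow> h r l = (if l = r then 1 else 0)"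
begin

section \<open>Charged sizes of values that depend on \<open>b\<close>\<close>

lemma wfs_reg_size: "wfs p \<Longrightarrow> r < 100 \<Longrightarrow> \<bar>rv p r\<bar> \<le> TB \<Longrightarrow> snd (reg p r) \<le> a0"
 using wfs_reg[of p r] a0[of "rv p r"] unfolding wfc_def by linarith

lemma wfs_T_size: "wfs p \<Longrightarrow> av p aT (int i * int n + int j) = T i j \<Longrightarrow> i < M \<Longrightarrow> j < n \<Longrightarrow>
  snd (arr p aT (int i * int n + int j)) \<le> a0"
 using wfs_arr[of p aT "int i * int n + int j"] a0[OF TB[OF tabl]] unfolding wfc_def by fastforce

lemma f_lt: "j < n \<Longrightarrow> f j < d" and rw_lt: "i < m \<Longrightarrow> rw i < d"
 using tabl by (simp_all add: tabl_def)

lemma a0_pos: "1 \<le> a0"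
 using a0[of 0] int_size_pos[of 0] TB_nonneg by simp

lemma backtrack_spec:
 assumes p: "pmem p" and b: "bmem p" and t: "tblok p n" and fx: "rv p xfx = int fx" "fx < S" "0 \<le> Yv p n fx"
 shows "spec backtrack p (100 * n) (\<lambda>q. frame 31 {} {au} p q \<and>
  (\<exists>y. (\<forall>l<n. y l < D) \<and> st n y fx \<and> Fv p n fx = (\<Sum>l<n. T K l * int (y l)) \<and>
   (\<forall>l<n. av q au (int l) = b (f l) - int (y l) \<and> snd (arr q au (int l)) \<le> a0 + 1)))"
proof -
 note mp = pmemD[OF p]
 \<comment> \<open>The unread slacks are kept universally quantified: any prefix \<open>z\<close>
   leading to \<open>x\<close> extends to a vector leading to \<open>fx\<close>. At stage 0 the
   empty prefix remains, for which \<open>baseok\<close> suffices.\<close>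
 define R where "R k q y x = (x < S \<and> rv q 31 = int x \<and> 0 \<le> Yv p (n - k) x \<and>
  (\<forall>l. n - k \<le> l \<and> l < n \<longrightarrow> y l < D \<and> av q au (int l) = b (f l) - int (y l) \<and> snd (arr q au (int l)) \<le> a0 + 1) \<and>
  (\<forall>z. st (n - k) z x \<longrightarrow> st n (\<lambda>l. if l < n - k then z l else y l) fx) \<and>
  Fv p n fx = Fv p (n - k) x + (\<Sum>l\<in>{n - k..<n}. T K l * int (y l)))" for k q and y :: "nat \<Rightarrow> nat" and x
 define I where "I k q = (frame 31 {} {au} p q \<and> (\<exists>y x. R k q y x))" for k q
 have step: "wp (33 ::= V xn -. N 1 -. V 32 ;.
   34 ::= Ix aY ((V 33 +. N 1) *. V xS +. V 31) ;.
   StoS au (V 33) (Ix ab (Ix acol (V 33)) -. V 34) ;.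
   31 ::= Ix aP ((V 33 +. N 1) *. V xS +. V 31)) (\<lambda>q'. rv q' 32 = int k \<and> (\<forall>v. I (Suc k) (set_reg 32 v q'))) q"
  if k: "k < n" and q: "I k q" "rv q 32 = int k" for k q
 proof -
  have fr: "frame 31 {} {au} p q" using q by (simp add: I_def)
  note f' = frame_reg[OF fr] frame_arr[OF fr]
  obtain y x where R: "R k q y x" using q by (auto simp: I_def)
  define j where "j = n - 1 - k"
  have j: "j < n" "n - k = Suc j" "n - Suc k = j" "int n - 1 - int k = int j" using k by (auto simp: j_def)
  have x: "x < S" "rv q 31 = int x" "0 \<le> Yv p (Suc j) x" using R j by (simp_all add: R_def)
  have "cellok p j x" using t j x by (simp add: tblok_def)
  then obtain y0 e where ye: "y0 < D" "Yv p (Suc j) x = int y0" "Pv p (Suc j) x = int e" "pr j x y0 e"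
   "0 \<le> Yv p j e" "Fv p (Suc j) x = Fv p j e + int y0 * T K j"
   using x(3) unfolding cellok_def by blast
  have addr: "(int j + 1) * int S + int x = int (Suc j) * int S + int x" by simp
  have cy: "av p aY ((int j + 1) * int S + int x) = int y0" "av p aP ((int j + 1) * int S + int x) = int e"
   using ye unfolding addr Yv_def Pv_def by simp_all
  have bj: "av p ab (int (f j)) = b (f j)" "snd (arr p ab (int (f j))) \<le> 1" using b f_lt[OF j(1)] by (simp_all add: bmem_def)
  have jb: "int j \<le> Bd" using j nm_le by simp
  define y' where "y' = y(j := y0)"
  have R': "R (Suc k) q' y' e" if "rv q' 31 = int e" "arr q' au = (arr q au)(int j := v)" "fst v = b (f j) - int y0" "snd v \<le> a0 + 1" for q' v
   unfolding R_def j(3)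
  proof (intro conjI allI impI)
   show "e < S" by (rule pr_lt[OF ye(4)])
   show "rv q' 31 = int e" "0 \<le> Yv p j e" using that ye by simp_all
   fix l assume l: "j \<le> l \<and> l < n"
   have old: "y l < D \<and> av q au (int l) = b (f l) - int (y l) \<and> snd (arr q au (int l)) \<le> a0 + 1" if "l \<noteq> j"
    using R l that unfolding R_def j by simp
   then show "y' l < D" "av q' au (int l) = b (f l) - int (y' l)" "snd (arr q' au (int l)) \<le> a0 + 1"
    using that ye(1) by (cases "l = j"; simp add: y'_def)+
  next
   fix z assume "st j z e"
   then have "st (Suc j) (z(j := y0)) x" using st_Suc[OF ye(4)] x by blast
   then have "st n (\<lambda>l. if l < Suc j then (z(j := y0)) l else y l) fx" using R unfolding R_def j by blast
   moreover have "(\<lambda>l. if l < Suc j then (z(j := y0)) l else y l) = (\<lambda>l. if l < j then z l else y' l)"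
    by (auto simp: y'_def fun_eq_iff)
   ultimately show "st n (\<lambda>l. if l < j then z l else y' l) fx" by simp
  next
   have "(\<Sum>l\<in>{j..<n}. T K l * int (y' l)) = T K j * int y0 + (\<Sum>l\<in>{Suc j..<n}. T K l * int (y' l))"
    using j by (simp add: sum.atLeast_Suc_lessThan y'_def)
   also have "(\<Sum>l\<in>{Suc j..<n}. T K l * int (y' l)) = (\<Sum>l\<in>{Suc j..<n}. T K l * int (y l))"
    by (intro sum.cong) (auto simp: y'_def)
   finally show "Fv p n fx = Fv p j e + (\<Sum>l\<in>{j..<n}. T K l * int (y' l))"
    using R ye(6) unfolding R_def j by (simp add: mult.commute)
  qed
  have szY: "snd w \<le> a0" if "wfs (set_reg 34 w q')" "fst w = int y0" for w q'
   using wfs_reg_size[OF that(1), of 34] that(2) ye(1) D_TB by simp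
  show ?thesis
   using x q(2) fr jb a_big a0_pos
   apply (simp add: f' mp j cy bj)
   apply (intro allI impI)
   subgoal for v w
   proof -
    assume wf: "wfs (set_reg 34 (int y0, w) (set_reg 33 (int j, v) q))"
    let ?u = "binop_cell OSub (arr p ab (int (f j))) (int y0, w)"
    have "w \<le> a0" using szY[OF wf] by simp
    \<comment> \<open>An entry of \<open>b\<close> has charge 1 and a slack at most
      \<open>a0\<close>, so the difference has charge at most \<open>a0 + 1\<close>, however large
      \<open>b\<close> is.\<close>
    then have sz: "snd ?u \<le> a0 + 1" using bj a0_pos by (simp add: snd_binop_cell)
    have "I (Suc k) (set_reg 32 r (set_reg 31 z (set_arr au (int j) ?u q')))"
     if "frame 31 {} {au} q q'" "arr q' = arr q" "fst z = int e" for r z q'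
     unfolding I_def
    proof (intro conjI exI)
     show "frame 31 {} {au} p (set_reg 32 r (set_reg 31 z (set_arr au (int j) ?u q')))"
      using fr that by (simp add: frame_def)
     show "R (Suc k) (set_reg 32 r (set_reg 31 z (set_arr au (int j) ?u q'))) y' e"
      by (rule R'[of _ ?u]) (use that bj sz in simp_all)
    qed
    then show ?thesis using sz a_big by simp
   qed
   done
 qed
 have y0: "R 0 q (\<lambda>_. 0) fx" if "rv q 31 = int fx" for q
  using that fx by (auto simp: R_def st_def)
 have fin: "frame 31 {} {au} p q \<and>
  (\<exists>y. (\<forall>l<n. y l < D) \<and> st n y fx \<and> Fv p n fx = (\<Sum>l<n. T K l * int (y l)) \<and>
   (\<forall>l<n. av q au (int l) = b (f l) - int (y l) \<and> snd (arr q au (int l)) \<le> a0 + 1))" if q: "I n q" for q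
 proof -
  obtain y x where R: "R n q y x" using q by (auto simp: I_def)
  have x: "x < S" "0 \<le> Yv p 0 x" using R by (simp_all add: R_def)
  have "baseok p" using t by (simp add: tblok_def)
  then have "st 0 y x" "Fv p 0 x = 0" using x by (simp_all add: baseok_def st_def)
  moreover have "st 0 y x \<longrightarrow> st n y fx" using R unfolding R_def by auto
  ultimately show ?thesis using R q by (auto simp: R_def I_def lessThan_atLeast0 intro!: exI[of _ y])
 qed
 have fxb: "int fx \<le> Bd" using fx by (intro nat_le_Bd) simp
 show ?thesis
  unfolding backtrack_def
  apply (rule spec_le, rule wp_Seq[where A = "\<lambda>q. \<forall>v. I 0 (set_reg 32 v q)"], simp)
  apply (use fx fxb y0 in \<open>auto simp: I_def intro!: exI[of _ "\<lambda>_. 0"] exI[of _ fx]\<close>)[1]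
  apply (rule spec_loop[where n = n and I = I])
  apply (simp_all add: nm_le)[4]
  apply blast
  apply (simp add: I_def frame_def mp; fail)
  apply (rule wp_spec, simp)
  apply (rule step; assumption)
  apply (erule fin)
  apply (use n_pos in simp)
  done
qed

text \<open>Shared by the targets, the objective and the coordinates, hence the summand
  \<open>e\<close> as a parameter. The charge grows by one bit per summand because only the
  accumulator is carried over.\<close>

lemma dot_loop_spec:
 assumes p: "mem p" and regs: "30 \<le> l" "l \<le> r" "l \<le> i" "r < 100" "i < 100" "i \<noteq> r" "\<rho> < l"
  and row: "rv p \<rho> = int ri" "ri < M" and r0: "rv p r = 0"
  and e: "wfe e" "szn e = 1" "cost e \<le> 5"
  and w: "\<And>q j. frame l {} {} p q \<Longrightarrow> rv q i = int j \<Longrightarrow> j < n \<Longrightarrow> fst (ev q e) = w j \<and> snd (ev q e) \<le> a0 + 1"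
 shows "spec (loop i xn (blk (AsgS r (V r +. Ix aT (V \<rho> *. V xn +. V i) *. e)))) p (20 * n)
  (\<lambda>q. frame l {} {} p q \<and> rv q r = (\<Sum>j<n. T ri j * w j) \<and> snd (reg q r) \<le> 2 * a0 + 1 + n)"
proof -
 note mp = memD[OF p]
 define I where "I k q = (frame l {} {} p q \<and> rv q r = (\<Sum>j<k. T ri j * w j) \<and> (0 < k \<longrightarrow> snd (reg q r) \<le> 2 * a0 + 1 + k))" for k q
 have step: "wp (AsgS r (V r +. Ix aT (V \<rho> *. V xn +. V i) *. e)) (\<lambda>q'. rv q' i = int k \<and> (\<forall>x. I (Suc k) (set_reg i x q'))) q"
  if k: "k < n" and q: "I k q" "wfs q" "rv q i = int k" for k q
 proof -
  have fr: "frame l {} {} p q" using q by (simp add: I_def)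
  have f: "rv q xn = int n" "rv q \<rho> = int ri" "arr q aT = arr p aT"
   using fr regs row mp by (simp_all add: frame_def)
  have T: "av p aT (int ri * int n + int k) = T ri k" using mp row k by simp
  have Ts: "snd (arr p aT (int ri * int n + int k)) \<le> a0"
   using wfs_T_size[OF q(2), of ri k] T row k by (simp add: f)
  have rs: "snd (reg q r) \<le> 2 * a0 + 1 + k"
  proof (cases "k = 0")
   case True
   then have "rv q r = 0" using q by (simp add: I_def)
   then have "snd (reg q r) \<le> a0" using wfs_reg_size[OF q(2) regs(4)] TB_nonneg by simp
   then show ?thesis by simp
  qed (use q in \<open>simp add: I_def\<close>)
  note we = w[OF fr q(3) k]
  let ?v = "ev q (V r +. Ix aT (V \<rho> *. V xn +. V i) *. e)"
  have v: "fst ?v = (\<Sum>j<Suc k. T ri j * w j)" using q we T by (simp add: I_def f)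
  have "snd ?v \<le> max (snd (reg q r)) (snd (arr p aT (int ri * int n + int k)) + snd (ev q e)) + 1"
   by (auto simp: snd_binop_cell f q(3) max_def min_def)
  then have sv: "snd ?v \<le> 2 * a0 + 1 + Suc k" using rs Ts we by linarith
  have "I (Suc k) (set_reg i x (set_reg r ?v q))" for x
   unfolding I_def using fr v sv regs by simp
  then show ?thesis using sv a_big k q(3) regs by (simp del: ev.simps)
 qed
 show ?thesis
  apply (rule spec_le, rule spec_loop[where n = n and I = I])
      apply (use regs in simp_all)[3]
    apply (rule nm_le)
    apply (use r0 regs in \<open>simp add: I_def; fail\<close>)
   apply (use regs in \<open>simp add: I_def frame_def mp; fail\<close>)
   apply (rule spec_blk[where T = 10])
    apply (use regs e in \<open>simp; fail\<close>)
   apply (rule step; assumption)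
   apply (use e in \<open>simp; fail\<close>)
  apply (use n_pos in \<open>simp add: I_def\<close>)
  apply (use n_pos in simp)
  done
qed

section \<open>Integer points from slack vectors\<close>

definition dots :: "nat \<Rightarrow> (nat \<Rightarrow> int) \<Rightarrow> int" where
 "dots i u = (\<Sum>j<n. T i j * u j)"

lemma dot_row_low: "i < m \<Longrightarrow> rw i < s \<Longrightarrow> dot n (row_vec rw i) z = z (rw i)"
 and dot_row_unit: "m \<le> i \<Longrightarrow> i < K \<Longrightarrow> dot n (row_vec rw i) z = z (s + i - m)"
 and dot_col_low: "j < n \<Longrightarrow> f j < s \<Longrightarrow> dot n (h (f j)) z = z (f j)"
proof -
 have un: "dot n (\<lambda>l. if l = x then 1 else 0) z = z x" if "x < n" for x
  using that by (simp add: dot_def if_distrib if_distribR cong: if_cong)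
 have uh: "dot n (h x) z = z x" if "x < s" for x
 proof -
  have "dot n (h x) z = dot n (\<lambda>l. if l = x then 1 else 0) z" unfolding dot_def
   using unit_rows[OF that] by (intro sum.cong) auto
  then show ?thesis using un[of x] that s_le by simp
 qed
 show "i < m \<Longrightarrow> rw i < s \<Longrightarrow> dot n (row_vec rw i) z = z (rw i)" by (simp add: row_vec_def uh)
 show "j < n \<Longrightarrow> f j < s \<Longrightarrow> dot n (h (f j)) z = z (f j)" by (simp add: uh)
 show "dot n (row_vec rw i) z = z (s + i - m)" if "m \<le> i" "i < K"
 proof -
  have "s + i - m < n" using that by (simp add: K_def)
  then show ?thesis using that by (simp add: row_vec_def un)
 qed
qed

text \<open>The combination \<open>z'\<close> of the edge directions takes the values \<delta> times
  \<open>u\<close> on the basis. Each of its coordinates is the value of a unit row, either basic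
  and equal to a multiple of \<delta>, or in the tableau and divisible by assumption. So
  \<open>z'\<close> can be divided by \<delta>.\<close>

lemma int_solution:
 assumes dvd: "\<And>i. i < K \<Longrightarrow> \<delta> dvd dots i u"
 shows "\<exists>z. (\<forall>j<n. dot n (h (f j)) z = u j) \<and> (\<forall>i<M. \<delta> * dot n (row_vec rw i) z = dots i u)"
proof -
 have D: "\<bar>\<delta>\<bar> = \<bar>bdet n h f\<bar>" "\<delta> \<noteq> 0" using tabl delta_pos by (auto simp: tabl_def)
 obtain v where v: "\<And>k. k < n \<Longrightarrow> (\<forall>j<n. dot n (h (f j)) (v k) = (if j = k then \<delta> else 0)) \<and>
  (\<forall>r T. tab_row n h f \<delta> r T \<longrightarrow> dot n r (v k) = T k)"
  using tab_row_dual[OF D] by metis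
 define z' where "z' l = (\<Sum>k<n. u k * v k l)" for l
 have dz: "dot n r z' = (\<Sum>k<n. u k * dot n r (v k))" for r
 proof -
  have "dot n r z' = (\<Sum>l<n. \<Sum>k<n. u k * (r l * v k l))"
   by (simp add: dot_def z'_def sum_distrib_left mult.left_commute)
  also have "\<dots> = (\<Sum>k<n. \<Sum>l<n. u k * (r l * v k l))" by (rule sum.swap)
  finally show ?thesis by (simp add: dot_def sum_distrib_left)
 qed
 have rows: "tab_row n h f \<delta> (row_vec rw i) (T i)" if "i < M" for i using tabl that by (simp add: tabl_def)
 have dr: "dot n (row_vec rw i) z' = dots i u" if "i < M" for i
  unfolding dz dots_def using v rows[OF that] by (intro sum.cong) (auto simp: mult.commute)
 have dc: "dot n (h (f j)) z' = \<delta> * u j" if "j < n" for j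
 proof -
  have "dot n (h (f j)) z' = (\<Sum>k<n. if k = j then \<delta> * u j else 0)"
   unfolding dz using v that by (intro sum.cong) auto
  then show ?thesis using that by simp
 qed
 have dv: "\<delta> dvd z' l" if l: "l < n" for l
 proof (cases "l < s")
  case True
  then have "l < d" using s_le by (simp add: d_def)
  then have "(\<exists>j<n. f j = l) \<or> (\<exists>i<m. rw i = l)" using tabl by (simp add: tabl_def)
  then show ?thesis
  proof
   assume "\<exists>j<n. f j = l"
   then obtain j where "j < n" "f j = l" by blast
   then have "z' l = \<delta> * u j" using dc[of j] dot_col_low[of j z'] True by simp
   then show ?thesis by simp
  next
   assume "\<exists>i<m. rw i = l"
   then obtain i where i: "i < m" "rw i = l" by blast
   then have "z' l = dots i u" using dr[OF KM(2)[OF i(1)]] dot_row_low[OF i(1), of z'] True by simp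
   then show ?thesis using dvd[OF KM(3)[OF i(1)]] by simp
  qed
 next
  case False
  define i where "i = m + (l - s)"
  have i: "m \<le> i" "i < K" "s + i - m = l" using False l by (auto simp: i_def K_def)
  then have "z' l = dots i u" using dr[OF KM(4)[OF i(2)]] dot_row_unit[OF i(1,2), of z'] by simp
  then show ?thesis using dvd[OF i(2)] by simp
 qed
 define z where "z l = z' l div \<delta>" for l
 have zd: "\<delta> * dot n r z = dot n r z'" for r
  unfolding dot_def sum_distrib_left using dv by (intro sum.cong) (auto simp: z_def dvd_def)
 have "dot n (h (f j)) z = u j" if "j < n" for j using zd[of "h (f j)"] dc[OF that] D by simp
 then show ?thesis using zd dr by (intro exI[of _ z] conjI allI impI) simp_all
qed

definition umem :: "state \<Rightarrow> (nat \<Rightarrow> int) \<Rightarrow> bool" where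
 "umem p u = ((\<forall>l<n. av p au (int l) = u l \<and> snd (arr p au (int l)) \<le> a0 + 1))"

lemma write_solution_spec:
 assumes p: "mem p" and u: "umem p u"
  and z: "\<And>j. j < n \<Longrightarrow> dot n (h (f j)) z = u j" "\<And>i. i < M \<Longrightarrow> \<delta> * dot n (row_vec rw i) z = dots i u"
 shows "spec write_solution p (100 * n * (K + 1)) (\<lambda>q. frame 32 {} {az} p q \<and> (\<forall>l<n. av q az (int l) = z l))"
proof -
 note mp = memD[OF p]
 define I where "I k q = (frame 32 {} {az} p q \<and> (\<forall>j<k. f j < s \<longrightarrow> av q az (int (f j)) = z (f j)))" for k q
 define J where "J k q = (I n q \<and> (\<forall>i<k. (i < m \<longrightarrow> rw i < s \<longrightarrow> av q az (int (rw i)) = z (rw i)) \<and>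
   (m \<le> i \<longrightarrow> av q az (int (s + i - m)) = z (s + i - m))))" for k q
 have step: "wp (If (V xs -. Ix acol (V 32)) (StoS az (Ix acol (V 32)) (Ix au (V 32))) Nop)
  (\<lambda>q'. rv q' 32 = int k \<and> (\<forall>x. I (Suc k) (set_reg 32 x q'))) q" if k: "k < n" and q: "I k q" "rv q 32 = int k" for k q
 proof -
  have fr: "frame 32 {} {az} p q" using q by (simp add: I_def)
  note f' = frame_reg[OF fr] frame_arr[OF fr]
  have uk: "av p au (int k) = u k" "snd (arr p au (int k)) \<le> a" using u k a_big by (auto simp: umem_def)
  have "z (f k) = u k" if "f k < s" using z(1)[OF k] dot_col_low[OF k that] by simp
  then show ?thesis using q uk k by (auto simp: f' mp I_def less_Suc_eq)
 qed
 have row: "spec write_row q (1 + (20 * n + 20)) (\<lambda>q'. rv q' 32 = int k \<and> (\<forall>x. J (Suc k) (set_reg 32 x q')))"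
  if k: "k < K" and q: "J k q" "rv q 32 = int k" for k q
 proof -
  have kM: "k < M" using k KM by simp
  have fr: "frame 32 {} {az} p q" using q by (simp add: J_def I_def)
  note f' = frame_reg[OF fr] frame_arr[OF fr]
  have A: "mem q'" "umem q' u" "rv q' 32 = int k" if "frame 33 {} {} q q'" for q'
  proof -
   show "mem q'" by (rule mem_frame[OF p, where l = 22 and X = "{}" and Y = "{az}"]) (use fr that in \<open>auto simp: frame_def\<close>)
   show "umem q' u" "rv q' 32 = int k" using u fr q that by (simp_all add: umem_def frame_def)
  qed
  have fin: "wp put_entry (\<lambda>q'. rv q' 32 = int k \<and> (\<forall>x. J (Suc k) (set_reg 32 x q'))) q2"
   if q2: "frame 33 {} {} q q2" "rv q2 33 = dots k u" "snd (reg q2 33) \<le> 2 * a0 + 1 + n" for q2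
  proof -
   note f2 = frame_reg[OF q2(1)] frame_arr[OF q2(1)]
   have mq2: "mem q2" "rv q2 32 = int k" using A[OF q2(1)] by auto
   note mq = memD[OF mq2(1)]
   let ?v = "binop_cell ODiv (reg q2 33) (reg q2 xdel)"
   have val: "dots k u div \<delta> = dot n (row_vec rw k) z" using z(2)[OF kM] delta_pos by (metis nonzero_mult_div_cancel_left less_irrefl)
   have sz: "snd ?v \<le> a" if "wfs q2"
   proof -
    have "snd (reg q2 xdel) \<le> a0" using wfs_reg_size[OF that, of xdel] mq delta_TB delta_pos by simp
    then have "snd ?v \<le> (2 * a0 + 1 + n) + a0" using q2(3) by (simp add: snd_binop_cell)
    then show ?thesis using a_big by simp
   qed
   have v: "fst ?v = dot n (row_vec rw k) z" using q2(2) mq val by simp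
   have Jq2: "frame 32 {} {az} p q2" "I n q2" "J k q2"
    using q q2(1) by (auto simp: J_def I_def frame_def)
   consider (low) "k < m" "rw k < s" | (high) "k < m" "\<not> rw k < s" | (unit) "m \<le> k" by linarith
   then show ?thesis
   proof cases
    case low
    then have "fst ?v = z (rw k)" using v dot_row_low by simp
    then show ?thesis using low Jq2 sz mq2 by (auto simp: put_entry_def mq J_def I_def less_Suc_eq)
   next
    case high
    then show ?thesis using Jq2 sz mq2 by (auto simp: put_entry_def mq J_def I_def less_Suc_eq)
   next
    case unit
    then have "fst ?v = z (s + k - m)" using v dot_row_unit k by simp
    moreover have "int s + int k - int m = int (s + k - m)" using unit by simp
    ultimately show ?thesis using unit Jq2 sz mq2 by (auto simp: put_entry_def mq J_def I_def less_Suc_eq simp del: of_nat_diff)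
   qed
  qed
  show ?thesis
   unfolding write_row_def
   apply (rule spec_le, rule wp_Seq[where A = "\<lambda>q'. frame 33 {} {} q q' \<and> rv q' 33 = 0"], simp)
   apply (use Bd_ge in \<open>simp; fail\<close>)
   apply (rule spec_Seq_mid, rule dot_loop_spec[where l = 33 and ri = k and w = u])
   apply (use A in \<open>simp; fail\<close>)
   apply (simp_all add: A kM)[13]
   subgoal for q1 q2 j
    using A(2)[of q2] unfolding umem_def by (simp add: frame_def)
   apply (rule wp_spec, simp add: put_entry_def, rule fin)
   apply (simp add: frame_def; fail)
   apply (simp add: dots_def; fail)
   apply simp
   apply (simp add: put_entry_def)
   done
 qed
 have fin: "frame 32 {} {az} p q \<and> (\<forall>l<n. av q az (int l) = z l)" if q: "J K q" for q
 proof (intro conjI allI impI)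
  show "frame 32 {} {az} p q" using q by (simp add: J_def I_def)
  fix l assume l: "l < n"
  show "av q az (int l) = z l"
  proof (cases "l < s")
   case True
   then have "l < d" using s_le by (simp add: d_def)
   then have "(\<exists>j<n. f j = l) \<or> (\<exists>i<m. rw i = l)" using tabl by (simp add: tabl_def)
   then show ?thesis using q True KM(3) by (auto simp: J_def I_def)
  next
   case False
   then have "m + (l - s) < K" "s + (m + (l - s)) - m = l" using l by (auto simp: K_def)
   then show ?thesis using q unfolding J_def by (metis le_add1)
  qed
 qed
 show ?thesis
  unfolding write_solution_def
  apply (rule spec_le, rule spec_loop_Seq[where n = n and I = I])
  apply (simp_all add: nm_le)[4]
  apply (simp add: I_def; fail)
  apply (simp add: I_def frame_def mp; fail)
  apply (rule wp_spec, simp)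
  apply (rule step; assumption)
  apply (rule spec_loop[where n = K and I = J])
  apply (simp_all add: K_le)[4]
  apply (simp add: J_def I_def; fail)
  apply (simp add: J_def I_def frame_def mp; fail)
  apply (rule row; assumption)
  apply (rule fin, assumption)
  apply (use n_pos in \<open>cases n; simp add: algebra_simps\<close>)
  done
qed

lemma objective_spec:
 assumes p: "mem p" and u: "umem p u"
  and z: "\<And>i. i < M \<Longrightarrow> \<delta> * dot n (row_vec rw i) z = dots i u"
 shows "spec objective p (20 * n + 10) (\<lambda>q. frame 31 {} {} p q \<and> rv q 31 = dot n c z \<and> snd (reg q 31) \<le> 3 * a0 + 1 + n)"
proof -
 note mp = memD[OF p]
 have A: "mem q" "umem q u" if "frame 31 {} {} p q" for q
 proof -
  show "mem q" using mem_frame[OF p that] by simp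
  show "umem q u" using u that by (simp add: umem_def frame_def)
 qed
 have KM': "K < M" using KM by simp
 have cz: "dots K u div \<delta> = dot n c z"
  using z[OF KM'] delta_pos by (metis nonzero_mult_div_cancel_left less_irrefl row_vec_def not_less_iff_gr_or_eq KM(3))
 show ?thesis
  unfolding objective_def
  apply (rule spec_le, rule wp_Seq[where A = "\<lambda>q'. frame 31 {} {} p q' \<and> rv q' 31 = 0"], simp)
  apply (use Bd_ge in \<open>simp; fail\<close>)
  apply (rule spec_Seq_mid, rule dot_loop_spec[where l = 31 and ri = K and w = u])
  apply (use A in \<open>simp; fail\<close>)
  apply (simp_all add: KM')[7]
  apply (simp add: mp frame_def; fail)
  apply (simp_all add: KM')[5]
  subgoal for q1 q2 j
   using A(2)[of q2] unfolding umem_def by (simp add: frame_def)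
  apply (rule wp_spec, simp)
  subgoal for q1 q2
  proof -
   assume "frame 31 {} {} p q1 \<and> rv q1 31 = 0"
    and q2: "frame 31 {} {} q1 q2 \<and> rv q2 31 = (\<Sum>j<n. T K j * u j) \<and> snd (reg q2 31) \<le> 2 * a0 + 1 + n"
   then have fr: "frame 31 {} {} p q2" by (simp add: frame_def)
   note mq = memD[OF A(1)[OF fr]]
   let ?v = "binop_cell ODiv (reg q2 31) (reg q2 xdel)"
   have sz: "snd ?v \<le> 3 * a0 + 1 + n" if "wfs q2"
   proof -
    have "snd (reg q2 xdel) \<le> a0" using wfs_reg_size[OF that, of xdel] mq delta_TB delta_pos by simp
    moreover have "snd ?v \<le> snd (reg q2 31) + snd (reg q2 xdel)" by (simp add: snd_binop_cell)
    ultimately show ?thesis using q2 by linarith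
   qed
   then have sza: "snd ?v \<le> a" if "wfs q2" using a_big that by fastforce
   have "fst ?v = dot n c z" using q2 cz by (simp add: mq dots_def)
   then show ?thesis using sz sza fr by simp
  qed
  apply simp
  done
qed

lemma finish_spec:
 assumes p: "mem p" and u: "umem p u"
  and z: "\<And>j. j < n \<Longrightarrow> dot n (h (f j)) z = u j" "\<And>i. i < M \<Longrightarrow> \<delta> * dot n (row_vec rw i) z = dots i u"
  and fe: "rv p xfeas = 0 \<or> rv p xfeas = 1"
 shows "spec finish p (300 * n * (K + 1)) (\<lambda>q. frame 31 {xfeas, xbest} {az} p q \<and>
  (if rv p xfeas = 1 \<and> dot n c z \<le> rv p xbest
   then reg q xfeas = reg p xfeas \<and> reg q xbest = reg p xbest \<and> arr q az = arr p az
   else rv q xfeas = 1 \<and> rv q xbest = dot n c z \<and> (\<forall>l<n. av q az (int l) = z l)))" (is "spec _ _ _ ?P")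
proof -
 define A where "A q = (frame 31 {} {} p q \<and> rv q 31 = dot n c z \<and> snd (reg q 31) \<le> 3 * a0 + 1 + n)" for q
 define E where "E q = (frame 31 {xfeas, xbest} {} p q \<and> rv q xfeas = 1 \<and> rv q xbest = dot n c z)" for q
 have take: "spec (blk (AsgS xbest (V 31 +. N 0) ;. xfeas ::= N 1) ;; write_solution) q (5 + 100 * n * (K + 1)) ?P"
  if q: "A q" "\<not> (rv p xfeas = 1 \<and> dot n c z \<le> rv p xbest)" for q
 proof -
  have sz: "snd (binop_cell OAdd (reg q 31) (exact_cell 0)) \<le> a"
  proof -
   have "snd (binop_cell OAdd (reg q 31) (exact_cell 0)) \<le> max (snd (reg q 31)) (int_size 0) + 1"
    by (simp add: snd_binop_cell)
   moreover have "snd (reg q 31) \<le> 3 * a0 + 1 + n" "int_size 0 \<le> a0" using q(1) a0[of 0] TB_nonneg by (simp_all add: A_def)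
   ultimately show ?thesis using a_big by linarith
  qed
  show ?thesis
   apply (rule spec_le, rule spec_Seq_mid[where A = E], rule wp_spec, simp)
   apply (use q(1) sz Bd_ge in \<open>simp add: A_def E_def frame_def\<close>)
   apply (rule spec_conseq, rule write_solution_spec[where z = z and u = u])
   subgoal for q1
    by (rule mem_frame[OF p, where l = 22 and X = "{xfeas, xbest}" and Y = "{}"]) (auto simp: E_def frame_def)
   subgoal for q1
    using u by (simp add: E_def umem_def frame_def)
   apply (rule z, assumption, rule z, assumption)
   subgoal for q1 q2
    using q(2) by (auto simp: E_def frame_def)
   apply simp
   done
 qed
 have skip: "?P q" if "A q" "rv p xfeas = 1" "dot n c z \<le> rv p xbest" for q
  using that by (simp add: A_def frame_def)
 show ?thesis
  unfolding finish_def
  apply (rule spec_le, rule spec_Seq_mid[where A = A], rule spec_conseq[OF objective_spec[OF p u z(2)]])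
  apply assumption
  apply (simp add: A_def)
  apply (rule spec_cif)
  apply simp
  apply (rule take, assumption)
  apply (simp add: A_def frame_def; fail)
  apply (rule spec_cif)
  apply simp
  apply (rule take, assumption)
  apply (simp add: A_def frame_def; fail)
  apply (rule spec_Skip, rule skip, assumption)
  apply (use fe in \<open>auto simp: A_def frame_def\<close>)[1]
  apply (simp add: A_def frame_def)
  apply (use n_pos in \<open>cases n; simp add: algebra_simps\<close>)
  done
qed

lemma prep_spec:
 assumes p: "mem p" "rv p xD = int D" "grp_mem p cnt 0 cnt G Sb"
 shows "spec prep p (200 * n * (m + 1)) (\<lambda>q. frame 30 {xW, xS} {aoff} p q \<and> pmem q)"
proof -
 note mp = memD[OF p(1)]
 have cnt: "rv p xcnt = int cnt" using p(3) by (simp add: grp_mem_def)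
 define A where "A k q = (frame 30 {xW, xS} {} p q \<and> rv q xW = int Wd \<and> rv q xS = int (cnt * Wd ^ k))" for k q
 define I where "I k q = (frame 30 {xW, xS} {aoff} p q \<and> rv q xW = int Wd \<and> rv q xS = int S \<and>
  (\<forall>i<k. av q aoff (int i) = off i))" for k q
 have Wd: "(int D - 1) * int n * int D + 1 = int Wd" using D_pos by (simp add: Wd_eq of_nat_diff)
 have Sb: "int cnt * int Wd ^ Suc k \<le> Bd" if "k < m" for k
 proof -
  have "Wd ^ Suc k \<le> Wd ^ m" using pos that by (intro power_increasing) auto
  then have "cnt * Wd ^ Suc k \<le> S" by (simp add: S_eq)
  from nat_le_Bd[OF this] show ?thesis by simp
 qed
 have part: "0 \<le> (int D - 1) * (\<Sum>j<k. max 0 (- T i j))" "(int D - 1) * (\<Sum>j<k. max 0 (- T i j)) \<le> Bd" if "i < m" "k \<le> n" for i k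
 proof -
  show "0 \<le> (int D - 1) * (\<Sum>j<k. max 0 (- T i j))" using D_pos by (intro mult_nonneg_nonneg sum_nonneg) auto
  have "(\<Sum>j<k. max 0 (- T i j)) \<le> (\<Sum>j<n. max 0 (- T i j))" using that by (intro sum_mono2) auto
  then have "(int D - 1) * (\<Sum>j<k. max 0 (- T i j)) \<le> off i" unfolding off_eq using D_pos by (intro mult_left_mono) auto
  then show "(int D - 1) * (\<Sum>j<k. max 0 (- T i j)) \<le> Bd" using off_bounds[OF that(1)] bounds by linarith
 qed
 have row: "spec offset_row q (40 * n + 5) (\<lambda>q'. rv q' 30 = int i \<and> (\<forall>x. I (Suc i) (set_reg 30 x q')))"
  if i: "i < m" and q: "I i q" "rv q 30 = int i" for i q
 proof -
  have fr: "frame 30 {xW, xS} {aoff} p q" using q by (simp add: I_def)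
  note f' = frame_reg[OF fr] frame_arr[OF fr]
  define J where "J k q' = (frame 31 {} {} q q' \<and> rv q' 31 = (int D - 1) * (\<Sum>j<k. max 0 (- T i j)))" for k q'
  have step: "wp (If (N 0 -. Ix aT (V 30 *. V xn +. V 32))
    (31 ::= V 31 -. (V xD -. N 1) *. Ix aT (V 30 *. V xn +. V 32)) Nop)
    (\<lambda>q''. rv q'' 32 = int k \<and> (\<forall>x. J (Suc k) (set_reg 32 x q''))) q'"
   if k: "k < n" and q': "J k q'" "rv q' 32 = int k" for k q'
  proof -
   have fr': "frame 31 {} {} q q'" using q' by (simp add: J_def)
   note f2 = frame_reg[OF fr'] frame_arr[OF fr']
   have T: "av p aT (int i * int n + int k) = T i k" using mp KM(2)[OF i] k by simp
   have S: "(int D - 1) * (\<Sum>j<Suc k. max 0 (- T i j)) = (int D - 1) * (\<Sum>j<k. max 0 (- T i j)) + (int D - 1) * max 0 (- T i k)"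
    by (simp add: distrib_left)
   show ?thesis
    using q' part[OF i, of "Suc k"] k
    by (auto simp: f2 f' mp p q T J_def S simp del: sum.lessThan_Suc)
  qed
  show ?thesis
   unfolding offset_row_def
   apply (rule spec_le, rule wp_Seq[where A = "J 0"], simp)
   apply (use Bd_ge in \<open>simp add: J_def\<close>)
   apply (rule spec_loop_Seq[where n = n and I = J])
   apply (simp_all add: nm_le)[4]
   apply (simp add: J_def; fail)
   apply (simp add: J_def frame_def f' mp; fail)
   apply (rule wp_spec, simp)
   apply (rule step; assumption)
   apply (rule wp_spec, simp)
   apply (use q in \<open>auto simp: J_def I_def frame_def less_Suc_eq off_eq\<close>)[1]
   apply (use n_pos in simp)
   done
 qed
 have fin: "frame 30 {xW, xS} {aoff} p q \<and> pmem q" if q: "I m q" for q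
 proof -
  have fr: "frame 30 {xW, xS} {aoff} p q" using q by (simp add: I_def)
  have "mem q" using mem_frame[OF p(1) fr] by simp
  moreover have "grp_mem q cnt 0 cnt G Sb" using p(3) fr by (simp add: grp_mem_def frame_def)
  ultimately show ?thesis using q p(2) fr by (simp add: pmem_def I_def frame_def)
 qed
 show ?thesis
  unfolding prep_def
  apply (rule spec_le, rule wp_Seq[where A = "A 0"], simp)
  apply (use bounds Wd in \<open>simp add: A_def mp p cnt\<close>)
  apply (rule spec_loop_Seq[where n = m and I = A])
  apply (simp_all add: nm_le)[4]
  apply (simp add: A_def; fail)
  apply (simp add: A_def frame_def mp; fail)
  apply (rule wp_spec, simp)
  subgoal for q1 k q
   using Sb[of k] by (simp add: A_def mult_ac)
  apply (rule spec_loop[where n = m and I = I])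
  apply (simp_all add: nm_le)[4]
  apply (simp add: A_def I_def S_eq frame_def; fail)
  apply (simp add: I_def frame_def mp; fail)
  apply (rule row; assumption)
  apply (erule fin)
  apply (use n_pos in \<open>cases n; simp add: algebra_simps\<close>)
  done
qed

lemma targets_spec:
 assumes p: "pmem p" and b: "bmem p"
 shows "spec targets p (300 * n * (K + 1) * (cnt + 1)) (\<lambda>q. frame 30 {xgs} {atau, aV, arho} p q \<and>
  (\<exists>gs<cnt. rv q xgs = int gs \<and> (\<forall>i<K. G gs i = hsh (\<lambda>j. b (f j)) i)) \<and>
  (\<forall>i<m. av q arho (int i) = dots i (\<lambda>j. b (f j)) - \<delta> * b (rw i)))" (is "spec _ _ _ ?P")
proof -
 have pm: "mem p" using p by (simp add: pmem_def)
 note mp = pmemD[OF p]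
 define bf where "bf = (\<lambda>j. b (f j))"
 define I where "I k q = (frame 30 {} {atau, aV} p q \<and> (\<forall>i<k. av q atau (int i) = dots i bf \<and>
  snd (arr q atau (int i)) \<le> 2 * a0 + 1 + n \<and> av q aV (int i) = hsh bf i))" for k q
 define J where "J k q = (frame 30 {} {atau, aV, arho} p q \<and> (\<forall>i<K. av q atau (int i) = dots i bf \<and>
  snd (arr q atau (int i)) \<le> 2 * a0 + 1 + n \<and> av q aV (int i) = hsh bf i) \<and>
  (\<forall>i<k. av q arho (int i) = dots i bf - \<delta> * b (rw i)))" for k q
 have row: "spec target_row q (20 * n + 10)
   (\<lambda>q'. rv q' 30 = int k \<and> (\<forall>x. I (Suc k) (set_reg 30 x q')))" if k: "k < K" and q: "I k q" "rv q 30 = int k" for k q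
 proof -
  have fr: "frame 30 {} {atau, aV} p q" using q by (simp add: I_def)
  have A: "mem q'" "bmem q'" "rv q' 30 = int k" "frame 30 {} {atau, aV} p q'" if "frame 31 {} {} q q'" for q'
  proof -
   show "mem q'" by (rule mem_frame[OF pm, where l = 22 and X = "{}" and Y = "{atau, aV}"]) (use fr that in \<open>auto simp: frame_def\<close>)
   show "bmem q'" "rv q' 30 = int k" "frame 30 {} {atau, aV} p q'" using b fr q that by (simp_all add: bmem_def frame_def)
  qed
  have kM: "k < M" using k KM by simp
  have fin: "wp (StoS atau (V 30) (V 31) ;. Sto aV (V 30) (V 31 mod. V xdel))
    (\<lambda>q'. rv q' 30 = int k \<and> (\<forall>x. I (Suc k) (set_reg 30 x q'))) q2"
   if q2: "frame 31 {} {} q q2" "rv q2 31 = dots k bf" "snd (reg q2 31) \<le> 2 * a0 + 1 + n" for q2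
  proof -
   note mq = memD[OF A(1)[OF q2(1)]]
   have h: "dots k bf mod \<delta> = hsh bf k" by (simp add: hsh_def dots_def)
   have hb: "\<bar>hsh bf k\<bar> \<le> Bd" using delta_pos delta_b pos_mod_bound[OF delta_pos, of "dots k bf"] pos_mod_sign[OF delta_pos, of "dots k bf"]
    unfolding h by linarith
   have "I k q2" using q q2(1) by (simp add: I_def frame_def)
   then show ?thesis
    using q2 A(3)[OF q2(1)] hb a_big by (auto simp: I_def mq h less_Suc_eq)
  qed
  show ?thesis
   unfolding target_row_def
   apply (rule spec_le, rule wp_Seq[where A = "\<lambda>q'. frame 31 {} {} q q' \<and> rv q' 31 = 0"], simp)
   apply (use Bd_ge in \<open>simp; fail\<close>)
   apply (rule spec_Seq_mid, rule dot_loop_spec[where l = 31 and ri = k and w = bf])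
   apply (use A in \<open>simp; fail\<close>)
   apply (simp_all add: A kM)[13]
   subgoal for q1 q2 j
   proof -
    assume "frame 31 {} {} q q1 \<and> rv q1 31 = 0" "frame 31 {} {} q1 q2" and j: "rv q2 32 = int j" "j < n"
    then have fq: "frame 31 {} {} q q2" by (simp add: frame_def)
    show ?thesis using A(2)[OF fq] memD(9)[OF A(1)[OF fq] j(2)] A(2)[OF fq, unfolded bmem_def, rule_format, OF f_lt[OF j(2)]] f_lt[OF j(2)] j a0_pos by (simp add: bf_def)
   qed
   apply (rule wp_spec, simp, rule fin)
   apply (simp add: frame_def; fail)
   apply (simp add: dots_def; fail)
   apply simp
   apply simp
   done
 qed
 have rho: "wp (StoS arho (V 30) (Ix atau (V 30) -. V xdel *. Ix ab (Ix arow (V 30))))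
   (\<lambda>q'. rv q' 30 = int k \<and> (\<forall>x. J (Suc k) (set_reg 30 x q'))) q" if k: "k < m" and q: "J k q" "wfs q" "rv q 30 = int k" for k q
 proof -
  have fr: "frame 30 {} {atau, aV, arho} p q" using q by (simp add: J_def)
  have mq: "mem q" using mem_frame[OF pm fr] by simp
  note mq = memD[OF mq]
  have bq: "bmem q" using b fr by (simp add: bmem_def frame_def)
  have bk: "av q ab (int (rw k)) = b (rw k)" "snd (arr q ab (int (rw k))) \<le> 1" using bq rw_lt[OF k] by (simp_all add: bmem_def)
  have tk: "av q atau (int k) = dots k bf" "snd (arr q atau (int k)) \<le> 2 * a0 + 1 + n"
   using q KM(3)[OF k] by (simp_all add: J_def)
  have ds: "snd (reg q xdel) \<le> a0" using wfs_reg_size[OF q(2), of xdel] mq delta_TB delta_pos by simp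
  let ?w = "binop_cell OMul (reg q xdel) (arr q ab (int (rw k)))"
  let ?v = "binop_cell OSub (arr q atau (int k)) ?w"
  have "snd ?w \<le> snd (reg q xdel) + snd (arr q ab (int (rw k)))" by (simp add: snd_binop_cell)
  moreover have "snd ?v \<le> max (snd (arr q atau (int k))) (snd ?w) + 1" by (simp add: snd_binop_cell)
  ultimately have "snd ?v \<le> a" using bk tk ds a_big by linarith
  then show ?thesis using q tk bk k by (auto simp: mq J_def less_Suc_eq)
 qed
 have dn: "int cnt \<le> Bd" by (rule bounds)
 have cost: "3 + K * (20 * n + 10 + 4) + (3 + m * (1 * 50 + 4) + (30 * (cnt + 1) * (K + 1) + 50)) \<le> 300 * n * (K + 1) * (cnt + 1)"
 proof -
  define X where "X = (K + 1) * (cnt + 1)"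
  have X: "K + 1 \<le> X" by (simp add: X_def)
  have "n * (K + 1) \<le> n * X" "1 * X \<le> n * X" using X n_pos by (auto intro!: mult_le_mono simp del: mult_Suc_right)
  moreover have "m \<le> K" by (simp add: K_def)
  moreover have "3 + K * (20 * n + 10 + 4) + (3 + m * (1 * 50 + 4) + (30 * (cnt + 1) * (K + 1) + 50)) =
   20 * (n * K) + 14 * K + 54 * m + 30 * X + 56" by (simp add: X_def algebra_simps)
  moreover have "n * (K + 1) = n * K + n" "300 * n * (K + 1) * (cnt + 1) = 300 * (n * X)" by (simp_all add: X_def algebra_simps)
  ultimately show ?thesis using X n_pos by linarith
 qed
 show ?thesis
  unfolding targets_def
  apply (rule spec_le, rule spec_loop_Seq[where n = K and I = I])
  apply (simp_all add: K_le)[4]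
  apply (simp add: I_def; fail)
  apply (simp add: I_def frame_def mp; fail)
  apply (rule row; assumption)
  apply (rule spec_loop_Seq[where n = m and I = J])
  apply (simp_all add: nm_le)[4]
  apply (simp add: I_def J_def frame_def; fail)
  apply (simp add: J_def frame_def mp; fail)
  apply (rule wp_spec, simp)
  apply (rule rho; assumption)
  apply (rule spec_Seq_mid, rule find_elem_spec[where v = "hsh bf" and G = G])
  apply (simp add: J_def frame_def mp; fail)
  apply (simp add: J_def frame_def mp; fail)
  apply (rule dn)
  apply (use p in \<open>simp add: J_def frame_def pmem_def grp_mem_def; fail\<close>)
  apply (simp add: J_def; fail)
  apply (rule wp_spec, simp)
  subgoal for q1 q2 q3
  proof -
   assume J: "J m q2" and q3: "frame 41 {} {} q2 q3 \<and>
    ((\<exists>e<cnt. rv q3 41 = int e \<and> (\<forall>i<K. G e i = hsh bf i)) \<or> rv q3 41 = int cnt \<and> (\<forall>e<cnt. \<exists>i<K. G e i \<noteq> hsh bf i))"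
   \<comment> \<open>The group list is complete, so the search for the target cannot fail.\<close>
   have "\<exists>g<cnt. \<forall>i<K. G g i = hsh bf i" by (rule grp_onto[OF grp])
   then obtain e where e: "e < cnt" "rv q3 41 = int e" "\<forall>i<K. G e i = hsh bf i" using q3 by blast
   then have "int e \<le> Bd" using dn by linarith
   moreover have "frame 30 {} {atau, aV, arho} p q3" "\<forall>i<m. av q3 arho (int i) = dots i bf - \<delta> * b (rw i)"
    using J q3 by (auto simp: J_def frame_def)
   moreover from this have "frame 30 {xgs} {atau, aV, arho} p q3" by (simp add: frame_def)
   ultimately show ?thesis using e by (auto simp: bf_def[symmetric])
  qed
  apply (rule order_trans[OF _ cost])
  apply simp
  done
qed

lemma dots_diff: "dots i (\<lambda>j. u j - v j) = dots i u - dots i v"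
 by (simp add: dots_def right_diff_distrib sum_subtractf)

text \<open>Equal residues of \<open>b\<close> and of the slacks make the combined row values
  divisible by \<delta>, so \<open>int_solution\<close> applies. Nonnegative slacks give the basic
  constraints, the thresholds the nonbasic ones.\<close>

lemma scan_candidate:
 assumes gs: "\<forall>i<K. G gs i = hsh (\<lambda>j. b (f j)) i" and st: "st n y x" and x: "x mod cnt = gs"
  and rho: "\<forall>i<m. dots i (\<lambda>j. b (f j)) - \<delta> * b (rw i) \<le> dgt x i - off i"
 shows "\<exists>z. feas_pt z \<and> (\<forall>j<n. dot n (h (f j)) z = b (f j) - int (y j)) \<and>
  (\<forall>i<M. \<delta> * dot n (row_vec rw i) z = dots i (\<lambda>j. b (f j) - int (y j)))"
proof -
 have "\<delta> dvd dots i (\<lambda>j. b (f j) - int (y j))" if i: "i < K" for i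
 proof -
  have "dots i (\<lambda>j. b (f j)) mod \<delta> = dots i (\<lambda>j. int (y j)) mod \<delta>"
   using gs st x i by (simp add: st_def hsh_def dots_def)
  then show ?thesis by (simp add: dots_diff mod_eq_dvd_iff)
 qed
 then obtain z where z: "\<forall>j<n. dot n (h (f j)) z = b (f j) - int (y j)"
  "\<forall>i<M. \<delta> * dot n (row_vec rw i) z = dots i (\<lambda>j. b (f j) - int (y j))"
  using int_solution by blast
 have "dot n (h r) z \<le> b r" if r: "r < d" for r
 proof -
  have "(\<exists>j<n. f j = r) \<or> (\<exists>i<m. rw i = r)" using tabl r by (simp add: tabl_def)
  then show ?thesis
  proof
   assume "\<exists>j<n. f j = r"
   then show ?thesis using z(1) by auto
  next
   assume "\<exists>i<m. rw i = r"
   then obtain i where i: "i < m" "rw i = r" by blast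
   have "\<delta> * dot n (h r) z = dots i (\<lambda>j. b (f j)) - dots i (\<lambda>j. int (y j))"
    using z(2) i KM(2)[OF i(1)] by (auto simp: row_vec_def dots_diff)
   also have "\<dots> \<le> \<delta> * b r" using rho st i by (fastforce simp: st_def dots_def)
   finally show ?thesis using delta_pos by simp
  qed
 qed
 then show ?thesis using z unfolding feas_pt_def by blast
qed

text \<open>Conversely, for an integer point the row values of \<open>b\<close> minus slack are
  multiples of \<delta>, so its slacks reach the target group element, and its feasibility is
  exactly the threshold condition.\<close>

lemma candidate_scan:
 assumes gs: "gs < cnt" "\<forall>i<K. G gs i = hsh (\<lambda>j. b (f j)) i" and z: "feas_pt z"
  and y: "\<And>j. j < n \<Longrightarrow> y j < D \<and> int (y j) = b (f j) - dot n (h (f j)) z"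
 shows "\<exists>x. st n y x \<and> x mod cnt = gs \<and> (\<forall>i<m. dots i (\<lambda>j. b (f j)) - \<delta> * b (rw i) \<le> dgt x i - off i)"
proof -
 obtain x where x: "st n y x" using st_exists[of y n] y by auto
 have dz: "dots i (\<lambda>j. b (f j)) - dots i (\<lambda>j. int (y j)) = \<delta> * dot n (row_vec rw i) z" if "i < M" for i
 proof -
  have "tab_row n h f \<delta> (row_vec rw i) (T i)" using tabl that by (simp add: tabl_def)
  from tab_row_dot[OF this] have "\<delta> * dot n (row_vec rw i) z = dots i (\<lambda>j. b (f j) - int (y j))"
   unfolding dots_def using y by (auto intro!: sum.cong)
  then show ?thesis by (simp add: dots_diff)
 qed
 have "\<forall>i<K. G (x mod cnt) i = G gs i"
 proof (intro allI impI)
  fix i assume i: "i < K"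
  have "G (x mod cnt) i = dots i (\<lambda>j. int (y j)) mod \<delta>" using x i by (simp add: st_def dots_def)
  also have "\<dots> = dots i (\<lambda>j. b (f j)) mod \<delta>" unfolding mod_eq_dvd_iff using dz[OF KM(4)[OF i]] by (metis dvd_triv_left minus_diff_eq dvd_minus_iff)
  also have "\<dots> = G gs i" using gs i by (simp add: hsh_def dots_def)
  finally show "G (x mod cnt) i = G gs i" .
 qed
 moreover have "x mod cnt < cnt" using pos by simp
 moreover have "\<exists>i<K. G g i \<noteq> G g' i" if "g < g'" "g' < cnt" for g g' using grp that by (simp add: grp_def)
 ultimately have "x mod cnt = gs" using gs(1) by (metis linorder_neqE_nat)
 moreover have "dots i (\<lambda>j. b (f j)) - \<delta> * b (rw i) \<le> dgt x i - off i" if i: "i < m" for i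
 proof -
  have "\<delta> * dot n (h (rw i)) z \<le> \<delta> * b (rw i)" using z rw_lt[OF i] delta_pos by (simp add: feas_pt_def)
  then show ?thesis using dz[OF KM(2)[OF i]] x i by (simp add: row_vec_def st_def dots_def)
 qed
 ultimately show ?thesis using x by blast
qed

end

context basis_sizes
begin

lemma body2_spec:
 assumes p: "mem p" "rv p xD = int D" "grp_mem p cnt 0 cnt G Sb" "bmem p" "sol p"
 shows "spec body2 p (2100 * n * S * D * (K + 1)) (\<lambda>q.
  frame 30 {xW, xS, xgs, xfx, xfeas, xbest} {aoff, atau, aV, arho, aA, aY, aF, aP, au, az} p q \<and>
  improves p q \<and> (\<forall>z. cand f (int D) z \<longrightarrow> rv q xfeas = 1 \<and> dot n c z \<le> rv q xbest))" (is "spec _ _ _ ?P")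
proof -
 define bf where "bf = (\<lambda>j. b (f j))"
 define rho where "rho i = dots i bf - \<delta> * b (rw i)" for i
 define fr where "fr q = (frame 30 {xW, xS, xgs, xfx} {aoff, atau, aV, arho, aA, aY, aF, aP} p q)" for q
 define tg where "tg gs q = (gs < cnt \<and> rv q xgs = int gs \<and> (\<forall>i<K. G gs i = hsh bf i) \<and> (\<forall>i<m. av q arho (int i) = rho i))" for gs q
 have bm: "bmem q" if "fr q" for q using that p(4) by (simp add: fr_def bmem_def frame_def)
 have fin: "spec (cif (V xfx +. N 1) (backtrack ;; finish) Skip) q (50 + 100 * n + 300 * n * (K + 1)) ?P"
  if q: "fr q" "pmem q" "tblok q n" "tg gs q"
   and sc: "(rv q xfx = -1 \<and> (\<forall>x<S. \<not> scan_ok q gs rho x)) \<or>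
    (\<exists>x<S. rv q xfx = int x \<and> scan_ok q gs rho x \<and> (\<forall>x'<S. scan_ok q gs rho x' \<longrightarrow> Fv q n x \<le> Fv q n x'))"
  for q gs
 proof -
  have pq: "rv q xfeas = rv p xfeas" "rv q xbest = rv p xbest" "arr q az = arr p az"
   using q(1) by (simp_all add: fr_def frame_def)
  have gs: "gs < cnt" "\<forall>i<K. G gs i = hsh (\<lambda>j. b (f j)) i" using q(4) by (simp_all add: tg_def bf_def)
  have best: "\<exists>x<S. scan_ok q gs rho x \<and> Fv q n x \<le> (\<Sum>l<n. T K l * (b (f l) - dot n (h (f l)) z))" if z: "cand f (int D) z" for z
  proof -
   define y where "y j = nat (b (f j) - dot n (h (f j)) z)" for j
   have fz: "feas_pt z" using z by (simp add: cand_def)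
   have y: "y j < D" "int (y j) = b (f j) - dot n (h (f j)) z" if "j < n" for j
   proof -
    have "dot n (h (f j)) z \<le> b (f j)" using fz f_lt[OF that] by (simp add: feas_pt_def)
    moreover have "b (f j) - dot n (h (f j)) z < int D" using z that by (simp add: cand_def)
    ultimately show "y j < D" "int (y j) = b (f j) - dot n (h (f j)) z" by (simp_all add: y_def)
   qed
   have "\<exists>x. st n y x \<and> x mod cnt = gs \<and> (\<forall>i<m. dots i (\<lambda>j. b (f j)) - \<delta> * b (rw i) \<le> dgt x i - off i)"
    by (rule candidate_scan[OF gs fz]) (use y in auto)
   then obtain x where x: "st n y x" "x mod cnt = gs" "\<forall>i<m. rho i \<le> dgt x i - off i"
    unfolding rho_def bf_def by blast
   have t: "0 \<le> Yv q n x \<and> Fv q n x \<le> (\<Sum>l<n. T K l * int (y l))"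
    by (rule tbl_complete[OF q(3)]) (use y x in auto)
   have "x < S" using x by (simp add: st_def)
   moreover have "scan_ok q gs rho x" using t x by (simp add: scan_ok_def)
   moreover have "(\<Sum>l<n. T K l * int (y l)) = (\<Sum>l<n. T K l * (b (f l) - dot n (h (f l)) z))" using y by simp
   ultimately show ?thesis using t by auto
  qed
  \<comment> \<open>Up to the factor \<delta>, the objective is a constant minus the value in the
    table, which is why the table minimises.\<close>
  have obj: "\<delta> * dot n c z = dots K bf - (\<Sum>l<n. T K l * (b (f l) - dot n (h (f l)) z))" for z
  proof -
   have "tab_row n h f \<delta> (row_vec rw K) (T K)" using tabl KM(1) by (simp add: tabl_def)
   from tab_row_dot[OF this] have "\<delta> * dot n c z = dots K (\<lambda>j. dot n (h (f j)) z)"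
    by (simp add: row_vec_def dots_def KM K_def)
   also have "\<dots> = dots K (\<lambda>j. bf j - (b (f j) - dot n (h (f j)) z))" by (simp add: bf_def)
   also have "\<dots> = dots K bf - (\<Sum>l<n. T K l * (b (f l) - dot n (h (f l)) z))"
    by (simp add: dots_def bf_def right_diff_distrib sum_subtractf)
   finally show ?thesis .
  qed
  have step: "spec (backtrack ;; finish) q (100 * n + 300 * n * (K + 1)) ?P"
   if fx: "rv q xfx = int x" "x < S" "scan_ok q gs rho x" "\<forall>x'<S. scan_ok q gs rho x' \<longrightarrow> Fv q n x \<le> Fv q n x'" for x
  proof -
   have Y: "0 \<le> Yv q n x" "x mod cnt = gs" "\<forall>i<m. rho i \<le> dgt x i - off i" using fx(3) by (simp_all add: scan_ok_def)
   show ?thesis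
   proof (rule spec_Seq_mid[OF backtrack_spec[OF q(2) bm[OF q(1)] q(3) fx(1,2) Y(1)]])
    fix q1
    assume "frame 31 {} {au} q q1 \<and>
     (\<exists>y. (\<forall>l<n. y l < D) \<and> st n y x \<and> Fv q n x = (\<Sum>l<n. T K l * int (y l)) \<and>
       (\<forall>l<n. av q1 au (int l) = b (f l) - int (y l) \<and> snd (arr q1 au (int l)) \<le> a0 + 1))"
    then obtain y where f1: "frame 31 {} {au} q q1" and y: "st n y x" "Fv q n x = (\<Sum>l<n. T K l * int (y l))"
     "\<forall>l<n. av q1 au (int l) = b (f l) - int (y l) \<and> snd (arr q1 au (int l)) \<le> a0 + 1" by blast
    have u: "umem q1 (\<lambda>j. b (f j) - int (y j))" using y(3) by (simp add: umem_def)
    obtain z where z: "feas_pt z" "\<forall>j<n. dot n (h (f j)) z = b (f j) - int (y j)"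
     "\<forall>i<M. \<delta> * dot n (row_vec rw i) z = dots i (\<lambda>j. b (f j) - int (y j))"
     using scan_candidate[OF gs(2) y(1) Y(2)] Y(3) unfolding rho_def bf_def by blast
    have m1: "mem q1" using q(2) mem_frame[of q 31 "{}" "{au}" q1] f1 by (simp add: pmem_def)
    have q1: "rv q1 xfeas = rv p xfeas" "rv q1 xbest = rv p xbest" "arr q1 az = arr p az" using f1 pq by (simp_all add: frame_def)
    have zbest: "dot n c z' \<le> dot n c z" if z': "cand f (int D) z'" for z'
    proof -
     obtain x' where x': "x' < S" "scan_ok q gs rho x'" "Fv q n x' \<le> (\<Sum>l<n. T K l * (b (f l) - dot n (h (f l)) z'))"
      using best[OF z'] by blast
     have "(\<Sum>l<n. T K l * (b (f l) - dot n (h (f l)) z)) = (\<Sum>l<n. T K l * int (y l))" using z(2) by simp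
     also have "\<dots> \<le> (\<Sum>l<n. T K l * (b (f l) - dot n (h (f l)) z'))" using fx(4) x' y(2) by fastforce
     finally have "\<delta> * dot n c z' \<le> \<delta> * dot n c z" unfolding obj by simp
     then show ?thesis using delta_pos by simp
    qed
    have fe: "rv q1 xfeas = 0 \<or> rv q1 xfeas = 1" using p(5) q1 by (auto simp: sol_def)
    show "spec finish q1 (300 * n * (K + 1)) ?P"
    proof (rule spec_conseq[OF finish_spec[OF m1 u _ _ fe]])
     show "dot n (h (f j)) z = b (f j) - int (y j)" if "j < n" for j using z(2) that by simp
     show "\<delta> * dot n (row_vec rw i) z = dots i (\<lambda>j. b (f j) - int (y j))" if "i < M" for i using z(3) that by simp
     fix q2
     assume a: "frame 31 {xfeas, xbest} {az} q1 q2 \<and>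
      (if rv q1 xfeas = 1 \<and> dot n c z \<le> rv q1 xbest
       then reg q2 xfeas = reg q1 xfeas \<and> reg q2 xbest = reg q1 xbest \<and> arr q2 az = arr q1 az
       else rv q2 xfeas = 1 \<and> rv q2 xbest = dot n c z \<and> (\<forall>l<n. av q2 az (int l) = z l))"
     have "frame 30 {xW, xS, xgs, xfx, xfeas, xbest} {aoff, atau, aV, arho, aA, aY, aF, aP, au, az} p q2"
      using a f1 q(1) by (simp add: frame_def fr_def)
     moreover have "improves p q2 \<and> rv q2 xfeas = 1 \<and> dot n c z \<le> rv q2 xbest"
     proof (cases "rv q1 xfeas = 1 \<and> dot n c z \<le> rv q1 xbest")
      case True
      then have "reg q2 xfeas = reg q1 xfeas \<and> reg q2 xbest = reg q1 xbest \<and> arr q2 az = arr q1 az" using a by simp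
      then show ?thesis using True q1 p(5) by (simp add: improves_def sol_def)
     next
      case False
      then have e: "rv q2 xfeas = 1" "rv q2 xbest = dot n c z" "\<forall>l<n. av q2 az (int l) = z l" using a by auto
      have "feas_pt (\<lambda>l. av q2 az (int l))" using z(1) e(3) by (subst feas_pt_cong[where v = z]) auto
      moreover have "dot n c (\<lambda>l. av q2 az (int l)) = dot n c z" using e(3) by (simp add: dot_def)
      ultimately show ?thesis using e False q1 by (auto simp: improves_def sol_def)
     qed
     ultimately show "?P q2" using zbest by fastforce
    qed
   qed
  qed
  show ?thesis
   apply (rule spec_le, rule spec_cif[where ?T1.0 = "100 * n + 300 * n * (K + 1)" and ?T2.0 = 0])
   apply simp
   subgoal using sc step by auto
   apply (rule spec_Skip)
   subgoal
   proof -
    assume "fst (ev q (V xfx +. N 1)) \<le> 0"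
    then have "\<forall>x<S. \<not> scan_ok q gs rho x" using sc by auto
    then have "\<not> cand f (int D) z" for z using best by blast
    moreover have "improves p q" using p(5) pq by (simp add: improves_def sol_def)
    ultimately show ?thesis using q(1) by (simp add: fr_def frame_def)
   qed
   apply simp
   done
 qed
 have s1: "spec prep p (200 * n * (m + 1)) (\<lambda>q. fr q \<and> pmem q)"
  by (rule spec_conseq[OF prep_spec[OF p(1-3)]]) (simp add: fr_def frame_def)
 have s2: "spec targets q (300 * n * (K + 1) * (cnt + 1)) (\<lambda>q'. \<exists>gs. fr q' \<and> pmem q' \<and> tg gs q')"
  if q: "fr q \<and> pmem q" for q
 proof (rule spec_conseq[OF targets_spec])
  show "pmem q" "bmem q" using q bm by blast+
  fix q' assume q': "frame 30 {xgs} {atau, aV, arho} q q' \<and>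
   (\<exists>gs<cnt. rv q' xgs = int gs \<and> (\<forall>i<K. G gs i = hsh (\<lambda>j. b (f j)) i)) \<and>
   (\<forall>i<m. av q' arho (int i) = dots i (\<lambda>j. b (f j)) - \<delta> * b (rw i))"
  then have "pmem q'" using q pmem_frame[of q 30 "{xgs}" "{atau, aV, arho}" q'] by simp
  then show "\<exists>gs. fr q' \<and> pmem q' \<and> tg gs q'" using q q' by (auto simp: fr_def tg_def bf_def rho_def frame_def)
 qed
 have s3: "spec dp q (600 * n * S * D * (m + 1)) (\<lambda>q'. fr q' \<and> pmem q' \<and> tg gs q' \<and> tblok q' n)"
  if q: "fr q \<and> pmem q \<and> tg gs q" for q gs
 proof (rule spec_conseq[OF dp_spec[OF _ off_bounds]])
  fix q' assume q': "frame 30 {} {aA, aY, aF, aP} q q' \<and> tblok q' n"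
  then have "pmem q'" using q pmem_frame[of q 30 "{}" "{aA, aY, aF, aP}" q'] by simp
  then show "fr q' \<and> pmem q' \<and> tg gs q' \<and> tblok q' n" using q q' by (simp add: fr_def tg_def frame_def)
 qed (use q in simp)
 have s4: "spec (scan ;; cif (V xfx +. N 1) (backtrack ;; finish) Skip) q (200 * S * (m + 1) + (50 + 100 * n + 300 * n * (K + 1))) ?P"
  if q: "fr q \<and> pmem q \<and> tg gs q \<and> tblok q n" for q gs
 proof (rule spec_Seq_mid[OF scan_spec[where gs = gs and rho = rho]])
  show "pmem q" "rv q xgs = int gs" "\<forall>i<m. av q arho (int i) = rho i" using q by (simp_all add: tg_def)
  fix q' assume q': "frame 30 {xfx} {aA} q q' \<and> ((rv q' xfx = -1 \<and> (\<forall>x<S. \<not> scan_ok q gs rho x)) \<or>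
   (\<exists>x<S. rv q' xfx = int x \<and> scan_ok q gs rho x \<and> (\<forall>x'<S. scan_ok q gs rho x' \<longrightarrow> Fv q n x \<le> Fv q n x')))"
  have v: "Yv q' = Yv q" "Fv q' = Fv q" "Pv q' = Pv q" using q' by (simp_all add: frame_def Yv_def Fv_def Pv_def fun_eq_iff)
  have so: "scan_ok q' gs rho x = scan_ok q gs rho x" for x by (simp add: scan_ok_def v)
  show "spec (cif (V xfx +. N 1) (backtrack ;; finish) Skip) q' (50 + 100 * n + 300 * n * (K + 1)) ?P"
  proof (rule fin)
   show "fr q'" "tg gs q'" using q q' by (simp_all add: fr_def tg_def frame_def)
   show "pmem q'" using q q' pmem_frame[of q 30 "{xfx}" "{aA}" q'] by simp
   show "tblok q' n" using tblok_cong[of q n q'] q v by simp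
  qed (use q' in \<open>unfold so v, blast\<close>)
 qed
 show ?thesis
  unfolding body2_def
 proof (rule spec_le)
  show "spec (prep ;; targets ;; dp ;; scan ;; cif (V xfx +. N 1) (backtrack ;; finish) Skip) p
   (200 * n * (m + 1) + (300 * n * (K + 1) * (cnt + 1) + (600 * n * S * D * (m + 1) + (200 * S * (m + 1) + (50 + 100 * n + 300 * n * (K + 1)))))) ?P"
   by (rule spec_Seq_mid[OF s1], rule spec_Seq_mid[OF s2], assumption, elim exE, rule spec_Seq_mid[OF s3], assumption, rule s4)
 next
  define X where "X = n * (S * (D * (K + 1)))"
  have le: "a * (b * (c * e)) \<le> X" if "a \<le> n" "b \<le> S" "c \<le> D" "e \<le> K + 1" for a b c e
   unfolding X_def using that by (intro mult_le_mono)
  have cs: "cnt \<le> S" using pos by (simp add: S_eq)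
  have mK: "m + 1 \<le> K + 1" by (simp add: K_def)
  note n1 = n_pos[folded Suc_le_eq, unfolded One_nat_def[symmetric]]
  have S1: "1 \<le> S" using pos by simp
  have "n * (1 * (1 * (m + 1))) \<le> X" "n * (1 * (1 * (K + 1))) \<le> X" "n * (cnt * (1 * (K + 1))) \<le> X" "n * (S * (D * (m + 1))) \<le> X"
   "1 * (S * (1 * (m + 1))) \<le> X" "1 * (1 * (1 * 1)) \<le> X" "n * (1 * (1 * 1)) \<le> X"
   by (intro le; use cs mK n1 S1 D_pos in linarith)+
  moreover have "200 * n * (m + 1) = 200 * (n * (1 * (1 * (m + 1))))" "300 * n * (K + 1) = 300 * (n * (1 * (1 * (K + 1))))"
   "300 * n * (K + 1) * (cnt + 1) = 300 * (n * (cnt * (1 * (K + 1)))) + 300 * (n * (1 * (1 * (K + 1))))"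
   "600 * n * S * D * (m + 1) = 600 * (n * (S * (D * (m + 1))))" "200 * S * (m + 1) = 200 * (1 * (S * (1 * (m + 1))))"
   "2100 * n * S * D * (K + 1) = 2100 * X" by (simp_all add: X_def algebra_simps)
  ultimately show "200 * n * (m + 1) + (300 * n * (K + 1) * (cnt + 1) + (600 * n * S * D * (m + 1) + (200 * S * (m + 1) + (50 + 100 * n + 300 * n * (K + 1)))))
   \<le> 2100 * n * S * D * (K + 1)" by linarith
 qed
qed

end

section \<open>Enumeration of the row sets\<close>

text \<open>The combinatorial number system: the successor in colexicographic order has the next rank.\<close>

definition rank :: "nat \<Rightarrow> (nat \<Rightarrow> nat) \<Rightarrow> nat" where
 "rank m q = (\<Sum>i<m. q i choose Suc i)"

text \<open>The sentinel at position \<open>m\<close> bounds the largest element and lets it be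
  tested for a gap like all others.\<close>

definition inc :: "nat \<Rightarrow> nat \<Rightarrow> (nat \<Rightarrow> nat) \<Rightarrow> bool" where
 "inc m d q = ((\<forall>i<m. q i < q (Suc i)) \<and> q m = d)"

text \<open>Pascal's rule adds the strict bound for the first elements to the term of the next
  one.\<close>

lemma rank_lt: "\<forall>i<m. q i < q (Suc i) \<Longrightarrow> rank m q < q m choose m"
proof (induction m)
 case 0
 then show ?case by (simp add: rank_def)
next
 case (Suc m)
 then have "rank (Suc m) q < (q m choose m) + (q m choose Suc m)" by (simp add: rank_def)
 also have "\<dots> = Suc (q m) choose Suc m" by simp
 also have "\<dots> \<le> q (Suc m) choose Suc m" using Suc.prems by (intro binomial_right_mono) (simp add: Suc_le_eq)
 finally show ?case .
qed

text \<open>By \<open>rank_lt\<close> the largest element outweighs everything below it, so it is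
  determined by the rank; then induction.\<close>

lemma rank_inj:
 "\<forall>i<m. q i < q (Suc i) \<Longrightarrow> \<forall>i<m. p i < p (Suc i) \<Longrightarrow> rank m q = rank m p \<Longrightarrow> i < m \<Longrightarrow> q i = p i"
proof (induction m arbitrary: i)
 case (Suc m)
 have *: False if "\<forall>i<Suc m. u i < u (Suc i)" "rank (Suc m) u = rank (Suc m) v" "u m < v m" for u v :: "nat \<Rightarrow> nat"
 proof -
  have "rank (Suc m) u < (u m choose m) + (u m choose Suc m)" using rank_lt[of m u] that(1) by (simp add: rank_def)
  also have "\<dots> = Suc (u m) choose Suc m" by simp
  also have "\<dots> \<le> v m choose Suc m" using that(3) by (intro binomial_right_mono) simp
  also have "\<dots> \<le> rank (Suc m) v" by (simp add: rank_def)
  finally show False using that(2) by simp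
 qed
 have eq: "q m = p m" using *[of q p] *[of p q] Suc.prems by (metis linorder_neqE_nat)
 then have "rank m q = rank m p" using Suc.prems(3) by (simp add: rank_def)
 then show ?case using Suc.IH[of i] Suc.prems eq by (cases "i = m") auto
qed simp

text \<open>The hockey-stick identity. A run of consecutive numbers has rank one less than a
  binomial coefficient, the one that its successor contributes.\<close>

lemma rank_run: "(\<Sum>i<j. (r + i) choose Suc i) + 1 = (r + j) choose j"
 by (induction j) auto

lemma run_eq: "\<forall>i<j. q (Suc i) = Suc (q i) \<Longrightarrow> i \<le> j \<Longrightarrow> q i = q 0 + i" for q :: "nat \<Rightarrow> nat"
proof (induction i)
 case (Suc i)
 have "q (Suc i) = Suc (q i)" using Suc.prems by (meson Suc_le_lessD less_le_trans)
 moreover have "q i = q 0 + i" by (rule Suc.IH) (use Suc.prems in auto)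
 ultimately show ?case by linarith
qed simp

definition succ_seq :: "nat \<Rightarrow> (nat \<Rightarrow> nat) \<Rightarrow> nat \<Rightarrow> nat" where
 "succ_seq j q i = (if i < j then i else if i = j then Suc (q j) else q i)"

text \<open>The elements up to \<open>j\<close> form a run. Replacing the run by its successor,
  reset to 0, 1, ... below position \<open>j\<close>, raises the rank by one by
  \<open>rank_run\<close>.\<close>

lemma succ_seq:
 assumes q: "inc m d q" and j: "j < m" and run: "\<forall>i<j. q (Suc i) = Suc (q i)" and gap: "q (Suc j) \<noteq> Suc (q j)"
 shows "inc m d (succ_seq j q)" "rank m (succ_seq j q) = Suc (rank m q)"
proof -
 have qj: "q j = q 0 + j" by (rule run_eq[OF run]) simp
 have lt: "q i < q (Suc i)" if "i < m" for i using q that by (simp add: inc_def)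
 show "inc m d (succ_seq j q)"
  unfolding inc_def succ_seq_def
 proof (intro conjI allI impI)
  fix i assume i: "i < m"
  have gt: "Suc (q j) < q (Suc j)" using lt[OF j] gap by linarith
  consider "Suc i < j" | "Suc i = j" | "i = j" | "j < i" by linarith
  then show "(if i < j then i else if i = j then Suc (q j) else q i)
   < (if Suc i < j then Suc i else if Suc i = j then Suc (q j) else q (Suc i))"
  proof cases
   case 2
   then have "i < q j" using qj by simp
   with 2 show ?thesis by simp
  next
   case 4
   then show ?thesis using lt[OF i] by simp
  qed (use gt in simp_all)
 next
  show "(if m < j then m else if m = j then Suc (q j) else q m) = d" using q j by (simp add: inc_def)
 qed
 have split: "(\<Sum>i<m. g i) = (\<Sum>i<Suc j. g i) + (\<Sum>i\<in>{Suc j..<m}. g i)" for g :: "nat \<Rightarrow> nat"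
 proof -
  have "{..<m} = {..<Suc j} \<union> {Suc j..<m}" using j by auto
  then show ?thesis by (simp add: sum.union_disjoint ivl_disj_int)
 qed
 have "(\<Sum>i<Suc j. q i choose Suc i) = (\<Sum>i<Suc j. (q 0 + i) choose Suc i)"
 proof (intro sum.cong)
  fix i assume "i \<in> {..<Suc j}"
  then have "q i = q 0 + i" using run_eq[OF run, of i] by simp
  then show "q i choose Suc i = (q 0 + i) choose Suc i" by (simp only:)
 qed simp
 then have "(\<Sum>i<Suc j. q i choose Suc i) + 1 = (q 0 + Suc j) choose Suc j" using rank_run[of "q 0" "Suc j"] by simp
 also have "\<dots> = (\<Sum>i<Suc j. succ_seq j q i choose Suc i)" by (simp add: succ_seq_def qj)
 finally show "rank m (succ_seq j q) = Suc (rank m q)"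
  unfolding rank_def split by (simp add: succ_seq_def)
qed

lemma rank_last: "inc m d q \<Longrightarrow> \<forall>i<m. q (Suc i) = Suc (q i) \<Longrightarrow> Suc (rank m q) = d choose m"
proof -
 assume q: "inc m d q" and run: "\<forall>i<m. q (Suc i) = Suc (q i)"
 have "rank m q = (\<Sum>i<m. (q 0 + i) choose Suc i)"
  unfolding rank_def
 proof (intro sum.cong)
  fix i assume "i \<in> {..<m}"
  then have "q i = q 0 + i" using run_eq[OF run, of i] by simp
  then show "q i choose Suc i = (q 0 + i) choose Suc i" by (simp only:)
 qed simp
 moreover have "d = q 0 + m" using run_eq[OF run, of m] q by (simp add: inc_def)
 ultimately show ?thesis using rank_run[of "q 0" m] by simp
qed

lemma inc_lt: "inc m d q \<Longrightarrow> i < m \<Longrightarrow> q i < d"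
proof -
 assume q: "inc m d q" and i: "i < m"
 have "q i < q j" if "i < j" "j \<le> m" for j
  using that
 proof (induction j)
  case (Suc j)
  then have "q j < q (Suc j)" using q by (simp add: inc_def)
  then show ?case using Suc by (cases "i = j") auto
 qed simp
 from this[of m] show ?thesis using q i by (simp add: inc_def)
qed

lemma inc_exists:
 assumes "Q \<subseteq> {..<d}" "card Q = m"
 shows "\<exists>q. inc m d q \<and> q ` {..<m} = Q"
proof -
 have fin: "finite Q" using assms finite_subset by blast
 define l where "l = sorted_list_of_set Q"
 have l: "length l = m" "set l = Q" "sorted_wrt (<) l" using fin assms by (simp_all add: l_def)
 define q where "q i = (if i < m then l ! i else d)" for i
 have "inc m d q" unfolding inc_def
 proof (intro conjI allI impI)
  fix i assume i: "i < m"
  have "l ! i \<in> Q" using l i nth_mem by blast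
  then show "q i < q (Suc i)" using i l assms(1) sorted_wrt_nth_less[OF l(3), of i "Suc i"] by (auto simp: q_def)
 qed (simp add: q_def)
 moreover have "q ` {..<m} = set l" using l by (auto simp: q_def set_conv_nth)
 ultimately show ?thesis using l by blast
qed

lemma card_inc: "inc m d q \<Longrightarrow> card (q ` {..<m}) = m"
proof -
 assume q: "inc m d q"
 have lt: "q i < q j" if "i < j" "j \<le> m" for i j
  using that
 proof (induction j)
  case (Suc j)
  then have "q j < q (Suc j)" using q by (simp add: inc_def)
  then show ?case using Suc by (cases "i = j") auto
 qed simp
 have "inj_on q {..<m}"
 proof (rule inj_onI)
  fix x y assume "x \<in> {..<m}" "y \<in> {..<m}" "q x = q y"
  then show "x = y" using lt[of x y] lt[of y x] by (cases x y rule: linorder_cases) auto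
 qed
 then show ?thesis by (simp add: card_image)
qed

text \<open>In an increasing sequence the guard is positive exactly if the next element is adjacent.
  The second sentinel, \<open>d + 2\<close> behind \<open>d\<close>, makes it 0 at position
  \<open>m\<close>. Passed elements are reset during the scan, as they are not read again.\<close>

definition enum_next :: com where
 "enum_next =
  blk (30 ::= N 0) ;;
  whl (Ix aq (V 30) +. N 2 -. Ix aq (V 30 +. N 1)) (blk (Sto aq (V 30) (V 30) ;. 30 ::= V 30 +. N 1)) ;;
  blk (If (V xm -. V 30) (Sto aq (V 30) (Ix aq (V 30) +. N 1)) (xgo ::= N 0))"

definition enum :: "com \<Rightarrow> com" where
 "enum P =
  loop 30 xm (blk (Sto aq (V 30) (V 30))) ;;
  blk (Sto aq (V xm) (V xd) ;. Sto aq (V xm +. N 1) (V xd +. N 2) ;. xgo ::= N 1) ;;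
  whl (V xgo) (P ;; enum_next)"

context ilp_bounds
begin

definition qmem :: "state \<Rightarrow> (nat \<Rightarrow> nat) \<Rightarrow> bool" where
 "qmem p q = ((\<forall>i\<le>m. av p aq (int i) = int (q i)) \<and> av p aq (int m + 1) = int d + 2)"

lemma enum_next_spec:
 assumes g: "glob p" and q: "qmem p qv" "inc m d qv" and go: "rv p xgo = 1" and Bd: "int d + 2 \<le> Bd"
 shows "spec enum_next p (50 * (m + 1)) (\<lambda>q. frame 30 {xgo} {aq} p q \<and>
  (if Suc (rank m qv) = d choose m then rv q xgo = 0
   else rv q xgo = 1 \<and> (\<exists>qv'. qmem q qv' \<and> inc m d qv' \<and> rank m qv' = Suc (rank m qv))))" (is "spec _ _ _ ?P")
proof -
 have xm: "rv p xm = int m" using g by (simp add: glob_def)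
 have md: "int m \<le> int d" by (simp add: d_def)
 define I where "I k q = (k \<le> m \<and> frame 30 {} {aq} p q \<and> rv q 30 = int k \<and> (\<forall>i<k. qv (Suc i) = Suc (qv i)) \<and>
  (\<forall>i\<le>m. av q aq (int i) = int (if i < k then i else qv i)) \<and> av q aq (int m + 1) = int d + 2)" for k q
 have cond: "fst (ev q (Ix aq (V 30) +. N 2 -. Ix aq (V 30 +. N 1))) = (if k = m then 0 else int (qv k) + 2 - int (qv (Suc k)))"
  if "I k q" for k q
 proof -
  have k: "k \<le> m" "rv q 30 = int k" "av q aq (int k) = int (qv k)" using that by (auto simp: I_def)
  show ?thesis
  proof (cases "k = m")
   case True
   then show ?thesis using that k q by (simp add: I_def inc_def)
  next
   case False
   then have "Suc k \<le> m" using k by simp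
   moreover have "\<forall>i\<le>m. av q aq (int i) = int (if i < k then i else qv i)" using that by (simp add: I_def)
   ultimately have "av q aq (int (Suc k)) = int (qv (Suc k))" by fastforce
   then have "av q aq (int k + 1) = int (qv (Suc k))" by (simp add: add.commute)
   then show ?thesis using k False by simp
  qed
 qed
 show ?thesis
  unfolding enum_next_def
  apply (rule spec_le, rule wp_Seq[where A = "I 0"], simp)
  apply (use q Bd_ge in \<open>simp add: I_def qmem_def\<close>)
  apply (rule spec_Seq_mid[where A = "\<lambda>q. \<exists>k. I k q \<and> (k = m \<or> qv (Suc k) \<noteq> Suc (qv k))"])
  apply (rule spec_whl[where n = m and I = I and T = 15])
  apply simp
  apply assumption
  subgoal for p' k q
  proof -
   assume k: "k \<le> m" and I: "I k q" and pos: "0 < fst (ev q (Ix aq (V 30) +. N 2 -. Ix aq (V 30 +. N 1)))"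
   have km: "k < m" "int (qv (Suc k)) < int (qv k) + 2" using pos k unfolding cond[OF I] by (auto split: if_splits)
   have "qv k < qv (Suc k)" using q km by (simp add: inc_def)
   then have s: "qv (Suc k) = Suc (qv k)" using km by simp
   have "spec (blk (Sto aq (V 30) (V 30) ;. 30 ::= V 30 +. N 1)) q 15 (I (Suc k))"
    apply (rule spec_le, rule wp_spec, simp)
    apply (use I km s md Bd in \<open>auto simp: I_def frame_def less_Suc_eq\<close>)
    done
   then show ?thesis using km by simp
  qed
  subgoal for p' k q
  proof -
   assume k: "k \<le> m" and I: "I k q" and neg: "fst (ev q (Ix aq (V 30) +. N 2 -. Ix aq (V 30 +. N 1))) \<le> 0"
   have "k = m \<or> qv (Suc k) \<noteq> Suc (qv k)" using neg unfolding cond[OF I] by (auto split: if_splits)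
   then show ?thesis using I by blast
  qed
  apply (rule wp_spec, simp)
  subgoal for p' q
  proof -
   assume "\<exists>k. I k q \<and> (k = m \<or> qv (Suc k) \<noteq> Suc (qv k))"
   then obtain k where I: "I k q" and k: "k = m \<or> qv (Suc k) \<noteq> Suc (qv k)" by blast
   have fr: "frame 30 {} {aq} p q" and r: "rv q 30 = int k" and run: "\<forall>i<k. qv (Suc i) = Suc (qv i)"
    and arr: "\<forall>i\<le>m. av q aq (int i) = int (if i < k then i else qv i)" "av q aq (int m + 1) = int d + 2" and km: "k \<le> m"
    using I unfolding I_def by blast+
   have xq: "rv q xm = int m" "rv q xgo = 1" using fr xm go by (simp_all add: frame_def)
   show ?thesis
   proof (cases "k = m")
    case True
    then have "Suc (rank m qv) = d choose m" using rank_last[OF q(2)] run by simp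
    then show ?thesis using True r xq fr Bd_ge by (simp add: frame_def)
   next
    case False
    then have lt: "k < m" using km by simp
    note ss = succ_seq[OF q(2) lt run]
    have gap: "qv (Suc k) \<noteq> Suc (qv k)" using k False by simp
    have "rank m (succ_seq k qv) < d choose m" using rank_lt[of m "succ_seq k qv"] ss(1)[OF gap] by (simp add: inc_def)
    then have ne: "Suc (rank m qv) \<noteq> d choose m" using ss(2)[OF gap] by simp
    have ak: "av q aq (int k) = int (qv k)" using arr(1) km by auto
    have "qv k < d" by (rule inc_lt[OF q(2) lt])
    then have "wp (Sto aq (V 30) (Ix aq (V 30) +. N 1)) ?P q"
    proof -
     have "qmem (set_arr aq (int k) (int (qv k) + 1, x) q) (succ_seq k qv)" for x
      using arr lt by (auto simp: qmem_def succ_seq_def)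
     then show ?thesis using fr r ne ss[OF gap] Bd ak xq \<open>qv k < d\<close> by (auto simp: frame_def)
    qed
    then show ?thesis using lt r xq ne by simp
   qed
  qed
  apply simp
  done
qed

text \<open>\<open>J k\<close> is meant for the sets of rank below \<open>k\<close>. The premise
  \<open>stable\<close> lets the enumeration update its own register and array between two
  visits.\<close>

lemma enum_spec:
 assumes J0: "\<And>q. frame 30 {xgo} {aq} p q \<Longrightarrow> J 0 q"
  and stable: "\<And>k q q'. J k q \<Longrightarrow> frame 30 {xgo} {aq} q q' \<Longrightarrow> J k q'"
  and gl: "\<And>k q. J k q \<Longrightarrow> glob q"
  and body: "\<And>k q qv. J k q \<Longrightarrow> inc m d qv \<Longrightarrow> rank m qv = k \<Longrightarrow> \<forall>i<m. av q aq (int i) = int (qv i) \<Longrightarrow>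
   spec P q T (\<lambda>q'. J (Suc k) q' \<and> reg q' xgo = reg q xgo \<and> arr q' aq = arr q aq)"
  and Bd: "int d + 2 \<le> Bd"
 shows "spec (enum P) p ((d choose m) * (T + 100 * (m + 1)) + 100 * (m + 1)) (J (d choose m))"
proof -
 have g: "glob p" using gl[OF J0, of p] by simp
 have gp: "rv p xm = int m" "rv p xd = int d" using g by (simp_all add: glob_def)
 define C where "C = d choose m"
 have md: "int m \<le> int d" by (simp add: d_def)
 have C1: "0 < C" by (simp add: C_def d_def)
 define A where "A k q = (frame 30 {} {aq} p q \<and> (\<forall>i<k. av q aq (int i) = int i))" for k q
 define I where "I k q = (J k q \<and> (if k = C then rv q xgo = 0
  else rv q xgo = 1 \<and> (\<exists>qv. qmem q qv \<and> inc m d qv \<and> rank m qv = k)))" for k q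
 have I0: "I 0 q" if "frame 30 {xgo} {aq} p q" "rv q xgo = 1" "\<forall>i<m. av q aq (int i) = int i" "av q aq (int m) = int d" "av q aq (int m + 1) = int d + 2" for q
 proof -
  define qv where "qv i = (if i < m then i else d)" for i
  have "inc m d qv" by (auto simp: inc_def qv_def d_def)
  moreover have "qmem q qv" using that by (auto simp: qmem_def qv_def le_less)
  moreover have "rank m qv = 0" by (simp add: rank_def qv_def)
  ultimately show ?thesis using J0[OF that(1)] that(2) C1 by (auto simp: I_def)
 qed
 have step: "spec (P ;; enum_next) q (T + 50 * (m + 1)) (I (Suc k))" if k: "k < C" and q: "I k q" for k q
 proof -
  obtain qv where J: "J k q" and qv: "qmem q qv" "inc m d qv" "rank m qv = k" and go: "rv q xgo = 1"
   using q k unfolding I_def by auto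
  show ?thesis
  proof (rule spec_Seq_mid)
   show "spec P q T (\<lambda>q'. J (Suc k) q' \<and> reg q' xgo = reg q xgo \<and> arr q' aq = arr q aq)"
    by (rule body[OF J qv(2,3)]) (use qv in \<open>simp add: qmem_def\<close>)
   fix q' assume q': "J (Suc k) q' \<and> reg q' xgo = reg q xgo \<and> arr q' aq = arr q aq"
   show "spec enum_next q' (50 * (m + 1)) (I (Suc k))"
   proof (rule spec_conseq[OF enum_next_spec[OF gl _ qv(2) _ Bd]])
    show "J (Suc k) q'" using q' by simp
    show "qmem q' qv" "rv q' xgo = 1" using q' qv go by (simp_all add: qmem_def)
    fix q2 assume "frame 30 {xgo} {aq} q' q2 \<and> (if Suc (rank m qv) = d choose m then rv q2 xgo = 0
     else rv q2 xgo = 1 \<and> (\<exists>qv'. qmem q2 qv' \<and> inc m d qv' \<and> rank m qv' = Suc (rank m qv)))"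
    then show "I (Suc k) q2" using q' stable[of "Suc k" q' q2] qv by (simp add: I_def C_def split: if_splits)
   qed
  qed
 qed
 show ?thesis
  unfolding enum_def
  apply (rule spec_le, rule spec_loop_Seq[where n = m and I = A])
  apply (use md Bd in simp_all)[4]
  apply (simp add: A_def; fail)
  apply (simp add: A_def frame_def gp; fail)
  apply (rule wp_spec, simp)
  apply (use md Bd in \<open>auto simp: A_def frame_def less_Suc_eq\<close>)[1]
  apply (rule wp_Seq[where A = "I 0"], simp)
  subgoal for q
  proof -
   assume A: "A m q"
   then have "rv q xm = int m" "rv q xd = int d" using gp by (simp_all add: A_def frame_def)
   then show ?thesis using A Bd Bd_ge by (auto simp: A_def frame_def intro!: I0)
  qed
  apply (rule spec_whl[where n = C and I = I and T = "T + 50 * (m + 1)"])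
  apply simp
  apply assumption
  subgoal for p' q1 k q
   using step[of k q] by (cases "k = C") (auto simp: I_def)
  subgoal for p' q1 k q
   by (cases "k = C") (auto simp: I_def C_def)
  subgoal
  proof -
   show ?thesis
    apply (simp add: C_def)
    apply (rule trans_le_add2, rule trans_le_add2, rule mult_le_mono2)
    apply simp
    done
  qed
  done
qed

end

section \<open>The two passes\<close>

text \<open>Two orderings of the same rows differ by a permutation of columns. So it suffices to
  meet each basis as a set.\<close>

lemma bdet_same_range:
 assumes "inj_on f {..<n}" "inj_on g {..<n}" "f ` {..<n} = g ` {..<n}"
 shows "\<bar>bdet n h f\<bar> = \<bar>bdet n h g\<bar>"
proof -
 define p where "p j = (if j < n then inv_into {..<n} g (f j) else j)" for j
 have im: "f j \<in> g ` {..<n}" if "j < n" for j using assms(3) that by auto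
 have p: "p j < n" "g (p j) = f j" if "j < n" for j
  using im[OF that] that inv_into_into[of "f j" g "{..<n}"] f_inv_into_f[of "f j" g "{..<n}"] by (auto simp: p_def)
 have "inj_on p {0..<n}"
 proof (rule inj_onI)
  fix x y assume xy: "x \<in> {0..<n}" "y \<in> {0..<n}" "p x = p y"
  then have "f x = f y" using p(2)[of x] p(2)[of y] by simp
  then show "x = y" using assms(1) xy by (auto dest: inj_onD)
 qed
 moreover have "p ` {0..<n} \<subseteq> {0..<n}" using p by auto
 ultimately have "bij_betw p {0..<n} {0..<n}" unfolding bij_betw_def using endo_inj_surj[of "{0..<n}" p] by simp
 then have perm: "p permutes {0..<n}" by (rule bij_imp_permutes) (simp add: p_def)
 let ?A = "transpose_mat (basis_mat n h g)"
 have "transpose_mat (basis_mat n h f) = mat n n (\<lambda>(i, j). ?A $$ (p i, j))"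
  by (rule eq_matI) (use p in \<open>auto simp: basis_mat_def\<close>)
 then have "det (transpose_mat (basis_mat n h f)) = signof p * det ?A"
  using det_permute_rows[OF _ perm, of ?A] by simp
 then have "bdet n h f = signof p * bdet n h g" by (simp add: det_transpose[of _ n])
 then show ?thesis by (simp add: abs_mult sign_def)
qed

definition update_D :: com where
 "update_D = blk (If (V xdel -. V xD) (xD ::= V xdel +. N 0) Nop)"

text \<open>The proximity bound needs the largest determinant over all bases, so it must be known
  before any basis is searched for solutions.\<close>

definition pass1 :: com where "pass1 = tableau ;; update_D"
definition pass2 :: com where "pass2 = tableau ;; ray_check ;; group ;; body2"

context ilp
begin

lemma avoids_range:
 assumes q: "inc m d qv" and g: "avoids (qv ` {..<m}) g"
 shows "inj_on g {..<n}" "g ` {..<n} = {..<d} - qv ` {..<m}"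
proof -
 show inj: "inj_on g {..<n}" using g bdet_noninj by (auto simp: avoids_def)
 have sub: "qv ` {..<m} \<subseteq> {..<d}" using inc_lt[OF q] by auto
 have "card (g ` {..<n}) = n" using inj by (simp add: card_image)
 moreover have "card ({..<d} - qv ` {..<m}) = n" using card_Diff_subset[OF _ sub] card_inc[OF q] by (simp add: d_def)
 moreover have "g ` {..<n} \<subseteq> {..<d} - qv ` {..<m}" using g by (auto simp: avoids_def)
 ultimately show "g ` {..<n} = {..<d} - qv ` {..<m}" by (metis card_subset_eq finite_Diff finite_lessThan)
qed

lemma avoids_exists:
 assumes "\<forall>j<n. g j < d" "bdet n h g \<noteq> 0"
 shows "\<exists>qv. inc m d qv \<and> avoids (qv ` {..<m}) g"
proof -
 have inj: "inj_on g {..<n}" using assms bdet_noninj by blast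
 have sub: "g ` {..<n} \<subseteq> {..<d}" using assms by auto
 have "card ({..<d} - g ` {..<n}) = m" using card_Diff_subset[OF _ sub] inj by (simp add: card_image d_def)
 then obtain qv where "inc m d qv" "qv ` {..<m} = {..<d} - g ` {..<n}" using inc_exists[of "{..<d} - g ` {..<n}" d m] by blast
 then show ?thesis using assms by (auto simp: avoids_def)
qed

definition good_tab :: "nat set \<Rightarrow> state \<Rightarrow> (nat \<Rightarrow> nat) \<Rightarrow> (nat \<Rightarrow> nat) \<Rightarrow> int \<Rightarrow> (nat \<Rightarrow> nat \<Rightarrow> int) \<Rightarrow> bool" where
 "good_tab Q q f rw \<delta> T = (tabl f rw \<delta> T \<and> 0 < \<delta> \<and> tab_mem q f rw \<delta> T \<and> (\<forall>g j. avoids Q g \<longrightarrow> j < n \<longrightarrow> f j \<notin> Q))"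

lemma good_tab_range:
 assumes q: "inc m d qv" and t: "good_tab (qv ` {..<m}) q f rw \<delta> T" and g: "avoids (qv ` {..<m}) g"
 shows "inj_on f {..<n}" "inj_on g {..<n}" "f ` {..<n} = g ` {..<n}" "\<bar>bdet n h g\<bar> = \<delta>"
proof -
 have "\<forall>j<n. f j \<notin> qv ` {..<m}" using t g unfolding good_tab_def by blast
 then have f: "avoids (qv ` {..<m}) f" using t by (simp add: good_tab_def avoids_def tabl_def)
 show r: "inj_on f {..<n}" "inj_on g {..<n}" "f ` {..<n} = g ` {..<n}" using avoids_range[OF q f] avoids_range[OF q g] by simp_all
 moreover have "0 < \<delta>" "\<bar>\<delta>\<bar> = \<bar>bdet n h f\<bar>" using t by (simp_all add: good_tab_def tabl_def)
 ultimately show "\<bar>bdet n h g\<bar> = \<delta>" using bdet_same_range[of f n g h] by simp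
qed

lemma rank_less_Suc:
 assumes "inc m d u" "inc m d v" "rank m u < Suc (rank m v)"
 shows "rank m u < rank m v \<or> u ` {..<m} = v ` {..<m}"
proof (cases "rank m u < rank m v")
 case False
 then have "u i = v i" if "i < m" for i using rank_inj[of m u v i] assms that by (simp add: inc_def)
 then show ?thesis by simp
qed simp

text \<open>The complement of a basis has exactly \<open>m\<close> rows, so each basis belongs to
  one of the enumerated sets.\<close>

lemma all_avoided:
 assumes "\<forall>qv g. inc m d qv \<and> rank m qv < d choose m \<and> avoids (qv ` {..<m}) g \<longrightarrow> P g"
  and f: "\<forall>j<n. f j < d" "bdet n h f \<noteq> 0"
 shows "P f"
proof -
 obtain qv where qv: "inc m d qv" "avoids (qv ` {..<m}) f" using avoids_exists[OF f] by blast
 then have "rank m qv < d choose m" using rank_lt[of m qv] by (simp add: inc_def)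
 then show ?thesis using assms(1) qv by blast
qed

definition ray_vec :: "(nat \<Rightarrow> int) \<Rightarrow> bool" where
 "ray_vec w = ((\<forall>i<d. dot n (h i) w \<le> 0) \<and> 0 < dot n c w)"

text \<open>Edge directions in the normalisation in which \<open>near_basis\<close> requires them
  not to improve the objective.\<close>

definition ray_at :: "(nat \<Rightarrow> nat) \<Rightarrow> bool" where
 "ray_at g = ((\<exists>k<n. \<exists>w. ray_vec w \<and> (\<forall>j<n. dot n (h (g j)) w = (if j = k then - \<bar>bdet n h g\<bar> else 0))))"

definition rays :: "state \<Rightarrow> bool" where
 "rays p = (rv p xray = 0 \<or> (rv p xray = 1 \<and> (\<exists>w. ray_vec w)))"

end

locale ilp_run = ilp_bounds +
 fixes a0 :: nat
 assumes a0: "\<And>v. \<bar>v\<bar> \<le> TB \<Longrightarrow> int_size v \<le> a0" and a_big: "3 * a0 + n + 20 \<le> a"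
  and Delta_TB: "\<Delta> \<le> TB" and Delta_pos: "1 \<le> \<Delta>"
  and S_bd: "\<Delta> * (int n * (\<Delta> * \<Delta>)) ^ m \<le> Bd" and W_bd: "int n * (\<Delta> * \<Delta>) + \<Delta> * \<Delta> \<le> Bd"
  and F_bd: "int n * (\<Delta> * TB) \<le> Bd" and d2: "int d + 2 \<le> Bd"
  and unit_rows: "\<And>r l. r < s \<Longrightarrow> l < n \<Longrightarrow> h r l = (if l = r then 1 else 0)"
begin

lemma init_mem_frame: "init_mem p T0 \<Longrightarrow> frame 22 X Y p q \<Longrightarrow>
  X \<inter> {xn, xm, xs, xK, xM, xMn, xd, xdB} = {} \<Longrightarrow> aT0 \<notin> Y \<Longrightarrow> init_mem q T0"
 by (simp add: init_mem_def glob_def frame_def)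

lemma tabl_delta_le: "tabl f rw \<delta> T \<Longrightarrow> \<delta> \<le> \<Delta>"
 using bdet_le[of f] unfolding tabl_def by (metis abs_ge_self order_trans)

lemma pass1_spec:
 assumes p: "init_mem p T0" "rv p xD = 1"
 shows "spec (enum pass1) p ((d choose m) * (400 * n * (d + M * n + 1) + 50 + 100 * (m + 1)) + 100 * (m + 1))
  (\<lambda>q. frame 30 {xgo, xD, xdel} {aq, amk, aT, aT2, acol, arow} p q \<and>
   (\<exists>D. rv q xD = int D \<and> 1 \<le> D \<and> int D \<le> \<Delta> \<and> (\<forall>f. (\<forall>j<n. f j < d) \<longrightarrow> \<bar>bdet n h f\<bar> \<le> int D)))"
proof -
 define J where "J k q = (frame 30 {xgo, xD, xdel} {aq, amk, aT, aT2, acol, arow} p q \<and> 1 \<le> rv q xD \<and> rv q xD \<le> \<Delta> \<and>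
  (\<forall>qv g. inc m d qv \<and> rank m qv < k \<and> avoids (qv ` {..<m}) g \<longrightarrow> \<bar>bdet n h g\<bar> \<le> rv q xD))" for k q
 have im: "init_mem q T0" if "J k q" for k q
  by (rule init_mem_frame[OF p(1), where X = "{xgo, xD, xdel}" and Y = "{aq, amk, aT, aT2, acol, arow}"])
   (use that in \<open>auto simp: J_def frame_def\<close>)
 show ?thesis
 proof (rule spec_conseq[OF enum_spec[where J = J]])
  show "J 0 q" if "frame 30 {xgo} {aq} p q" for q
   using that p Delta_pos by (simp add: J_def frame_def)
  show "J k q'" if "J k q" "frame 30 {xgo} {aq} q q'" for k q q'
   using that by (simp add: J_def frame_def)
  show "glob q" if "J k q" for k q using im[OF that] by (simp add: init_mem_def)
  show "int d + 2 \<le> Bd" by (rule d2)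
 next
  fix k q qv assume J: "J k q" and qv: "inc m d qv" "rank m qv = k" and aqv: "\<forall>i<m. av q aq (int i) = int (qv i)"
  have qd: "\<forall>i<m. qv i < d" using inc_lt[OF qv(1)] by blast
  show "spec pass1 q (400 * n * (d + M * n + 1) + 50) (\<lambda>q'. J (Suc k) q' \<and> reg q' xgo = reg q xgo \<and> arr q' aq = arr q aq)"
   unfolding pass1_def
  proof (rule spec_Seq_mid[OF tableau_spec[OF im[OF J] aqv qd, folded good_tab_def]], elim conjE exE)
   fix q1 f rw \<delta> T
   assume fr: "frame 30 {xdel} {amk, aT, aT2, acol, arow} q q1" and gt: "good_tab (qv ` {..<m}) q1 f rw \<delta> T"
   have t: "tabl f rw \<delta> T" "0 < \<delta>" "rv q1 xdel = \<delta>" using gt by (simp_all add: good_tab_def tab_mem_def)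
   have upd: "J (Suc k) q'" if f': "frame 30 {xD} {} q1 q'" and D: "rv q' xD = max (rv q1 xD) \<delta>" for q'
    unfolding J_def
   proof (intro conjI allI impI)
    have q1D: "rv q1 xD = rv q xD" using fr by (simp add: frame_def)
    show "frame 30 {xgo, xD, xdel} {aq, amk, aT, aT2, acol, arow} p q'" using J fr f' by (simp add: J_def frame_def)
    show "1 \<le> rv q' xD" "rv q' xD \<le> \<Delta>" using J D q1D tabl_delta_le[OF t(1)] by (auto simp: J_def)
    fix u g assume u: "inc m d u \<and> rank m u < Suc k \<and> avoids (u ` {..<m}) g"
    then consider "rank m u < k" | "u ` {..<m} = qv ` {..<m}" using rank_less_Suc[of u qv] qv by blast
    then show "\<bar>bdet n h g\<bar> \<le> rv q' xD"
    proof cases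
     case 1
     then have "\<bar>bdet n h g\<bar> \<le> rv q xD" using J u unfolding J_def by blast
     then show ?thesis using D q1D by simp
    next
     case 2
     then show ?thesis using good_tab_range(4)[OF qv(1) gt, of g] u D by simp
    qed
   qed
   show "spec update_D q1 50 (\<lambda>q'. J (Suc k) q' \<and> reg q' xgo = reg q xgo \<and> arr q' aq = arr q aq)"
    unfolding update_D_def
    apply (rule spec_le, rule wp_spec, simp)
    subgoal
     using fr t(3) tabl_delta_le[OF t(1)] Delta_le t(2) upd[of "set_reg xD (\<delta>, x) q1" for x] upd[of q1]
     by (auto simp: frame_def)
    apply simp
    done
  qed
 next
  fix q assume J: "J (d choose m) q"
  define D where "D = nat (rv q xD)"
  have D: "rv q xD = int D" "1 \<le> D" "int D \<le> \<Delta>" using J by (auto simp: J_def D_def)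
  have "\<bar>bdet n h f\<bar> \<le> int D" if f: "\<forall>j<n. f j < d" for f
   using all_avoided[where P = "\<lambda>g. \<bar>bdet n h g\<bar> \<le> int D", OF _ f] J D(1) by (cases "bdet n h f = 0") (simp_all add: J_def)
  then show "frame 30 {xgo, xD, xdel} {aq, amk, aT, aT2, acol, arow} p q \<and>
   (\<exists>D. rv q xD = int D \<and> 1 \<le> D \<and> int D \<le> \<Delta> \<and> (\<forall>f. (\<forall>j<n. f j < d) \<longrightarrow> \<bar>bdet n h f\<bar> \<le> int D))"
   using J D unfolding J_def by blast
 qed
qed

definition sets2 :: "nat set" where "sets2 = {xgo, xdel, xray, xcnt, xW, xS, xgs, xfx, xfeas, xbest}"
definition sets2a :: "nat set" where
 "sets2a = {aq, amk, aT, aT2, acol, arow, aV, aG, aSub, aoff, atau, arho, aA, aY, aF, aP, au, az}"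

definition cost2 :: nat where
 "cost2 = (let N = nat \<Delta> in 400 * n * (d + M * n + 1) + (100 * n * (m + 1) + (400 * n * N * (N + 1) * (K + 1) +
  2100 * n * (N * (n * (N * N)) ^ m) * N * (K + 1))))"

text \<open>What one visit leaves behind for a basis. It survives later visits, because the
  incumbent only improves and the ray flag is never cleared.\<close>

definition visited :: "int \<Rightarrow> (nat \<Rightarrow> nat) \<Rightarrow> state \<Rightarrow> bool" where
 "visited D g q = ((\<forall>z. cand g D z \<longrightarrow> rv q xfeas = 1 \<and> dot n c z \<le> rv q xbest) \<and> (ray_at g \<longrightarrow> rv q xray = 1))"

lemma basis_body_spec:
 assumes im: "init_mem p T0" and D: "rv p xD = int D" "1 \<le> D" "int D \<le> \<Delta>" "\<And>f. \<forall>j<n. f j < d \<Longrightarrow> \<bar>bdet n h f\<bar> \<le> int D"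
  and b: "bmem p" and so: "sol p" "rays p"
  and qv: "inc m d qv" "\<forall>i<m. av p aq (int i) = int (qv i)"
 shows "spec pass2 p cost2 (\<lambda>q. frame 30 (sets2 - {xgo}) (sets2a - {aq}) p q \<and> improves p q \<and> rays q \<and>
  (rv p xray = 1 \<longrightarrow> rv q xray = 1) \<and> (\<forall>g. avoids (qv ` {..<m}) g \<longrightarrow> visited (int D) g q))" (is "spec _ _ _ ?P")
proof -
 define N where "N = nat \<Delta>"
 have DN: "D \<le> N" using D by (simp add: N_def)
 have qd: "\<forall>i<m. qv i < d" using inc_lt[OF qv(1)] by blast
 have tail: "spec (ray_check ;; group ;; body2) q1 (100 * n * (m + 1) + (400 * n * N * (N + 1) * (K + 1) +
   2100 * n * (N * (n * (N * N)) ^ m) * N * (K + 1))) ?P"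
  if fr1: "frame 30 {xdel} {amk, aT, aT2, acol, arow} p q1" and gt: "good_tab (qv ` {..<m}) q1 f rw \<delta> T" for q1 f rw \<delta> T
 proof -
  have t: "tabl f rw \<delta> T" "0 < \<delta>" "tab_mem q1 f rw \<delta> T" using gt by (simp_all add: good_tab_def)
  have KMn: "int K \<le> Bd"
  proof -
   have "M * 1 \<le> M * n" using n_pos by (intro mult_le_mono2) simp
   then have "K \<le> M * n" by (simp add: M_def)
   then show ?thesis using Mn_le by linarith
  qed
  interpret B: basis mul L W a \<mu> Bd n m s h b c \<Delta> TB f rw \<delta> T
   by unfold_locales (use t KMn in auto)
  have dD: "\<delta> \<le> int D" using t D(4)[of f] by (simp add: tabl_def)
  have m1: "B.mem q1" using t im fr1 by (simp add: B.mem_def init_mem_def glob_def frame_def)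
  have ray: "B.is_ray j \<Longrightarrow> j < n \<Longrightarrow> \<exists>w. ray_vec w" for j
  proof -
   assume r: "B.is_ray j" and j: "j < n"
   have "\<bar>\<delta>\<bar> = \<bar>bdet n h f\<bar>" "\<delta> \<noteq> 0" using t by (auto simp: tabl_def)
   from tab_row_dual[OF this j] obtain v where v: "\<forall>i<n. dot n (h (f i)) v = (if i = j then \<delta> else 0)"
    "\<forall>r U. tab_row n h f \<delta> r U \<longrightarrow> dot n r v = U j" by blast
   have row: "dot n (row_vec rw i) v = T i j" if "i < M" for i using v(2) t(1) that by (simp add: tabl_def)
   define w where "w l = - v l" for l
   have neg: "dot n u w = - dot n u v" for u by (simp add: dot_def w_def sum_negf)
   have "dot n (h i) w \<le> 0" if i: "i < d" for i
   proof -
    have "(\<exists>j<n. f j = i) \<or> (\<exists>i'<m. rw i' = i)" using t(1) i by (simp add: tabl_def)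
    then show ?thesis
    proof
     assume "\<exists>j<n. f j = i"
     then show ?thesis using v(1) t(2) by (auto simp: neg)
    next
     assume "\<exists>i'<m. rw i' = i"
     then obtain i' where i': "i' < m" "rw i' = i" by blast
     then have "dot n (h i) v = T i' j" using row[of i'] B.KM(2)[OF i'(1)] by (simp add: row_vec_def)
     then show ?thesis using r i'(1) by (simp add: neg B.is_ray_def)
    qed
   qed
   moreover have "dot n c w = - T K j" using row[OF B.KM(1)] by (simp add: neg row_vec_def K_def)
   ultimately show "\<exists>w. ray_vec w" using r unfolding ray_vec_def B.is_ray_def by (intro exI[of _ w]) simp
  qed
  show ?thesis
  proof (rule spec_Seq_mid[OF B.ray_check_spec[OF m1]])
   fix q2 assume q2: "frame 30 {xray} {} q1 q2 \<and> rv q2 xray = (if \<exists>j<n. B.is_ray j then 1 else rv q1 xray)"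
   have m2: "B.mem q2" using B.mem_frame[OF m1 conjunct1[OF q2]] by simp
   have x1: "rv q1 xray = rv p xray" using fr1 by (simp add: frame_def)
   have r2: "rays q2" "rv p xray = 1 \<longrightarrow> rv q2 xray = 1"
    using so(2) q2 ray x1 unfolding rays_def by (auto split: if_splits)
   show "spec (group ;; body2) q2 (400 * n * N * (N + 1) * (K + 1) + 2100 * n * (N * (n * (N * N)) ^ m) * N * (K + 1)) ?P"
   proof (rule spec_Seq_mid[OF spec_le[OF B.group_spec[OF m2]]], goal_cases)
    case 1
    have "nat \<delta> \<le> N" using dD DN by simp
    then show ?case by (intro mult_le_mono) auto
   next
    case (2 q3)
    then obtain cnt G Sb where fr3: "frame 30 {xcnt} {aV, aG, aSub} q2 q3" and gr: "B.grp cnt 0 cnt G Sb" "B.grp_mem q3 cnt 0 cnt G Sb" by blast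
    define Wd where "Wd = (D - 1) * n * D + 1"
    define S where "S = cnt * Wd ^ m"
    define off where "off i = (int D - 1) * (\<Sum>j<n. max 0 (- T i j))" for i
    have cD: "cnt \<le> D" using B.grp_cnt[OF gr(1)] dD by simp
    \<comment> \<open>The extra 1 in \<open>Wd\<close> is paid by replacing the factor
      \<open>D - 1\<close> by \<open>D\<close>, a gain of \<open>n * D\<close>.\<close>
    have WN: "Wd \<le> n * (N * N)"
    proof -
     obtain D' where D': "D = Suc D'" using D(2) by (cases D) auto
     have "1 * 1 \<le> n * D" using n_pos D(2) by (intro mult_le_mono) auto
     then have "Wd \<le> n * (D * D)" by (simp add: Wd_def D' algebra_simps)
     also have "\<dots> \<le> n * (N * N)" using DN by (intro mult_le_mono) auto
     finally show ?thesis .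
    qed
    have SN: "S \<le> N * (n * (N * N)) ^ m" unfolding S_def using cD DN WN by (intro mult_le_mono power_mono) auto
    have N: "int N = \<Delta>" using Delta_pos by (simp add: N_def)
    have DD: "int D * int D \<le> \<Delta> * \<Delta>" using D by (intro mult_mono) auto
    interpret R: basis_sizes mul L W a \<mu> Bd n m s h b c \<Delta> TB f rw \<delta> T D cnt G Sb Wd S off a0
    proof unfold_locales
     show "1 \<le> D" by (rule D(2))
     show "\<bar>T i j\<bar> \<le> int D" if "i < m" "j < n" for i j
     proof -
      have "tab_row n h f \<delta> (h (rw i)) (T i)" using t(1) that(1) B.KM(2)[OF that(1)] by (auto simp: tabl_def row_vec_def)
      then have "\<bar>T i j\<bar> = \<bar>bdet n h (f(j := rw i))\<bar>" using t(1) that by (intro tab_row_bdet) (auto simp: tabl_def)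
      also have "\<dots> \<le> int D" using t(1) that by (intro D(4)) (auto simp: tabl_def)
      finally show ?thesis .
     qed
     show "B.grp cnt 0 cnt G Sb" by (rule gr(1))
     show "Wd = (D - 1) * n * D + 1" "S = cnt * Wd ^ m" by (simp_all add: Wd_def S_def)
     show "off i = (int D - 1) * (\<Sum>j<n. max 0 (- T i j))" for i by (simp add: off_def)
     have "int S \<le> int (N * (n * (N * N)) ^ m)" using SN by linarith
     then show "int S \<le> Bd" using S_bd by (simp add: N)
     have "int Wd \<le> int (n * (N * N))" using WN by linarith
     then show "int Wd + int D * int D \<le> Bd" using W_bd DD by (simp add: N)
     have "int n * (int D * TB) \<le> int n * (\<Delta> * TB)" using D Delta_pos Delta_TB by (intro mult_left_mono mult_right_mono) auto
     then show "int n * (int D * TB) \<le> Bd" using F_bd by linarith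
     show "0 \<le> TB" "int D \<le> TB" "\<delta> \<le> TB" using Delta_pos Delta_TB D dD by linarith+
     show "int_size v \<le> a0" if "\<bar>v\<bar> \<le> TB" for v by (rule a0[OF that])
     show "3 * a0 + n + 20 \<le> a" by (rule a_big)
     show "h r l = (if l = r then 1 else 0)" if "r < s" "l < n" for r l by (rule unit_rows[OF that])
    qed
    have fr13: "frame 30 {xdel, xray, xcnt} {amk, aT, aT2, acol, arow, aV, aG, aSub} p q3" using fr1 q2 fr3 by (simp add: frame_def)
    have m3: "B.mem q3" using B.mem_frame[OF m2 fr3] by simp
    have xr3: "rv q3 xray = rv q2 xray" using fr3 by (simp add: frame_def)
    have "2100 * n * S * D * (K + 1) \<le> 2100 * n * (N * (n * (N * N)) ^ m) * N * (K + 1)"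
     using SN DN by (intro mult_le_mono) auto
    then show ?case
    proof (rule spec_le[rotated], intro spec_conseq[OF R.body2_spec[OF m3 _ gr(2)]])
     show "rv q3 xD = int D" "bmem q3" "sol q3" using fr13 D(1) b so(1) by (simp_all add: frame_def bmem_def sol_def)
     fix q assume "frame 30 {xW, xS, xgs, xfx, xfeas, xbest} {aoff, atau, aV, arho, aA, aY, aF, aP, au, az} q3 q \<and>
      improves q3 q \<and> (\<forall>z. cand f (int D) z \<longrightarrow> rv q xfeas = 1 \<and> dot n c z \<le> rv q xbest)"
     then have fr: "frame 30 {xW, xS, xgs, xfx, xfeas, xbest} {aoff, atau, aV, arho, aA, aY, aF, aP, au, az} q3 q"
      and im': "improves q3 q" and cd: "\<And>z. cand f (int D) z \<Longrightarrow> rv q xfeas = 1 \<and> dot n c z \<le> rv q xbest" by blast+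
     have "frame 30 (sets2 - {xgo}) (sets2a - {aq}) p q" using fr fr13 by (simp add: frame_def sets2_def sets2a_def)
     moreover have "improves p q" using im' fr13 by (simp add: improves_def frame_def)
     moreover have xr: "rv q xray = rv q2 xray" using fr xr3 by (simp add: frame_def)
     \<comment> \<open>The tableau may order the basis differently from \<open>g\<close>; both the
       closeness condition and the rays depend on the set of rows only, after matching
       positions.\<close>
     moreover have "visited (int D) g q" if g: "avoids (qv ` {..<m}) g" for g
     proof -
      note rg = good_tab_range[OF qv(1) gt g]
      note bd = rg(4) and eq = rg(3)
      have fg: "\<exists>k<n. g k = f j" if "j < n" for j
      proof -
       have "f j \<in> g ` {..<n}" unfolding eq[symmetric] using that by simp
       then show ?thesis by auto
      qed
      have gf: "\<exists>k<n. f k = g j" if "j < n" for j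
      proof -
       have "g j \<in> f ` {..<n}" unfolding eq using that by simp
       then show ?thesis by auto
      qed
      have "cand f (int D) z" if "cand g (int D) z" for z
       using that fg unfolding cand_def by metis
      moreover have "rv q xray = 1" if ra: "ray_at g"
      proof -
       obtain k w where k: "k < n" and w: "ray_vec w" "\<forall>j<n. dot n (h (g j)) w = (if j = k then - \<delta> else 0)"
        using ra bd unfolding ray_at_def by auto
       obtain j where j: "j < n" "f j = g k" using gf[OF k] by blast
       have fw: "dot n (h (f i)) w = (if i = j then - \<delta> else 0)" if i: "i < n" for i
       proof -
        obtain l where l: "l < n" "g l = f i" using fg[OF i] by blast
        have "l = k \<longleftrightarrow> i = j" using l k j i inj_on_eq_iff[OF rg(1), of i j] inj_on_eq_iff[OF rg(2), of l k] by auto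
        then show ?thesis using w(2) l by auto
       qed
       have rw: "dot n (row_vec rw i) w = - T i j" if "i < M" for i
       proof -
        have "\<delta> * dot n (row_vec rw i) w = (\<Sum>l<n. T i l * dot n (h (f l)) w)"
         by (rule tab_row_dot) (use t(1) that in \<open>simp add: tabl_def\<close>)
        also have "\<dots> = (\<Sum>l<n. if l = j then T i j * (- \<delta>) else 0)" using fw by (intro sum.cong) auto
        also have "\<dots> = \<delta> * (- T i j)" using j by simp
        finally show ?thesis using t(2) mult_left_cancel[of \<delta>] by blast
       qed
       have "0 \<le> T i j" if i: "i < m" for i
       proof -
        have "dot n (h (rw i)) w \<le> 0" using w(1) t(1) i by (simp add: ray_vec_def tabl_def)
        then show ?thesis using rw[OF B.KM(2)[OF i]] i by (simp add: row_vec_def)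
       qed
       moreover have "T K j < 0" using rw[OF B.KM(1)] w(1) by (simp add: row_vec_def K_def ray_vec_def)
       ultimately have "\<exists>j<n. B.is_ray j" using j unfolding B.is_ray_def by blast
       then show ?thesis using q2 xr by simp
      qed
      ultimately show ?thesis using cd unfolding visited_def by blast
     qed
     ultimately show "?P q" using r2 by (simp add: rays_def)
    qed
   qed
  qed
 qed
 show ?thesis
  unfolding pass2_def cost2_def Let_def N_def[symmetric]
  by (rule spec_Seq_mid[OF tableau_spec[OF im qv(2) qd, folded good_tab_def]], elim conjE exE, rule tail)
qed

lemma pass2_spec:
 assumes p: "init_mem p T0" "rv p xfeas = 0" "rv p xray = 0" "bmem p"
  and D: "rv p xD = int D" "1 \<le> D" "int D \<le> \<Delta>" "\<And>f. \<forall>j<n. f j < d \<Longrightarrow> \<bar>bdet n h f\<bar> \<le> int D"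
 shows "spec (enum pass2) p ((d choose m) * (cost2 + 100 * (m + 1)) + 100 * (m + 1))
  (\<lambda>q. frame 30 sets2 sets2a p q \<and> sol q \<and> rays q \<and> (\<forall>z. feas_pt z \<longrightarrow> rv q xfeas = 1) \<and>
   (rv q xray = 0 \<longrightarrow> (\<forall>z. feas_pt z \<longrightarrow> dot n c z \<le> rv q xbest)))"
proof -
 define J where "J k q = (frame 30 sets2 sets2a p q \<and> sol q \<and> rays q \<and>
  (\<forall>qv g. inc m d qv \<and> rank m qv < k \<and> avoids (qv ` {..<m}) g \<longrightarrow> visited (int D) g q))" for k q
 have im: "init_mem q T0" if "J k q" for k q
  by (rule init_mem_frame[OF p(1), where X = sets2 and Y = sets2a])
   (use that in \<open>auto simp: J_def frame_def sets2_def sets2a_def\<close>)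
 show ?thesis
 proof (rule spec_conseq[OF enum_spec[where J = J]])
  show "J 0 q" if "frame 30 {xgo} {aq} p q" for q
   using that p by (simp add: J_def frame_def sets2_def sets2a_def sol_def rays_def)
  show "J k q'" if "J k q" "frame 30 {xgo} {aq} q q'" for k q q'
   using that by (simp add: J_def frame_def sets2_def sets2a_def sol_def rays_def visited_def)
  show "glob q" if "J k q" for k q using im[OF that] by (simp add: init_mem_def)
  show "int d + 2 \<le> Bd" by (rule d2)
 next
  fix k q qv assume J: "J k q" and qv: "inc m d qv" "rank m qv = k" and aqv: "\<forall>i<m. av q aq (int i) = int (qv i)"
  have q: "rv q xD = int D" "bmem q" "sol q" "rays q" using J D(1) p(4) by (simp_all add: J_def frame_def sets2_def sets2a_def bmem_def)
  show "spec pass2 q cost2 (\<lambda>q'. J (Suc k) q' \<and> reg q' xgo = reg q xgo \<and> arr q' aq = arr q aq)"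
  proof (rule spec_conseq[OF basis_body_spec[OF im[OF J] q(1) D(2-4) q(2-4) qv(1) aqv]])
   fix q' assume q': "frame 30 (sets2 - {xgo}) (sets2a - {aq}) q q' \<and> improves q q' \<and> rays q' \<and>
    (rv q xray = 1 \<longrightarrow> rv q' xray = 1) \<and> (\<forall>g. avoids (qv ` {..<m}) g \<longrightarrow> visited (int D) g q')"
   have "visited (int D) g q'" if u: "inc m d u \<and> rank m u < Suc k \<and> avoids (u ` {..<m}) g" for u g
   proof -
    consider "rank m u < k" | "u ` {..<m} = qv ` {..<m}" using rank_less_Suc[of u qv] u qv by blast
    then show ?thesis
    proof cases
     case 1
     then have "visited (int D) g q" using J u unfolding J_def by blast
     then show ?thesis using q' unfolding visited_def improves_def by (meson order_trans)
    next
     case 2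
     then show ?thesis using q' u by simp
    qed
   qed
   moreover have "frame 30 sets2 sets2a p q'" using J q' unfolding J_def frame_def by (metis Diff_iff)
   ultimately show "J (Suc k) q' \<and> reg q' xgo = reg q xgo \<and> arr q' aq = arr q aq"
    using q' by (simp add: J_def improves_def) (simp add: frame_def)
  qed
 next
  fix q assume J: "J (d choose m) q"
  have vis: "visited (int D) f q" if "\<forall>j<n. f j < d" "bdet n h f \<noteq> 0" for f
   using all_avoided[where P = "\<lambda>g. visited (int D) g q", OF _ that] J by (simp add: J_def)
  have t0: "\<forall>j<n. (\<lambda>j. j) j < d" "bdet n h (\<lambda>j. j) \<noteq> 0" using p(1) by (auto simp: init_mem_def tabl_def)
  \<comment> \<open>Used twice: with the objective \<open>c\<close> if no ray was found, and with
    the zero objective, to which no ray is improving, so that feasibility is also detected for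
    unbounded programs.\<close>
  have near: "\<exists>f z'. (\<forall>j<n. f j < d) \<and> bdet n h f \<noteq> 0 \<and> cand f (int D) z' \<and> dot n c' z \<le> dot n c' z'"
   if z: "feas_pt z" and nr: "\<And>w. ray_vec w \<Longrightarrow> dot n c' w \<le> 0 \<or> c' = c \<and> rv q xray = 0" and c': "c' = c \<or> c' = (\<lambda>_. 0)" for z c'
  proof -
   have "\<exists>f z'. (\<forall>j<n. f j < d) \<and> bdet n h f \<noteq> 0 \<and> (\<forall>i<d. dot n (h i) z' \<le> b i) \<and>
    dot n c' z \<le> dot n c' z' \<and> (\<forall>j<n. b (f j) - dot n (h (f j)) z' < int D)"
   proof (rule near_basis[OF D(4) t0])
    fix f k w
    assume f: "\<forall>j<n. f j < d" "bdet n h f \<noteq> 0" "k < n" and w: "\<forall>j<n. dot n (h (f j)) w = (if j = k then - \<bar>bdet n h f\<bar> else 0)"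
     "\<forall>i<d. dot n (h i) w \<le> 0"
    show "dot n c' w \<le> 0"
    proof (cases "ray_vec w")
     case True
     then have "ray_at f" using f w unfolding ray_at_def by blast
     then have "rv q xray = 1" using vis[OF f(1,2)] by (simp add: visited_def)
     then show ?thesis using nr[OF True] by simp
    next
     case False
     then show ?thesis using w(2) c' by (auto simp: ray_vec_def dot_def)
    qed
   qed (use z in \<open>simp_all add: feas_pt_def\<close>)
   then show ?thesis unfolding cand_def feas_pt_def by blast
  qed
  have "rv q xfeas = 1" if z: "feas_pt z" for z
  proof -
   obtain f z' where "\<forall>j<n. f j < d" "bdet n h f \<noteq> 0" "cand f (int D) z'"
    using near[OF z, of "\<lambda>_. 0"] by (auto simp: dot_def)
   then show ?thesis using vis[of f] by (simp add: visited_def)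
  qed
  moreover have "dot n c z \<le> rv q xbest" if z: "feas_pt z" and x: "rv q xray = 0" for z
  proof -
   obtain f z' where f: "\<forall>j<n. f j < d" "bdet n h f \<noteq> 0" "cand f (int D) z'" "dot n c z \<le> dot n c z'"
    using near[OF z, of c] x by auto
   then have "dot n c z' \<le> rv q xbest" using vis[OF f(1,2)] by (simp add: visited_def)
   then show ?thesis using f(4) by simp
  qed
  ultimately show "frame 30 sets2 sets2a p q \<and> sol q \<and> rays q \<and> (\<forall>z. feas_pt z \<longrightarrow> rv q xfeas = 1) \<and>
   (rv q xray = 0 \<longrightarrow> (\<forall>z. feas_pt z \<longrightarrow> dot n c z \<le> rv q xbest))"
   using J by (simp add: J_def)
 qed
qed

end

section \<open>Initial tableau\<close>

text \<open>Diagonal entries are positive, so \<open>s\<close> is the number of those below 2. Their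
  product is the determinant of the triangular first basis.\<close>

definition init_dims :: com where
 "init_dims =
  blk (xn ::= V 0 +. N 0 ;. xm ::= V 1 +. N 0 ;. xd ::= V 0 +. V 1 ;. xdB ::= N 1 ;. xs ::= N 0 ;.
   xfeas ::= N 0 ;. xray ::= N 0 ;. xD ::= N 1) ;;
  loop 30 xn (blk (
   xdB ::= V xdB *. Ix aH (V 30 *. V xn +. V 30) ;.
   If (N 2 -. Ix aH (V 30 *. V xn +. V 30)) (xs ::= V xs +. N 1) Nop)) ;;
  blk (xK ::= V xm +. V xn -. V xs ;. xM ::= V xK +. N 1 ;. xMn ::= V xM *. V xn)"

definition load_row :: com where
 "load_row =
  loop 31 xn (blk (If (V xm -. V 30) (Sto au (V 31) (Ix aH ((V xn +. V 30) *. V xn +. V 31)))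
   (If (V xK -. V 30) (Sto au (V 31) (N 0)) (Sto au (V 31) (Ix ac (V 31)))))) ;;
  blk (If (V xK -. V 30) (If (V xm -. V 30) Nop (Sto au (V xs +. V 30 -. V xm) (N 1))) Nop)"

text \<open>The first basis is lower triangular, so coordinates are determined from the last column
  backwards. The division by the diagonal entry is exact because the tableau row is
  integral.\<close>

definition subst_entry :: com where
 "subst_entry =
  blk (32 ::= V xn -. N 1 -. V 31 ;. 33 ::= V xdB *. Ix au (V 32)) ;;
  loop 34 31 (blk (33 ::= V 33 -.
   Ix aT0 (V 30 *. V xn +. (V 32 +. N 1 +. V 34)) *. Ix aH ((V 32 +. N 1 +. V 34) *. V xn +. V 32))) ;;
  blk (Sto aT0 (V 30 *. V xn +. V 32) (V 33 div. Ix aH (V 32 *. V xn +. V 32)))"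

definition back_subst :: com where "back_subst = loop 31 xn subst_entry"

definition init :: com where
 "init = init_dims ;; loop 30 xM (load_row ;; back_subst)"

definition main :: com where
 "main = init ;; enum pass1 ;; enum pass2 ;;
  blk (If (V xfeas) (If (V xray) (0 ::= N 2) (0 ::= N 1)) (0 ::= N 0))"

locale hnf =
 fixes n m s :: nat and h :: "nat \<Rightarrow> nat \<Rightarrow> int" and \<Delta> :: int
 assumes n_pos: "0 < n" and s_le: "s \<le> n"
  and bdet_le: "\<And>f. \<forall>j<n. f j < n + m \<Longrightarrow> \<bar>bdet n h f\<bar> \<le> \<Delta>"
  and tri: "\<And>i j. i < j \<Longrightarrow> j < n \<Longrightarrow> h i j = 0"
  and diag1: "\<And>i. i < s \<Longrightarrow> h i i = 1" and diag2: "\<And>i. s \<le> i \<Longrightarrow> i < n \<Longrightarrow> 2 \<le> h i i"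
  and low: "\<And>i j. i < n \<Longrightarrow> j < i \<Longrightarrow> 0 \<le> h i j \<and> h i j < h i i"
begin

section \<open>Entry bounds from the Hermite form\<close>

definition dB :: int where "dB = (\<Prod>i<n. h i i)"

lemma diag_pos: "i < n \<Longrightarrow> 1 \<le> h i i"
 using diag1[of i] diag2[of i] by (cases "i < s") auto

lemma bdet_id: "bdet n h (\<lambda>j. j) = dB"
proof -
 have "upper_triangular (basis_mat n h (\<lambda>j. j))" using tri by (auto simp: basis_mat_def upper_triangular_def)
 then have "bdet n h (\<lambda>j. j) = prod_list (diag_mat (basis_mat n h (\<lambda>j. j)))" by (rule det_upper_triangular) (rule basis_mat_carrier)
 also have "\<dots> = (\<Prod>i = 0..<n. h i i)" unfolding prod_list_diag_prod by (intro prod.cong) (auto simp: basis_mat_def)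
 finally show ?thesis by (simp add: dB_def atLeast0LessThan)
qed

lemma dB_pos: "0 < dB"
 unfolding dB_def by (intro prod_pos) (use diag_pos in force)

lemma dB_le: "dB \<le> \<Delta>"
 using bdet_le[of "\<lambda>j. j"] bdet_id by simp

lemma Delta_pos: "1 \<le> \<Delta>"
 using dB_pos dB_le by simp

lemma prefix_le: "k \<le> n \<Longrightarrow> 1 \<le> (\<Prod>i<k. h i i) \<and> (\<Prod>i<k. h i i) \<le> dB"
proof -
 assume k: "k \<le> n"
 have p: "1 \<le> (\<Prod>i\<in>A. h i i)" if "A \<subseteq> {..<n}" for A using that diag_pos by (intro prod_ge_1) auto
 have "{..<n} = {..<k} \<union> {k..<n}" using k by auto
 then have "dB = (\<Prod>i<k. h i i) * (\<Prod>i\<in>{k..<n}. h i i)" unfolding dB_def by (simp add: prod.union_disjoint ivl_disj_int)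
 moreover have "(\<Prod>i<k. h i i) * 1 \<le> (\<Prod>i<k. h i i) * (\<Prod>i\<in>{k..<n}. h i i)"
  by (intro mult_left_mono p order_trans[OF zero_le_one p]) (use k in auto)
 ultimately show ?thesis using p[of "{..<k}"] k by auto
qed

lemma diag_le: "i < n \<Longrightarrow> h i i \<le> \<Delta>"
proof -
 assume i: "i < n"
 have "1 * h i i \<le> (\<Prod>i<i. h i i) * h i i" using prefix_le[of i] i diag_pos[OF i] by (intro mult_right_mono) auto
 also have "\<dots> \<le> dB" using prefix_le[of "Suc i"] i by simp
 finally show ?thesis using dB_le by simp
qed

lemma entry_le: "i < n \<Longrightarrow> j < n \<Longrightarrow> \<bar>h i j\<bar> \<le> \<Delta>"
proof -
 assume ij: "i < n" "j < n"
 consider "i < j" | "i = j" | "j < i" by linarith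
 then show ?thesis
 proof cases
  case 1
  then show ?thesis using tri ij Delta_pos by simp
 next
  case 2
  then show ?thesis using diag_le[OF ij(1)] diag_pos[OF ij(1)] by simp
 next
  case 3
  then show ?thesis using low[OF ij(1), of j] diag_le[OF ij(1)] by simp
 qed
qed

text \<open>Each of the last \<open>n - s\<close> diagonal entries contributes a factor of at least
  2 to the determinant.\<close>

lemma two_pow_le: "2 ^ (n - s) \<le> \<Delta>"
proof -
 have "2 ^ (i - s) \<le> (\<Prod>l<i. h l l)" if "i \<le> n" for i
  using that
 proof (induction i)
  case (Suc i)
  show ?case
  proof (cases "i < s")
   case True
   then show ?thesis using prefix_le[of "Suc i"] Suc.prems by simp
  next
   case False
   then have "(2::int) ^ (Suc i - s) = 2 ^ (i - s) * 2" by (simp add: Suc_diff_le)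
   also have "\<dots> \<le> (\<Prod>l<i. h l l) * h i i" using Suc diag2[of i] False by (intro mult_mono) (auto intro: order_trans[of 0 "2 ^ (i - s)"])
   finally show ?thesis by simp
  qed
 qed simp
 from this[of n] show ?thesis using dB_le by (simp add: dB_def)
qed

lemma tab_row_h_le:
 assumes "bdet n h f \<noteq> 0" "\<bar>\<delta>\<bar> = \<bar>bdet n h f\<bar>" "tab_row n h f \<delta> (h i) T" "k < n" "\<forall>j<n. f j < n + m" "i < n + m"
 shows "\<bar>T k\<bar> \<le> \<Delta>"
 unfolding tab_row_bdet[OF assms(1-4)] using assms(5,6) by (intro bdet_le) simp

text \<open>Rows outside the triangular part are restricted through determinants only. In the first
  basis their coordinates are at most \<Delta>, and the entries of that basis are at most \<Delta>,
  too.\<close>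

lemma row_entry_le:
 assumes i: "i < n + m" and l: "l < n"
 shows "\<bar>h i l\<bar> \<le> int n * (\<Delta> * \<Delta>)"
proof -
 obtain T where T: "tab_row n h (\<lambda>j. j) dB (h i) T" using tab_row_exists[of dB n h "\<lambda>j. j" "h i"] by (auto simp: bdet_id)
 have Tl: "\<bar>T j\<bar> \<le> \<Delta>" if "j < n" for j
  by (rule tab_row_h_le[OF _ _ T that _ i]) (use bdet_id dB_pos in auto)
 have "1 * \<bar>h i l\<bar> \<le> dB * \<bar>h i l\<bar>" using dB_pos by (intro mult_right_mono) auto
 also have "\<dots> = \<bar>dB * h i l\<bar>" using dB_pos by (simp add: abs_mult)
 also have "\<dots> = \<bar>\<Sum>j<n. T j * h j l\<bar>" using T l by (simp add: tab_row_def)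
 also have "\<dots> \<le> (\<Sum>j<n. \<bar>T j * h j l\<bar>)" by (rule sum_abs)
 also have "\<dots> \<le> (\<Sum>j<n. \<Delta> * \<Delta>)"
  unfolding abs_mult using Tl entry_le l Delta_pos by (intro sum_mono mult_mono) auto
 finally show ?thesis by simp
qed

text \<open>An entry is the product of \<open>r\<close> with an edge direction \<open>v\<close>, so
  it suffices to bound \<open>v\<close>. Its products with the rows of the triangular part are at
  most \<Delta>, and forward substitution recovers \<open>v\<close> from them. Each row may double
  the sum of the coordinates found so far, except for the first \<open>s\<close> rows, which are
  unit vectors. The growth is thus 2^(n - s) \<le> \<Delta> instead of 2^n.\<close>

lemma tab_row_le:
 assumes f: "bdet n h f \<noteq> 0" "\<bar>\<delta>\<bar> = \<bar>bdet n h f\<bar>" "\<forall>j<n. f j < n + m" and T: "tab_row n h f \<delta> r T"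
  and k: "k < n" and r: "\<forall>l<n. \<bar>r l\<bar> \<le> x"
 shows "\<bar>T k\<bar> \<le> x * (int (n + 1) * (\<Delta> * \<Delta>))"
proof -
 have d0: "\<delta> \<noteq> 0" using f by auto
 obtain v where v: "\<And>r T. tab_row n h f \<delta> r T \<Longrightarrow> dot n r v = T k" using tab_row_dual[OF f(2) d0 k] by blast
 have hv: "\<bar>dot n (h i) v\<bar> \<le> \<Delta>" if "i < n" for i
 proof -
  obtain U where U: "tab_row n h f \<delta> (h i) U" using tab_row_exists[OF f(2)] by blast
  have "\<bar>U k\<bar> \<le> \<Delta>" by (rule tab_row_h_le[OF f(1,2) U k f(3)]) (use that in simp)
  then show ?thesis using v[OF U] by simp
 qed
 define S where "S i = (\<Sum>l<i. \<bar>v l\<bar>)" for i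
 have S0: "0 \<le> S i" for i by (simp add: S_def sum_nonneg)
 \<comment> \<open>Off-diagonal entries are at most \<open>h i i - 1\<close>, so after division by
   the diagonal entry the earlier coordinates enter with a factor below 1.\<close>
 have vi: "\<bar>v i\<bar> \<le> (if i < s then \<Delta> else \<Delta> + S i)" if i: "i < n" for i
 proof -
  have "dot n (h i) v = (\<Sum>l<Suc i. h i l * v l)"
   unfolding dot_def using tri[of i] i by (intro sum.mono_neutral_right) auto
  then have e: "h i i * v i = dot n (h i) v - (\<Sum>l<i. h i l * v l)" by simp
  have p: "1 \<le> h i i" by (rule diag_pos[OF i])
  have "\<bar>\<Sum>l<i. h i l * v l\<bar> \<le> (\<Sum>l<i. \<bar>h i l * v l\<bar>)" by (rule sum_abs)
  also have "\<dots> \<le> (\<Sum>l<i. (h i i - 1) * \<bar>v l\<bar>)"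
   unfolding abs_mult using low[OF i] by (intro sum_mono mult_right_mono) force+
  also have "\<dots> = (h i i - 1) * S i" by (simp add: S_def sum_distrib_left)
  finally have "h i i * \<bar>v i\<bar> \<le> \<Delta> + (h i i - 1) * S i"
   using hv[OF i] e p by (simp add: abs_mult[symmetric] flip: abs_mult)
  then have le: "h i i * \<bar>v i\<bar> \<le> \<Delta> + (h i i - 1) * S i" .
  show ?thesis
  proof (cases "i < s")
   case True
   then show ?thesis using le diag1[OF True] by simp
  next
   case False
   have "1 * \<Delta> \<le> h i i * \<Delta>" using p Delta_pos by (intro mult_right_mono) auto
   then have "h i i * \<bar>v i\<bar> \<le> h i i * (\<Delta> + S i)" using le S0[of i] by (simp add: algebra_simps)
   then have "\<bar>v i\<bar> \<le> \<Delta> + S i" by (rule mult_left_le_imp_le) (use p in simp)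
   then show ?thesis using False by simp
  qed
 qed
 \<comment> \<open>The sum is considered together with \<Delta>, because it is this quantity that at
   most doubles in a nontrivial row; in a trivial row it grows by \<Delta> only.\<close>
 have "S i + \<Delta> \<le> 2 ^ (i - s) * (int (i + 1) * \<Delta>)" if "i \<le> n" for i
  using that
 proof (induction i)
  case 0
  then show ?case by (simp add: S_def)
 next
  case (Suc i)
  have S: "S (Suc i) = S i + \<bar>v i\<bar>" by (simp add: S_def)
  have IH: "S i + \<Delta> \<le> 2 ^ (i - s) * (int (i + 1) * \<Delta>)" using Suc by simp
  show ?case
  proof (cases "i < s")
   case True
   then show ?thesis using IH vi[of i] Suc.prems S by (simp add: algebra_simps)
  next
   case False
   have "S (Suc i) + \<Delta> \<le> 2 * (S i + \<Delta>)" using vi[of i] Suc.prems S False by simp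
   also have "\<dots> \<le> 2 * (2 ^ (i - s) * (int (i + 1) * \<Delta>))" using IH by simp
   also have "\<dots> = 2 ^ (Suc i - s) * (int (i + 1) * \<Delta>)" using False by (simp add: Suc_diff_le)
   also have "\<dots> \<le> 2 ^ (Suc i - s) * (int (Suc i + 1) * \<Delta>)" using Delta_pos by (intro mult_left_mono mult_right_mono) auto
   finally show ?thesis .
  qed
 qed
 from this[of n] have "S n \<le> 2 ^ (n - s) * (int (n + 1) * \<Delta>)" using Delta_pos by simp
 also have "\<dots> \<le> \<Delta> * (int (n + 1) * \<Delta>)" using two_pow_le Delta_pos by (intro mult_right_mono) auto
 finally have Sn: "S n \<le> int (n + 1) * (\<Delta> * \<Delta>)" by (simp add: algebra_simps)
 have x0: "0 \<le> x" using r n_pos by force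
 have "\<bar>T k\<bar> = \<bar>dot n r v\<bar>" using v[OF T] by simp
 also have "\<dots> \<le> (\<Sum>l<n. \<bar>r l * v l\<bar>)" unfolding dot_def by (rule sum_abs)
 also have "\<dots> \<le> (\<Sum>l<n. x * \<bar>v l\<bar>)" unfolding abs_mult using r by (intro sum_mono mult_right_mono) auto
 also have "\<dots> = x * S n" by (simp add: S_def sum_distrib_left)
 also have "\<dots> \<le> x * (int (n + 1) * (\<Delta> * \<Delta>))" using Sn x0 by (rule mult_left_mono)
 finally show ?thesis .
qed

end

locale hnf_run = ilp_run mul L W a \<mu> Bd n m s h b c \<Delta> TB a0 + hnf n m s h \<Delta>
 for mul L W a \<mu> Bd n m s h b c \<Delta> TB a0
begin

section \<open>Back substitution for the first tableau\<close>

lemma row_index_inj: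
 assumes "l < n" "l' < n" "int i * int n + int l = int i' * int n + int l'"
 shows "i = i' \<and> l = l'"
proof -
 have e: "i * n + l = i' * n + l'" using assms(3) by (simp flip: of_nat_mult of_nat_add)
 have "i = (i * n + l) div n" "i' = (i' * n + l') div n" using assms(1,2) by simp_all
 then have "i = i'" using e by simp
 then show ?thesis using e by simp
qed

text \<open>Chosen by existence. As the triangular system determines its solution, back substitution
  reproduces this choice.\<close>

definition T0 :: "nat \<Rightarrow> nat \<Rightarrow> int" where
 "T0 i = (SOME T. tab_row n h (\<lambda>j. j) dB (row_vec (\<lambda>i. n + i) i) T)"

lemma T0: "tab_row n h (\<lambda>j. j) dB (row_vec (\<lambda>i. n + i) i) (T0 i)"
proof -
 have "\<exists>T. tab_row n h (\<lambda>j. j) dB (row_vec (\<lambda>i. n + i) i) T" by (rule tab_row_exists) (simp add: bdet_id)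
 then show ?thesis unfolding T0_def by (rule someI_ex)
qed

lemma tabl0: "tabl (\<lambda>j. j) (\<lambda>i. n + i) dB T0"
 unfolding tabl_def
proof (intro conjI allI impI)
 fix r assume r: "r < d"
 show "(\<exists>j<n. j = r) \<or> (\<exists>i<m. n + i = r)"
 proof (cases "r < n")
  case False
  then show ?thesis using r by (intro disjI2 exI[of _ "r - n"]) (auto simp: d_def)
 qed simp
qed (use T0 bdet_id dB_pos in \<open>auto simp: d_def\<close>)

lemma T0_le: "i < M \<Longrightarrow> j < n \<Longrightarrow> \<bar>T0 i j\<bar> \<le> TB"
 by (rule TB[OF tabl0])

lemma T0_eq: "l < n \<Longrightarrow> dB * row_vec (\<lambda>i. n + i) i l = (\<Sum>j<n. T0 i j * h j l)"
 using T0[of i] by (simp add: tab_row_def)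

lemma partial_le: "i < M \<Longrightarrow> l < n \<Longrightarrow> A \<subseteq> {..<n} \<Longrightarrow> \<bar>\<Sum>j\<in>A. T0 i j * h j l\<bar> \<le> Bd"
proof -
 assume i: "i < M" and l: "l < n" and A: "A \<subseteq> {..<n}"
 have TB0: "0 \<le> TB" using Delta_pos Delta_TB by simp
 have "\<bar>\<Sum>j\<in>A. T0 i j * h j l\<bar> \<le> (\<Sum>j\<in>A. \<bar>T0 i j * h j l\<bar>)" by (rule sum_abs)
 also have "\<dots> \<le> (\<Sum>j\<in>A. \<Delta> * TB)"
 proof (rule sum_mono)
  fix j assume "j \<in> A"
  then have "\<bar>T0 i j\<bar> \<le> TB" "\<bar>h j l\<bar> \<le> \<Delta>" using A T0_le[OF i, of j] entry_le[of j l] l by auto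
  then have "\<bar>T0 i j\<bar> * \<bar>h j l\<bar> \<le> TB * \<Delta>" using TB0 by (intro mult_mono) auto
  then show "\<bar>T0 i j * h j l\<bar> \<le> \<Delta> * TB" by (simp add: abs_mult mult.commute)
 qed
 also have "\<dots> = int (card A) * (\<Delta> * TB)" by simp
 also have "\<dots> \<le> int n * (\<Delta> * TB)" using card_mono[OF _ A] TB0 Delta_pos by (intro mult_right_mono) auto
 finally show ?thesis using F_bd by simp
qed

definition input_mem :: "state \<Rightarrow> bool" where
 "input_mem p = ((\<forall>i<d. \<forall>l<n. av p aH (int i * int n + int l) = h i l) \<and> (\<forall>l<n. av p ac (int l) = c l))"

lemma init_dims_spec:
 assumes p: "rv p 0 = int n" "rv p 1 = int m" "input_mem p"
 shows "spec init_dims p (200 * n)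
  (\<lambda>q. frame 2 {} {} p q \<and> glob q \<and> rv q xdB = dB \<and> rv q xfeas = 0 \<and> rv q xray = 0 \<and> rv q xD = 1)"
proof -
 define I where "I k q = (frame 2 {} {} p q \<and> rv q xn = int n \<and> rv q xm = int m \<and> rv q xd = int d \<and>
  rv q xdB = (\<Prod>i<k. h i i) \<and> rv q xs = int (min k s) \<and> rv q xfeas = 0 \<and> rv q xray = 0 \<and> rv q xD = 1)" for k q
 have nd: "int n + int m = int d" by (simp add: d_def)
 have step: "wp (xdB ::= V xdB *. Ix aH (V 30 *. V xn +. V 30) ;.
   If (N 2 -. Ix aH (V 30 *. V xn +. V 30)) (xs ::= V xs +. N 1) Nop)
   (\<lambda>q'. rv q' 30 = int k \<and> (\<forall>x. I (Suc k) (set_reg 30 x q'))) q"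
  if k: "k < n" and q: "I k q" "rv q 30 = int k" for k q
 proof -
  have H: "av q aH (int k * int n + int k) = h k k" using q(1) p(3) k by (simp add: I_def frame_def input_mem_def d_def)
  have pr: "\<bar>(\<Prod>i<Suc k. h i i)\<bar> \<le> Bd" using prefix_le[of "Suc k"] k dB_le Delta_le by (simp del: prod.lessThan_Suc)
  have sb: "int (min k s) + 1 \<le> Bd" using k nm_le by (simp add: min_def)
  show ?thesis
   using q pr sb H diag1[of k] diag2[of k] k
   by (cases "k < s") (auto simp: I_def frame_def mult.commute min_def)
 qed
 show ?thesis
  unfolding init_dims_def
  apply (rule spec_le, rule wp_Seq[where A = "I 0"], simp)
  apply (use p Bd_ge nm_le d_le nd in \<open>simp add: I_def frame_def\<close>)
  apply (rule spec_loop_Seq[where n = n and I = I])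
  apply (simp_all add: nm_le)[4]
  apply (simp add: I_def frame_def; fail)
  apply (simp add: I_def; fail)
  apply (rule wp_spec, simp)
  apply (rule step; assumption)
  apply (rule wp_spec, simp)
  subgoal for q1 q
  proof -
   assume q: "I n q"
   have K: "int m + int n - int s = int K" using s_le by (simp add: K_def)
   have M: "int K + 1 = int M" by (simp add: M_def)
   have "M * 1 \<le> M * n" using n_pos by (intro mult_le_mono2) simp
   then have "int M \<le> Bd" using Mn_le by linarith
   moreover from this M have "int K \<le> Bd" by linarith
   moreover have "rv q xs = int s" using q s_le by (simp add: I_def min_absorb2)
   ultimately show ?thesis
    using q K M Mn_le by (simp add: I_def frame_def glob_def dB_def)
  qed
  apply (use n_pos in simp)
  done
qed

abbreviation (input) R0 :: "nat \<Rightarrow> nat \<Rightarrow> int" where "R0 i \<equiv> row_vec (\<lambda>i. n + i) i"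

definition imem :: "nat \<Rightarrow> state \<Rightarrow> bool" where
 "imem k q = (glob q \<and> input_mem q \<and> rv q xdB = dB \<and> (\<forall>i<k. \<forall>l<n. av q aT0 (int i * int n + int l) = T0 i l))"

lemma load_row_spec:
 assumes p: "imem i p" "rv p 30 = int i" "i < M"
 shows "spec load_row p (100 * n) (\<lambda>q. frame 31 {} {au} p q \<and> (\<forall>l<n. av q au (int l) = R0 i l))"
proof -
 have g: "glob p" "input_mem p" using p by (simp_all add: imem_def)
 note gp = g(1)[unfolded glob_def]
 define I where "I k q = (frame 31 {} {au} p q \<and>
  (\<forall>l<k. av q au (int l) = (if i < m then h (n + i) l else if i < K then 0 else c l)))" for k q
 have step: "wp (If (V xm -. V 30) (Sto au (V 31) (Ix aH ((V xn +. V 30) *. V xn +. V 31)))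
   (If (V xK -. V 30) (Sto au (V 31) (N 0)) (Sto au (V 31) (Ix ac (V 31)))))
   (\<lambda>q'. rv q' 31 = int k \<and> (\<forall>x. I (Suc k) (set_reg 31 x q'))) q"
  if k: "k < n" and q: "I k q" "rv q 31 = int k" for k q
 proof -
  have H: "av q aH ((int n + int i) * int n + int k) = h (n + i) k" if "i < m"
  proof -
   have "av p aH (int (n + i) * int n + int k) = h (n + i) k"
    using g(2)[unfolded input_mem_def, THEN conjunct1, rule_format, of "n + i" k] k that by (simp add: d_def)
   then show ?thesis using q(1) by (simp add: I_def frame_def)
  qed
  have C: "av q ac (int k) = c k" using g(2) q(1) k by (simp add: input_mem_def I_def frame_def)
  have r: "rv q xm = int m" "rv q xK = int K" "rv q xn = int n" "rv q 30 = int i" using q(1) gp p(2) by (simp_all add: I_def frame_def)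
  show ?thesis
  proof (cases "i < m")
   case True
   then show ?thesis using q r H[OF True] by (auto simp: I_def frame_def less_Suc_eq)
  next
   case False
   then show ?thesis using q r C Bd_ge by (auto simp: I_def frame_def less_Suc_eq)
  qed
 qed
 show ?thesis
  unfolding load_row_def
  apply (rule spec_le, rule spec_loop_Seq[where n = n and I = I])
  apply (simp_all add: nm_le)[4]
  apply (simp add: I_def; fail)
  apply (simp add: I_def frame_def gp; fail)
  apply (rule wp_spec, simp)
  apply (rule step; assumption)
  apply (rule wp_spec, simp)
  subgoal for q
  proof -
   assume q: "I n q"
   have r: "rv q xm = int m" "rv q xK = int K" "rv q xs = int s" "rv q 30 = int i" using q gp p(2) by (simp_all add: I_def frame_def)
   consider "i < m" | "m \<le> i" "i < K" | "i = K" using p(3) unfolding M_def by linarith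
   then show ?thesis
   proof cases
    case 1
    then show ?thesis using q r by (simp add: I_def row_vec_def K_def)
   next
    case 2
    have e: "int s + int i - int m = int (s + i - m)" using 2 by simp
    have "av (set_arr au (int (s + i - m)) x q) au (int l) = R0 i l" if "fst x = 1" "l < n" for x l
    proof -
     have "av q au (int l) = 0" using q 2 that(2) by (simp add: I_def)
     moreover have "R0 i l = (if l = s + i - m then 1 else 0)" using 2 by (simp add: row_vec_def)
     ultimately show ?thesis using that(1) by (simp del: of_nat_diff)
    qed
    moreover have "frame 31 {} {au} p (set_arr au (int (s + i - m)) x q)" for x using q by (simp add: I_def frame_def)
    ultimately show ?thesis using 2 r Bd_ge by (simp add: e del: of_nat_diff)
   next
    case 3
    then show ?thesis using q r by (simp add: I_def row_vec_def K_def)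
   qed
  qed
  apply (use n_pos in simp)
  done
qed

lemma back_subst_spec:
 assumes p: "imem i p" "rv p 30 = int i" "i < M" "\<forall>l<n. av p au (int l) = R0 i l"
 shows "spec back_subst p (100 * n * (n + 1)) (\<lambda>q. frame 31 {} {aT0} p q \<and> imem (Suc i) q)"
proof -
 have g: "glob p" "input_mem p" "rv p xdB = dB" using p by (simp_all add: imem_def)
 note gp = g(1)[unfolded glob_def]
 define I where "I k q = (frame 31 {} {aT0} p q \<and> (\<forall>i'<i. \<forall>l<n. av q aT0 (int i' * int n + int l) = T0 i' l) \<and>
  (\<forall>l. n - k \<le> l \<longrightarrow> l < n \<longrightarrow> av q aT0 (int i * int n + int l) = T0 i l))" for k q
 have step: "spec subst_entry q (80 * n)
   (\<lambda>q'. rv q' 31 = int k \<and> (\<forall>x. I (Suc k) (set_reg 31 x q')))"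
  if k: "k < n" and q: "I k q" "rv q 31 = int k" for k q
 proof -
  define l where "l = n - 1 - k"
  have l: "l < n" "n - k = Suc l" "n - Suc k = l" "int n - 1 - int k = int l" "k = n - 1 - l" using k by (auto simp: l_def)
  have fr: "frame 31 {} {aT0} p q" using q by (simp add: I_def)
  have r: "rv q xn = int n" "rv q xdB = dB" "rv q 30 = int i" "arr q aH = arr p aH" "arr q au = arr p au" using fr gp g p(2) by (simp_all add: frame_def)
  have H: "av p aH (int j * int n + int l) = h j l" if "j < n" for j using g(2) that l(1) by (simp add: input_mem_def d_def)
  have T: "av q aT0 (int i * int n + int j) = T0 i j" if "l < j" "j < n" for j using q(1) that l by (simp add: I_def)
  \<comment> \<open>The running remainder is written as what is left of the full sum after
    \<open>t\<close> known terms. In this form it is a subsum, bounded by \<open>partial_le\<close>;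
    at the end only the diagonal term survives, the terms with smaller \<open>j\<close> being
    0.\<close>
  define rest where "rest t = (\<Sum>j\<in>{..<n} - {l<..<l + 1 + t}. T0 i j * h j l)" for t
  have "{l<..<l + 1 + 0} = {}" by auto
  then have rest0: "rest 0 = dB * R0 i l" unfolding rest_def T0_eq[OF l(1)] by (simp only: Diff_empty)
  have restS: "rest t = rest (Suc t) + T0 i (l + 1 + t) * h (l + 1 + t) l" if "l + 1 + t < n" for t
  proof -
   have "{..<n} - {l<..<l + 1 + t} = insert (l + 1 + t) ({..<n} - {l<..<l + 1 + Suc t})" using that by auto
   then show ?thesis unfolding rest_def by simp
  qed
  have restn: "rest (n - 1 - l) = T0 i l * h l l"
  proof -
   have "rest (n - 1 - l) = (\<Sum>j\<in>{l}. T0 i j * h j l)"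
    unfolding rest_def by (rule sum.mono_neutral_right) (use l(1) tri in auto)
   then show ?thesis by simp
  qed
  have rb: "\<bar>rest t\<bar> \<le> Bd" for t unfolding rest_def by (rule partial_le[OF p(3) l(1)]) auto
  define J where "J t q' = (frame 32 {} {} q q' \<and> rv q' 32 = int l \<and> rv q' 33 = rest t)" for t q'
  show ?thesis
   unfolding subst_entry_def
   apply (rule spec_le, rule wp_Seq[where A = "J 0"], simp)
   apply (use r q(2) l p(4) rb[of 0] rest0 nm_le in \<open>simp add: J_def frame_def\<close>)
   apply (rule spec_loop_Seq[where n = k and I = J])
   apply (use k nm_le in simp_all)[4]
   apply (simp add: J_def; fail)
   apply (use q(2) in \<open>simp add: J_def frame_def\<close>)
   apply (rule wp_spec, simp)
   subgoal for q1 t q2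
   proof -
    assume t: "t < k" and J: "J t q2" and r34: "rv q2 34 = int t"
    have lt: "l + 1 + t < n" using t l k by linarith
    have e: "int l + 1 + int t = int (l + 1 + t)" by simp
    have f2: "rv q2 xn = int n" "rv q2 30 = int i" "arr q2 aH = arr p aH" "arr q2 aT0 = arr q aT0" "rv q2 32 = int l" "rv q2 33 = rest t"
     using J r by (simp_all add: J_def frame_def)
    show ?thesis
     using J r34 restS[OF lt] rb[of "Suc t"] T[of "l + 1 + t"] H[of "l + 1 + t"] lt
     by (simp add: f2 r e J_def frame_def del: of_nat_add of_nat_Suc)
   qed
   apply (rule wp_spec, simp)
   subgoal for q1 q2
   proof -
    assume J: "J k q2"
    have f2: "frame 32 {} {} q q2" "rv q2 xn = int n" "rv q2 30 = int i" "arr q2 aH = arr p aH" "rv q2 32 = int l" "rv q2 33 = T0 i l * h l l"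
     using J r restn l(5) by (simp_all add: J_def frame_def)
    have d: "T0 i l * h l l div h l l = T0 i l" using diag_pos[OF l(1)] by simp
    have tb: "\<bar>T0 i l\<bar> \<le> Bd" using T0_le[OF p(3) l(1)] TB_le by simp
    have "I (Suc k) (set_reg 31 y (set_arr aT0 (int i * int n + int l) x q2))" if "fst x = T0 i l" for x y
     unfolding I_def
    proof (intro conjI allI impI)
     show "frame 31 {} {aT0} p (set_reg 31 y (set_arr aT0 (int i * int n + int l) x q2))" using fr f2(1) by (simp add: frame_def)
     fix i' l' assume "i' < i" "l' < n"
     then show "av (set_reg 31 y (set_arr aT0 (int i * int n + int l) x q2)) aT0 (int i' * int n + int l') = T0 i' l'"
      using row_index_inj[of l' l i' i] l(1) q(1) f2(1) by (auto simp: I_def frame_def)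
    next
     fix l' assume "n - Suc k \<le> l'" "l' < n"
     then show "av (set_reg 31 y (set_arr aT0 (int i * int n + int l) x q2)) aT0 (int i * int n + int l') = T0 i l'"
      using that l q(1) f2(1) by (cases "l' = l") (auto simp: I_def frame_def)
    qed
    then show ?thesis using f2 H[OF l(1)] d tb q(2) by (simp add: frame_def)
   qed
   apply (use k in simp)
   done
 qed
 show ?thesis
  unfolding back_subst_def
  apply (rule spec_le, rule spec_loop[where n = n and I = I])
  apply (simp_all add: nm_le)[4]
  apply (use p(1) in \<open>simp add: I_def imem_def\<close>)
  apply (simp add: I_def frame_def gp; fail)
  apply (rule step; assumption)
  subgoal for q
  proof -
   assume I: "I n q"
   then have "frame 31 {} {aT0} p q" "\<forall>i'<Suc i. \<forall>l<n. av q aT0 (int i' * int n + int l) = T0 i' l" by (auto simp: I_def less_Suc_eq)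
   moreover from this have "glob q" "input_mem q" "rv q xdB = dB" using g by (simp_all add: frame_def glob_def input_mem_def)
   ultimately show ?thesis by (simp add: imem_def)
  qed
  apply (use n_pos in \<open>cases n; simp add: algebra_simps\<close>)
  done
qed

lemma init_spec:
 assumes p: "rv p 0 = int n" "rv p 1 = int m" "input_mem p" "bmem p"
 shows "spec init p (500 * M * n * (n + 1)) (\<lambda>q. init_mem q T0 \<and> bmem q \<and> rv q xfeas = 0 \<and> rv q xray = 0 \<and> rv q xD = 1)"
proof -
 define I where "I k q = (imem k q \<and> bmem q \<and> rv q xfeas = 0 \<and> rv q xray = 0 \<and> rv q xD = 1)" for k q
 have step: "spec (load_row ;; back_subst) q (200 * n * (n + 1)) (\<lambda>q'. rv q' 30 = int k \<and> (\<forall>x. I (Suc k) (set_reg 30 x q')))"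
  if k: "k < M" and q: "I k q" "rv q 30 = int k" for k q
  apply (rule spec_le, rule spec_Seq_mid[OF load_row_spec[OF _ q(2) k]])
  apply (use q in \<open>simp add: I_def\<close>)
  apply (rule spec_conseq[OF back_subst_spec[OF _ _ k]])
  apply (use q in \<open>simp add: I_def imem_def frame_def glob_def input_mem_def\<close>)
  apply (use q in \<open>simp add: frame_def\<close>)
  apply simp
  apply (use q in \<open>simp add: I_def frame_def imem_def bmem_def glob_def input_mem_def\<close>)
  apply (simp add: algebra_simps)
  done
 have MB: "int M \<le> Bd"
 proof -
  have "M * 1 \<le> M * n" using n_pos by (intro mult_le_mono2) simp
  then show ?thesis using Mn_le by linarith
 qed
 show ?thesis
  unfolding init_def
  apply (rule spec_le, rule spec_Seq_mid[OF init_dims_spec[OF p(1-3)]], rule spec_loop[where n = M and I = I])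
      apply (simp_all add: MB)[4]
     apply (use p in \<open>simp add: I_def imem_def frame_def input_mem_def bmem_def glob_def\<close>)
    apply (simp add: I_def imem_def glob_def)
    apply (rule step; assumption)
   apply (use tabl0 in \<open>simp add: I_def imem_def init_mem_def\<close>)
 proof -
  have *: "200 * y + (3 + x * (200 * y * (y + 1) + 4)) \<le> 500 * x * y * (y + 1)" if "0 < y" "0 < x" for x y :: nat
   using that by (cases x; cases y; simp add: algebra_simps)
  show "200 * n + (3 + M * (200 * n * (n + 1) + 4)) \<le> 500 * M * n * (n + 1)"
   by (rule *) (use n_pos in \<open>simp_all add: M_def\<close>)
 qed
qed

definition main_cost :: nat where
 "main_cost = 500 * M * n * (n + 1) + (((d choose m) * (400 * n * (d + M * n + 1) + 50 + 100 * (m + 1)) + 100 * (m + 1)) +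
  (((d choose m) * (cost2 + 100 * (m + 1)) + 100 * (m + 1)) + 50))"

lemma main_spec:
 assumes p: "rv p 0 = int n" "rv p 1 = int m" "input_mem p" "bmem p"
 shows "spec main p main_cost (\<lambda>q.
  (rv q 0 = 0 \<and> (\<forall>z. \<not> feas_pt z)) \<or>
  (rv q 0 = 1 \<and> feas_pt (\<lambda>l. av q az (int l)) \<and> (\<forall>z. feas_pt z \<longrightarrow> dot n c z \<le> dot n c (\<lambda>l. av q az (int l)))) \<or>
  (rv q 0 = 2 \<and> (\<exists>z. feas_pt z) \<and> (\<exists>w. ray_vec w)))" (is "spec _ _ _ ?P")
 unfolding main_def main_cost_def
proof (rule spec_Seq_mid[OF init_spec[OF p]])
 fix q1 assume q1: "init_mem q1 T0 \<and> bmem q1 \<and> rv q1 xfeas = 0 \<and> rv q1 xray = 0 \<and> rv q1 xD = 1"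
 let ?e = "blk (If (V xfeas) (If (V xray) (0 ::= N 2) (0 ::= N 1)) (0 ::= N 0))"
 let ?c1 = "(d choose m) * (400 * n * (d + M * n + 1) + 50 + 100 * (m + 1)) + 100 * (m + 1)"
 let ?c2 = "(d choose m) * (cost2 + 100 * (m + 1)) + 100 * (m + 1)"
 show "spec (enum pass1 ;; enum pass2 ;; ?e) q1 (?c1 + (?c2 + 50)) ?P"
 proof (rule spec_Seq_mid[OF pass1_spec], use q1 in blast, use q1 in blast, elim conjE exE)
  fix q2 D assume fr2: "frame 30 {xgo, xD, xdel} {aq, amk, aT, aT2, acol, arow} q1 q2" and
   D: "rv q2 xD = int D" "1 \<le> D" "int D \<le> \<Delta>" "\<forall>f. (\<forall>j<n. f j < d) \<longrightarrow> \<bar>bdet n h f\<bar> \<le> int D"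
  have q2: "init_mem q2 T0" "rv q2 xfeas = 0" "rv q2 xray = 0" "bmem q2"
   using q1 fr2 by (simp_all add: frame_def bmem_def init_mem_def glob_def)
  show "spec (enum pass2 ;; ?e) q2 (?c2 + 50) ?P"
   apply (rule spec_Seq_mid[OF pass2_spec[OF q2 D(1-3)]])
   apply (use D(4) in blast)
   apply (rule spec_le, rule wp_spec, simp)
   apply (use Bd_ge in \<open>fastforce simp: sol_def rays_def\<close>)
   apply simp
   done
 qed
qed

end

section \<open>One variable\<close>

text \<open>For one variable the machine is used with \<open>W = a\<close>: with the reserve of a
  factor 8, counters could exceed the word length and their cost would depend on m. Hence sizes are
  computed along each expression.\<close>

fun szb :: "state \<Rightarrow> aexp \<Rightarrow> nat" where
 "szb p (N z) = 3"
| "szb p (V r) = snd (reg p r)"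
| "szb p (B f x y) = binop_size f (szb p x) (szb p y)"
| "szb p (Ix b e) = snd (arr p b (fst (ev p e)))"

fun wfz :: "aexp \<Rightarrow> bool" where
 "wfz (N z) \<longleftrightarrow> \<bar>z\<bar> \<le> 2"
| "wfz (V r) \<longleftrightarrow> r < 100"
| "wfz (B f x y) \<longleftrightarrow> wfz x \<and> wfz y"
| "wfz (Ix b e) \<longleftrightarrow> wfz e"

fun wfq :: "prog \<Rightarrow> bool" where
 "wfq Nop \<longleftrightarrow> True"
| "wfq (r ::= e) \<longleftrightarrow> wfz e \<and> \<not> is_reg e \<and> r < 100"
| "wfq (Sto b i e) \<longleftrightarrow> wfz i \<and> wfz e"
| "wfq (AsgS r e) \<longleftrightarrow> False"
| "wfq (StoS b i e) \<longleftrightarrow> False"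
| "wfq (If e P R) \<longleftrightarrow> wfz e \<and> wfq P \<and> wfq R"
| "wfq (P ;. R) \<longleftrightarrow> wfq P \<and> wfq R"

lemma binop_size_mono: "k \<le> k' \<Longrightarrow> l \<le> l' \<Longrightarrow> binop_size f k l \<le> binop_size f k' l'"
 by (cases f) auto

lemma int_size_2: "\<bar>z\<bar> \<le> 2 \<Longrightarrow> int_size z \<le> 3"
 using int_size_le_iff[of z 2] by simp

lemma snd_ev_szb: "wfz e \<Longrightarrow> snd (ev p e) \<le> szb p e"
proof (induction e)
 case (B f x y)
 then have "binop_size f (snd (ev p x)) (snd (ev p y)) \<le> szb p (B f x y)" by (simp add: binop_size_mono)
 then show ?case by (simp add: snd_binop_cell)
qed (auto simp: exact_cell_def int_size_2)

context machine
begin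

fun okS :: "state \<Rightarrow> aexp \<Rightarrow> bool" where
 "okS p (N z) \<longleftrightarrow> True"
| "okS p (V r) \<longleftrightarrow> snd (reg p r) \<le> a"
| "okS p (B f x y) \<longleftrightarrow> okS p x \<and> okS p y \<and> szb p (B f x y) \<le> a"
| "okS p (Ix b e) \<longleftrightarrow> okS p e \<and> snd (arr p b (fst (ev p e))) \<le> a"

lemma a_ge3: "3 \<le> a"
proof -
 have "3 \<le> int_size 2"
 proof (rule ccontr)
  assume "\<not> 3 \<le> int_size 2"
  then have "int_size 2 \<le> Suc 1" by simp
  then show False using int_size_le_iff[of 2 1] by simp
 qed
 moreover have "int_size 2 \<le> a" using size_le[of 2] Bd_ge by simp
 ultimately show ?thesis by linarith
qed

lemma okS: "wfz e \<Longrightarrow> okS p e \<Longrightarrow> okE p e \<and> szb p e \<le> a"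
proof (induction e)
 case (N z)
 then show ?case using a_ge3 a_le int_size_2[of z] by auto
next
 case (B f x y)
 have "snd (ev p (B f x y)) \<le> szb p (B f x y)" by (rule snd_ev_szb[OF B.prems(1)])
 then show ?case using B a_le by auto
qed (use a_le in auto)

fun wq :: "prog \<Rightarrow> (state \<Rightarrow> bool) \<Rightarrow> state \<Rightarrow> bool" where
 "wq Nop Q p \<longleftrightarrow> Q p"
| "wq (r ::= e) Q p \<longleftrightarrow> okS p e \<and> (\<forall>k \<le> szb p e. Q (set_reg r (fst (ev p e), k) p))"
| "wq (Sto b i e) Q p \<longleftrightarrow> okS p i \<and> okS p e \<and> (\<forall>k \<le> szb p e. Q (set_arr b (fst (ev p i)) (fst (ev p e), k) p))"
| "wq (AsgS r e) Q p \<longleftrightarrow> False"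
| "wq (StoS b i e) Q p \<longleftrightarrow> False"
| "wq (If e P R) Q p \<longleftrightarrow> okS p e \<and> (0 < fst (ev p e) \<longrightarrow> wq P Q p) \<and> (fst (ev p e) \<le> 0 \<longrightarrow> wq R Q p)"
| "wq (P ;. R) Q p \<longleftrightarrow> wq P (wq R Q) p"

lemma wfz_regs: "wfz e \<Longrightarrow> \<forall>r\<in>regs_of e. r < 100"
 by (induction e) auto

lemma wq_spec: "wfq P \<Longrightarrow> wq P Q p \<Longrightarrow> spec (blk P) p (pcost P) Q"
proof (induction P arbitrary: Q p)
 case Nop
 then show ?case by (auto simp: blk.simps intro: spec_Skip)
next
 case (Asg r e)
 then have "okE p e" "snd (ev p e) \<le> a" "snd (ev p e) \<le> szb p e" using okS[of e p] snd_ev_szb[of e p] by auto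
 moreover from this(3) have "wq (r ::= e) Q p \<Longrightarrow> Q (set_reg r (ev p e) p)" by (metis prod.collapse wq.simps(2))
 ultimately show ?case using Asg unfolding blk.simps pcost.simps by (intro spec_asg_basic) (auto simp: wfz_regs)
next
 case (Sto b i e)
 then have "okE p i" "okE p e" "snd (ev p e) \<le> a" "snd (ev p e) \<le> szb p e" using okS[of e p] okS[of i p] snd_ev_szb[of e p] by auto
 moreover from this(4) have "wq (Sto b i e) Q p \<Longrightarrow> Q (set_arr b (fst (ev p i)) (ev p e) p)" by (metis prod.collapse wq.simps(3))
 ultimately show ?case using Sto unfolding blk.simps pcost.simps by (intro spec_sto_basic) (auto simp: wfz_regs)
next
 case (If e P R)
 then show ?case unfolding blk.simps pcost.simps using okS[of e p] by (intro spec_cif_basic) (auto simp: wfz_regs)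
next
 case (Sq P R)
 then have "wq P (wq R Q) p" "wfq P" "wfq R" by auto
 from spec_conseq[OF Sq.IH(1)[OF this(2,1)] Sq.IH(2)[OF this(3)]] show ?case
  unfolding blk.simps pcost.simps by (rule spec_Seq)
qed simp_all

end

text \<open>Register 5 is the least upper bound so far, register 6 the greatest lower bound, valid
  if register 3 is 1. Register 4 becomes 0 at a violated row with coefficient zero. Negating before
  and after the floor division rounds up.\<close>

definition single_row :: prog where
 "single_row =
  (8 ::= Ix aH (V 7) ;.
  If (V 8)
   (9 ::= Ix ab (V 7) div. V 8 ;. If (V 5 -. V 9) (5 ::= V 9 +. N 0) Nop)
   (If (N 0 -. V 8)
    (10 ::= N 0 -. V 8 ;. 10 ::= Ix ab (V 7) div. V 10 ;. 9 ::= N 0 -. V 10 ;.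
     If (V 3) (If (V 9 -. V 6) (6 ::= V 9 +. N 0) Nop) (6 ::= V 9 +. N 0 ;. 3 ::= N 1))
    (If (N 0 -. Ix ab (V 7)) (4 ::= N 0) Nop)))"

definition single_out :: prog where
 "single_out =
  If (V 4)
   (If (V 3)
    (If (V 6 -. V 5) (0 ::= N 0)
     (0 ::= N 1 ;. If (N 0 -. Ix ac (N 0)) (Sto az (N 0) (V 6)) (Sto az (N 0) (V 5))))
    (If (N 0 -. Ix ac (N 0)) (0 ::= N 2) (0 ::= N 1 ;. Sto az (N 0) (V 5))))
   (0 ::= N 0)"

text \<open>Row 0 has the positive diagonal entry as coefficient, so it provides an initial upper
  bound. Unboundedness is thus possible only towards minus infinity.\<close>

definition single :: com where
 "single =
  blk (2 ::= V 0 +. V 1 ;. 3 ::= N 0 ;. 4 ::= N 1 ;. 6 ::= N 0 ;. 8 ::= Ix aH (N 0) ;.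
   5 ::= Ix ab (N 0) div. V 8) ;;
  loop 7 2 (blk single_row) ;;
  blk single_out"

locale single_var = machine +
 fixes d sz :: nat and h b :: "nat \<Rightarrow> int" and c :: int
 assumes d_pos: "0 < d" and h0: "1 \<le> h 0" and h_sz: "\<And>i. i < d \<Longrightarrow> int_size (h i) \<le> sz" and c_sz: "int_size c \<le> sz"
  and sz3: "3 \<le> sz" and sz_a: "sz + 10 \<le> a" and d_le: "int d \<le> Bd" and d_a: "int_size (int d) + 1 \<le> a"
begin

definition smem :: "state \<Rightarrow> bool" where
 "smem p = ((\<forall>i<d. av p aH (int i) = h i \<and> av p ab (int i) = b i \<and> snd (arr p ab (int i)) \<le> 1 \<and> snd (arr p aH (int i)) \<le> sz) \<and>
  av p ac 0 = c \<and> snd (arr p ac 0) \<le> sz)"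

definition feas1 :: "int \<Rightarrow> bool" where "feas1 x = ((\<forall>i<d. h i * x \<le> b i))"

lemma upper: "0 < u \<Longrightarrow> u * x \<le> v \<longleftrightarrow> x \<le> v div u" for u v x :: int
proof
 assume u: "0 < u" and "u * x \<le> v"
 then have "u * x div u \<le> v div u" by (intro zdiv_mono1)
 then show "x \<le> v div u" using u by simp
next
 assume u: "0 < u" and "x \<le> v div u"
 then have "u * x \<le> u * (v div u)" by simp
 also have "\<dots> = v - v mod u" by (simp add: minus_mod_eq_mult_div)
 also have "\<dots> \<le> v" using u by simp
 finally show "u * x \<le> v" .
qed

lemma lower: "u < 0 \<Longrightarrow> u * x \<le> v \<longleftrightarrow> - (v div (- u)) \<le> x" for u v x :: int
 using upper[of "- u" "- x" v] by auto

text \<open>The second conjunct says that the bound stems from an actual row; this makes it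
  necessary for feasibility.\<close>

definition up :: "nat \<Rightarrow> int \<Rightarrow> bool" where
 "up k u = ((\<forall>i<k. 0 < h i \<longrightarrow> u \<le> b i div h i) \<and> (\<exists>i<d. 0 < h i \<and> u = b i div h i))"

definition lo :: "nat \<Rightarrow> int \<Rightarrow> int \<Rightarrow> bool" where
 "lo k f l = (f = 0 \<and> (\<forall>i<k. 0 \<le> h i) \<or>
  f = 1 \<and> (\<forall>i<k. h i < 0 \<longrightarrow> - (b i div (- h i)) \<le> l) \<and> (\<exists>i<d. h i < 0 \<and> l = - (b i div (- h i))))"

definition okv :: "nat \<Rightarrow> int \<Rightarrow> bool" where
 "okv k v = (v = (if \<exists>i<k. h i = 0 \<and> b i < 0 then 0 else 1))"

lemma up_keep: "up k u \<Longrightarrow> (0 < h k \<Longrightarrow> u \<le> b k div h k) \<Longrightarrow> up (Suc k) u"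
 by (auto simp: up_def less_Suc_eq)

lemma up_take: "up k u \<Longrightarrow> k < d \<Longrightarrow> 0 < h k \<Longrightarrow> b k div h k < u \<Longrightarrow> up (Suc k) (b k div h k)"
 by (fastforce simp: up_def less_Suc_eq)

lemma lo_keep: "lo k f l \<Longrightarrow> (h k < 0 \<Longrightarrow> f = 1 \<and> - (b k div (- h k)) \<le> l) \<Longrightarrow> lo (Suc k) f l"
 unfolding lo_def by (cases "h k < 0") (auto simp: less_Suc_eq)

lemma lo_take: "lo k f l \<Longrightarrow> k < d \<Longrightarrow> h k < 0 \<Longrightarrow> (f = 1 \<Longrightarrow> l < - (b k div (- h k))) \<Longrightarrow> lo (Suc k) 1 (- (b k div (- h k)))"
 by (fastforce simp: lo_def less_Suc_eq)

lemma okv_keep: "okv k v \<Longrightarrow> \<not> (h k = 0 \<and> b k < 0) \<Longrightarrow> okv (Suc k) v"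
proof -
 assume a: "okv k v" "\<not> (h k = 0 \<and> b k < 0)"
 have "(\<exists>i<Suc k. h i = 0 \<and> b i < 0) \<longleftrightarrow> (\<exists>i<k. h i = 0 \<and> b i < 0)" using a(2) by (auto simp: less_Suc_eq)
 then show ?thesis using a(1) by (simp add: okv_def)
qed

lemma okv_fail: "h k = 0 \<Longrightarrow> b k < 0 \<Longrightarrow> okv (Suc k) 0"
 by (auto simp: okv_def)

lemma lo_flag: "lo k f l \<Longrightarrow> f = 0 \<or> f = 1"
 by (auto simp: lo_def)

definition inv1 :: "state \<Rightarrow> nat \<Rightarrow> state \<Rightarrow> bool" where
 "inv1 p k q = (arr q = arr p \<and> rv q 2 = int d \<and> snd (reg q 5) \<le> sz + 5 \<and> snd (reg q 6) \<le> sz + 6 \<and>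
  up k (rv q 5) \<and> lo k (rv q 3) (rv q 6) \<and> snd (reg q 3) \<le> 3 \<and> okv k (rv q 4) \<and> snd (reg q 4) \<le> 3)"

lemma row_step:
 assumes p: "smem p" and k: "k < d" and q: "inv1 p k q" "rv q 7 = int k" "snd (reg q 7) \<le> a"
 shows "wq single_row (\<lambda>q'. rv q' 7 = int k \<and> (\<forall>x. inv1 p (Suc k) (set_reg 7 x q'))) q"
proof -
 have m: "av p aH (int k) = h k" "av p ab (int k) = b k" "snd (arr p ab (int k)) \<le> 1" "snd (arr p aH (int k)) \<le> sz"
  using p k by (simp_all add: smem_def)
 have i: "arr q = arr p" "rv q 2 = int d" "snd (reg q 5) \<le> sz + 5" "snd (reg q 6) \<le> sz + 6" "up k (rv q 5)"
  "lo k (rv q 3) (rv q 6)" "snd (reg q 3) \<le> 3" "okv k (rv q 4)" "snd (reg q 4) \<le> 3" using q(1) by (simp_all add: inv1_def)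
 have sz: "snd (arr p aH (int k)) \<le> a" "snd (arr p ab (int k)) \<le> a" "snd (reg q 5) \<le> a" "snd (reg q 6) \<le> a" "snd (reg q 3) \<le> a"
  using m i sz3 sz_a by linarith+
 consider "0 < h k" | "h k < 0" | "h k = 0" by linarith
 then show ?thesis
 proof cases
  case 1
  have "lo (Suc k) (rv q 3) (rv q 6)" "okv (Suc k) (rv q 4)" using lo_keep[OF i(6)] okv_keep[OF i(8)] 1 by simp_all
  moreover have "b k div h k < rv q 5 \<Longrightarrow> up (Suc k) (b k div h k)" "rv q 5 \<le> b k div h k \<Longrightarrow> up (Suc k) (rv q 5)"
   using up_take[OF i(5) k 1] up_keep[OF i(5)] by simp_all
  ultimately show ?thesis using 1 unfolding single_row_def
   apply (simp add: i m q inv1_def sz)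
   apply (use m(3,4) i(3,4) sz3 sz_a in auto)
   done
 next
  case 2
  have "up (Suc k) (rv q 5)" "okv (Suc k) (rv q 4)" using up_keep[OF i(5)] okv_keep[OF i(8)] 2 by simp_all
  moreover have "rv q 3 = 0 \<or> rv q 6 < - (b k div - h k) \<Longrightarrow> lo (Suc k) 1 (- (b k div - h k))"
   using lo_take[OF i(6) k 2] by auto
  moreover have "rv q 3 = 1 \<Longrightarrow> - (b k div - h k) \<le> rv q 6 \<Longrightarrow> lo (Suc k) (rv q 3) (rv q 6)" using lo_keep[OF i(6)] by simp
  ultimately show ?thesis using 2 lo_flag[OF i(6)] unfolding single_row_def
   apply (simp add: i m q inv1_def sz)
   apply (use m(3,4) i(3,4,7) sz3 sz_a in auto)
   done
 next
  case 3
  have "up (Suc k) (rv q 5)" "lo (Suc k) (rv q 3) (rv q 6)" using up_keep[OF i(5)] lo_keep[OF i(6)] 3 by simp_all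
  moreover have "b k < 0 \<Longrightarrow> okv (Suc k) 0" "0 \<le> b k \<Longrightarrow> okv (Suc k) (rv q 4)" using okv_keep[OF i(8)] okv_fail 3 by auto
  ultimately show ?thesis using 3 unfolding single_row_def
   apply (simp add: i m q inv1_def sz)
   apply (use m(3,4) i(3,4) sz3 sz_a in auto)
   done
 qed
qed

definition single_post :: "state \<Rightarrow> bool" where
 "single_post q = ((rv q 0 = 0 \<and> (\<forall>x. \<not> feas1 x)) \<or>
  (rv q 0 = 1 \<and> feas1 (av q az 0) \<and> (\<forall>x. feas1 x \<longrightarrow> c * x \<le> c * av q az 0)) \<or>
  (rv q 0 = 2 \<and> (\<exists>x. feas1 x) \<and> (\<forall>B. \<exists>x. feas1 x \<and> B < c * x)))"

lemma feas1_iff: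
 assumes "up d u" "lo d f l" "okv d v"
 shows "feas1 x \<longleftrightarrow> v = 1 \<and> x \<le> u \<and> (f = 1 \<longrightarrow> l \<le> x)"
proof
 assume x: "feas1 x"
 have xi: "h i * x \<le> b i" if "i < d" for i using x that by (simp add: feas1_def)
 have "\<not> (\<exists>i<d. h i = 0 \<and> b i < 0)" using xi by fastforce
 then have "v = 1" using assms(3) by (auto simp: okv_def)
 moreover have "x \<le> u" using assms(1) xi upper unfolding up_def by metis
 moreover have "l \<le> x" if f: "f = 1"
 proof -
  obtain i where "i < d" "h i < 0" "l = - (b i div (- h i))" using assms(2) f unfolding lo_def by auto
  then show ?thesis using xi[of i] lower[of "h i" x "b i"] by simp
 qed
 ultimately show "v = 1 \<and> x \<le> u \<and> (f = 1 \<longrightarrow> l \<le> x)" by simp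
next
 assume x: "v = 1 \<and> x \<le> u \<and> (f = 1 \<longrightarrow> l \<le> x)"
 show "feas1 x" unfolding feas1_def
 proof (intro allI impI)
  fix i assume i: "i < d"
  consider "0 < h i" | "h i < 0" | "h i = 0" by linarith
  then show "h i * x \<le> b i"
  proof cases
   case 1
   then have "u \<le> b i div h i" using assms(1) i by (simp add: up_def)
   then have "x \<le> b i div h i" using x by linarith
   then show ?thesis using upper[OF 1] by blast
  next
   case 2
   then have "f = 1" "- (b i div (- h i)) \<le> l" using assms(2) i unfolding lo_def by force+
   then have "- (b i div (- h i)) \<le> x" using x by linarith
   then show ?thesis using lower[OF 2] by blast
  next
   case 3
   have "\<not> (\<exists>i<d. h i = 0 \<and> b i < 0)" using assms(3) x by (auto simp: okv_def split: if_splits)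
   then have "0 \<le> b i" using i 3 by force
   then show ?thesis using 3 by simp
  qed
 qed
qed

lemma out_step:
 assumes p: "smem p" and q: "inv1 p d q"
 shows "wq single_out single_post q"
proof -
 have m: "av p ac 0 = c" "snd (arr p ac 0) \<le> sz" using p by (simp_all add: smem_def)
 have i: "arr q = arr p" "snd (reg q 5) \<le> sz + 5" "snd (reg q 6) \<le> sz + 6" "up d (rv q 5)"
  "lo d (rv q 3) (rv q 6)" "snd (reg q 3) \<le> 3" "okv d (rv q 4)" "snd (reg q 4) \<le> 3" using q by (simp_all add: inv1_def)
 have sz: "snd (arr p ac 0) \<le> a" "snd (reg q 5) \<le> a" "snd (reg q 6) \<le> a" "snd (reg q 3) \<le> a" "snd (reg q 4) \<le> a"
  "Suc (max (snd (reg q 6)) (snd (reg q 5))) \<le> a" "Suc (max 3 (snd (arr p ac 0))) \<le> a"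
  using m i sz3 sz_a by linarith+
 note F = feas1_iff[OF i(4,5,7)]
 have v: "rv q 4 = 0 \<or> rv q 4 = 1" using i(7) by (auto simp: okv_def)
 have pos: "c * x \<le> c * y" if "0 \<le> c" "x \<le> y" for x y using that by (rule mult_left_mono[rotated])
 have neg: "c * x \<le> c * y" if "c < 0" "y \<le> x" for x y using that by (intro mult_left_mono_neg) auto
 have unb: "\<exists>x. x \<le> u \<and> B < c * x" if "c < 0" for u B
 proof -
  define x where "x = min u (- (\<bar>B\<bar> + 1))"
  have "c * x \<ge> - 1 * x" using that by (intro mult_right_mono_neg) (auto simp: x_def)
  then have "B < c * x" by (simp add: x_def)
  then show ?thesis by (intro exI[of _ x]) (simp add: x_def)
 qed
 show ?thesis
  unfolding single_out_def
  using v lo_flag[OF i(5)] pos neg unb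
  by (auto simp: i m[simplified] sz[simplified] single_post_def F)
qed

lemma single_spec:
 assumes p: "smem p" "rv p 0 = 1" "rv p 1 = int d - 1" "snd (reg p 0) + 1 \<le> a" "snd (reg p 1) + 1 \<le> a"
 shows "spec single p (100 * (d + 1)) single_post"
proof -
 have m: "av p aH 0 = h 0" "av p ab 0 = b 0" "snd (arr p ab 0) \<le> 1" "snd (arr p aH 0) \<le> sz"
  using p(1) d_pos unfolding smem_def by force+
 have sz: "snd (arr p aH 0) \<le> a" "snd (arr p ab 0) \<le> a" "snd (arr p ab 0) + snd (arr p aH 0) \<le> a" "snd (arr p ab 0) + snd (arr p aH 0) \<le> sz + 5"
  "snd (reg p 0) \<le> a" "snd (reg p 1) \<le> a" "Suc (max (snd (reg p 0)) (snd (reg p 1))) \<le> a"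
  using m p sz_a by linarith+
 have up0: "up 0 (b 0 div h 0)" using h0 d_pos by (force simp: up_def)
 have 0: "lo 0 0 0" "okv 0 1" by (simp_all add: lo_def okv_def)
 show ?thesis
  unfolding single_def
  apply (rule spec_le, rule spec_Seq, rule spec_conseq[where Q = "\<lambda>q. \<forall>x. inv1 p 0 (set_reg 7 x q)"], rule wq_spec)
  apply simp
  apply (use sz[simplified] m p 0 up0 in \<open>auto simp: inv1_def\<close>)[1]
  apply (rule spec_Seq, rule spec_conseq[where Q = "inv1 p d"])
  apply (rule spec_loop[where n = d and I = "inv1 p" and T = "pcost single_row"])
  apply (simp_all add: d_le)[4]
  apply blast
  apply (simp add: inv1_def; fail)
  apply (rule wq_spec)
  apply (simp add: single_row_def; fail)
  subgoal for q1 k q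
   using row_step[OF p(1), of k q] wfs_reg[of q 7] by (simp add: wfc_def)
  apply assumption
  apply (rule wq_spec)
  apply (simp add: single_out_def; fail)
  apply (rule out_step[OF p(1)], assumption)
  apply (simp add: single_row_def single_out_def)
  done
qed

end

section \<open>Size and cost estimates\<close>

lemma binomial_step: "real (Suc m) * real ((n + Suc m) choose Suc m) = real (n + Suc m) * real ((n + m) choose m)"
 using Suc_times_binomial_eq[of "n + m" m] by (simp only: of_nat_mult[symmetric] of_nat_eq_iff add_Suc_right mult.commute)

text \<open>The quotient of consecutive terms of \<open>(n + m choose m) / n ^ m\<close> is \<open>1 / (m + 1) + 1 / n\<close>.\<close>

lemma binomial_le_pow:
 assumes "2 \<le> n"
 shows "real ((n + m) choose m) \<le> 8 * (3 / 4) ^ m * real n ^ m"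
proof -
 define A where "A m = real ((n + m) choose m)" for m
 have step: "A (Suc m) \<le> (1 / real (Suc m) + 1 / 2) * real n * A m" for m
 proof -
  have "real (Suc m) * A (Suc m) = (real n + real (Suc m)) * A m" using binomial_step[of m n] by (simp add: A_def)
  then have "A (Suc m) = (real n / real (Suc m) + 1) * A m" by (simp add: field_simps)
  also have "\<dots> \<le> ((1 / real (Suc m) + 1 / 2) * real n) * A m"
  proof (rule mult_right_mono)
   have "(1 / real (Suc m) + 1 / 2) * real n = real n / real (Suc m) + real n / 2" by (simp add: distrib_right)
   then show "real n / real (Suc m) + 1 \<le> (1 / real (Suc m) + 1 / 2) * real n" using assms by simp
  qed (simp add: A_def)
  finally show ?thesis .
 qed
 have A0: "A 0 = 1" by (simp add: A_def)
 have A1: "A 1 \<le> 3 / 2 * real n" using step[of 0] A0 by simp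
 have A2: "A 2 \<le> 9 / 4 * real n ^ 2"
 proof -
  have "A 2 \<le> real n * A 1" using step[of 1] by (simp add: numeral_2_eq_2)
  also have "\<dots> \<le> real n * (3 / 2 * real n)" using A1 by (intro mult_left_mono) auto
  also have "\<dots> \<le> 9 / 4 * real n ^ 2" by (simp add: power2_eq_square)
  finally show ?thesis .
 qed
 \<comment> \<open>From index 3 on the quotient is at most 1/4 + 1/2 = 3/4. The constant 8 leaves
   room for the earlier terms, whose quotients are larger.\<close>
 have A3: "A (3 + k) \<le> 8 * (3 / 4) ^ (3 + k) * real n ^ (3 + k)" for k
 proof (induction k)
  case 0
  have "A 3 \<le> (5 / 6) * real n * A 2" using step[of 2] by (simp add: numeral_3_eq_3 numeral_2_eq_2)
  also have "\<dots> \<le> (5 / 6) * real n * (9 / 4 * real n ^ 2)" using A2 by (intro mult_left_mono) auto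
  also have "\<dots> \<le> 27 / 8 * real n ^ 3" by (simp add: power2_eq_square power3_eq_cube)
  finally show ?case by (simp add: power3_eq_cube)
 next
  case (Suc k)
  have "1 / real (Suc (3 + k)) + 1 / 2 \<le> 3 / 4" by (simp add: field_simps)
  then have "A (Suc (3 + k)) \<le> (3 / 4) * real n * A (3 + k)"
   by (intro order_trans[OF step] mult_right_mono) (auto simp: A_def)
  also have "\<dots> \<le> (3 / 4) * real n * (8 * (3 / 4) ^ (3 + k) * real n ^ (3 + k))" using Suc by (intro mult_left_mono) auto
  also have "\<dots> = 8 * (3 / 4) ^ Suc (3 + k) * real n ^ Suc (3 + k)" by (simp only: power_Suc mult_ac)
  finally show ?case by (simp only: add_Suc_right)
 qed
 have "A m \<le> 8 * (3 / 4) ^ m * real n ^ m"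
 proof -
  consider "m = 0" | "m = 1" | "m = 2" | k where "m = 3 + k" using le_Suc_ex[of 3 m] by (cases "3 \<le> m") force+
  then show ?thesis
  proof cases
   case 3
   have "9 / 4 * real n ^ 2 \<le> 9 / 2 * real n ^ 2" by (intro mult_right_mono) auto
   moreover have e: "8 * (3 / 4 :: real) ^ 2 = 9 / 2" by (simp add: power2_eq_square)
   ultimately show ?thesis unfolding 3 e using A2 by linarith
  qed (use A0 A1 A3 in auto)
 qed
 then show ?thesis by (simp add: A_def)
qed

text \<open>For \<open>t\<close> the e-th root of \<open>r\<close>, \<open>(m + 1) * t ^ m\<close>
  is at most the partial sum of the geometric series, hence bounded; then the e-th power is
  taken.\<close>

lemma pow_mult_geometric_bounded:
 fixes r :: real
 assumes "0 < r" "r < 1"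
 shows "\<exists>C. \<forall>m :: nat. (real m + 1) ^ e * r ^ m \<le> C"
proof (cases "e = 0")
 case True
 then show ?thesis using assms by (intro exI[of _ 1]) (simp add: power_le_one)
next
 case False
 define t where "t = root e r"
 have t: "0 < t" "t < 1" "t ^ e = r" using False assms by (auto simp: t_def real_root_lt_1_iff)
 have b: "(real m + 1) * t ^ m \<le> 1 / (1 - t)" for m
 proof -
  have "(real m + 1) * t ^ m = (\<Sum>i<Suc m. t ^ m)" by simp
  also have "\<dots> \<le> (\<Sum>i<Suc m. t ^ i)" using t by (intro sum_mono power_decreasing) auto
  also have "\<dots> = (1 - t ^ Suc m) / (1 - t)" using t by (subst sum_gp_strict) auto
  also have "\<dots> \<le> 1 / (1 - t)" using t by (intro divide_right_mono) auto
  finally show ?thesis .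
 qed
 have "(real m + 1) ^ e * r ^ m \<le> (1 / (1 - t)) ^ e" for m
 proof -
  have "r ^ m = (t ^ m) ^ e" using t(3) by (metis power_mult mult.commute)
  then have "(real m + 1) ^ e * r ^ m = ((real m + 1) * t ^ m) ^ e" by (simp add: power_mult_distrib)
  also have "\<dots> \<le> (1 / (1 - t)) ^ e" using b t by (intro power_mono) auto
  finally show ?thesis .
 qed
 then show ?thesis by blast
qed

lemma binomial_poly_bounded:
 "\<exists>C>0. \<forall>n m. 2 \<le> n \<longrightarrow> real ((n + m) choose m) * (real m + 1) ^ e \<le> C * real n ^ m"
proof -
 obtain C where C: "\<And>m :: nat. (real m + 1) ^ e * (3 / 4) ^ m \<le> C" using pow_mult_geometric_bounded[of "3 / 4" e] by auto
 have C0: "0 < C" using C[of 0] by simp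
 have "real ((n + m) choose m) * (real m + 1) ^ e \<le> (8 * C) * real n ^ m" if "2 \<le> n" for n m
 proof -
  have "real ((n + m) choose m) * (real m + 1) ^ e \<le> (8 * (3 / 4) ^ m * real n ^ m) * (real m + 1) ^ e"
   using binomial_le_pow[OF that] by (intro mult_right_mono) auto
  also have "\<dots> = (8 * real n ^ m) * ((real m + 1) ^ e * (3 / 4) ^ m)" by (simp add: mult_ac)
  also have "\<dots> \<le> (8 * real n ^ m) * C" using C by (intro mult_left_mono) auto
  finally show ?thesis by (simp add: mult_ac)
 qed
 then show ?thesis using C0 by (intro exI[of _ "8 * C"]) auto
qed

section \<open>Growth of the multiplication cost\<close>

lemma mul_pow2:
 fixes mul :: "nat \<Rightarrow> nat"
 assumes "\<And>k. mul (2 * k) \<le> K0 * mul k"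
 shows "mul (2 ^ p * x) \<le> K0 ^ p * mul x"
proof (induction p)
 case (Suc p)
 have "mul (2 ^ Suc p * x) \<le> K0 * mul (2 ^ p * x)" using assms[of "2 ^ p * x"] by (simp add: mult.assoc)
 also have "\<dots> \<le> K0 * (K0 ^ p * mul x)" using Suc by (rule mult_le_mono2)
 finally show ?case by (simp add: mult_ac)
qed simp

lemma exists_pow2: "1 \<le> j \<Longrightarrow> \<exists>p. j \<le> 2 ^ p \<and> 2 ^ p \<le> 2 * (j :: nat)"
proof (induction j rule: nat_induct_at_least)
 case base
 then show ?case by (intro exI[of _ 0]) simp
next
 case (Suc j)
 then obtain p where p: "j \<le> 2 ^ p" "2 ^ p \<le> 2 * j" by blast
 show ?case
 proof (cases "Suc j \<le> 2 ^ p")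
  case True
  then show ?thesis using p by (intro exI[of _ p]) simp
 next
  case False
  then have "j = 2 ^ p" using p by simp
  then show ?thesis by (intro exI[of _ "Suc p"]) simp
 qed
qed

text \<open>Repeated doubling gives polynomial growth with exponent \<kappa>; rounding
  \<open>j\<close> up to a power of two costs the factor 2 in the base.\<close>

lemma mul_times:
 fixes mul :: "nat \<Rightarrow> nat"
 assumes "mono mul" "\<And>k. mul (2 * k) \<le> K0 * mul k" "K0 \<le> 2 ^ \<kappa>" "1 \<le> j"
 shows "mul (j * x) \<le> (2 * j) ^ \<kappa> * mul x"
proof -
 obtain p where p: "j \<le> 2 ^ p" "2 ^ p \<le> 2 * j" using exists_pow2[OF assms(4)] by blast
 have "mul (j * x) \<le> mul (2 ^ p * x)" using p assms(1) by (intro monoD[OF assms(1)]) simp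
 also have "\<dots> \<le> K0 ^ p * mul x" by (rule mul_pow2[of mul K0 p x, OF assms(2)])
 also have "\<dots> \<le> (2 ^ p) ^ \<kappa> * mul x"
 proof (rule mult_le_mono1)
  have "K0 ^ p \<le> (2 ^ \<kappa>) ^ p" using assms(3) by (intro power_mono) auto
  then show "K0 ^ p \<le> (2 ^ p) ^ \<kappa>" by (simp add: power_mult[symmetric] mult.commute)
 qed
 also have "\<dots> \<le> (2 * j) ^ \<kappa> * mul x" using p by (intro mult_le_mono1 power_mono) auto
 finally show ?thesis .
qed

lemma int_size_mono: "\<bar>u\<bar> \<le> \<bar>v\<bar> \<Longrightarrow> int_size u \<le> int_size v"
proof -
 assume a: "\<bar>u\<bar> \<le> \<bar>v\<bar>"
 obtain k where k: "int_size v = Suc k" using int_size_pos[of v] by (cases "int_size v") auto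
 have "\<bar>v\<bar> + 1 \<le> 2 ^ k" using int_size_le_iff[of v k] k by simp
 then show ?thesis using int_size_le_iff[of u k] a k by simp
qed

section \<open>Total cost and parameter choices\<close>

context hnf_run
begin

text \<open>Each summand for one row set is a sum of products of five factors bounded by n, n,
  \<open>E\<close>, \<open>D * D\<close> and \<open>P\<close>. The dominating one is the dynamic
  program; the second n stems from building the tableaux.\<close>

lemma main_cost_le:
 defines "D \<equiv> nat \<Delta>"
 shows "main_cost \<le> 7000 * (((n + m) choose m) * (n * n * ((m + 1) * (n - s + 1)) * (D * D) * (n * (D * D)) ^ m))"
proof -
 define E where "E = (m + 1) * (n - s + 1)"
 define P where "P = (n * (D * D)) ^ m"
 define Q where "Q = (n + m) choose m"
 define G where "G = n * n * E * (D * D) * P"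
 have N1: "1 \<le> D" using Delta_pos by (simp add: D_def)
 have n1: "1 \<le> n" using n_pos by simp
 have E1: "1 \<le> E" "m + 1 \<le> E" "M \<le> E" by (simp_all add: E_def M_def K_def)
 have P1: "1 \<le> P" using n1 N1 by (simp add: P_def Suc_le_eq)
 have Q1: "1 \<le> Q" by (simp add: Q_def Suc_le_eq)
 have NN: "1 \<le> D * D" using N1 by (simp add: Suc_le_eq)
 have le: "x1 * x2 * x3 * x4 * x5 \<le> G" if "x1 \<le> n" "x2 \<le> n" "x3 \<le> E" "x4 \<le> D * D" "x5 \<le> P" for x1 x2 x3 x4 x5
  unfolding G_def using that by (intro mult_le_mono)
 have L: "n * n * M * 1 * 1 \<le> G" "n * 1 * M * 1 * 1 \<le> G" "n * n * 1 * 1 * 1 \<le> G" "n * 1 * (m + 1) * 1 * 1 \<le> G"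
  "1 * 1 * 1 * 1 * 1 \<le> G" "1 * 1 * (m + 1) * 1 * 1 \<le> G" "n * 1 * M * (D * D) * 1 \<le> G" "n * 1 * M * (D * D) * P \<le> G"
  by (intro le; use n1 E1 NN P1 in simp)+
 have L9: "n * 1 * M * (1 * D) * 1 \<le> G"
  by (intro le) (use n1 E1 N1 P1 in \<open>auto intro: mult_le_mono\<close>)
 have c1: "500 * M * n * (n + 1) \<le> 1000 * G" using L(1,2) by (simp add: algebra_simps)
 have c0: "400 * n * (d + M * n + 1) \<le> 1200 * G" using L(1,3,4) by (simp add: algebra_simps d_def)
 have c2: "400 * n * D * (D + 1) * (K + 1) \<le> 800 * G" using L(7) L9 by (simp add: algebra_simps M_def)
 have c3: "2100 * n * (D * P) * D * (K + 1) \<le> 2100 * G" using L(8) by (simp add: algebra_simps M_def)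
 have m1: "100 * (m + 1) \<le> 100 * G" "100 * n * (m + 1) \<le> 100 * G" "50 \<le> 50 * G" using L(4,5,6) by (simp_all add: algebra_simps)
 have cc: "cost2 \<le> 4200 * G"
  unfolding cost2_def Let_def D_def[symmetric] P_def[symmetric] using c0 c2 c3 m1 by linarith
 have "Q * (400 * n * (d + M * n + 1) + 50 + 100 * (m + 1)) \<le> Q * (1350 * G)" using c0 m1 by (intro mult_le_mono2) linarith
 moreover have "Q * (cost2 + 100 * (m + 1)) \<le> Q * (4300 * G)" using cc m1 by (intro mult_le_mono2) linarith
 moreover have "1 * G \<le> Q * G" using Q1 by (intro mult_le_mono1)
 ultimately have "500 * M * n * (n + 1) + ((Q * (400 * n * (d + M * n + 1) + 50 + 100 * (m + 1)) + 100 * (m + 1)) +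
  ((Q * (cost2 + 100 * (m + 1)) + 100 * (m + 1)) + 50)) \<le> 7000 * (Q * G)"
  using c1 m1 by linarith
 then show ?thesis unfolding main_cost_def by (simp add: Q_def G_def E_def P_def d_def)
qed

end

text \<open>The exponent of \<open>Bd\<close> is dictated by the number of states, which takes up to
  \<open>lg + (V + 2 * lg) * m\<close> bits. \<open>V\<close> stands for the size of the objective,
  which also exceeds the logarithm of n.\<close>

lemma setup_sizes:
 fixes \<Delta> :: int and n m V lg :: nat
 defines "X \<equiv> V + lg"
 defines "TB \<equiv> 2 ^ V * (int (n + 1) * (\<Delta> * \<Delta>))" and "Bd \<equiv> (2 :: int) ^ (8 * X * (m + 1))"
 assumes n: "0 < n" "2 * n \<le> V" and D: "1 \<le> \<Delta>" "\<Delta> \<le> 2 ^ lg" and k: "k \<le> n"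
 shows "TB \<le> 2 ^ (2 * X)" "\<Delta> \<le> TB" "TB \<le> Bd" "\<Delta> * (int n * (\<Delta> * \<Delta>)) ^ m \<le> Bd"
  "int n * (\<Delta> * \<Delta>) + \<Delta> * \<Delta> \<le> Bd" "int n * (\<Delta> * TB) \<le> Bd" "int (n + m) + 2 \<le> Bd"
  "int ((m + k + 1) * n) \<le> Bd" "10 \<le> Bd" "2 ^ V \<le> Bd" "\<Delta> \<le> Bd" "0 \<le> TB"
proof -
 have pm: "x * y \<le> 2 ^ (i + j)" if "0 \<le> x" "x \<le> 2 ^ i" "0 \<le> y" "y \<le> 2 ^ j" for x y :: int and i j
  unfolding power_add using that by (intro mult_mono) auto
 have Bd: "x \<le> Bd" if "x \<le> 2 ^ e" "e \<le> 8 * X * (m + 1)" for x e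
  unfolding Bd_def by (rule order_trans[OF that(1) power_increasing[OF that(2)]]) simp
 have lt: "int k + 1 \<le> 2 ^ k" for k
  using less_exp[of k] by (metis of_nat_less_iff of_nat_power of_nat_numeral zless_imp_add1_zle)
 have nV: "int n + 1 \<le> 2 ^ V" "int n \<le> 2 ^ V" using lt[of V] n by linarith+
 have mX: "m \<le> X * m" "2 \<le> X" using n by (simp_all add: X_def)
 have DD: "1 \<le> \<Delta> * \<Delta>" "\<Delta> * \<Delta> \<le> 2 ^ (lg + lg)" using mult_mono[of 1 \<Delta> 1 \<Delta>] pm[of \<Delta> lg \<Delta> lg] D by simp_all
 have nDD: "1 \<le> int (n + 1) * (\<Delta> * \<Delta>)" "int (n + 1) * (\<Delta> * \<Delta>) \<le> 2 ^ (V + (lg + lg))"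
  using mult_mono[of 1 "int (n + 1)" 1 "\<Delta> * \<Delta>"] pm[of "int (n + 1)" V "\<Delta> * \<Delta>" "lg + lg"] nV DD by simp_all
 have TB1: "TB \<le> 2 ^ (V + (V + (lg + lg)))" unfolding TB_def by (rule pm) (use nDD in auto)
 then show TB: "TB \<le> 2 ^ (2 * X)" by (simp add: X_def mult_2 add_ac)
 have "1 * (1 * (1 * \<Delta>)) \<le> TB" unfolding TB_def using D by (intro mult_mono) auto
 then show "\<Delta> \<le> TB" by simp
 then show TB0: "0 \<le> TB" using D by simp
 show TBd: "TB \<le> Bd" by (rule Bd[OF TB]) simp
 then show "\<Delta> \<le> Bd" using \<open>\<Delta> \<le> TB\<close> by simp
 show "2 ^ V \<le> Bd" by (rule Bd[OF order_refl]) (simp add: X_def)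
 show "10 \<le> Bd" by (rule Bd[where e = 4]) (use mX in simp_all)
 have nD: "int n * (\<Delta> * \<Delta>) \<le> 2 ^ (V + (lg + lg))" using nDD(2) DD(1) by (simp add: algebra_simps)
 have "(int n * (\<Delta> * \<Delta>)) ^ m \<le> (2 ^ (V + (lg + lg))) ^ m" using nD DD by (intro power_mono) auto
 then have "\<Delta> * (int n * (\<Delta> * \<Delta>)) ^ m \<le> 2 ^ (lg + (V + (lg + lg)) * m)"
  by (intro pm) (use D DD in \<open>auto simp: power_mult\<close>)
 then show "\<Delta> * (int n * (\<Delta> * \<Delta>)) ^ m \<le> Bd" by (rule Bd) (simp add: X_def algebra_simps)
 have "int n * (\<Delta> * \<Delta>) + \<Delta> * \<Delta> \<le> 2 ^ (V + (lg + lg))" using nDD(2) by (simp add: algebra_simps)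
 then show "int n * (\<Delta> * \<Delta>) + \<Delta> * \<Delta> \<le> Bd" by (rule Bd) (simp add: X_def algebra_simps)
 have "int n * (\<Delta> * TB) \<le> 2 ^ (V + (lg + 2 * X))" by (rule pm) (use nV pm[of \<Delta> lg TB "2 * X"] D TB TB0 in auto)
 then show "int n * (\<Delta> * TB) \<le> Bd" by (rule Bd) (simp add: X_def algebra_simps)
 have nm: "(int n + 1) * (int m + 1) \<le> 2 ^ (V + m)" by (rule pm) (use nV lt in auto)
 moreover have "0 \<le> int n * int m" "0 \<le> int n" "0 \<le> int m" by simp_all
 moreover have "(int n + 1) * (int m + 1) = int n * int m + int n + int m + 1" by (simp add: algebra_simps)
 ultimately have "int (n + m) + 2 \<le> 2 ^ (1 + (V + m))" unfolding power_add[of 2 1] power_one_right of_nat_add by linarith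
 then show "int (n + m) + 2 \<le> Bd" by (rule Bd) (use mX in \<open>simp add: X_def algebra_simps\<close>)
 have "int k \<le> int n + int m * int n" using k by (simp add: add_increasing2)
 then have "int (m + k + 1) \<le> 2 ^ (V + m)" using nm by (simp add: algebra_simps)
 from pm[OF _ this _ nV(2)] have "int (m + k + 1) * int n \<le> 2 ^ (V + m + V)" by simp
 then show "int ((m + k + 1) * n) \<le> Bd" unfolding of_nat_mult by (rule Bd) (use mX in \<open>simp add: X_def algebra_simps\<close>)
qed

text \<open>\<open>a\<close> has to cover the bit length \<open>8 * X * (m + 1)\<close> of
  \<open>Bd\<close> as well as the charge \<open>3 * (2 * X + 2) + n + 20\<close> of values
  depending on \<open>b\<close>; 20 suffices for both. \<open>W\<close> is 8 times as large, as
  \<open>wfe\<close> demands.\<close>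

lemma hnf_run_setup:
 fixes \<Delta> :: int and n m V lg :: nat
 defines "X \<equiv> V + lg"
 defines "W \<equiv> 160 * X * (m + 1)"
 assumes mc: "multiplication_cost mul" and hn: "hnf n m s h \<Delta>"
  and V: "2 * n \<le> V" "\<And>l. l < n \<Longrightarrow> \<bar>c l\<bar> + 1 \<le> 2 ^ V" and lg: "\<Delta> \<le> 2 ^ lg"
 shows "hnf_run mul L W (20 * X * (m + 1)) (mul W) (2 ^ (8 * X * (m + 1))) n m s h c \<Delta>
  (2 ^ V * (int (n + 1) * (\<Delta> * \<Delta>))) (2 * X + 2)" (is "hnf_run _ _ _ ?a _ ?Bd _ _ _ _ _ _ ?TB _")
proof -
 interpret H: hnf n m s h \<Delta> by (rule hn)
 have nk: "n - s \<le> n" by simp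
 note sz = setup_sizes(1,2)[OF H.n_pos V(1) H.Delta_pos lg nk, folded X_def]
  setup_sizes(3-11)[where m = m, OF H.n_pos V(1) H.Delta_pos lg nk, folded X_def]
 have X2: "2 \<le> X" using H.n_pos V(1) by (simp add: X_def)
 have Xa: "X \<le> X * (m + 1)" by simp
 interpret I: ilp mul L W ?a "mul W" ?Bd n m s h b c \<Delta> ?TB
 proof unfold_locales
  show "?a \<le> W" "8 * ?a \<le> W" by (simp_all add: W_def)
  show "charge mul L k \<le> mul W" if "k \<le> W" for k
  proof -
   have "1 \<le> W" using X2 by (simp add: W_def)
   then have "1 \<le> mul W" using mc unfolding multiplication_cost_def by (meson le_trans)
   moreover have "mul k \<le> mul W" using mc that by (simp add: multiplication_cost_def monoD)
   ultimately show ?thesis by (simp add: charge_def)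
  qed
  show "int_size v \<le> ?a" if "\<bar>v\<bar> \<le> ?Bd" for v
  proof -
   have "\<bar>v\<bar> + 1 \<le> 2 * ?Bd" using that sz(9) by linarith
   then have "int_size v \<le> Suc (Suc (8 * X * (m + 1)))" using int_size_le_iff[of v "Suc (8 * X * (m + 1))"] by simp
   also have "\<dots> \<le> ?a" using X2 Xa by (simp add: algebra_simps)
   finally show ?thesis .
  qed
  show "10 \<le> ?Bd" by (rule sz)
 qed (rule H.n_pos H.s_le)+
 show ?thesis
 proof unfold_locales
  show "\<bar>T i j\<bar> \<le> ?TB" if t: "I.tabl f rw \<delta> T" "i < I.M" "j < n" for f rw \<delta> T i j
  proof (cases "i < m")
   case True
   then have "tab_row n h f \<delta> (h (rw i)) (T i)" "rw i < n + m" using t unfolding I.tabl_def I.d_def by (auto simp: I.row_vec_def)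
   then have "\<bar>T i j\<bar> \<le> \<Delta>" using t by (intro H.tab_row_h_le) (auto simp: I.tabl_def I.d_def)
   then show ?thesis using sz(2) by linarith
  next
   case False
   then have "\<bar>I.row_vec rw i l\<bar> \<le> 2 ^ V" if "l < n" for l
    using V(2)[OF that] by (auto simp: I.row_vec_def)
   then show ?thesis using t
    by (intro H.tab_row_le[where r = "I.row_vec rw i" and f = f and \<delta> = \<delta>]) (simp_all add: I.tabl_def I.d_def)
  qed
  show "\<bar>bdet n h f\<bar> \<le> \<Delta>" if "\<forall>j<n. f j < I.d" for f using that by (intro H.bdet_le) (simp add: I.d_def)
  show "?TB \<le> ?Bd" "\<Delta> \<le> ?Bd" "\<Delta> \<le> ?TB" "int n * (\<Delta> * ?TB) \<le> ?Bd" by (rule sz)+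
  show "int (I.M * n) \<le> ?Bd" using sz(8) by (simp add: I.M_def I.K_def)
  show "int I.d \<le> ?Bd" "int I.d + 2 \<le> ?Bd" using sz(7) by (simp_all add: I.d_def)
  show "int_size v \<le> 2 * X + 2" if "\<bar>v\<bar> \<le> ?TB" for v
  proof -
   have "(1 :: int) \<le> 2 ^ (2 * X)" by simp
   then have "\<bar>v\<bar> + 1 \<le> 2 ^ Suc (2 * X)" using that sz(1) unfolding power_Suc by linarith
   then show ?thesis using int_size_le_iff[of v "Suc (2 * X)"] by simp
  qed
  show "3 * (2 * X + 2) + n + 20 \<le> ?a" using X2 Xa V(1) by (simp add: X_def algebra_simps)
  show "1 \<le> \<Delta>" by (rule H.Delta_pos)
  show "\<Delta> * (int n * (\<Delta> * \<Delta>)) ^ m \<le> ?Bd" "int n * (\<Delta> * \<Delta>) + \<Delta> * \<Delta> \<le> ?Bd" by (rule sz)+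
  show "h r l = (if l = r then 1 else 0)" if "r < s" "l < n" for r l
  proof -
   consider "l < r" | "l = r" | "r < l" by linarith
   then show ?thesis
   proof cases
    case 1
    then show ?thesis using H.low[of r l] H.diag1[OF that(1)] that H.s_le by simp
   qed (use H.diag1[OF that(1)] H.tri that in auto)
  qed
 qed
qed

section \<open>The algorithm\<close>

definition ilp_program :: com where
 "ilp_program = cif (V 0 -. N 1) main single"

lemma hnf_of:
 assumes H: "H \<in> carrier_mat (n + m) n" "mat_rank H = n" "reduced_hnf H" and n: "1 \<le> n"
 shows "\<exists>s. hnf n m s (\<lambda>i l. H $$ (i, l)) (Delta H)"
proof -
 have B: "basis_part H $$ (i, j) = H $$ (i, j)" if "i < n" "j < n" for i j using H(1) that by (simp add: basis_part_def)
 have dc: "dim_col H = n" using H(1) by simp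
 note r = H(3)[unfolded reduced_hnf_def Let_def dc]
 obtain s where s: "s \<le> n" "\<forall>i<s. basis_part H $$ (i, i) = 1" "\<forall>i. s \<le> i \<and> i < n \<longrightarrow> 2 \<le> basis_part H $$ (i, i)" using r by blast
 have "hnf n m s (\<lambda>i l. H $$ (i, l)) (Delta H)"
 proof
  show "0 < n" "s \<le> n" using n s by simp_all
  show "\<bar>bdet n (\<lambda>i l. H $$ (i, l)) f\<bar> \<le> Delta H" if "\<forall>j<n. f j < n + m" for f
   by (rule bdet_le_Delta[OF H(1,2) _ that]) simp
  show "H $$ (i, j) = 0" if "i < j" "j < n" for i j using r B[of i j] that by auto
  show "H $$ (i, i) = 1" if "i < s" for i using s B[of i i] that by auto
  show "2 \<le> H $$ (i, i)" if "s \<le> i" "i < n" for i using s B[of i i] that by auto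
  show "0 \<le> H $$ (i, j) \<and> H $$ (i, j) < H $$ (i, i)" if "i < n" "j < i" for i j
  proof -
   have "\<forall>i<n. \<forall>j<i. 0 \<le> basis_part H $$ (i, j) \<and> basis_part H $$ (i, j) < basis_part H $$ (i, i)" using r by blast
   from this[rule_format, OF that] show ?thesis using B[of i i] B[of i j] that by simp
  qed
 qed
 then show ?thesis by blast
qed

section \<open>Input, output and the two cases\<close>

lemma integer_points_iff:
 assumes H: "H \<in> carrier_mat d n" and b: "b \<in> carrier_vec d"
 shows "x \<in> integer_points H b \<longleftrightarrow> x \<in> carrier_vec n \<and> (\<forall>i<d. dot n (\<lambda>l. H $$ (i, l)) (\<lambda>l. x $ l) \<le> b $ i)"
proof -
 have row: "(map_mat real_of_int H *\<^sub>v map_vec real_of_int x) $ i = real_of_int (dot n (\<lambda>l. H $$ (i, l)) (\<lambda>l. x $ l))"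
  if "x \<in> carrier_vec n" "i < d" for i
  using H that by (auto simp: scalar_prod_def dot_def atLeast0LessThan intro!: sum.cong)
 have dims: "dim_col (map_mat real_of_int H) = n" "dim_vec (map_mat real_of_int H *\<^sub>v map_vec real_of_int x) = d"
  "dim_vec (map_vec real_of_int b) = d" using H b by simp_all
 have "map_mat real_of_int H *\<^sub>v map_vec real_of_int x \<le> map_vec real_of_int b \<longleftrightarrow>
   (\<forall>i<d. dot n (\<lambda>l. H $$ (i, l)) (\<lambda>l. x $ l) \<le> b $ i)" if x: "x \<in> carrier_vec n"
  unfolding less_eq_vec_def dims using row[OF x] b by simp
 then show ?thesis
  unfolding integer_points_def polyhedron_def mem_Collect_eq dims map_carrier_vec by blast
qed

lemma solves_ilpI:
 fixes H :: "int mat" and b c :: "int vec" and d n :: nat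
 defines "h \<equiv> \<lambda>i l. H $$ (i, l)"
 defines "feas \<equiv> \<lambda>z. \<forall>i<d. dot n (h i) z \<le> b $ i"
 assumes H: "H \<in> carrier_mat d n" and b: "b \<in> carrier_vec d" and c: "c \<in> carrier_vec n"
  and post: "(rv s 0 = 0 \<and> (\<forall>z. \<not> feas z)) \<or>
   (rv s 0 = 1 \<and> feas (\<lambda>l. av s az (int l)) \<and> (\<forall>z. feas z \<longrightarrow> dot n (($) c) z \<le> dot n (($) c) (\<lambda>l. av s az (int l)))) \<or>
   (rv s 0 = 2 \<and> (\<forall>B. \<exists>z. feas z \<and> B < dot n (($) c) z))"
 shows "solves_ilp H c b s"
proof -
 have ip: "x \<in> integer_points H b \<longleftrightarrow> x \<in> carrier_vec n \<and> feas (($) x)" for x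
  using integer_points_iff[OF H b] by (simp add: feas_def h_def)
 have dc: "dot n u (($) (vec n z)) = dot n u z" for u z by (simp add: dot_def)
 have ipv: "vec n z \<in> integer_points H b \<longleftrightarrow> feas z" for z unfolding ip by (simp add: feas_def dc)
 have cx: "c \<bullet> x = dot n (($) c) (($) x)" if "x \<in> carrier_vec n" for x
  using that by (simp add: scalar_prod_def dot_def atLeast0LessThan)
 have ov: "output_vec (dim_col H) s = vec n (\<lambda>l. av s az (int l))" using H by (simp add: output_vec_def)
 have cv: "c \<bullet> vec n z = dot n (($) c) z" for z using cx[of "vec n z"] by (simp add: dc)
 from post show ?thesis
 proof (elim disjE conjE)
  assume "rv s 0 = 0" "\<forall>z. \<not> feas z"
  then show ?thesis using ip by (auto simp: solves_ilp_def Let_def)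
 next
  assume a: "rv s 0 = 1" "feas (\<lambda>l. av s az (int l))" "\<forall>z. feas z \<longrightarrow> dot n (($) c) z \<le> dot n (($) c) (\<lambda>l. av s az (int l))"
  have "\<forall>y\<in>integer_points H b. c \<bullet> y \<le> c \<bullet> vec n (\<lambda>l. av s az (int l))"
   using a(3) ip cx cv by simp
  then show ?thesis using a ipv by (simp add: solves_ilp_def Let_def ov)
 next
  assume a: "rv s 0 = 2" "\<forall>B. \<exists>z. feas z \<and> B < dot n (($) c) z"
  have "\<exists>y\<in>integer_points H b. B < c \<bullet> y" for B
   using a(2) ipv cv by metis
  moreover from this have "integer_points H b \<noteq> {}" by blast
  ultimately show ?thesis using a(1) by (simp add: solves_ilp_def Let_def)
 qed
qed

lemma (in machine) wfs_input:
 assumes "\<And>i l. i < dim_row H \<Longrightarrow> l < dim_col H \<Longrightarrow> int_size (H $$ (i, l)) \<le> a"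
  and "\<And>l. l < dim_vec c \<Longrightarrow> int_size (c $ l) \<le> a"
  and "int_size (int (dim_col H)) \<le> a" "int_size (int (dim_row H) - int (dim_col H)) \<le> a"
 shows "wfs (view (input_state H c b))"
proof -
 have z: "int_size 0 \<le> a" using size_le[of 0] Bd_ge by simp
 then have a1: "1 \<le> a" using int_size_pos[of 0] by linarith
 have "wfc (input_array H c b x i)" for x i
 proof -
  have "nat i div dim_col H < dim_row H \<and> nat i mod dim_col H < dim_col H" if "0 \<le> i" "i < int (dim_row H * dim_col H)"
  proof -
   have lt: "nat i < dim_row H * dim_col H" using that by linarith
   then have "0 < dim_col H" by (cases "dim_col H") auto
   then show ?thesis using lt by (simp add: less_mult_imp_div_less)
  qed
  then show ?thesis using assms(1,2) z a1 unfolding input_array_def wfc_def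
   by (auto simp: exact_cell_def cell_of_def nat_less_iff)
 qed
 moreover have "wfc (reg (view (input_state H c b)) r)" if "r < 100" for r
  using assms(3,4) z that by (auto simp: reg_view input_state_def wfc_def exact_cell_def)
 ultimately show ?thesis by (simp add: wfs_def input_state_def)
qed

lemma input_view:
 assumes H: "H \<in> carrier_mat (n + m) n" and c: "c \<in> carrier_vec n" and b: "b \<in> carrier_vec (n + m)"
 defines "p \<equiv> view (input_state H c b)"
 shows "reg p 0 = exact_cell (int n)" "reg p 1 = exact_cell (int m)"
  "\<And>i l. i < n + m \<Longrightarrow> l < n \<Longrightarrow> arr p aH (int i * int n + int l) = exact_cell (H $$ (i, l))"
  "\<And>l. l < n \<Longrightarrow> arr p ac (int l) = exact_cell (c $ l)"
  "\<And>i. i < n + m \<Longrightarrow> arr p ab (int i) = cell_of (b $ i) 1"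
proof -
 show "reg p 0 = exact_cell (int n)" "reg p 1 = exact_cell (int m)" using H by (simp_all add: p_def reg_view input_state_def)
 show "arr p aH (int i * int n + int l) = exact_cell (H $$ (i, l))" if "i < n + m" "l < n" for i l
 proof -
  have "i * n + l < Suc i * n" using that by simp
  also have "\<dots> \<le> (n + m) * n" using that by (intro mult_le_mono1) simp
  finally have lt: "i * n + l < (n + m) * n" .
  have e: "int i * int n + int l = int (i * n + l)" by simp
  have dm: "(i * n + l) div n = i" "(i * n + l) mod n = l" using that by simp_all
  have dims: "dim_row H = n + m" "dim_col H = n" using H by simp_all
  show ?thesis
   unfolding e p_def arr_view input_state_def state.simps input_array_def nat_int of_nat_less_iff dims dm
   using lt by simp
 qed
 show "arr p ac (int l) = exact_cell (c $ l)" if "l < n" for l using c that by (simp add: p_def input_state_def input_array_def)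
 show "arr p ab (int i) = cell_of (b $ i) 1" if "i < n + m" for i using b that by (simp add: p_def input_state_def input_array_def)
qed

lemma vec_size_bounds:
 assumes "c \<in> carrier_vec n"
 shows "2 * n \<le> vec_size c" "\<And>l. l < n \<Longrightarrow> int_size (c $ l) \<le> vec_size c" "\<And>l. l < n \<Longrightarrow> \<bar>c $ l\<bar> + 1 \<le> 2 ^ vec_size c"
proof -
 have v: "vec_size c = n + (\<Sum>i<n. int_size (c $ i))" using assms by (simp add: vec_size_def)
 have "(\<Sum>i<n. 1) \<le> (\<Sum>i<n. int_size (c $ i))" using int_size_pos by (intro sum_mono) (simp add: Suc_le_eq)
 then show "2 * n \<le> vec_size c" by (simp add: v)
 show le: "int_size (c $ l) \<le> vec_size c" if "l < n" for l
  using member_le_sum[of l "{..<n}" "\<lambda>i. int_size (c $ i)"] that by (simp add: v)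
 show "\<bar>c $ l\<bar> + 1 \<le> 2 ^ vec_size c" if "l < n" for l
 proof -
  have "\<bar>c $ l\<bar> + 1 \<le> 2 ^ (int_size (c $ l) - 1)" by (rule abs_lt_int_size)
  also have "\<dots> \<le> 2 ^ vec_size c" using le[OF that] by (intro power_increasing) auto
  finally show ?thesis .
 qed
qed

lemma le_pow_ceil_log:
 assumes "1 \<le> (x :: int)"
 shows "x \<le> 2 ^ nat \<lceil>log 2 (real_of_int x)\<rceil>"
proof -
 define k where "k = nat \<lceil>log 2 (real_of_int x)\<rceil>"
 have "log 2 (real_of_int x) \<le> real k" unfolding k_def by linarith
 then have "real_of_int x \<le> 2 ^ k" using assms by (simp add: log_le_iff powr_realpow)
 also have "\<dots> = real_of_int (2 ^ k)" by simp
 finally show ?thesis unfolding k_def[symmetric] by (simp only: of_int_le_iff)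
qed

text \<open>\<open>k\<close> stands for \<open>n - s\<close>; the only fact exported about it is the
  one that bounds it by log \<Delta>.\<close>

lemma general_case:
 fixes mul :: "nat \<Rightarrow> nat"
 assumes mc: "multiplication_cost mul" and n: "2 \<le> n"
  and H: "H \<in> carrier_mat (n + m) n" "mat_rank H = n" "reduced_hnf H" and c: "c \<in> carrier_vec n" and b: "b \<in> carrier_vec (n + m)"
 defines "X \<equiv> vec_size c + nat \<lceil>log 2 (real_of_int (Delta H))\<rceil>" and "D \<equiv> nat (Delta H)"
 shows "\<exists>t s k. exec mul (word_length H c b) ilp_program (input_state H c b) t s \<and> solves_ilp H c b s \<and> 2 ^ k \<le> Delta H \<and>
  t \<le> 7003 * (((n + m) choose m) * (n * n * ((m + 1) * (k + 1)) * (D * D) * (n * (D * D)) ^ m)) * mul (160 * (m + 1) * X)"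
proof -
 define h where "h = (\<lambda>i l. H $$ (i, l))"
 obtain s where hn: "hnf n m s h (Delta H)" using hnf_of[OF H] n by (auto simp: h_def)
 interpret Hn: hnf n m s h "Delta H" by (rule hn)
 define \<Delta> where "\<Delta> = Delta H"
 define Vc where "Vc = vec_size c"
 define lg where "lg = nat \<lceil>log 2 (real_of_int \<Delta>)\<rceil>"
 have X: "X = Vc + lg" by (simp add: X_def Vc_def lg_def \<Delta>_def)
 have D1: "1 \<le> \<Delta>" using Hn.Delta_pos by (simp add: \<Delta>_def)
 have lg: "Delta H \<le> 2 ^ lg" using le_pow_ceil_log[of \<Delta>] D1 by (simp add: lg_def \<Delta>_def)
 note vs = vec_size_bounds[OF c, folded Vc_def]
 interpret R: hnf_run mul "word_length H c b" "160 * (Vc + lg) * (m + 1)" "20 * (Vc + lg) * (m + 1)" "mul (160 * (Vc + lg) * (m + 1))"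
  "2 ^ (8 * (Vc + lg) * (m + 1))" n m s h "\<lambda>i. b $ i" "\<lambda>l. c $ l" "Delta H"
  "2 ^ Vc * (int (n + 1) * (Delta H * Delta H))" "2 * (Vc + lg) + 2"
  by (rule hnf_run_setup[OF mc hn vs(1,3) lg])
 let ?p = "view (input_state H c b)"
 note iv = input_view[OF H(1) c b]
 have Bd: "2 ^ Vc \<le> (2 :: int) ^ (8 * (Vc + lg) * (m + 1))" by (rule power_increasing) auto
 have wf: "R.wfs ?p"
 proof (rule R.wfs_input)
  show "int_size (H $$ (i, l)) \<le> 20 * (Vc + lg) * (m + 1)" if "i < dim_row H" "l < dim_col H" for i l
  proof (rule R.size_le)
   have "\<bar>h i l\<bar> \<le> int n * (Delta H * Delta H)" by (rule Hn.row_entry_le) (use that H in auto)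
   also have "\<dots> \<le> 2 ^ (8 * (Vc + lg) * (m + 1))"
   proof -
    have "0 \<le> Delta H * Delta H" by simp
    then show ?thesis using R.W_bd by linarith
   qed
   finally show "\<bar>H $$ (i, l)\<bar> \<le> 2 ^ (8 * (Vc + lg) * (m + 1))" by (simp add: h_def)
  qed
  show "int_size (c $ l) \<le> 20 * (Vc + lg) * (m + 1)" if "l < dim_vec c" for l
  proof (rule R.size_le)
   have "\<bar>c $ l\<bar> + 1 \<le> 2 ^ Vc" using vs(3)[of l] that c by simp
   then show "\<bar>c $ l\<bar> \<le> 2 ^ (8 * (Vc + lg) * (m + 1))" using Bd by linarith
  qed
  have dims: "dim_col H = n" "int (dim_row H) - int n = int m" using H(1) by simp_all
  show "int_size (int (dim_col H)) \<le> 20 * (Vc + lg) * (m + 1)"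
   unfolding dims by (rule R.size_le) (use R.nm_le in simp)
  show "int_size (int (dim_row H) - int (dim_col H)) \<le> 20 * (Vc + lg) * (m + 1)"
   unfolding dims by (rule R.size_le) (use R.nm_le in simp)
 qed
 let ?post = "\<lambda>q. (rv q 0 = 0 \<and> (\<forall>z. \<not> R.feas_pt z)) \<or>
  (rv q 0 = 1 \<and> R.feas_pt (\<lambda>l. av q az (int l)) \<and> (\<forall>z. R.feas_pt z \<longrightarrow> dot n (\<lambda>l. c $ l) z \<le> dot n (\<lambda>l. c $ l) (\<lambda>l. av q az (int l)))) \<or>
  (rv q 0 = 2 \<and> (\<exists>z. R.feas_pt z) \<and> (\<exists>w. R.ray_vec w))"
 have "R.spec ilp_program ?p (3 + R.main_cost) ?post"
  unfolding ilp_program_def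
 proof (rule R.spec_le, rule R.spec_cif)
  show "wfe (V 0 -. N 1)" by simp
  have "rv ?p 0 = int n" "rv ?p 1 = int m" using iv(1,2) by (simp_all add: exact_cell_def)
  moreover have "R.input_mem ?p" unfolding R.input_mem_def R.d_def using iv(3,4) by (simp add: h_def exact_cell_def)
  moreover have "R.bmem ?p" unfolding R.bmem_def R.d_def using iv(5) by (simp add: cell_of_def)
  ultimately show "R.spec main ?p R.main_cost ?post" by (rule R.main_spec)
  assume "fst (ev ?p (V 0 -. N 1)) \<le> 0"
  then show "R.spec single ?p 0 ?post" using iv(1) n by (simp add: exact_cell_def)
 qed simp
 then obtain t s' where ex: "exec mul (word_length H c b) ilp_program (input_state H c b) t s'"
  "t \<le> (3 + R.main_cost) * mul (160 * (Vc + lg) * (m + 1))" "?post (view s')"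
  using wf unfolding R.spec_def by blast
 have fp: "R.feas_pt z \<longleftrightarrow> (\<forall>i<n + m. dot n (\<lambda>l. H $$ (i, l)) z \<le> b $ i)" for z
  unfolding R.feas_pt_def R.d_def by (simp add: h_def)
 have unb: "\<exists>y. R.feas_pt y \<and> B < dot n (\<lambda>l. c $ l) y" if z: "R.feas_pt z" and w: "R.ray_vec w" for z w B
 proof -
  \<comment> \<open>By integrality the ray gains at least 1 per unit, so this many units exceed
    \<open>B\<close>.\<close>
  define x where "x = \<bar>B - dot n (\<lambda>l. c $ l) z\<bar> + 1"
  define y where "y l = 1 * z l + x * w l" for l
  have dy: "dot n u y = 1 * dot n u z + x * dot n u w" for u unfolding y_def by (rule dot_lin)
  have "dot n (h i) y \<le> b $ i" if "i < R.d" for i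
  proof -
   have "x * dot n (h i) w \<le> 0" using w that by (intro mult_nonneg_nonpos) (auto simp: x_def R.ray_vec_def)
   then show ?thesis using z that dy[of "h i"] by (fastforce simp: R.feas_pt_def)
  qed
  moreover have "B < dot n (\<lambda>l. c $ l) y"
  proof -
   have "x * 1 \<le> x * dot n (\<lambda>l. c $ l) w" using w by (intro mult_left_mono) (auto simp: x_def R.ray_vec_def)
   moreover have "B < dot n (\<lambda>l. c $ l) z + x" by (simp add: x_def)
   ultimately show ?thesis unfolding dy by linarith
  qed
  ultimately show ?thesis by (auto simp: R.feas_pt_def)
 qed
 have "solves_ilp H c b s'"
  by (rule solves_ilpI[OF H(1) b c]) (use ex(3) unb in \<open>auto simp: reg_view fp\<close>)
 moreover have "t \<le> 7003 * (((n + m) choose m) * (n * n * ((m + 1) * (n - s + 1)) * (D * D) * (n * (D * D)) ^ m)) * mul (160 * (m + 1) * X)"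
 proof -
  define Y where "Y = ((n + m) choose m) * (n * n * ((m + 1) * (n - s + 1)) * (D * D) * (n * (D * D)) ^ m)"
  have "0 < Y" using n D1 by (simp add: Y_def D_def \<Delta>_def)
  moreover have "R.main_cost \<le> 7000 * Y" unfolding Y_def D_def by (rule R.main_cost_le)
  ultimately have "3 + R.main_cost \<le> 7003 * Y" by linarith
  then have "t \<le> (7003 * Y) * mul (160 * (Vc + lg) * (m + 1))" using ex(2) by (meson le_trans mult_le_mono1)
  moreover have "160 * (Vc + lg) * (m + 1) = 160 * (m + 1) * X" by (simp add: X algebra_simps)
  ultimately show ?thesis unfolding Y_def by simp
 qed
 ultimately show ?thesis using ex(1) Hn.two_pow_le by blast
qed

lemma single_case:
 fixes mul :: "nat \<Rightarrow> nat"
 assumes mc: "multiplication_cost mul"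
  and H: "H \<in> carrier_mat (1 + m) 1" "mat_rank H = 1" "reduced_hnf H" and c: "c \<in> carrier_vec 1" and b: "b \<in> carrier_vec (1 + m)"
 defines "X \<equiv> vec_size c + nat \<lceil>log 2 (real_of_int (Delta H))\<rceil>"
 shows "\<exists>t s. exec mul (word_length H c b) ilp_program (input_state H c b) t s \<and> solves_ilp H c b s \<and> 1 \<le> Delta H \<and>
  t \<le> (3 + 100 * (m + 2)) * mul (16 * X)"
proof -
 define h where "h = (\<lambda>i l. H $$ (i, l))"
 obtain s where hn: "hnf 1 m s h (Delta H)" using hnf_of[OF H] by (auto simp: h_def)
 interpret Hn: hnf 1 m s h "Delta H" by (rule hn)
 define lg where "lg = nat \<lceil>log 2 (real_of_int (Delta H))\<rceil>"
 define L where "L = word_length H c b"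
 \<comment> \<open>Sizes up to the word length are free of bit charges, and sizes beyond it are at
   most \<open>2 * X + 13\<close>. The price of an instruction is therefore independent of
   m.\<close>
 define a where "a = max L (2 * X + 13)"
 define Bd where "Bd = max 10 (int (1 + m))"
 have lg: "Delta H \<le> 2 ^ lg" using le_pow_ceil_log[OF Hn.Delta_pos] by (simp add: lg_def)
 note vs = vec_size_bounds[OF c]
 have X: "X = vec_size c + lg" "2 \<le> X" using vs(1) by (simp_all add: X_def lg_def)
 \<comment> \<open>There are more than twice as many input cells as rows, so an address has a bit
   more than the number of rows; this bit is the carry in adding the two dimensions.\<close>
 have L: "int_size (int (1 + m)) + 1 \<le> L"
 proof -
  have Leq: "L = int_size (2 * int (1 + m) + 1)" using H c b by (simp add: L_def word_length_def algebra_simps)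
  have "0 < L" unfolding Leq by (rule int_size_pos)
  then obtain k where k: "L = Suc k" by (cases L) auto
  have le: "2 * int (1 + m) + 2 \<le> 2 ^ k" using int_size_le_iff[of "2 * int (1 + m) + 1" k] Leq k by simp
  then obtain k' where k': "k = Suc k'" by (cases k) auto
  then have "int_size (int (1 + m)) \<le> Suc k'" using int_size_le_iff[of "int (1 + m)" k'] le by simp
  then show ?thesis using k k' by simp
 qed
 interpret R: machine mul L a a "mul (2 * X + 13)" Bd
 proof
  show "charge mul L k \<le> mul (2 * X + 13)" if "k \<le> a" for k
  proof (cases "k \<le> L")
   case True
   have "1 \<le> mul (2 * X + 13)" using mc unfolding multiplication_cost_def by (meson le_trans le_add2 one_le_numeral)
   with True show ?thesis by (simp add: charge_def)
  next
   case False
   then have "k \<le> 2 * X + 13" using that by (simp add: a_def)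
   then have "mul k \<le> mul (2 * X + 13)" using mc by (auto simp: multiplication_cost_def intro: monoD)
   with False show ?thesis by (simp add: charge_def)
  qed
  show "int_size v \<le> a" if "\<bar>v\<bar> \<le> Bd" for v
  proof (cases "\<bar>v\<bar> \<le> 10")
   case True
   then have "int_size v \<le> Suc 4" using int_size_le_iff[of v 4] by simp
   then show ?thesis by (simp add: a_def)
  next
   case False
   then have "int_size v \<le> int_size (int (1 + m))" using that by (intro int_size_mono) (auto simp: Bd_def)
   then show ?thesis using L by (simp add: a_def)
  qed
 qed (simp_all add: Bd_def)
 have h_sz: "int_size (h i 0) \<le> 2 * X + 3" if "i < 1 + m" for i
 proof -
  have DD: "Delta H * Delta H \<le> 2 ^ lg * 2 ^ lg" using lg Hn.Delta_pos by (intro mult_mono) auto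
  have "\<bar>h i 0\<bar> \<le> Delta H * Delta H" using Hn.row_entry_le[of i 0] that by simp
  moreover have "(1 :: int) \<le> 2 ^ lg * 2 ^ lg" by (simp add: one_le_power power_add[symmetric])
  ultimately have "\<bar>h i 0\<bar> + 1 \<le> 2 * (2 ^ lg * 2 ^ lg)" using DD by linarith
  also have "\<dots> = 2 ^ Suc (lg + lg)" by (simp add: power_add)
  finally have "int_size (h i 0) \<le> Suc (Suc (lg + lg))" using int_size_le_iff[of "h i 0" "Suc (lg + lg)"] by simp
  then show ?thesis using X by simp
 qed
 interpret S: single_var mul L a a "mul (2 * X + 13)" Bd "1 + m" "2 * X + 3" "\<lambda>i. h i 0" "\<lambda>i. b $ i" "c $ 0"
 proof
  show "0 < 1 + m" by simp
  show "1 \<le> h 0 0" by (rule Hn.diag_pos) simp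
  show "int_size (h i 0) \<le> 2 * X + 3" if "i < 1 + m" for i by (rule h_sz[OF that])
  show "int_size (c $ 0) \<le> 2 * X + 3" using vs(2)[of 0] X by simp
  show "3 \<le> 2 * X + 3" "2 * X + 3 + 10 \<le> a" by (simp_all add: a_def)
  show "int (1 + m) \<le> Bd" by (simp add: Bd_def)
  show "int_size (int (1 + m)) + 1 \<le> a" using L by (simp add: a_def)
 qed
 let ?p = "view (input_state H c b)"
 note iv = input_view[OF H(1) c b]
 have sm: "int_size 1 + 1 \<le> a" "int_size (int m) + 1 \<le> a"
 proof -
  have "int_size 1 \<le> int_size (int (1 + m))" "int_size (int m) \<le> int_size (int (1 + m))" by (intro int_size_mono; simp)+
  then show "int_size 1 + 1 \<le> a" "int_size (int m) + 1 \<le> a" using L by (simp_all add: a_def)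
 qed
 have wf: "R.wfs ?p"
 proof (rule R.wfs_input)
  have dims: "dim_row H = 1 + m" "dim_col H = 1" "dim_vec c = 1" using H c by simp_all
  show "int_size (H $$ (i, l)) \<le> a" if "i < dim_row H" "l < dim_col H" for i l
   using h_sz[of i] that unfolding dims by (simp add: h_def a_def)
  show "int_size (c $ l) \<le> a" if "l < dim_vec c" for l
   using vs(2)[of l] that X unfolding dims by (simp add: a_def)
  show "int_size (int (dim_col H)) \<le> a" "int_size (int (dim_row H) - int (dim_col H)) \<le> a"
   unfolding dims using sm by simp_all
 qed
 have sp: "R.spec ilp_program ?p (2 + 1 + max 0 (100 * (1 + m + 1))) S.single_post"
 proof -
  have r: "reg ?p 0 = exact_cell 1" "reg ?p 1 = exact_cell (int m)" using iv(1,2) by simp_all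
  have w: "wfz (V 0 -. N 1)" by simp
  have a13: "13 \<le> a" by (simp add: a_def)
  have "R.okS ?p (V 0 -. N 1)" using r(1) sm(1) a13 unfolding R.okS.simps szb.simps by (simp add: exact_cell_def)
  from R.okS[OF w this] have ok: "R.okE ?p (V 0 -. N 1)" by blast
  have "R.spec ilp_program ?p (cost (V 0 -. N 1) + 1 + max 0 (100 * (1 + m + 1))) S.single_post"
   unfolding ilp_program_def
  proof (rule R.spec_cif_basic)
   show "\<forall>q\<in>regs_of (V 0 -. N 1). q < 100" by simp
   show "R.okE ?p (V 0 -. N 1)" by (rule ok)
   show "R.spec main ?p 0 S.single_post" if "0 < fst (ev ?p (V 0 -. N 1))" using that r by (simp add: exact_cell_def)
   have "S.smem ?p"
    unfolding S.smem_def
   proof (intro conjI allI impI)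
    fix i assume i: "i < 1 + m"
    have "arr ?p aH (int i) = exact_cell (h i 0)" using iv(3)[OF i, of 0] by (simp add: h_def)
    then show "av ?p aH (int i) = h i 0" "snd (arr ?p aH (int i)) \<le> 2 * X + 3" using h_sz[OF i] by (simp_all add: exact_cell_def)
    show "av ?p ab (int i) = b $ i" "snd (arr ?p ab (int i)) \<le> 1" using iv(5)[OF i] by (simp_all add: cell_of_def)
   next
    show "av ?p ac 0 = c $ 0" "snd (arr ?p ac 0) \<le> 2 * X + 3" using iv(4)[of 0] vs(2)[of 0] X by (simp_all add: exact_cell_def)
   qed
   then show "R.spec single ?p (100 * (1 + m + 1)) S.single_post"
    by (rule S.single_spec) (use r sm in \<open>simp_all add: exact_cell_def\<close>)
  qed
  then show ?thesis by simp
 qed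
 then obtain t s' where ex: "exec mul L ilp_program (input_state H c b) t s'"
  "t \<le> (2 + 1 + max 0 (100 * (1 + m + 1))) * mul (2 * X + 13)" "S.single_post (view s')"
  using wf unfolding R.spec_def by blast
 have f1: "S.feas1 x \<longleftrightarrow> (\<forall>i<1 + m. dot 1 (\<lambda>l. H $$ (i, l)) (\<lambda>_. x) \<le> b $ i)" for x
  unfolding S.feas1_def by (simp add: dot_def h_def)
 have fz: "(\<forall>i<1 + m. dot 1 (\<lambda>l. H $$ (i, l)) z \<le> b $ i) \<longleftrightarrow> S.feas1 (z 0)" for z
  unfolding S.feas1_def by (simp add: dot_def h_def)
 have dz: "dot 1 (($) c) z = c $ 0 * z 0" for z by (simp add: dot_def)
 have post: "(rv s' 0 = 0 \<and> (\<forall>x. \<not> S.feas1 x)) \<or>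
  (rv s' 0 = 1 \<and> S.feas1 (av s' az 0) \<and> (\<forall>x. S.feas1 x \<longrightarrow> c $ 0 * x \<le> c $ 0 * av s' az 0)) \<or>
  (rv s' 0 = 2 \<and> (\<forall>B. \<exists>x. S.feas1 x \<and> B < c $ 0 * x))"
  using ex(3) unfolding S.single_post_def by (auto simp: reg_view)
 have const: "(\<exists>z :: nat \<Rightarrow> int. Q (z 0)) \<longleftrightarrow> (\<exists>x. Q x)" "(\<forall>z :: nat \<Rightarrow> int. Q (z 0)) \<longleftrightarrow> (\<forall>x. Q x)" for Q
 proof -
  have ev: "\<exists>z :: nat \<Rightarrow> int. z 0 = x" for x by (rule exI[of _ "\<lambda>_. x"]) simp
  show "(\<exists>z :: nat \<Rightarrow> int. Q (z 0)) \<longleftrightarrow> (\<exists>x. Q x)" using ev by metis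
  show "(\<forall>z :: nat \<Rightarrow> int. Q (z 0)) \<longleftrightarrow> (\<forall>x. Q x)" using ev by metis
 qed
 have "solves_ilp H c b s'"
  by (rule solves_ilpI[OF H(1) b c], unfold fz dz const(1)[of "\<lambda>x. S.feas1 x \<and> _ < c $ 0 * x"]
   const(2)[of "\<lambda>x. \<not> S.feas1 x"] const(2)[of "\<lambda>x. S.feas1 x \<longrightarrow> c $ 0 * x \<le> _"] of_nat_0) (rule post)
 moreover have "2 * X + 13 \<le> 16 * X" using X by simp
 then have "mul (2 * X + 13) \<le> mul (16 * X)" using mc unfolding multiplication_cost_def by (meson monoD)
 then have "t \<le> (3 + 100 * (m + 2)) * mul (16 * X)" using ex(2) by (auto intro: order_trans mult_le_mono)
 ultimately show ?thesis using ex(1) Hn.Delta_pos unfolding L_def by blast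
qed

theorem theorem3:
  fixes mul :: "nat \<Rightarrow> nat"
  assumes "multiplication_cost mul"
  shows "\<exists>(P :: com) (C :: real).
    \<forall>(n :: nat) (m :: nat) (H :: int mat) (c :: int vec) (b :: int vec).
      1 \<le> n \<and> H \<in> carrier_mat (n + m) n \<and> mat_rank H = n \<and> reduced_hnf H \<and>
      c \<in> carrier_vec n \<and> b \<in> carrier_vec (n + m) \<longrightarrow>
      (\<exists>t s. exec mul (word_length H c b) P (input_state H c b) t s \<and>
             solves_ilp H c b s \<and>
             real t \<le> C * ilp_bound mul n m (Delta H) c)"
proof -
 obtain K0 where K0: "\<And>k. mul (2 * k) \<le> K0 * mul k" and mono: "mono mul" using assms unfolding multiplication_cost_def by blast
 \<comment> \<open>A crude exponent, good enough because any fixed power of m + 1 can be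
   absorbed.\<close>
 define \<kappa> where "\<kappa> = K0"
 have \<kappa>: "K0 \<le> 2 ^ \<kappa>" using less_exp[of K0] by (simp add: \<kappa>_def)
 \<comment> \<open>\<kappa> factors m + 1 come from multiplying numbers that are longer by this
   factor, one more from the cost per state.\<close>
 obtain C1 where C1: "0 < C1" "\<And>n m. 2 \<le> n \<Longrightarrow> real ((n + m) choose m) * (real m + 1) ^ (\<kappa> + 1) \<le> C1 * real n ^ m"
  using binomial_poly_bounded by blast
 define C where "C = max (7003 * 320 ^ \<kappa> * 2 * C1) (303 * 32 ^ \<kappa>)"
 have regroup: "7003 * (q * (x * x * (u * v) * (y * y) * p)) * ((320 * u) ^ \<kappa> * z) =
  (7003 * 320 ^ \<kappa>) * v * (q * u ^ (\<kappa> + 1)) * (x * x * (y * y) * p * z)" for p q u v x y z :: real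
  by (simp add: power_mult_distrib mult_ac)
 have bound: "\<exists>t s. exec mul (word_length H c b) ilp_program (input_state H c b) t s \<and> solves_ilp H c b s \<and>
   real t \<le> C * ilp_bound mul n m (Delta H) c"
  if n: "1 \<le> n" and H: "H \<in> carrier_mat (n + m) n" "mat_rank H = n" "reduced_hnf H"
   and c: "c \<in> carrier_vec n" and b: "b \<in> carrier_vec (n + m)" for n m H c b
 proof -
  define X where "X = vec_size c + nat \<lceil>log 2 (real_of_int (Delta H))\<rceil>"
  define \<Lambda> where "\<Lambda> = max 1 (log 2 (real_of_int (Delta H)) + real m)"
  define D where "D = real_of_int (Delta H)"
  define R where "R = \<Lambda> * real n ^ (2 * (m + 1)) * D ^ (2 * (m + 1)) * real (mul X)"
  have ib: "ilp_bound mul n m (Delta H) c = R" by (simp add: ilp_bound_def R_def \<Lambda>_def D_def X_def)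
  have L1: "1 \<le> \<Lambda>" by (simp add: \<Lambda>_def)
  show ?thesis
  proof (cases "n = 1")
   case True
   obtain t s where ts: "exec mul (word_length H c b) ilp_program (input_state H c b) t s" "solves_ilp H c b s" "1 \<le> Delta H"
    "t \<le> (3 + 100 * (m + 2)) * mul (16 * X)"
    using single_case[OF assms H[unfolded True] c[unfolded True] b[unfolded True]] by (auto simp: X_def)
   have D1: "1 \<le> D" using ts(3) by (simp add: D_def)
   have "mul (16 * X) \<le> 32 ^ \<kappa> * mul X" using mul_times[OF mono K0 \<kappa>, of 16 X] by simp
   then have "t \<le> (3 + 100 * (m + 2)) * (32 ^ \<kappa> * mul X)" using ts(4) by (meson le_trans mult_le_mono2)
   then have "real t \<le> real ((3 + 100 * (m + 2)) * (32 ^ \<kappa> * mul X))" by linarith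
   also have "\<dots> = (203 + 100 * real m) * (32 ^ \<kappa> * real (mul X))" by simp
   also have "\<dots> \<le> (303 * \<Lambda>) * (32 ^ \<kappa> * real (mul X))"
   proof (rule mult_right_mono)
    have "0 \<le> log 2 D" using D1 by simp
    then show "203 + 100 * real m \<le> 303 * \<Lambda>" unfolding \<Lambda>_def D_def by (cases "m = 0") auto
   qed simp
   also have "\<dots> = (303 * 32 ^ \<kappa>) * (\<Lambda> * 1 * 1 * real (mul X))" by simp
   also have "\<dots> \<le> (303 * 32 ^ \<kappa>) * R" unfolding R_def
    using one_le_power[OF D1, of "2 * (m + 1)"] L1 True by (intro mult_left_mono mult_mono) simp_all
   also have "\<dots> \<le> C * R" by (intro mult_right_mono) (use D1 L1 in \<open>auto simp: C_def R_def\<close>)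
   finally show ?thesis using ts ib by auto
  next
   case False
   then have n2: "2 \<le> n" using n by simp
   define N where "N = nat (Delta H)"
   obtain t s k where ts: "exec mul (word_length H c b) ilp_program (input_state H c b) t s" "solves_ilp H c b s" and k: "2 ^ k \<le> Delta H" and
    t: "t \<le> 7003 * (((n + m) choose m) * (n * n * ((m + 1) * (k + 1)) * (N * N) * (n * (N * N)) ^ m)) * mul (160 * (m + 1) * X)"
    using general_case[OF assms n2 H c b] by (auto simp: X_def N_def)
   have "(1 :: int) \<le> 2 ^ k" by simp
   then have D1: "1 \<le> Delta H" using k by linarith
   then have ND: "real N = D" "1 \<le> D" by (simp_all add: N_def D_def)
   \<comment> \<open>Here the number of coordinates with a nontrivial diagonal entry becomes the
     factor log \<Delta> of the bound.\<close>
   have kL: "real k + 1 \<le> 2 * \<Lambda>"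
   proof -
    have "real_of_int (2 ^ k) \<le> D" using k unfolding D_def by (simp only: of_int_le_iff)
    then have "real k \<le> log 2 D" using ND by (simp add: le_log_iff powr_realpow)
    then have "real k \<le> \<Lambda>" by (simp add: \<Lambda>_def D_def)
    then show ?thesis using L1 by simp
   qed
   define Y where "Y = ((n + m) choose m) * (n * n * ((m + 1) * (k + 1)) * (N * N) * (n * (N * N)) ^ m)"
   have "mul (160 * (m + 1) * X) \<le> (2 * (160 * (m + 1))) ^ \<kappa> * mul X" by (rule mul_times[OF mono K0 \<kappa>]) simp
   then have "t \<le> 7003 * Y * ((2 * (160 * (m + 1))) ^ \<kappa> * mul X)" using t unfolding Y_def[symmetric] by (meson le_trans mult_le_mono2)
   then have "real t \<le> real (7003 * Y * ((2 * (160 * (m + 1))) ^ \<kappa> * mul X))" by linarith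
   also have "\<dots> = 7003 * real Y * ((320 * (real m + 1)) ^ \<kappa> * real (mul X))" by (simp add: algebra_simps)
   also have "real Y = real ((n + m) choose m) * (real n * real n * ((real m + 1) * (real k + 1)) * (D * D) * (real n * (D * D)) ^ m)"
    by (simp only: Y_def of_nat_mult of_nat_power of_nat_add of_nat_1 ND(1))
   also have "7003 * (real ((n + m) choose m) * (real n * real n * ((real m + 1) * (real k + 1)) * (D * D) * (real n * (D * D)) ^ m)) *
     ((320 * (real m + 1)) ^ \<kappa> * real (mul X)) =
    (7003 * 320 ^ \<kappa>) * (real k + 1) * (real ((n + m) choose m) * (real m + 1) ^ (\<kappa> + 1)) *
     (real n * real n * (D * D) * (real n * (D * D)) ^ m * real (mul X))"
    by (rule regroup)
   also have "\<dots> \<le> (7003 * 320 ^ \<kappa>) * (2 * \<Lambda>) * (C1 * real n ^ m) * (real n * real n * (D * D) * (real n * (D * D)) ^ m * real (mul X))"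
   proof (rule mult_right_mono, rule mult_mono)
    show "7003 * 320 ^ \<kappa> * (real k + 1) \<le> 7003 * 320 ^ \<kappa> * (2 * \<Lambda>)" using kL by (intro mult_left_mono) auto
    show "real ((n + m) choose m) * (real m + 1) ^ (\<kappa> + 1) \<le> C1 * real n ^ m" by (rule C1(2)[OF n2])
   qed (use L1 ND in auto)
   \<comment> \<open>One n^m counts the row sets, the other belongs to the states, and n^2 to the
     remaining work per set.\<close>
   also have "\<dots> = (7003 * 320 ^ \<kappa> * 2 * C1) * R"
    by (simp add: R_def power_mult_distrib power_mult power2_eq_square power_add mult_ac)
   also have "\<dots> \<le> C * R"
    using L1 ND by (intro mult_right_mono) (auto simp: C_def R_def)
   finally show ?thesis using ts ib by auto
  qed
 qed
 show ?thesis
  by (rule exI[of _ ilp_program], rule exI[of _ C]) (use bound in blast)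
qed

end
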